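(* There exist rational Poincaré duality spaces $X$ and $Y$ and a non-zero degree map $f\colon Y\to X$, together with classes $w,x,y,z\in H^*(X;\mathbb{Q})$, such that the quadruple Massey product $\langle w,x,y,z\rangle$ is defined and does not contain $0$, while $0\in\langle f^*w,f^*x,f^*y,f^*z\rangle$.
   Context: A rational Poincaré duality space of dimension $n$ is a space $X$ whose rational cohomology satisfies Poincaré duality: $H^n(X;\mathbb{Q})\cong\mathbb{Q}$ and the cup product pairings $H^k(X;\mathbb{Q})\otimes H^{n-k}(X;\mathbb{Q})\to H^n(X;\mathbb{Q})\cong\mathbb{Q}$ are non-degenerate for all $k$. A map $f\colon Y\to X$ of rational Poincaré duality spaces of the same dimension $n$ has non-zero degree if $f^*\colon H^n(X;\mathbb{Q})\to H^n(Y;\mathbb{Q})$ is non-zero. Massey products of a space are those of its cdga $A_{PL}(X)$ of rational piecewise-linear forms. For a cdga $A$ over $\mathbb{Q}$ and homogeneous classes $x_1,\dots,x_m\in H(A)$, $m\geq 3$ (here $m=4$), a defining system consists of homogeneous elements $a_{i,j}$, $0\le i<j\le m$, $(i,j)\neq(0,m)$, where $a_{i-1,i}$ is a closed representative of $x_i$ and $da_{i,j}=\sum_{i<l<j}\bar a_{i,l}a_{l,j}$ for $j-i\ge2$, with $\bar a=(-1)^{|a|+1}a$. It yields the class $[\sum_{0<l<m}\bar a_{0,l}a_{l,m}]$. The Massey product $\langle x_1,\dots,x_m\rangle\subseteq H(A)$ is the set of all classes so obtained; it is defined if a defining system exists, and trivial if it contains $0$. *)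

theory Defs
  imports
    "HOL-Homology.Homology"
    "HOL-Library.Poly_Mapping"
    "HOL-Library.Function_Algebras"
begin

section \<open>Differential graded algebras over the rationals and their cohomology\<close>

text \<open>
  Addition, subtraction and zero are those of the ambient type; the operations are only meant
  to be used on the homogeneous parts \<^term>\<open>dga_part A p\<close>, which are subsets of one ambient
  type. Degrees are integers, so that negative degrees (where the algebras below vanish)
  need no special treatment.
\<close>

record 'a dga =
  dga_part :: "int \<Rightarrow> 'a set"
  dga_scale :: "rat \<Rightarrow> 'a \<Rightarrow> 'a"
  dga_mult :: "'a \<Rightarrow> 'a \<Rightarrow> 'a"
  dga_diff :: "'a \<Rightarrow> 'a"

definition cocycles :: "('a::ab_group_add) dga \<Rightarrow> int \<Rightarrow> 'a set" where
  "cocycles A p = {a \<in> dga_part A p. dga_diff A a = 0}"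

definition coboundaries :: "('a::ab_group_add) dga \<Rightarrow> int \<Rightarrow> 'a set" where
  "coboundaries A p = dga_diff A ` dga_part A (p - 1)"

definition coh_class :: "('a::ab_group_add) dga \<Rightarrow> int \<Rightarrow> 'a \<Rightarrow> 'a set" where
  "coh_class A p a = {b \<in> cocycles A p. b - a \<in> coboundaries A p}"

definition cohomology :: "('a::ab_group_add) dga \<Rightarrow> int \<Rightarrow> 'a set set" where
  "cohomology A p = coh_class A p ` cocycles A p"

text \<open>Operations on classes are unions over representatives, all contributing the same class.\<close>

definition coh_mult ::
    "('a::ab_group_add) dga \<Rightarrow> int \<Rightarrow> int \<Rightarrow> 'a set \<Rightarrow> 'a set \<Rightarrow> 'a set" where
  "coh_mult A p q x y = (\<Union>a\<in>x. \<Union>b\<in>y. coh_class A (p + q) (dga_mult A a b))"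

definition coh_map ::
    "('b::ab_group_add) dga \<Rightarrow> int \<Rightarrow> ('a \<Rightarrow> 'b) \<Rightarrow> 'a set \<Rightarrow> 'b set" where
  "coh_map B p h x = (\<Union>a\<in>x. coh_class B p (h a))"

definition coh_one_dimensional :: "('a::ab_group_add) dga \<Rightarrow> int \<Rightarrow> bool" where
  "coh_one_dimensional A p \<longleftrightarrow>
     (\<exists>\<phi> :: 'a set \<Rightarrow> rat. bij_betw \<phi> (cohomology A p) UNIV \<and>
        (\<forall>a\<in>cocycles A p. \<forall>b\<in>cocycles A p.
           \<phi> (coh_class A p (a + b)) = \<phi> (coh_class A p a) + \<phi> (coh_class A p b)) \<and>
        (\<forall>c. \<forall>a\<in>cocycles A p.
           \<phi> (coh_class A p (dga_scale A c a)) = c * \<phi> (coh_class A p a)))"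

definition coh_pairing_nondegenerate :: "('a::ab_group_add) dga \<Rightarrow> int \<Rightarrow> int \<Rightarrow> bool" where
  "coh_pairing_nondegenerate A p q \<longleftrightarrow>
     (\<forall>x\<in>cohomology A p.
        (\<forall>y\<in>cohomology A q. coh_mult A p q x y = coh_class A (p + q) 0)
          \<longrightarrow> x = coh_class A p 0) \<and>
     (\<forall>y\<in>cohomology A q.
        (\<forall>x\<in>cohomology A p. coh_mult A p q x y = coh_class A (p + q) 0)
          \<longrightarrow> y = coh_class A q 0)"

section \<open>Massey products\<close>

text \<open>
  \<open>ps\<close> lists the degrees of the classes \<open>x\<^sub>1, \<dots>, x\<^sub>m\<close> in \<open>xs\<close>; list positions start at \<open>0\<close>, so
  \<open>x\<^sub>i\<close> is \<open>xs ! (i - 1)\<close>. The element \<open>a\<^sub>i\<^sub>j\<close> of a defining system has degree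
  \<open>\<bar>x\<^bsub>i+1\<^esub>\<bar> + \<dots> + \<bar>x\<^sub>j\<bar> - (j - i - 1)\<close>, the one for which the defining equations are
  homogeneous.
\<close>

definition massey_degree :: "int list \<Rightarrow> nat \<Rightarrow> nat \<Rightarrow> int" where
  "massey_degree ps i j = (\<Sum>l\<in>{i..<j}. ps ! l) - (int j - int i - 1)"

definition dga_bar :: "int \<Rightarrow> 'a::ab_group_add \<Rightarrow> 'a" where
  "dga_bar p a = (if even (p + 1) then a else - a)"

definition defining_system ::
    "('a::ab_group_add) dga \<Rightarrow> int list \<Rightarrow> 'a set list \<Rightarrow> (nat \<Rightarrow> nat \<Rightarrow> 'a) \<Rightarrow> bool" where
  "defining_system A ps xs a \<longleftrightarrow>
     (\<forall>i j. i < j \<and> j \<le> length xs \<and> (i, j) \<noteq> (0, length xs) \<longrightarrow>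
        a i j \<in> dga_part A (massey_degree ps i j)) \<and>
     (\<forall>i. 1 \<le> i \<and> i \<le> length xs \<longrightarrow> a (i - 1) i \<in> xs ! (i - 1)) \<and>
     (\<forall>i j. i + 2 \<le> j \<and> j \<le> length xs \<and> (i, j) \<noteq> (0, length xs) \<longrightarrow>
        dga_diff A (a i j) =
          (\<Sum>l\<in>{i<..<j}. dga_mult A (dga_bar (massey_degree ps i l) (a i l)) (a l j)))"

definition massey_product ::
    "('a::ab_group_add) dga \<Rightarrow> int list \<Rightarrow> 'a set list \<Rightarrow> 'a set set" where
  "massey_product A ps xs =
     {coh_class A (massey_degree ps 0 (length xs) + 1)
        (\<Sum>l\<in>{0<..<length xs}. dga_mult A (dga_bar (massey_degree ps 0 l) (a 0 l)) (a l (length xs)))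
      | a. defining_system A ps xs a}"

section \<open>Singular cochains with rational coefficients\<close>

type_synonym 'a simplex = "(nat \<Rightarrow> real) \<Rightarrow> 'a"

text \<open>
  The action of a vertex map \<open>\<theta> : {0..m} \<rightarrow> {0..n}\<close> on singular simplices: precomposition with
  the affine map \<open>\<Delta>\<^sup>m \<rightarrow> \<Delta>\<^sup>n\<close> sending the vertex \<open>j\<close> to the vertex \<open>\<theta> j\<close>.
\<close>

definition simplex_act :: "nat \<Rightarrow> (nat \<Rightarrow> nat) \<Rightarrow> 'a simplex \<Rightarrow> 'a simplex" where
  "simplex_act m \<theta> \<sigma> =
     restrict (\<sigma> \<circ> oriented_simplex m (\<lambda>j i. if i = \<theta> j then 1 else 0)) (standard_simplex m)"

type_synonym 'a cochain = "nat \<Rightarrow> 'a simplex \<Rightarrow> rat"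

definition singular_coboundary :: "'a topology \<Rightarrow> 'a cochain \<Rightarrow> 'a cochain" where
  "singular_coboundary X c = (\<lambda>q \<sigma>.
     if 0 < q \<and> singular_simplex q X \<sigma>
     then \<Sum>k\<le>q. (-1) ^ k * c (q - 1) (singular_face q k \<sigma>) else 0)"

definition singular_cup :: "'a topology \<Rightarrow> 'a cochain \<Rightarrow> 'a cochain \<Rightarrow> 'a cochain" where
  "singular_cup X c d = (\<lambda>q \<sigma>.
     if singular_simplex q X \<sigma>
     then \<Sum>p\<le>q. c p (simplex_act p id \<sigma>) * d (q - p) (simplex_act (q - p) (\<lambda>j. p + j) \<sigma>)
     else 0)"

definition singular_cochains :: "'a topology \<Rightarrow> 'a cochain dga" where
  "singular_cochains X = \<lparr>
     dga_part = (\<lambda>p. {c. \<forall>q \<sigma>. c q \<sigma> \<noteq> 0 \<longrightarrow> int q = p \<and> singular_simplex q X \<sigma>}),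
     dga_scale = (\<lambda>r c q \<sigma>. r * c q \<sigma>),
     dga_mult = singular_cup X,
     dga_diff = singular_coboundary X \<rparr>"

abbreviation singular_cohomology :: "'a topology \<Rightarrow> int \<Rightarrow> 'a cochain set set" where
  "singular_cohomology X \<equiv> cohomology (singular_cochains X)"

definition cochain_pullback :: "'b topology \<Rightarrow> ('b \<Rightarrow> 'a) \<Rightarrow> 'a cochain \<Rightarrow> 'b cochain" where
  "cochain_pullback Y f c = (\<lambda>q \<sigma>. if singular_simplex q Y \<sigma> then c q (simplex_map q f \<sigma>) else 0)"

text \<open>\<open>f\<^sup>*\<close> in degree \<open>p\<close>, for a continuous map \<open>f\<close> defined on \<open>Y\<close>.\<close>

definition cohomology_pullback ::
    "'b topology \<Rightarrow> ('b \<Rightarrow> 'a) \<Rightarrow> int \<Rightarrow> 'a cochain set \<Rightarrow> 'b cochain set" where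
  "cohomology_pullback Y f p = coh_map (singular_cochains Y) p (cochain_pullback Y f)"

definition rational_PD_space :: "nat \<Rightarrow> 'a topology \<Rightarrow> bool" where
  "rational_PD_space n X \<longleftrightarrow>
     coh_one_dimensional (singular_cochains X) (int n) \<and>
     (\<forall>k. coh_pairing_nondegenerate (singular_cochains X) k (int n - k))"

definition nonzero_degree :: "nat \<Rightarrow> 'b topology \<Rightarrow> 'a topology \<Rightarrow> ('b \<Rightarrow> 'a) \<Rightarrow> bool" where
  "nonzero_degree n Y X f \<longleftrightarrow>
     (\<exists>x\<in>singular_cohomology X (int n).
        cohomology_pullback Y f (int n) x \<noteq> coh_class (singular_cochains Y) (int n) 0)"

section \<open>Polynomial differential forms on simplices\<close>

text \<open>
  The algebra of polynomial forms on \<open>\<Delta>\<^sup>n\<close>, the quotient of the free graded commutative algebra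
  \<open>\<Lambda>(t\<^sub>0, \<dots>, t\<^sub>n, dt\<^sub>0, \<dots>, dt\<^sub>n)\<close> by \<open>\<Sum> t\<^sub>i = 1\<close> and \<open>\<Sum> dt\<^sub>i = 0\<close>, is free on \<open>t\<^sub>1, \<dots>, t\<^sub>n\<close> and
  \<open>dt\<^sub>1, \<dots>, dt\<^sub>n\<close>, and is represented in these coordinates; \<open>t\<^sub>0\<close> is \<open>1 - (t\<^sub>1 + \<dots> + t\<^sub>n)\<close>.
  A polynomial is a finitely supported map from exponents to coefficients. A form \<open>\<omega>\<close> stands
  for \<open>\<Sum>\<^sub>I \<omega>\<^sub>I dt\<^sub>I\<close>, where for \<open>I = {i\<^sub>1 < \<dots> < i\<^sub>p}\<close>, \<open>dt\<^sub>I\<close> is \<open>dt\<^bsub>i1\<^esub> \<and> \<dots> \<and> dt\<^bsub>ip\<^esub>\<close>.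
\<close>

type_synonym rpoly = "(nat \<Rightarrow>\<^sub>0 nat) \<Rightarrow>\<^sub>0 rat"
type_synonym form = "nat set \<Rightarrow> rpoly"

definition poly_const :: "rat \<Rightarrow> rpoly" where
  "poly_const c = Poly_Mapping.single 0 c"

definition poly_var :: "nat \<Rightarrow> rpoly" where
  "poly_var i = Poly_Mapping.single (Poly_Mapping.single i 1) 1"

definition poly_partial :: "nat \<Rightarrow> rpoly \<Rightarrow> rpoly" where
  "poly_partial k P = (\<Sum>m\<in>Poly_Mapping.keys P.
     Poly_Mapping.single (m - Poly_Mapping.single k 1)
       (of_nat (Poly_Mapping.lookup m k) * Poly_Mapping.lookup P m))"

definition poly_subst :: "(nat \<Rightarrow> rpoly) \<Rightarrow> rpoly \<Rightarrow> rpoly" where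
  "poly_subst s P = (\<Sum>m\<in>Poly_Mapping.keys P.
     poly_const (Poly_Mapping.lookup P m) *
     (\<Prod>i\<in>Poly_Mapping.keys m. s i ^ Poly_Mapping.lookup m i))"

definition form_of_poly :: "rpoly \<Rightarrow> form" where
  "form_of_poly P = (\<lambda>I. if I = {} then P else 0)"

definition form_mult :: "form \<Rightarrow> form \<Rightarrow> form" where
  "form_mult \<omega> \<eta> = (\<lambda>K. \<Sum>I\<in>Pow K.
     (-1) ^ card {(i, j). i \<in> I \<and> j \<in> K - I \<and> j < i} * \<omega> I * \<eta> (K - I))"

definition form_diff :: "form \<Rightarrow> form" where
  "form_diff \<omega> = (\<lambda>K. \<Sum>k\<in>K. (-1) ^ card {i \<in> K. i < k} * poly_partial k (\<omega> (K - {k})))"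

definition simplex_forms :: "nat \<Rightarrow> int \<Rightarrow> form set" where
  "simplex_forms n p = {\<omega>. \<forall>I. \<omega> I \<noteq> 0 \<longrightarrow>
     I \<subseteq> {1..n} \<and> int (card I) = p \<and>
     (\<forall>m\<in>Poly_Mapping.keys (\<omega> I). Poly_Mapping.keys m \<subseteq> {1..n})}"

definition barycentric :: "nat \<Rightarrow> nat \<Rightarrow> rpoly" where
  "barycentric m j = (if j = 0 then 1 - (\<Sum>i\<in>{1..m}. poly_var i) else poly_var j)"

text \<open>Pullback of forms along the affine map \<open>\<Delta>\<^sup>m \<rightarrow> \<Delta>\<^sup>n\<close> given by a vertex map \<open>\<theta>\<close>.\<close>

definition vertex_pullback :: "nat \<Rightarrow> (nat \<Rightarrow> nat) \<Rightarrow> nat \<Rightarrow> rpoly" where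
  "vertex_pullback m \<theta> i = (\<Sum>j\<in>{j. j \<le> m \<and> \<theta> j = i}. barycentric m j)"

definition form_pullback :: "nat \<Rightarrow> nat \<Rightarrow> (nat \<Rightarrow> nat) \<Rightarrow> form \<Rightarrow> form" where
  "form_pullback m n \<theta> \<omega> = (\<Sum>I\<in>Pow {1..n}.
     form_mult (form_of_poly (poly_subst (vertex_pullback m \<theta>) (\<omega> I)))
       (foldr form_mult
          (map (\<lambda>i. form_diff (form_of_poly (vertex_pullback m \<theta> i))) (sorted_list_of_set I))
          (form_of_poly 1)))"

text \<open>
  Integration over \<open>\<Delta>\<^sup>n\<close>, by
  \<open>\<integral> t\<^sub>1\<^bsup>m1\<^esup> \<cdots> t\<^sub>n\<^bsup>mn\<^esup> dt\<^sub>1 \<cdots> dt\<^sub>n = m\<^sub>1! \<cdots> m\<^sub>n! / (m\<^sub>1 + \<dots> + m\<^sub>n + n)!\<close>.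
\<close>

definition simplex_integral :: "nat \<Rightarrow> form \<Rightarrow> rat" where
  "simplex_integral n \<omega> = (\<Sum>m\<in>Poly_Mapping.keys (\<omega> {1..n}).
     Poly_Mapping.lookup (\<omega> {1..n}) m *
     (\<Prod>i\<in>{1..n}. fact (Poly_Mapping.lookup m i)) /
     fact ((\<Sum>i\<in>{1..n}. Poly_Mapping.lookup m i) + n))"

section \<open>Piecewise-linear forms on a space\<close>

text \<open>
  A form on \<open>X\<close> is a map of simplicial sets from the singular set of \<open>X\<close> to polynomial
  forms, that is, a family of forms natural in all monotone vertex maps.
\<close>

definition A_PL :: "'a topology \<Rightarrow> (nat \<Rightarrow> 'a simplex \<Rightarrow> form) dga" where
  "A_PL X = \<lparr>
     dga_part = (\<lambda>p. {\<omega>.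
       (\<forall>n \<sigma>. singular_simplex n X \<sigma> \<longrightarrow> \<omega> n \<sigma> \<in> simplex_forms n p) \<and>
       (\<forall>n \<sigma>. \<not> singular_simplex n X \<sigma> \<longrightarrow> \<omega> n \<sigma> = 0) \<and>
       (\<forall>m n \<theta> \<sigma>. singular_simplex n X \<sigma> \<and> mono_on {..m} \<theta> \<and> \<theta> ` {..m} \<subseteq> {..n} \<longrightarrow>
          \<omega> m (simplex_act m \<theta> \<sigma>) = form_pullback m n \<theta> (\<omega> n \<sigma>))}),
     dga_scale = (\<lambda>r \<omega> n \<sigma> I. poly_const r * \<omega> n \<sigma> I),
     dga_mult = (\<lambda>\<omega> \<eta> n \<sigma>. form_mult (\<omega> n \<sigma>) (\<eta> n \<sigma>)),
     dga_diff = (\<lambda>\<omega> n \<sigma>. form_diff (\<omega> n \<sigma>)) \<rparr>"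

definition integration :: "(nat \<Rightarrow> 'a simplex \<Rightarrow> form) \<Rightarrow> 'a cochain" where
  "integration \<omega> = (\<lambda>n \<sigma>. simplex_integral n (\<omega> n \<sigma>))"

text \<open>
  Integration induces the natural isomorphism from the cohomology of \<open>A_PL X\<close> to singular
  cohomology; the class corresponding to a singular class \<open>x\<close> is its preimage.
\<close>

definition PL_class ::
    "'a topology \<Rightarrow> int \<Rightarrow> 'a cochain set \<Rightarrow> (nat \<Rightarrow> 'a simplex \<Rightarrow> form) set" where
  "PL_class X p x = {\<omega> \<in> cocycles (A_PL X) p. integration \<omega> \<in> x}"

definition space_massey_product ::
    "'a topology \<Rightarrow> int list \<Rightarrow> 'a cochain set list \<Rightarrow> (nat \<Rightarrow> 'a simplex \<Rightarrow> form) set set" where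
  "space_massey_product X ps xs = massey_product (A_PL X) ps (map2 (PL_class X) ps xs)"

definition massey_defined :: "'a topology \<Rightarrow> int list \<Rightarrow> 'a cochain set list \<Rightarrow> bool" where
  "massey_defined X ps xs \<longleftrightarrow> (\<exists>a. defining_system (A_PL X) ps (map2 (PL_class X) ps xs) a)"

definition massey_zero ::
    "'a topology \<Rightarrow> int list \<Rightarrow> (nat \<Rightarrow> 'a simplex \<Rightarrow> form) set" where
  "massey_zero X ps = coh_class (A_PL X) (massey_degree ps 0 (length ps) + 1) 0"

end

theory Submission
  imports Defs "HOL-Analysis.Lebesgue_Measure" "HOL-Analysis.Abstract_Metric_Spaces"
begin

text \<open>
  The spaces are classifying spaces \<open>E/G\<close> and \<open>E/N\<close> of an infra-nilpotent group \<open>G\<close> of Hirsch length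
  nine and a subgroup \<open>N\<close> of index two, where \<open>E\<close> is the contractible space of step functions with
  values in \<open>G\<close>. Duality in group cohomology is carried along a chain of infinite cyclic
  extensions by the Wang sequence and through the index two extension by averaging. A defining
  system for four classes of degree one, together with a primitive of its product, is a flat
  connection with values in unipotent matrices of size five; integrating it along edges gives a
  representation of the fundamental group whose superdiagonal consists of the four characters, and
  interpolating a representation linearly on simplices recovers a connection. The subgroup \<open>N\<close> has
  such a representation, while that of \<open>G\<close> exists only up to the corner entry: two elements \<open>U\<close> and
  \<open>V\<close> are inverted by involutions, so they act trivially in every unipotent representation, but
  their commutator equals an iterated commutator of the other generators, whose corner entry is
  the product of the characters and does not vanish.
\<close>

section \<open>Linear functionals on cochains\<close>

text \<open>The two quotients differ in what becomes of the corner entry. In the absence of the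
  sign, \<open>f + h\<close> transforms under \<open>T_x (1 + u D)\<close>, so its constant term
  \<open>f0 + h0\<close> can serve as the corner of an affine representation. The sign keeps
  \<open>f\<close> and negates \<open>h\<close>; this breaks the combination and leaves the base
  only \<open>f\<close> modulo constants. Duality must survive the sign as well: it negates
  \<open>h0\<close>, \<open>h1\<close>, \<open>h2\<close> and \<open>u\<close>, an even number of
  coordinates, so the top class is preserved. The constant 6 is the third difference of the cube,
  and \<open>V\<close> carries the same factor so that its commutator with \<open>U\<close> matches
  it. Only the homotopy type of the quotients matters, so instead of a manifold model any
  contractible space with a suitable free action will do. Step functions are convenient for two
  reasons: distinct translates of a point are at distance exactly 1, which gives unique lifting, and
  barycentric coordinates cut the unit interval into pieces, which gives explicit straight simplices
  and joins.\<close>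

definition fscale :: "rat \<Rightarrow> ('i \<Rightarrow> 's \<Rightarrow> rat) \<Rightarrow> 'i \<Rightarrow> 's \<Rightarrow> rat" where
  "fscale r c = (\<lambda>i s. r * c i s)"

lemma fscale_apply [simp]: "fscale r c i s = r * c i s"
  by (simp add: fscale_def)

interpretation fs: vector_space fscale
  by unfold_locales (auto simp: fun_eq_iff algebra_simps)

interpretation fsr: vector_space_pair fscale "(*) :: rat \<Rightarrow> rat \<Rightarrow> rat"
  by unfold_locales (auto simp: algebra_simps)

interpretation fsp: vector_space
  "\<lambda>r (a :: ('i \<Rightarrow> 's \<Rightarrow> rat) \<times> ('i \<Rightarrow> 's \<Rightarrow> rat)). (fscale r (fst a), fscale r (snd a))"
  by unfold_locales (auto simp: fun_eq_iff algebra_simps)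

interpretation fspp: vector_space_pair
  "\<lambda>r (a :: ('i \<Rightarrow> 's \<Rightarrow> rat) \<times> ('i \<Rightarrow> 's \<Rightarrow> rat)). (fscale r (fst a), fscale r (snd a))" fscale
  by unfold_locales

interpretation fss: vector_space_pair fscale fscale
  by unfold_locales

abbreviation functional :: "(('i \<Rightarrow> 's \<Rightarrow> rat) \<Rightarrow> rat) \<Rightarrow> bool" where
  "functional \<equiv> Vector_Spaces.linear fscale (*)"

abbreviation linop :: "(('i \<Rightarrow> 's \<Rightarrow> rat) \<Rightarrow> 'j \<Rightarrow> 't \<Rightarrow> rat) \<Rightarrow> bool" where
  "linop \<equiv> Vector_Spaces.linear fscale fscale"

lemma linop_I:
  assumes "\<And>a b. T (a + b) = T a + T b" "\<And>r a. T (fscale r a) = fscale r (T a)"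
  shows "linop T"
  using assms by unfold_locales auto

lemma functional_I:
  assumes "\<And>a b. T (a + b) = T a + T b" "\<And>r a. T (fscale r a) = r * T a"
  shows "functional T"
  using assms by unfold_locales auto

lemmas lin_simps = module_hom.add[OF Vector_Spaces.linear.axioms(3)]
  module_hom.scale[OF Vector_Spaces.linear.axioms(3)] module_hom.diff[OF Vector_Spaces.linear.axioms(3)]
  module_hom.neg[OF Vector_Spaces.linear.axioms(3)] module_hom.zero[OF Vector_Spaces.linear.axioms(3)]

text \<open>The sum map from \<open>V \<times> W\<close> to \<open>V + W\<close> has a linear right
  inverse. On \<open>V\<close> it returns a pair whose second component lies in both spaces, where
  \<open>nu\<close> vanishes; on \<open>W\<close> the same holds for the first component. So
  \<open>nu\<close> of the first component is the extension.\<close>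

lemma functional_separate_extension:
  fixes nu :: "('i \<Rightarrow> 's \<Rightarrow> rat) \<Rightarrow> rat"
  assumes "fs.subspace V" "fs.subspace W" "functional nu" "\<And>v. v \<in> V \<Longrightarrow> v \<in> W \<Longrightarrow> nu v = 0"
  obtains \<mu> where "functional \<mu>" "\<And>v. v \<in> V \<Longrightarrow> \<mu> v = nu v" "\<And>w. w \<in> W \<Longrightarrow> \<mu> w = 0"
proof -
  let ?sc = "\<lambda>r (a :: ('i \<Rightarrow> 's \<Rightarrow> rat) \<times> ('i \<Rightarrow> 's \<Rightarrow> rat)). (fscale r (fst a), fscale r (snd a))"
  have "Vector_Spaces.linear ?sc fscale (\<lambda>a. fst a + snd a)"
    by unfold_locales (auto simp: fun_eq_iff algebra_simps)
  moreover have "fsp.subspace (V \<times> W)"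
    using assms(1,2) by (auto simp: fsp.subspace_def fs.subspace_def zero_prod_def)
  ultimately obtain g where g: "g ` UNIV \<subseteq> V \<times> W" "Vector_Spaces.linear fscale ?sc g"
    "\<And>x. x \<in> (\<lambda>a. fst a + snd a) ` (V \<times> W) \<Longrightarrow> fst (g x) + snd (g x) = x"
    using fspp.linear_exists_right_inverse_on[of "\<lambda>a. fst a + snd a" "V \<times> W"] by blast
  show ?thesis
  proof
    show "functional (\<lambda>x. nu (fst (g x)))"
      by (intro functional_I) (simp_all add: lin_simps[OF g(2)] lin_simps[OF assms(3)])
  next
    fix v assume v: "v \<in> V"
    then have "v \<in> (\<lambda>a. fst a + snd a) ` (V \<times> W)"
      using fs.subspace_0[OF assms(2)] by (intro image_eqI[of _ _ "(v, 0)"]) auto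
    then have e: "fst (g v) + snd (g v) = v" by (rule g)
    have 1: "fst (g v) \<in> V" "snd (g v) \<in> W" using g(1) by (auto simp: mem_Times_iff image_subset_iff)
    have 2: "snd (g v) = v - fst (g v)" using e by (simp add: algebra_simps)
    then have "snd (g v) \<in> V" using 1 v fs.subspace_diff[OF assms(1)] by simp
    then have "nu (snd (g v)) = 0" using 1 assms(4) by blast
    then show "nu (fst (g v)) = nu v" using 2 lin_simps[OF assms(3)] by simp
  next
    fix v assume v: "v \<in> W"
    then have "v \<in> (\<lambda>a. fst a + snd a) ` (V \<times> W)"
      using fs.subspace_0[OF assms(1)] by (intro image_eqI[of _ _ "(0, v)"]) auto
    then have e: "fst (g v) + snd (g v) = v" by (rule g)
    have 1: "fst (g v) \<in> V" "snd (g v) \<in> W" using g(1) by (auto simp: mem_Times_iff image_subset_iff)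
    have 2: "fst (g v) = v - snd (g v)" using e by (simp add: algebra_simps)
    then have "fst (g v) \<in> W" using 1 v fs.subspace_diff[OF assms(2)] by simp
    then show "nu (fst (g v)) = 0" using 1 assms(4) by blast
  qed
qed

text \<open>With \<open>g\<close> a linear section of \<open>T\<close> over the image of
  \<open>V\<close>, the element \<open>g (T v) - v\<close> lies in \<open>V\<close> and in the
  kernel of \<open>T\<close>, where \<open>nu\<close> vanishes. This later yields functionals on
  spaces of coboundaries.\<close>

lemma functional_factor:
  fixes nu :: "('i \<Rightarrow> 's \<Rightarrow> rat) \<Rightarrow> rat" and T :: "('i \<Rightarrow> 's \<Rightarrow> rat) \<Rightarrow> 'j \<Rightarrow> 't \<Rightarrow> rat"
  assumes "fs.subspace V" "functional nu" "linop T" "\<And>v. v \<in> V \<Longrightarrow> T v = 0 \<Longrightarrow> nu v = 0"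
  obtains \<mu> where "functional \<mu>" "\<And>v. v \<in> V \<Longrightarrow> \<mu> (T v) = nu v"
proof -
  obtain g where g: "g ` UNIV \<subseteq> V" "linop g" "\<And>x. x \<in> T ` V \<Longrightarrow> T (g x) = x"
    using fss.linear_exists_right_inverse_on[OF assms(3,1)] by meson
  show ?thesis
  proof
    show "functional (\<lambda>x. nu (g x))"
      by (intro functional_I) (simp_all add: lin_simps[OF g(2)] lin_simps[OF assms(2)])
  next
    fix v assume v: "v \<in> V"
    have "T (g (T v) - v) = 0" using g(3) v by (simp add: lin_simps[OF assms(3)])
    moreover have "g (T v) - v \<in> V" using g(1) v fs.subspace_diff[OF assms(1)] by blast
    ultimately have "nu (g (T v) - v) = 0" by (rule assms(4)[rotated])
    then show "nu (g (T v)) = nu v" by (simp add: lin_simps[OF assms(2)])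
  qed
qed

text \<open>A coordinate at which \<open>a\<close> is nonzero is kept on the line spanned by
  \<open>a\<close> and replaced by 0 on \<open>W\<close>; the two meet only in 0.\<close>

lemma functional_separates:
  fixes a :: "'i \<Rightarrow> 's \<Rightarrow> rat"
  assumes "fs.subspace W" "a \<notin> W"
  obtains \<mu> where "functional \<mu>" "\<And>w. w \<in> W \<Longrightarrow> \<mu> w = 0" "\<mu> a \<noteq> 0"
proof -
  have "a \<noteq> 0" using assms fs.subspace_0 by metis
  then obtain i s where nz: "a i s \<noteq> 0" by (auto simp: fun_eq_iff)
  have 1: "functional (\<lambda>c. c i s)" by (intro functional_I) auto
  let ?V = "range (\<lambda>r. fscale r a)"
  have 2: "v i s = 0" if v: "v \<in> ?V" and w: "v \<in> W" for v
  proof -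
    obtain r where r: "v = fscale r a" using v by auto
    have "r = 0"
    proof (rule ccontr)
      assume "r \<noteq> 0"
      then have "fscale (1/r) v = a" by (simp add: r fun_eq_iff)
      then show False using fs.subspace_scale[OF assms(1) w] assms(2) by metis
    qed
    then show ?thesis by (simp add: r)
  qed
  have 3: "fs.subspace ?V"
    using fs.subspace_span[of "{a}"] by (simp add: fs.span_singleton)
  obtain \<mu> where m: "functional \<mu>" "\<And>v. v \<in> ?V \<Longrightarrow> \<mu> v = v i s" "\<And>w. w \<in> W \<Longrightarrow> \<mu> w = 0"
    using functional_separate_extension[where nu="\<lambda>c. c i s" and V = ?V and W = W, OF 3 assms(1) 1] 2 by blast
  have "a \<in> ?V" by (rule image_eqI[of _ _ 1]) auto
  then have "\<mu> a \<noteq> 0" using m(2) nz by simp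
  then show ?thesis using that[OF m(1,3)] by blast
qed

section \<open>Poincare duality for algebras of rational cochains\<close>

text \<open>Differential and product are linear on the whole function space, so functionals can be
  composed with them freely; only the Leibniz rule and \<open>d d = 0\<close> are tied to
  homogeneous elements.\<close>

definition cochain_dga :: "('i \<Rightarrow> 's \<Rightarrow> rat) dga \<Rightarrow> bool" where
  "cochain_dga A \<longleftrightarrow> (\<forall>p. fs.subspace (dga_part A p)) \<and> dga_scale A = fscale \<and>
     linop (dga_diff A) \<and> (\<forall>a. linop (dga_mult A a)) \<and> (\<forall>b. linop (\<lambda>a. dga_mult A a b)) \<and>
     (\<forall>p. \<forall>a\<in>dga_part A p. dga_diff A a \<in> dga_part A (p + 1) \<and> dga_diff A (dga_diff A a) = 0) \<and>
     (\<forall>p q. \<forall>a\<in>dga_part A p. \<forall>b\<in>dga_part A q. dga_mult A a b \<in> dga_part A (p + q) \<and>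
        dga_diff A (dga_mult A a b) = dga_mult A (dga_diff A a) b +
          fscale (if even p then 1 else -1) (dga_mult A a (dga_diff A b)))"

text \<open>Duality is stated as representability of functionals, on both sides, rather than as
  nondegeneracy: the extension step has to produce classes, and no appeal to finite dimension is
  made. Functionals live on all cochains and are compared on cocycles only.\<close>

definition duality :: "('i \<Rightarrow> 's \<Rightarrow> rat) dga \<Rightarrow> int \<Rightarrow> (('i \<Rightarrow> 's \<Rightarrow> rat) \<Rightarrow> rat) \<Rightarrow> bool" where
  "duality A n I \<longleftrightarrow> functional I \<and> (\<forall>b\<in>coboundaries A n. I b = 0) \<and>
     (\<forall>p q \<mu>. p + q = n \<and> functional \<mu> \<and> (\<forall>b\<in>coboundaries A q. \<mu> b = 0) \<longrightarrow>
        (\<exists>a\<in>cocycles A p. \<forall>b\<in>cocycles A q. \<mu> b = I (dga_mult A a b))) \<and>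
     (\<forall>p q \<mu>. p + q = n \<and> functional \<mu> \<and> (\<forall>a\<in>coboundaries A p. \<mu> a = 0) \<longrightarrow>
        (\<exists>b\<in>cocycles A q. \<forall>a\<in>cocycles A p. \<mu> a = I (dga_mult A a b)))"

lemma dualityD1:
  assumes "duality A n I" "p + q = n" "functional \<mu>" "\<And>b. b \<in> coboundaries A q \<Longrightarrow> \<mu> b = 0"
  obtains a where "a \<in> cocycles A p" "\<And>b. b \<in> cocycles A q \<Longrightarrow> \<mu> b = I (dga_mult A a b)"
proof -
  have "\<exists>a\<in>cocycles A p. \<forall>b\<in>cocycles A q. \<mu> b = I (dga_mult A a b)"
    using assms(1)[unfolded duality_def, THEN conjunct2, THEN conjunct2, THEN conjunct1, rule_format, of p q \<mu>] assms
    by blast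
  then show ?thesis using that by blast
qed

lemma dualityD2:
  assumes "duality A n I" "p + q = n" "functional \<mu>" "\<And>b. b \<in> coboundaries A p \<Longrightarrow> \<mu> b = 0"
  obtains b where "b \<in> cocycles A q" "\<And>a. a \<in> cocycles A p \<Longrightarrow> \<mu> a = I (dga_mult A a b)"
proof -
  have "\<exists>b\<in>cocycles A q. \<forall>a\<in>cocycles A p. \<mu> a = I (dga_mult A a b)"
    using assms(1)[unfolded duality_def, THEN conjunct2, THEN conjunct2, THEN conjunct2, rule_format, of p q \<mu>] assms
    by blast
  then show ?thesis using that by blast
qed

section \<open>Cocycles, coboundaries and cohomology classes in a cochain algebra with
  duality\<close>

locale cochain_algebra =
  fixes A :: "('i \<Rightarrow> 's \<Rightarrow> rat) dga"
  assumes dga: "cochain_dga A"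
begin

abbreviation "d \<equiv> dga_diff A"
abbreviation "part \<equiv> dga_part A"
abbreviation "Z \<equiv> cocycles A"
abbreviation "B \<equiv> coboundaries A"
abbreviation prd (infixl "\<frown>" 70) where "a \<frown> b \<equiv> dga_mult A a b"

lemma part_subspace: "fs.subspace (part p)"
  and scale_eq: "dga_scale A = fscale"
  and lin_d: "linop d"
  and lin_mult_right: "linop (\<lambda>b. a \<frown> b)"
  and lin_mult_left: "linop (\<lambda>a. a \<frown> b)"
  using dga unfolding cochain_dga_def by auto

lemmas d_simps = lin_simps[OF lin_d]
lemmas mult_simps = lin_simps[OF lin_mult_right] lin_simps[OF lin_mult_left]

lemma d_part: "a \<in> part p \<Longrightarrow> d a \<in> part (p + 1)"
  and d_d: "a \<in> part p \<Longrightarrow> d (d a) = 0"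
  and mult_part: "a \<in> part p \<Longrightarrow> b \<in> part q \<Longrightarrow> a \<frown> b \<in> part (p + q)"
  and leibniz: "a \<in> part p \<Longrightarrow> b \<in> part q \<Longrightarrow>
     d (a \<frown> b) = d a \<frown> b + fscale (if even p then 1 else -1) (a \<frown> d b)"
  using dga unfolding cochain_dga_def by blast+

lemma Z_iff: "a \<in> Z p \<longleftrightarrow> a \<in> part p \<and> d a = 0"
  by (simp add: cocycles_def)

lemma B_iff: "b \<in> B p \<longleftrightarrow> (\<exists>a\<in>part (p - 1). b = d a)"
  by (auto simp: coboundaries_def)

lemma Z_subspace: "fs.subspace (Z p)"
  using part_subspace[of p] by (auto simp: fs.subspace_def Z_iff d_simps)

lemma B_subspace: "fs.subspace (B p)"
  unfolding coboundaries_def using fss.linear_subspace_image[OF lin_d part_subspace] .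

lemma B_Z: "b \<in> B p \<Longrightarrow> b \<in> Z p"
  using d_part d_d by (force simp: B_iff Z_iff)

lemma ZZ: "a \<in> Z p \<Longrightarrow> b \<in> Z q \<Longrightarrow> a \<frown> b \<in> Z (p + q)"
  using leibniz[of a p b q] mult_part by (auto simp: Z_iff mult_simps)

lemma BZ: "a \<in> B p \<Longrightarrow> b \<in> Z q \<Longrightarrow> a \<frown> b \<in> B (p + q)"
proof -
  assume "a \<in> B p" "b \<in> Z q"
  then obtain c where c: "c \<in> part (p - 1)" "a = d c" "b \<in> part q" "d b = 0"
    by (auto simp: B_iff Z_iff)
  have "d (c \<frown> b) = a \<frown> b" using leibniz[OF c(1,3)] c by (simp add: mult_simps)
  moreover have "c \<frown> b \<in> part (p + q - 1)" using mult_part[OF c(1,3)] by (simp add: algebra_simps)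
  ultimately show ?thesis by (metis B_iff)
qed

lemma ZB: "a \<in> Z p \<Longrightarrow> b \<in> B q \<Longrightarrow> a \<frown> b \<in> B (p + q)"
proof -
  assume "a \<in> Z p" "b \<in> B q"
  then obtain c where c: "c \<in> part (q - 1)" "b = d c" "a \<in> part p" "d a = 0"
    by (auto simp: B_iff Z_iff)
  let ?s = "if even p then 1 else -1 :: rat"
  have "d (fscale ?s (a \<frown> c)) = a \<frown> b" using leibniz[OF c(3,1)] c by (simp add: mult_simps d_simps)
  moreover have "fscale ?s (a \<frown> c) \<in> part (p + q - 1)"
    using mult_part[OF c(3,1)] fs.subspace_scale[OF part_subspace] by (simp add: algebra_simps)
  ultimately show ?thesis by (metis B_iff)
qed

text \<open>A cocycle that is not a coboundary is detected by a functional killing coboundaries, and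
  that functional is a product with some \<open>b\<close>.\<close>

lemma duality_nondegenerate_left:
  assumes "duality A n I" "p + q = n" "a \<in> Z p" "\<And>b. b \<in> Z q \<Longrightarrow> I (a \<frown> b) = 0"
  shows "a \<in> B p"
proof (rule ccontr)
  assume "a \<notin> B p"
  then obtain \<mu> where m: "functional \<mu>" "\<And>w. w \<in> B p \<Longrightarrow> \<mu> w = 0" "\<mu> a \<noteq> 0"
    using functional_separates[OF B_subspace] by metis
  obtain b where "b \<in> Z q" "\<And>a. a \<in> Z p \<Longrightarrow> \<mu> a = I (a \<frown> b)"
    using dualityD2[OF assms(1,2) m(1,2)] by metis
  then show False using assms m by simp
qed

lemma duality_nondegenerate_right:
  assumes "duality A n I" "p + q = n" "b \<in> Z q" "\<And>a. a \<in> Z p \<Longrightarrow> I (a \<frown> b) = 0"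
  shows "b \<in> B q"
proof (rule ccontr)
  assume "b \<notin> B q"
  then obtain \<mu> where m: "functional \<mu>" "\<And>w. w \<in> B q \<Longrightarrow> \<mu> w = 0" "\<mu> b \<noteq> 0"
    using functional_separates[OF B_subspace] by metis
  obtain a where "a \<in> Z p" "\<And>b. b \<in> Z q \<Longrightarrow> \<mu> b = I (a \<frown> b)"
    using dualityD1[OF assms(1,2) m(1,2)] by metis
  then show False using assms m by simp
qed

lemma coh_class_eq_iff:
  assumes "a \<in> Z p"
  shows "coh_class A p a = coh_class A p b \<longleftrightarrow> a - b \<in> B p"
proof
  assume "coh_class A p a = coh_class A p b"
  moreover have "a \<in> coh_class A p a"
    using assms fs.subspace_0[OF B_subspace] by (simp add: coh_class_def)
  ultimately show "a - b \<in> B p" by (auto simp: coh_class_def)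
next
  assume h: "a - b \<in> B p"
  have "c - a \<in> B p \<longleftrightarrow> c - b \<in> B p" for c
    using fs.subspace_add[OF B_subspace h, of "c - a"] fs.subspace_diff[OF B_subspace _ h, of "c - b"] by auto
  then show "coh_class A p a = coh_class A p b" by (simp add: coh_class_def)
qed

lemma coh_class_self: "a \<in> Z p \<Longrightarrow> a \<in> coh_class A p a"
  using fs.subspace_0[OF B_subspace] by (simp add: coh_class_def)

lemma coh_mult_class:
  assumes "a \<in> Z p" "b \<in> Z q"
  shows "coh_mult A p q (coh_class A p a) (coh_class A q b) = coh_class A (p + q) (a \<frown> b)"
proof -
  have "coh_class A (p + q) (a' \<frown> b') = coh_class A (p + q) (a \<frown> b)"
    if "a' \<in> coh_class A p a" "b' \<in> coh_class A q b" for a' b'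
  proof -
    have h: "a' \<in> Z p" "b' \<in> Z q" "a' - a \<in> B p" "b' - b \<in> B q"
      using that by (auto simp: coh_class_def)
    have "a' \<frown> b' - a \<frown> b = (a' - a) \<frown> b' + a \<frown> (b' - b)" by (simp add: mult_simps)
    also have "\<dots> \<in> B (p + q)" using h assms BZ ZB fs.subspace_add[OF B_subspace] by blast
    finally show ?thesis using coh_class_eq_iff ZZ h by blast
  qed
  moreover have "a \<in> coh_class A p a" "b \<in> coh_class A q b" using coh_class_self assms by auto
  ultimately show ?thesis unfolding coh_mult_def by blast
qed

lemma pairing_nondegenerate:
  assumes "duality A n I" "p + q = n"
  shows "coh_pairing_nondegenerate A p q"
  unfolding coh_pairing_nondegenerate_def
proof (intro conjI ballI impI)
  have IB: "I b = 0" if "b \<in> B n" for b using assms(1) that by (auto simp: duality_def)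
  have I0: "I (a \<frown> b) = 0" if "coh_mult A p q (coh_class A p a) (coh_class A q b) = coh_class A (p + q) 0"
    "a \<in> Z p" "b \<in> Z q" for a b
    using that coh_class_eq_iff[OF ZZ[OF that(2,3)], of 0] IB assms(2) by (simp add: coh_mult_class)
  fix x assume x: "x \<in> cohomology A p" "\<forall>y\<in>cohomology A q. coh_mult A p q x y = coh_class A (p + q) 0"
  then obtain a where a: "a \<in> Z p" "x = coh_class A p a" by (auto simp: cohomology_def)
  have "I (a \<frown> b) = 0" if "b \<in> Z q" for b using I0 x a that by (auto simp: cohomology_def)
  then show "x = coh_class A p 0" using duality_nondegenerate_left[OF assms a(1)] coh_class_eq_iff a by simp
next
  have IB: "I b = 0" if "b \<in> B n" for b using assms(1) that by (auto simp: duality_def)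
  have I0: "I (a \<frown> b) = 0" if "coh_mult A p q (coh_class A p a) (coh_class A q b) = coh_class A (p + q) 0"
    "a \<in> Z p" "b \<in> Z q" for a b
    using that coh_class_eq_iff[OF ZZ[OF that(2,3)], of 0] IB assms(2) by (simp add: coh_mult_class)
  fix y assume y: "y \<in> cohomology A q" "\<forall>x\<in>cohomology A p. coh_mult A p q x y = coh_class A (p + q) 0"
  then obtain b where b: "b \<in> Z q" "y = coh_class A q b" by (auto simp: cohomology_def)
  have "I (a \<frown> b) = 0" if "a \<in> Z p" for a using I0 y b that by (auto simp: cohomology_def)
  then show "y = coh_class A q 0" using duality_nondegenerate_right[OF assms b(1)] coh_class_eq_iff b by simp
qed

text \<open>\<open>I\<close> is constant on cohomology classes, so evaluating it on an arbitrary
  representative gives the isomorphism; its kernel is the coboundaries and \<open>e\<close> makes it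
  onto.\<close>

lemma one_dimensional:
  assumes "functional I" "\<And>b. b \<in> B n \<Longrightarrow> I b = 0" "\<And>b. b \<in> Z n \<Longrightarrow> I b = 0 \<Longrightarrow> b \<in> B n"
    and e: "e \<in> Z n" "I e = 1"
  shows "coh_one_dimensional A n"
proof -
  define \<phi> where "\<phi> x = I (SOME a. a \<in> x)" for x
  have ph: "\<phi> (coh_class A n a) = I a" if "a \<in> Z n" for a
  proof -
    have "(SOME b. b \<in> coh_class A n a) \<in> coh_class A n a"
      using coh_class_self[OF that] by (rule someI[where P="\<lambda>b. b \<in> coh_class A n a"])
    then have "I ((SOME b. b \<in> coh_class A n a) - a) = 0" using assms(2) by (auto simp: coh_class_def)
    then show ?thesis by (simp add: \<phi>_def lin_simps[OF assms(1)])
  qed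
  have sub: "fscale r a \<in> Z n" "a + b \<in> Z n" if "a \<in> Z n" "b \<in> Z n" for r a b
    using fs.subspace_scale[OF Z_subspace] fs.subspace_add[OF Z_subspace] that by auto
  have "bij_betw \<phi> (cohomology A n) UNIV"
  proof (intro bij_betwI' iffI)
    fix x y assume xy: "x \<in> cohomology A n" "y \<in> cohomology A n" "\<phi> x = \<phi> y"
    then obtain a b where ab: "a \<in> Z n" "x = coh_class A n a" "b \<in> Z n" "y = coh_class A n b"
      by (auto simp: cohomology_def)
    have "I (a - b) = 0" using xy ab ph by (simp add: lin_simps[OF assms(1)])
    then have "a - b \<in> B n" using assms(3) ab fs.subspace_diff[OF Z_subspace] by blast
    then show "x = y" using ab coh_class_eq_iff by simp
  next
    fix r :: rat
    have "r = \<phi> (coh_class A n (fscale r e))" using ph[OF sub(1)[OF e(1) e(1)]] e(2) by (simp add: lin_simps[OF assms(1)])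
    then show "\<exists>x\<in>cohomology A n. r = \<phi> x" using sub(1)[OF e(1) e(1)] by (auto simp: cohomology_def)
  qed auto
  moreover have "\<forall>a\<in>Z n. \<forall>b\<in>Z n. \<phi> (coh_class A n (a + b)) = \<phi> (coh_class A n a) + \<phi> (coh_class A n b)"
    using ph sub by (simp add: lin_simps[OF assms(1)])
  moreover have "\<forall>c. \<forall>a\<in>Z n. \<phi> (coh_class A n (dga_scale A c a)) = c * \<phi> (coh_class A n a)"
    using ph sub by (simp add: lin_simps[OF assms(1)] scale_eq)
  ultimately show ?thesis unfolding coh_one_dimensional_def by blast
qed

end

text \<open>\<open>F\<close> is multiplicative with a chain map \<open>G\<close> as strict right
  inverse and homotopy left inverse. A functional is pulled back along \<open>G\<close>, represented
  in \<open>C\<close>, and the representative is returned by \<open>G\<close>. \<open>G\<close> is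
  only a chain map: products are always compared after applying \<open>F\<close>.\<close>

lemma duality_transfer:
  assumes "cochain_dga A" "cochain_dga C" "duality C n I"
    and lin: "linop F" "linop G"
    and F: "\<And>p a. a \<in> dga_part A p \<Longrightarrow> F a \<in> dga_part C p" "\<And>a p. a \<in> dga_part A p \<Longrightarrow> F (dga_diff A a) = dga_diff C (F a)"
      "\<And>p q a b. a \<in> dga_part A p \<Longrightarrow> b \<in> dga_part A q \<Longrightarrow> F (dga_mult A a b) = dga_mult C (F a) (F b)"
    and G: "\<And>p b. b \<in> dga_part C p \<Longrightarrow> G b \<in> dga_part A p" "\<And>p b. b \<in> dga_part C p \<Longrightarrow> G (dga_diff C b) = dga_diff A (G b)"
    and FG: "\<And>p b. b \<in> dga_part C p \<Longrightarrow> F (G b) = b"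
    and GF: "\<And>p a. a \<in> cocycles A p \<Longrightarrow> G (F a) - a \<in> coboundaries A p"
  shows "duality A n (\<lambda>a. I (F a))"
proof -
  interpret A: cochain_algebra A by unfold_locales fact
  interpret C: cochain_algebra C by unfold_locales fact
  note I = assms(3)[unfolded duality_def, THEN conjunct1]
  have FZ: "F a \<in> C.Z p" if "a \<in> A.Z p" for a p
    using that F by (metis A.Z_iff C.Z_iff lin_simps(5)[OF lin(1)])
  have GZ: "G a \<in> A.Z p" if "a \<in> C.Z p" for a p
    using that G by (metis A.Z_iff C.Z_iff lin_simps(5)[OF lin(2)])
  have FB: "F a \<in> C.B p" if "a \<in> A.B p" for a p
    using that F by (metis A.B_iff C.B_iff)
  have GB: "G a \<in> A.B p" if "a \<in> C.B p" for a p
    using that G by (metis A.B_iff C.B_iff)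
  show ?thesis unfolding duality_def
  proof (intro conjI allI impI ballI)
    show "functional (\<lambda>a. I (F a))"
      by (intro functional_I) (simp_all add: lin_simps[OF I] lin_simps[OF lin(1)])
    show "I (F b) = 0" if "b \<in> A.B n" for b using FB[OF that] assms(3) by (auto simp: duality_def)
  next
    fix p q \<mu> assume h: "p + q = n \<and> functional \<mu> \<and> (\<forall>b\<in>A.B q. \<mu> b = 0)"
    then have m: "functional \<mu>" by simp
    have "functional (\<lambda>b. \<mu> (G b))"
      by (intro functional_I) (simp_all add: lin_simps[OF m] lin_simps[OF lin(2)])
    then obtain a where a: "a \<in> C.Z p" "\<And>b. b \<in> C.Z q \<Longrightarrow> \<mu> (G b) = I (dga_mult C a b)"
      using dualityD1[OF assms(3), of p q "\<lambda>b. \<mu> (G b)"] h GB by metis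
    show "\<exists>a\<in>A.Z p. \<forall>b\<in>A.Z q. \<mu> b = I (F (dga_mult A a b))"
    proof (intro bexI ballI)
      show "G a \<in> A.Z p" using GZ a by simp
      fix b assume b: "b \<in> A.Z q"
      have "\<mu> (G (F b) - b) = 0" using h GF[OF b] by simp
      then have "\<mu> b = \<mu> (G (F b))" by (simp add: lin_simps[OF m])
      also have "\<dots> = I (dga_mult C a (F b))" using a FZ[OF b] by simp
      also have "\<dots> = I (dga_mult C (F (G a)) (F b))" using FG[of a p] a(1) by (simp add: C.Z_iff)
      also have "\<dots> = I (F (dga_mult A (G a) b))" using F(3)[of "G a" p b q] GZ[OF a(1)] b by (simp add: A.Z_iff)
      finally show "\<mu> b = I (F (dga_mult A (G a) b))" .
    qed
  next
    fix p q \<mu> assume h: "p + q = n \<and> functional \<mu> \<and> (\<forall>b\<in>A.B p. \<mu> b = 0)"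
    then have m: "functional \<mu>" by simp
    have "functional (\<lambda>b. \<mu> (G b))"
      by (intro functional_I) (simp_all add: lin_simps[OF m] lin_simps[OF lin(2)])
    then obtain b where a: "b \<in> C.Z q" "\<And>a. a \<in> C.Z p \<Longrightarrow> \<mu> (G a) = I (dga_mult C a b)"
      using dualityD2[OF assms(3), of p q "\<lambda>b. \<mu> (G b)"] h GB by metis
    show "\<exists>b\<in>A.Z q. \<forall>a\<in>A.Z p. \<mu> a = I (F (dga_mult A a b))"
    proof (intro bexI ballI)
      show "G b \<in> A.Z q" using GZ a by simp
      fix x assume b: "x \<in> A.Z p"
      have "\<mu> (G (F x) - x) = 0" using h GF[OF b] by simp
      then have "\<mu> x = \<mu> (G (F x))" by (simp add: lin_simps[OF m])
      also have "\<dots> = I (dga_mult C (F x) b)" using a FZ[OF b] by simp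
      also have "\<dots> = I (dga_mult C (F x) (F (G b)))" using FG[of b q] a(1) by (simp add: C.Z_iff)
      also have "\<dots> = I (F (dga_mult A x (G b)))" using F(3)[of x p "G b" q] GZ[OF a(1)] b by (simp add: A.Z_iff)
      finally show "\<mu> x = I (F (dga_mult A x (G b)))" .
    qed
  qed
qed

section \<open>Cochains on simplicial sets\<close>

definition skip :: "nat \<Rightarrow> nat \<Rightarrow> nat" where
  "skip k j = (if j < k then j else Suc j)"

definition vertex_map :: "nat \<Rightarrow> nat \<Rightarrow> (nat \<Rightarrow> nat) \<Rightarrow> bool" where
  "vertex_map m n \<theta> \<longleftrightarrow> mono_on {..m} \<theta> \<and> \<theta> ` {..m} \<subseteq> {..n}"

lemma vertex_map_skip: "vertex_map n (Suc n) (skip k)"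
  by (auto simp: vertex_map_def skip_def mono_on_def)

lemma vertex_map_id: "p \<le> q \<Longrightarrow> vertex_map p q id"
  by (auto simp: vertex_map_def mono_on_def)

lemma vertex_map_shift: "p \<le> q \<Longrightarrow> vertex_map (q - p) q (\<lambda>j. p + j)"
  by (auto simp: vertex_map_def mono_on_def)

lemma skip_skip: "l < k \<Longrightarrow> skip k \<circ> skip l = skip l \<circ> skip (k - 1)"
  by (auto simp: skip_def fun_eq_iff)

definition ss_diff :: "(nat \<Rightarrow> 's set) \<Rightarrow> (nat \<Rightarrow> (nat \<Rightarrow> nat) \<Rightarrow> 's \<Rightarrow> 's) \<Rightarrow> (nat \<Rightarrow> 's \<Rightarrow> rat) \<Rightarrow> nat \<Rightarrow> 's \<Rightarrow> rat"
  where "ss_diff S act c = (\<lambda>q s.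
     if 0 < q \<and> s \<in> S q then \<Sum>k\<le>q. (-1) ^ k * c (q - 1) (act (q - 1) (skip k) s) else 0)"

definition ss_cup :: "(nat \<Rightarrow> 's set) \<Rightarrow> (nat \<Rightarrow> (nat \<Rightarrow> nat) \<Rightarrow> 's \<Rightarrow> 's) \<Rightarrow> (nat \<Rightarrow> 's \<Rightarrow> rat) \<Rightarrow>
    (nat \<Rightarrow> 's \<Rightarrow> rat) \<Rightarrow> nat \<Rightarrow> 's \<Rightarrow> rat"
  where "ss_cup S act c d = (\<lambda>q s.
     if s \<in> S q then \<Sum>p\<le>q. c p (act p id s) * d (q - p) (act (q - p) (\<lambda>j. p + j) s) else 0)"

text \<open>One construction covers singular cochains, with \<open>T\<close> empty, and homogeneous
  group cochains, with \<open>T\<close> the left translations by a subgroup.\<close>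

definition ss_part :: "(nat \<Rightarrow> 's set) \<Rightarrow> ('s \<Rightarrow> 's) set \<Rightarrow> int \<Rightarrow> (nat \<Rightarrow> 's \<Rightarrow> rat) set" where
  "ss_part S T p = {c. (\<forall>q s. c q s \<noteq> 0 \<longrightarrow> int q = p \<and> s \<in> S q) \<and> (\<forall>\<tau>\<in>T. \<forall>q. \<forall>s\<in>S q. c q (\<tau> s) = c q s)}"

definition ss_dga :: "(nat \<Rightarrow> 's set) \<Rightarrow> (nat \<Rightarrow> (nat \<Rightarrow> nat) \<Rightarrow> 's \<Rightarrow> 's) \<Rightarrow> ('s \<Rightarrow> 's) set \<Rightarrow> (nat \<Rightarrow> 's \<Rightarrow> rat) dga"
  where "ss_dga S act T = \<lparr> dga_part = ss_part S T, dga_scale = fscale, dga_mult = ss_cup S act,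
     dga_diff = ss_diff S act \<rparr>"

lemma ss_dga_simps [simp]:
  "dga_part (ss_dga S act T) = ss_part S T" "dga_mult (ss_dga S act T) = ss_cup S act"
  "dga_diff (ss_dga S act T) = ss_diff S act" "dga_scale (ss_dga S act T) = fscale"
  by (simp_all add: ss_dga_def)

text \<open>The simplicial cancellation behind \<open>d d = 0\<close>: the term (k, l) with
  \<open>l < k\<close> is paired with (l, k - 1), whose sign is opposite.\<close>

lemma alternating_double_sum:
  fixes f :: "nat \<Rightarrow> nat \<Rightarrow> rat"
  assumes "\<And>k l. k \<le> Suc q \<Longrightarrow> l < k \<Longrightarrow> f k l = f l (k - 1)"
  shows "(\<Sum>k\<le>Suc q. \<Sum>l\<le>q. (-1) ^ k * ((-1) ^ l * f k l)) = 0"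
proof -
  let ?A = "{(k, l). k \<le> Suc q \<and> l \<le> q \<and> l < k}" and ?B = "{(k, l). k \<le> Suc q \<and> l \<le> q \<and> k \<le> l}"
  let ?g = "\<lambda>(k, l). (-1) ^ k * ((-1) ^ l * f k l)"
  have fin: "finite ({..Suc q} \<times> {..q})" by simp
  have "(\<Sum>k\<le>Suc q. \<Sum>l\<le>q. (-1) ^ k * ((-1) ^ l * f k l)) = sum ?g ({..Suc q} \<times> {..q})"
    by (simp only: sum.cartesian_product)
  also have "{..Suc q} \<times> {..q} = ?A \<union> ?B" by auto
  also have "sum ?g (?A \<union> ?B) = sum ?g ?A + sum ?g ?B"
    by (rule sum.union_disjoint) (auto intro: finite_subset[OF _ fin])
  also have "sum ?g ?A = sum (\<lambda>x. - ?g x) ?B"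
  proof (rule sum.reindex_bij_witness[of _ "\<lambda>(k, l). (Suc l, k)" "\<lambda>(k, l). (l, k - 1)"], goal_cases)
    case (5 a)
    then obtain k l where a: "a = (k, l)" "k \<le> Suc q" "l < k" by auto
    then have "(-1 :: rat) ^ k = - ((-1) ^ (k - 1))" by (cases k) auto
    then show ?case using a assms[of k l] by simp
  qed auto
  finally show ?thesis by (simp add: sum_negf)
qed

locale simplicial =
  fixes S :: "nat \<Rightarrow> 's set" and act :: "nat \<Rightarrow> (nat \<Rightarrow> nat) \<Rightarrow> 's \<Rightarrow> 's" and T :: "('s \<Rightarrow> 's) set"
  assumes act_in: "s \<in> S n \<Longrightarrow> vertex_map m n \<theta> \<Longrightarrow> act m \<theta> s \<in> S m"
    and act_act: "s \<in> S n \<Longrightarrow> vertex_map m n \<theta> \<Longrightarrow> vertex_map k m \<phi> \<Longrightarrow>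
      act k \<phi> (act m \<theta> s) = act k (\<theta> \<circ> \<phi>) s"
    and act_cong: "(\<And>j. j \<le> m \<Longrightarrow> \<theta> j = \<theta>' j) \<Longrightarrow> act m \<theta> s = act m \<theta>' s"
    and T_in: "\<tau> \<in> T \<Longrightarrow> s \<in> S n \<Longrightarrow> \<tau> s \<in> S n"
    and T_act: "\<tau> \<in> T \<Longrightarrow> s \<in> S n \<Longrightarrow> vertex_map m n \<theta> \<Longrightarrow> act m \<theta> (\<tau> s) = \<tau> (act m \<theta> s)"
begin

lemma invariant: "c \<in> ss_part S T p \<Longrightarrow> \<tau> \<in> T \<Longrightarrow> s \<in> S q \<Longrightarrow> c q (\<tau> s) = c q s"
  by (simp add: ss_part_def)

lemma support: "c \<in> ss_part S T p \<Longrightarrow> int q \<noteq> p \<or> s \<notin> S q \<Longrightarrow> c q s = 0"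
  by (auto simp: ss_part_def)

lemma diff_zero_one: "s \<in> S (Suc q) \<Longrightarrow> k \<le> Suc q \<Longrightarrow> act q (skip k) s \<in> S q"
  using act_in vertex_map_skip by blast

lemma diff_part:
  assumes c: "c \<in> ss_part S T p"
  shows "ss_diff S act c \<in> ss_part S T (p + 1)"
  unfolding ss_part_def
proof (intro CollectI conjI allI impI ballI)
  fix q s assume nz: "ss_diff S act c q s \<noteq> 0"
  then have qs: "0 < q" "s \<in> S q" by (auto simp: ss_diff_def split: if_splits)
  then obtain r where r: "q = Suc r" by (cases q) auto
  have "\<exists>k\<le>q. c r (act r (skip k) s) \<noteq> 0"
  proof (rule ccontr)
    assume "\<not> ?thesis"
    then show False using nz r by (auto simp: ss_diff_def split: if_splits)
  qed
  then show "int q = p + 1" using c r by (auto simp: ss_part_def)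
  show "s \<in> S q" by fact
next
  fix \<tau> q s assume h: "\<tau> \<in> T" "s \<in> S q"
  show "ss_diff S act c q (\<tau> s) = ss_diff S act c q s"
  proof (cases q)
    case (Suc r)
    then show ?thesis using h T_in[OF h]
      by (simp add: ss_diff_def T_act[OF _ _ vertex_map_skip] invariant[OF c] diff_zero_one)
  qed (simp add: ss_diff_def)
qed

lemma diff_diff: "c \<in> ss_part S T p \<Longrightarrow> ss_diff S act (ss_diff S act c) = 0"
proof (intro ext)
  fix q s
  show "ss_diff S act (ss_diff S act c) q s = 0 q s"
  proof (cases "2 \<le> q \<and> s \<in> S q")
    case True
    then obtain r where r: "q = Suc (Suc r)" by (metis add_2_eq_Suc le_Suc_ex)
    have s: "s \<in> S (Suc (Suc r))" using True r by simp
    have "ss_diff S act (ss_diff S act c) q s =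
      (\<Sum>k\<le>Suc (Suc r). \<Sum>l\<le>Suc r. (-1) ^ k * ((-1) ^ l * c r (act r (skip k \<circ> skip l) s)))"
      unfolding r ss_diff_def using s
      by (simp add: diff_zero_one act_act[OF s vertex_map_skip vertex_map_skip] sum_distrib_left
          del: sum.atMost_Suc)
    also have "\<dots> = 0"
      by (rule alternating_double_sum) (simp add: skip_skip)
    finally show ?thesis by simp
  next
    case False
    show ?thesis
    proof (cases "q = 1 \<and> s \<in> S q")
      case True
      then show ?thesis by (auto simp: ss_diff_def)
    qed (use False in \<open>auto simp: ss_diff_def\<close>)
  qed
qed

lemma cup_eval:
  assumes "c \<in> ss_part S T (int p)" "s \<in> S (p + r)"
  shows "ss_cup S act c d (p + r) s = c p (act p id s) * d r (act r (\<lambda>j. p + j) s)"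
proof -
  have "c i (act i id s) * d (p + r - i) (act (p + r - i) ((+) i) s) =
      (if i = p then c p (act p id s) * d r (act r (\<lambda>j. p + j) s) else 0)" for i
    using support[OF assms(1), of i] by (cases "i = p") auto
  then show ?thesis unfolding ss_cup_def using assms(2) by simp
qed

lemma cup_part:
  assumes c: "c \<in> ss_part S T p" and d: "d \<in> ss_part S T q"
  shows "ss_cup S act c d \<in> ss_part S T (p + q)"
  unfolding ss_part_def
proof (intro CollectI conjI allI impI ballI)
  fix n s assume nz: "ss_cup S act c d n s \<noteq> 0"
  then show "s \<in> S n" by (auto simp: ss_cup_def split: if_splits)
  have "\<exists>i\<le>n. c i (act i id s) * d (n - i) (act (n - i) (\<lambda>j. i + j) s) \<noteq> 0"
  proof (rule ccontr)
    assume "\<not> ?thesis"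
    then have "ss_cup S act c d n s = 0" by (auto simp: ss_cup_def intro!: sum.neutral)
    then show False using nz by simp
  qed
  then obtain i where "i \<le> n" "c i (act i id s) \<noteq> 0" "d (n - i) (act (n - i) (\<lambda>j. i + j) s) \<noteq> 0" by auto
  then have "int i = p" "int (n - i) = q" "i \<le> n" using c d unfolding ss_part_def by blast+
  then show "int n = p + q" by simp
next
  fix \<tau> n s assume h: "\<tau> \<in> T" "s \<in> S n"
  show "ss_cup S act c d n (\<tau> s) = ss_cup S act c d n s"
    unfolding ss_cup_def using h T_in[OF h]
    by (auto intro!: sum.cong simp: T_act[OF h vertex_map_id] T_act[OF h vertex_map_shift]
        invariant[OF c] invariant[OF d] act_in[OF _ vertex_map_id] act_in[OF _ vertex_map_shift])
qed

lemma cup_zero_left: "c = 0 \<Longrightarrow> ss_cup S act c d = 0"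
  by (auto simp: ss_cup_def fun_eq_iff)

lemma part_negative: "p < 0 \<Longrightarrow> c \<in> ss_part S T p \<Longrightarrow> c = 0"
  by (auto simp: ss_part_def fun_eq_iff)

lemma cup_leibniz:
  assumes c: "c \<in> ss_part S T p" and d: "d \<in> ss_part S T q"
  shows "ss_diff S act (ss_cup S act c d) = ss_cup S act (ss_diff S act c) d +
      fscale (if even p then 1 else -1) (ss_cup S act c (ss_diff S act d))"
proof -
  have zero: "ss_cup S act a 0 = 0" "ss_cup S act 0 a = 0" "ss_diff S act 0 = 0" for a
    by (auto simp: ss_cup_def ss_diff_def fun_eq_iff)
  \<comment> \<open>Degrees are integers, but parts of negative degree vanish, so natural degrees
    suffice.\<close>
  consider "c = 0" | "d = 0" | p' q' where "p = int p'" "q = int q'"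
    using part_negative c d by (metis nonneg_int_cases not_less)
  then show ?thesis
  proof cases
    case 3
    note cp = c[unfolded 3] and dq = d[unfolded 3]
    define sg where "sg = (if even p then 1 else -1 :: rat)"
    have sg: "sg = (-1) ^ p'" by (simp add: sg_def 3)
    have dc: "ss_diff S act c \<in> ss_part S T (int (Suc p'))" using diff_part[OF cp] by (simp add: add.commute)
    show ?thesis unfolding sg_def[symmetric]
    proof (intro ext)
      fix n s
      show "ss_diff S act (ss_cup S act c d) n s = (ss_cup S act (ss_diff S act c) d + fscale sg (ss_cup S act c (ss_diff S act d))) n s"
      proof (cases "n = Suc (p' + q') \<and> s \<in> S n")
        case False
        then have z: "int n \<noteq> p + q + 1 \<or> s \<notin> S n" using 3 by fastforce
        have "ss_diff S act (ss_cup S act c d) n s = 0"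
          using support[OF diff_part[OF cup_part[OF c d]] z] .
        moreover have "ss_cup S act (ss_diff S act c) d n s = 0"
          using support[OF cup_part[OF diff_part[OF c] d]] z by (simp add: add_ac)
        moreover have "ss_cup S act c (ss_diff S act d) n s = 0"
          using support[OF cup_part[OF c diff_part[OF d]]] z by (simp add: add_ac)
        ultimately show ?thesis by simp
      next
        case True
        then have n: "n = Suc (p' + q')" and s: "s \<in> S (Suc (p' + q'))" by auto
        let ?t = "\<lambda>k. c p' (act p' (skip k \<circ> id) s) * d q' (act q' (skip k \<circ> (\<lambda>j. p' + j)) s)"
        have "ss_diff S act (ss_cup S act c d) n s = (\<Sum>k\<le>Suc (p' + q'). (-1) ^ k * ?t k)"
          unfolding n ss_diff_def using s
          by (auto intro!: sum.cong simp: cup_eval[OF cp] diff_zero_one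
              act_act[OF s vertex_map_skip vertex_map_id] act_act[OF s vertex_map_skip vertex_map_shift[of p' "p' + q'", simplified]])
        also have "{..Suc (p' + q')} = {..p'} \<union> {Suc p'..Suc (p' + q')}" by auto
        also have "(\<Sum>k\<in>{..p'} \<union> {Suc p'..Suc (p' + q')}. (-1) ^ k * ?t k) =
            (\<Sum>k\<le>p'. (-1) ^ k * ?t k) + (\<Sum>k=Suc p'..Suc (p' + q'). (-1) ^ k * ?t k)"
          by (rule sum.union_disjoint) auto
        also have "(\<Sum>k=Suc p'..Suc (p' + q'). (-1) ^ k * ?t k) = (\<Sum>k\<le>q'. (-1) ^ (k + Suc p') * ?t (k + Suc p'))"
          by (rule sum.reindex_bij_witness[of _ "\<lambda>k. k + Suc p'" "\<lambda>k. k - Suc p'"]) auto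
        finally have L: "ss_diff S act (ss_cup S act c d) n s =
            (\<Sum>k\<le>p'. (-1) ^ k * ?t k) + (\<Sum>k\<le>q'. (-1) ^ (k + Suc p') * ?t (k + Suc p'))" .
        have vs: "vertex_map (Suc p') (Suc (p' + q')) id" "vertex_map (Suc q') (Suc (p' + q')) (\<lambda>j. p' + j)"
          "vertex_map p' (Suc (p' + q')) id" "vertex_map q' (Suc (p' + q')) (\<lambda>j. Suc p' + j)"
          by (auto simp: vertex_map_def mono_on_def)
        have cs: "c p' (act p' (skip k \<circ> id) s) = c p' (act p' (id \<circ> skip k) s)"
          "k \<le> p' \<Longrightarrow> act q' (skip k \<circ> (\<lambda>j. p' + j)) s = act q' (\<lambda>j. Suc p' + j) s"
          "act p' (id \<circ> skip (Suc p')) s = act p' id s"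
          "act p' (skip (k + Suc p') \<circ> id) s = act p' id s"
          "act q' (skip (k + Suc p') \<circ> (\<lambda>j. p' + j)) s = act q' ((\<lambda>j. p' + j) \<circ> skip (Suc k)) s"
          "act q' ((\<lambda>j. p' + j) \<circ> skip 0) s = act q' (\<lambda>j. Suc p' + j) s" for k
          by (auto intro!: arg_cong[where f="c p'"] act_cong simp: skip_def)
        \<comment> \<open>The product of \<open>u\<close> and \<open>v\<close> is the one term
          absent from the left side. It occurs as the last face in \<open>dc \<smile> d\<close> with
          sign \<open>(-1) ^ Suc p'\<close> and as the zeroth face in \<open>c \<smile> dd\<close>
          with sign \<open>(-1) ^ p'\<close>, and cancels.\<close>
        define u where "u = c p' (act p' id s)"
        define v where "v = d q' (act q' (\<lambda>j. Suc p' + j) s)"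
        have "ss_cup S act (ss_diff S act c) d n s = ss_diff S act c (Suc p') (act (Suc p') id s) * v"
          using cup_eval[OF dc, of s q' d] s n by (simp add: v_def)
        also have "ss_diff S act c (Suc p') (act (Suc p') id s) = (\<Sum>k\<le>Suc p'. (-1) ^ k * c p' (act p' (id \<circ> skip k) s))"
          unfolding ss_diff_def using act_in[OF s vs(1)] act_act[OF s vs(1) vertex_map_skip] by (simp del: sum.atMost_Suc)
        finally have R1: "ss_cup S act (ss_diff S act c) d n s = (\<Sum>k\<le>p'. (-1) ^ k * ?t k) + (-1) ^ Suc p' * (u * v)"
          using cs by (simp add: sum_distrib_right left_diff_distrib mult.assoc u_def v_def)
        have "ss_cup S act c (ss_diff S act d) n s = u * ss_diff S act d (Suc q') (act (Suc q') (\<lambda>j. p' + j) s)"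
          using cup_eval[OF cp, of s "Suc q'"] s n by (simp add: u_def)
        also have "ss_diff S act d (Suc q') (act (Suc q') (\<lambda>j. p' + j) s) = (\<Sum>k\<le>Suc q'. (-1) ^ k * d q' (act q' ((\<lambda>j. p' + j) \<circ> skip k) s))"
          unfolding ss_diff_def using act_in[OF s vs(2)] act_act[OF s vs(2) vertex_map_skip] by (simp del: sum.atMost_Suc)
        also have "\<dots> = v + (\<Sum>k\<le>q'. (-1) ^ Suc k * d q' (act q' ((\<lambda>j. p' + j) \<circ> skip (Suc k)) s))"
          unfolding sum.atMost_Suc_shift using cs by (simp add: v_def)
        finally have R: "ss_cup S act c (ss_diff S act d) n s =
            u * (v + (\<Sum>k\<le>q'. (-1) ^ Suc k * d q' (act q' ((\<lambda>j. p' + j) \<circ> skip (Suc k)) s)))" .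
        have "(\<Sum>k\<le>q'. (-1) ^ (k + Suc p') * ?t (k + Suc p')) =
            (\<Sum>k\<le>q'. (-1) ^ p' * (u * ((-1) ^ Suc k * d q' (act q' ((\<lambda>j. p' + j) \<circ> skip (Suc k)) s))))"
          unfolding cs u_def by (intro sum.cong) (simp_all add: power_add)
        then have R2: "fscale sg (ss_cup S act c (ss_diff S act d)) n s =
            (-1) ^ p' * (u * v) + (\<Sum>k\<le>q'. (-1) ^ (k + Suc p') * ?t (k + Suc p'))"
          unfolding fscale_apply sg R by (simp only: distrib_left sum_distrib_left)
        show ?thesis using L R1 R2 by simp
      qed
    qed
  qed (simp_all add: zero)
qed

lemma cochain_dga: "cochain_dga (ss_dga S act T)"
  unfolding cochain_dga_def ss_dga_simps
proof (intro conjI allI ballI)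
  show "fs.subspace (ss_part S T p)" for p
    by (auto simp: fs.subspace_def ss_part_def) (metis add.right_neutral)+
  show "linop (ss_diff S act)"
    by (intro linop_I) (auto simp: ss_diff_def fun_eq_iff algebra_simps sum.distrib sum_distrib_left)
  show "linop (ss_cup S act a)" for a
    by (intro linop_I) (auto simp: ss_cup_def fun_eq_iff algebra_simps sum.distrib sum_distrib_left)
  show "linop (\<lambda>a. ss_cup S act a b)" for b
    by (intro linop_I) (auto simp: ss_cup_def fun_eq_iff algebra_simps sum.distrib sum_distrib_left)
qed (simp_all add: diff_part diff_diff cup_part cup_leibniz)

sublocale cochain_algebra "ss_dga S act T"
  by unfold_locales (rule cochain_dga)

end

section \<open>Singular cochains\<close>

text \<open>The affine map in coordinates: the weight at a vertex is the sum of the weights over its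
  fibre. Being defined everywhere, it composes without side conditions on the argument.\<close>

definition affine_vertex :: "nat \<Rightarrow> (nat \<Rightarrow> nat) \<Rightarrow> (nat \<Rightarrow> real) \<Rightarrow> nat \<Rightarrow> real" where
  "affine_vertex m \<theta> x = (\<lambda>i. \<Sum>j | j \<le> m \<and> \<theta> j = i. x j)"

lemma oriented_simplex_affine_vertex:
  assumes "x \<in> standard_simplex m"
  shows "oriented_simplex m (\<lambda>j i. if i = \<theta> j then 1 else 0) x = affine_vertex m \<theta> x"
proof
  fix i
  have "(\<Sum>j\<le>m. (if i = \<theta> j then 1 else 0) * x j) = (\<Sum>j\<in>{..m}. if \<theta> j = i then x j else 0)"
    by (intro sum.cong) auto
  also have "\<dots> = (\<Sum>j | j \<in> {..m} \<and> \<theta> j = i. x j)"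
    by (rule sum.inter_filter[symmetric]) simp
  finally show "oriented_simplex m (\<lambda>j i. if i = \<theta> j then 1 else 0) x i = affine_vertex m \<theta> x i"
    using assms by (simp add: oriented_simplex_def affine_vertex_def)
qed

lemma simplex_act_eq: "simplex_act m \<theta> \<sigma> = restrict (\<lambda>x. \<sigma> (affine_vertex m \<theta> x)) (standard_simplex m)"
  unfolding simplex_act_def by (auto simp: restrict_def fun_eq_iff oriented_simplex_affine_vertex)

lemma affine_vertex_simplex:
  assumes "x \<in> standard_simplex m" "\<theta> ` {..m} \<subseteq> {..n}"
  shows "affine_vertex m \<theta> x \<in> standard_simplex n"
proof -
  have x: "\<And>j. 0 \<le> x j" "(\<Sum>j\<le>m. x j) = 1" using assms by (auto simp: standard_simplex_def)
  have le: "affine_vertex m \<theta> x i \<le> 1" for i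
    unfolding affine_vertex_def x(2)[symmetric] by (rule sum_mono2) (auto simp: x)
  have "(\<Sum>i\<le>n. affine_vertex m \<theta> x i) = (\<Sum>i\<in>{..n}. sum x {j \<in> {..m}. \<theta> j = i})"
    by (simp add: affine_vertex_def)
  also have "\<dots> = (\<Sum>j\<le>m. x j)"
    by (rule sum.group) (use assms in auto)
  moreover have "affine_vertex m \<theta> x i = 0" if "i > n" for i
    unfolding affine_vertex_def using assms(2) that by (intro sum.neutral) fastforce
  ultimately show ?thesis
    using le x by (auto simp: standard_simplex_def affine_vertex_def intro!: sum_nonneg)
qed

lemma affine_vertex_affine_vertex:
  assumes "\<phi> ` {..k} \<subseteq> {..m}"
  shows "affine_vertex m \<theta> (affine_vertex k \<phi> x) = affine_vertex k (\<theta> \<circ> \<phi>) x"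
proof
  fix i
  have "(\<Sum>j | j \<le> m \<and> \<theta> j = i. sum x {l \<in> {l. l \<le> k \<and> \<theta> (\<phi> l) = i}. \<phi> l = j}) = (\<Sum>l | l \<le> k \<and> \<theta> (\<phi> l) = i. x l)"
    by (rule sum.group) (use assms in auto)
  moreover have "{l \<in> {l. l \<le> k \<and> \<theta> (\<phi> l) = i}. \<phi> l = j} = {l. l \<le> k \<and> \<phi> l = j}" if "\<theta> j = i" for j
    using that by auto
  ultimately show "affine_vertex m \<theta> (affine_vertex k \<phi> x) i = affine_vertex k (\<theta> \<circ> \<phi>) x i"
    by (simp add: affine_vertex_def)
qed

lemma affine_vertex_cong: "(\<And>j. j \<le> m \<Longrightarrow> \<theta> j = \<theta>' j) \<Longrightarrow> affine_vertex m \<theta> x = affine_vertex m \<theta>' x"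
  unfolding affine_vertex_def by (intro ext sum.cong) auto

text \<open>The fibre of \<open>skip k\<close> over \<open>i\<close> is empty for
  \<open>i = k\<close> and at most a point otherwise, so the affine map inserts a zero coordinate as
  the library face operator does.\<close>

lemma affine_vertex_skip:
  assumes "x \<in> standard_simplex n"
  shows "affine_vertex n (skip k) x = simplical_face k x"
proof
  fix i
  have z: "i > n \<Longrightarrow> x i = 0" for i using assms by (auto simp: standard_simplex_def)
  have "{j. j \<le> n \<and> skip k j = i} = (if i < k then {i} \<inter> {..n} else if i = k then {} else {i - 1} \<inter> {..n})"
    by (auto simp: skip_def split: if_splits)
  moreover have "sum x ({j} \<inter> {..n}) = x j" for j using z by (cases "j \<le> n") auto
  ultimately show "affine_vertex n (skip k) x i = simplical_face k x i"
    by (auto simp: affine_vertex_def simplical_face_def)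
qed

lemma continuous_affine_vertex:
  "continuous_map (powertop_real UNIV) (powertop_real UNIV) (affine_vertex m \<theta>)"
  unfolding continuous_map_componentwise_UNIV affine_vertex_def
  by (intro allI continuous_map_sum) (auto intro: continuous_map_product_projection)

lemma simplex_act_singular:
  assumes "singular_simplex n X \<sigma>" "\<theta> ` {..m} \<subseteq> {..n}"
  shows "singular_simplex m X (simplex_act m \<theta> \<sigma>)"
proof -
  let ?PT = "powertop_real UNIV"
  have "continuous_map (subtopology ?PT (standard_simplex m)) (subtopology ?PT (standard_simplex n)) (affine_vertex m \<theta>)"
    unfolding continuous_map_in_subtopology
    using affine_vertex_simplex[OF _ assms(2)] continuous_affine_vertex
    by (auto intro: continuous_map_from_subtopology)
  then have "continuous_map (subtopology ?PT (standard_simplex m)) X (\<sigma> \<circ> affine_vertex m \<theta>)"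
    using assms(1) continuous_map_compose singular_simplex_def by blast
  then show ?thesis unfolding singular_simplex_def simplex_act_eq
    by (auto simp: o_def intro: continuous_map_eq)
qed

lemma simplex_act_act:
  assumes "\<phi> ` {..k} \<subseteq> {..m}"
  shows "simplex_act k \<phi> (simplex_act m \<theta> \<sigma>) = simplex_act k (\<theta> \<circ> \<phi>) \<sigma>"
  unfolding simplex_act_eq
  using affine_vertex_simplex[OF _ assms] by (auto simp: restrict_def fun_eq_iff[of "\<lambda>x. if _ x then _ x else _ x"] affine_vertex_affine_vertex[OF assms])

lemma simplex_act_cong: "(\<And>j. j \<le> m \<Longrightarrow> \<theta> j = \<theta>' j) \<Longrightarrow> simplex_act m \<theta> s = simplex_act m \<theta>' s"
  unfolding simplex_act_eq using affine_vertex_cong by metis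

lemma singular_face_act:
  shows "singular_face (Suc n) k \<sigma> = simplex_act n (skip k) \<sigma>"
  unfolding singular_face_def simplex_act_eq by (auto simp: affine_vertex_skip restrict_def fun_eq_iff)

abbreviation sing :: "'a topology \<Rightarrow> nat \<Rightarrow> ((nat \<Rightarrow> real) \<Rightarrow> 'a) set" where
  "sing X \<equiv> \<lambda>q. {\<sigma>. singular_simplex q X \<sigma>}"

lemma simplicial_sing: "simplicial (sing X) simplex_act {}"
proof
  show "\<And>m \<theta> \<theta>' s. (\<And>j. j \<le> m \<Longrightarrow> \<theta> j = \<theta>' j) \<Longrightarrow> simplex_act m \<theta> s = simplex_act m \<theta>' s"
    by (rule simplex_act_cong)
qed (auto simp: vertex_map_def simplex_act_singular simplex_act_act)

lemma singular_cochains_eq: "singular_cochains X = ss_dga (sing X) simplex_act {}"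
proof -
  have "singular_coboundary X = ss_diff (sing X) simplex_act"
    unfolding singular_coboundary_def ss_diff_def
    by (intro ext) (auto simp: gr0_conv_Suc singular_face_act intro!: sum.cong)
  then show ?thesis
    by (simp add: singular_cochains_def ss_dga_def ss_part_def ss_cup_def singular_cup_def fscale_def fun_eq_iff)
qed

section \<open>Homogeneous group cochains\<close>

definition tuples :: "nat \<Rightarrow> 'g list set" where
  "tuples q = {s. length s = Suc q}"

definition tuple_act :: "nat \<Rightarrow> (nat \<Rightarrow> nat) \<Rightarrow> 'g list \<Rightarrow> 'g list" where
  "tuple_act m \<theta> s = map (\<lambda>j. s ! \<theta> j) [0..<Suc m]"

abbreviation shift :: "'g::group_add \<Rightarrow> 'g list \<Rightarrow> 'g list" where
  "shift g \<equiv> map ((+) g)"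

abbreviation shifts :: "'g::group_add set \<Rightarrow> ('g list \<Rightarrow> 'g list) set" where
  "shifts H \<equiv> shift ` H"

text \<open>The cochains of the classifying space of a subgroup \<open>H\<close>, computed on the universal \<open>G\<close>-simplex.\<close>

definition inv_cochains :: "'g::group_add set \<Rightarrow> (nat \<Rightarrow> 'g list \<Rightarrow> rat) dga" where
  "inv_cochains H = ss_dga tuples tuple_act (shifts H)"

lemma length_tuple_act [simp]: "length (tuple_act m \<theta> s) = Suc m"
  by (simp add: tuple_act_def)

lemma nth_tuple_act [simp]: "j \<le> m \<Longrightarrow> tuple_act m \<theta> s ! j = s ! \<theta> j"
  unfolding tuple_act_def by (subst nth_map) (simp_all add: less_Suc_eq_le del: upt_Suc)

lemma tuple_act_shift:
  assumes "length s = Suc n" "vertex_map m n \<theta>"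
  shows "tuple_act m \<theta> (shift g s) = shift g (tuple_act m \<theta> s)"
proof (rule nth_equalityI)
  fix i assume "i < length (tuple_act m \<theta> (shift g s))"
  then have "i \<le> m" by simp
  moreover from this have "\<theta> i < length s" using assms by (auto simp: vertex_map_def)
  ultimately show "tuple_act m \<theta> (shift g s) ! i = shift g (tuple_act m \<theta> s) ! i" by simp
qed simp

lemma simplicial_tuples: "simplicial tuples tuple_act (shifts H)"
proof
  fix n m k \<theta> \<phi> and s :: "'a list"
  assume "vertex_map m n \<theta>" "vertex_map k m \<phi>"
  then show "tuple_act k \<phi> (tuple_act m \<theta> s) = tuple_act k (\<theta> \<circ> \<phi>) s"
    by (intro nth_equalityI) (auto simp: vertex_map_def less_Suc_eq_le)
next
  fix m and \<theta> \<theta>' :: "nat \<Rightarrow> nat" and s :: "'a list"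
  assume "\<And>j. j \<le> m \<Longrightarrow> \<theta> j = \<theta>' j"
  then show "tuple_act m \<theta> s = tuple_act m \<theta>' s" by (simp add: tuple_act_def)
qed (auto simp: tuples_def tuple_act_shift)

lemma tuple_act_id: "length s = Suc q \<Longrightarrow> tuple_act q id s = s"
  by (rule nth_equalityI) (auto simp: less_Suc_eq_le)

text \<open>The inverse in the argument makes this a left action; it commutes with coboundary and
  cup product.\<close>

definition lact :: "'g::group_add \<Rightarrow> (nat \<Rightarrow> 'g list \<Rightarrow> rat) \<Rightarrow> nat \<Rightarrow> 'g list \<Rightarrow> rat" where
  "lact g f = (\<lambda>q s. f q (shift (- g) s))"

lemma shift_shift: "shift g (shift h s) = shift (g + h) s"
  by (simp add: add.assoc)

lemma shift_zero [simp]: "shift 0 s = s"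
  by (simp add: map_idI)

lemma lact_lact: "lact g (lact h f) = lact (g + h) f"
  by (simp only: lact_def shift_shift minus_add)

lemma lact_zero [simp]: "lact 0 f = f"
  using shift_zero by (simp add: lact_def fun_eq_iff map_idI)

lemma lact_neg [simp]: "lact (- g) (lact g f) = f" "lact g (lact (- g) f) = f"
  by (simp_all add: lact_lact)

lemma lact_linear: "linop (lact g)"
  by (intro linop_I) (simp_all add: lact_def fun_eq_iff)

lemmas lact_simps = lin_simps[OF lact_linear]

abbreviation gdiff :: "(nat \<Rightarrow> 'g list \<Rightarrow> rat) \<Rightarrow> nat \<Rightarrow> 'g list \<Rightarrow> rat" where
  "gdiff \<equiv> ss_diff tuples tuple_act"

abbreviation gcup (infixl \<open>\<smile>\<close> 70) where
  "a \<smile> b \<equiv> ss_cup tuples tuple_act a b"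

lemma lact_gdiff: "lact g (gdiff f) = gdiff (lact g f)"
proof (intro ext)
  fix q s
  show "lact g (gdiff f) q s = gdiff (lact g f) q s"
  proof (cases q)
    case (Suc r)
    then show ?thesis
      by (simp add: lact_def ss_diff_def tuples_def tuple_act_shift[OF _ vertex_map_skip])
  qed (simp add: lact_def ss_diff_def)
qed

lemma lact_gcup: "lact g (a \<smile> b) = lact g a \<smile> lact g b"
  by (auto simp: lact_def ss_cup_def tuples_def tuple_act_shift[OF _ vertex_map_id]
      tuple_act_shift[OF _ vertex_map_shift] fun_eq_iff intro!: sum.cong)

abbreviation ipart :: "'g::group_add set \<Rightarrow> int \<Rightarrow> (nat \<Rightarrow> 'g list \<Rightarrow> rat) set" where
  "ipart H \<equiv> ss_part tuples (shifts H)"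

definition subgrp :: "'g::group_add set \<Rightarrow> bool" where
  "subgrp H \<longleftrightarrow> 0 \<in> H \<and> (\<forall>a\<in>H. \<forall>b\<in>H. a + b \<in> H) \<and> (\<forall>a\<in>H. - a \<in> H)"

text \<open>Invariance on tuples of the right length is invariance everywhere, because the cochain
  vanishes on all other lists and translation keeps lengths.\<close>

lemma ipart_iff:
  assumes "subgrp H"
  shows "f \<in> ipart H p \<longleftrightarrow> (\<forall>q s. f q s \<noteq> 0 \<longrightarrow> int q = p \<and> length s = Suc q) \<and> (\<forall>h\<in>H. lact h f = f)"
proof (intro iffI conjI ballI)
  fix h assume f: "f \<in> ipart H p" and "h \<in> H"
  then have h: "- h \<in> H" using assms by (auto simp: subgrp_def)
  have "f q (shift (- h) s) = f q s" for q s
  proof (cases "length s = Suc q")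
    case True
    then show ?thesis using f h by (auto simp: ss_part_def tuples_def)
  next
    case False
    have "f q x = 0" if "length x \<noteq> Suc q" for x using f that by (auto simp: ss_part_def tuples_def)
    then show ?thesis using False by simp
  qed
  then show "lact h f = f" by (simp add: lact_def)
next
  assume r: "(\<forall>q s. f q s \<noteq> 0 \<longrightarrow> int q = p \<and> length s = Suc q) \<and> (\<forall>h\<in>H. lact h f = f)"
  have "f q (shift h s) = f q s" if "h \<in> H" for h q s
  proof -
    have "lact (- h) f = f" using r that assms by (auto simp: subgrp_def)
    then show ?thesis unfolding lact_def by (metis minus_minus)
  qed
  then show "f \<in> ipart H p" using r by (simp add: ss_part_def tuples_def)
qed (auto simp: ss_part_def tuples_def)

lemma lact_ipart:
  assumes "subgrp H" "\<And>h. h \<in> H \<Longrightarrow> - g + h + g \<in> H" "f \<in> ipart H p"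
  shows "lact g f \<in> ipart H p"
  unfolding ipart_iff[OF assms(1)]
proof (intro conjI ballI allI impI)
  note f = assms(3)[unfolded ipart_iff[OF assms(1)]]
  fix q s assume "lact g f q s \<noteq> 0"
  then have "f q (shift (- g) s) \<noteq> 0" by (simp add: lact_def)
  then have "int q = p \<and> length (shift (- g) s) = Suc q" using f by blast
  then show "int q = p" "length s = Suc q" by auto
next
  note f = assms(3)[unfolded ipart_iff[OF assms(1)]]
  fix h assume h: "h \<in> H"
  have "lact h (lact g f) = lact g (lact (- g + h + g) f)" by (simp add: lact_lact add.assoc[symmetric])
  then show "lact h (lact g f) = lact g f" using f assms(2)[OF h] by simp
qed

locale group_cochains =
  fixes H :: "'g::group_add set"
  assumes subgrp: "subgrp H"
begin

sublocale simplicial tuples tuple_act "shifts H" by (rule simplicial_tuples)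

abbreviation "Zc p \<equiv> cocycles (inv_cochains H) p"
abbreviation "Bc p \<equiv> coboundaries (inv_cochains H) p"

lemma Zc_iff: "a \<in> Zc p \<longleftrightarrow> a \<in> ipart H p \<and> gdiff a = 0"
  and Bc_iff: "b \<in> Bc p \<longleftrightarrow> (\<exists>a\<in>ipart H (p - 1). b = gdiff a)"
  by (auto simp: inv_cochains_def cocycles_def coboundaries_def)

lemmas part_iff = ipart_iff[OF subgrp]

lemma lact_Zc: "\<lbrakk>\<And>h. h \<in> H \<Longrightarrow> - g + h + g \<in> H; a \<in> Zc p\<rbrakk> \<Longrightarrow> lact g a \<in> Zc p"
  using lact_ipart[OF subgrp] by (auto simp: Zc_iff simp flip: lact_gdiff simp: lact_simps)

text \<open>The cocycle condition on the edge \<open>[0, g]\<close> equates the values at the two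
  end points.\<close>

lemma Zc0_constant:
  assumes "a \<in> Zc 0"
  shows "a = fscale (a 0 [0]) (\<lambda>q s. if q = 0 \<and> length s = 1 then 1 else 0)"
proof -
  have "a 0 [g] = a 0 [0]" for g
  proof -
    have "gdiff a 1 [0, g] = 0" using assms by (simp add: Zc_iff)
    then have "a 0 (tuple_act 0 (skip 0) [0, g]) = a 0 (tuple_act 0 (skip 1) [0, g])"
      by (simp add: ss_diff_def tuples_def)
    then show ?thesis by (simp add: tuple_act_def skip_def)
  qed
  moreover have "a q s = 0" if "\<not> (q = 0 \<and> length s = 1)" for q s
  proof (rule ccontr)
    assume "a q s \<noteq> 0"
    then have "int q = 0 \<and> length s = Suc q" using assms[unfolded Zc_iff part_iff] by blast
    then show False using that by simp
  qed
  ultimately show ?thesis by (auto simp: fun_eq_iff length_Suc_conv)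
qed

lemma unit_cup:
  assumes "b \<in> ipart H p"
  shows "(\<lambda>q s. if q = 0 \<and> length s = 1 then 1 else 0) \<smile> b = b"
proof (intro ext)
  fix q s
  let ?u = "\<lambda>q s. if q = 0 \<and> length s = 1 then 1 else 0 :: rat"
  show "(?u \<smile> b) q s = b q s"
  proof (cases "length s = Suc q")
    case True
    have "?u p (tuple_act p id s) * b (q - p) (tuple_act (q - p) (\<lambda>j. p + j) s) = (if p = 0 then b q s else 0)" for p
      using tuple_act_id[OF True] by (simp add: id_def)
    then have "(?u \<smile> b) q s = (\<Sum>p\<le>q. if p = 0 then b q s else 0)"
      unfolding ss_cup_def using True by (simp add: tuples_def)
    then show ?thesis by simp
  next
    case False
    then show ?thesis using support[OF assms] by (simp add: ss_cup_def tuples_def)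
  qed
qed

lemma unit_Zc: "(\<lambda>q s. if q = 0 \<and> length s = 1 then 1 else 0) \<in> Zc 0"
proof -
  let ?u = "\<lambda>q (s :: 'g list). if q = 0 \<and> length s = 1 then 1 else 0 :: rat"
  have "gdiff ?u q s = 0" for q s
  proof (cases "q = 1")
    case True
    then show ?thesis by (simp add: ss_diff_def)
  qed (auto simp: ss_diff_def)
  then have "gdiff ?u = 0" by (simp add: fun_eq_iff)
  moreover have "?u \<in> ipart H 0" by (auto simp: part_iff lact_def fun_eq_iff split: if_splits)
  ultimately show ?thesis by (simp add: Zc_iff)
qed

text \<open>Degree 0 consists of the constants. Representing the evaluation at \<open>[0]\<close>
  and testing it on the unit gives a top cocycle of integral 1; and a top cocycle of integral 0
  pairs to 0 with every constant.\<close>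

lemma duality_top:
  assumes "duality (inv_cochains H) n I"
  shows "\<exists>b\<in>Zc n. I b = 1" and "b \<in> Zc n \<Longrightarrow> I b = 0 \<Longrightarrow> b \<in> Bc n"
proof -
  let ?u = "\<lambda>q (s :: 'g list). if q = 0 \<and> length s = 1 then 1 else 0 :: rat"
  have I: "functional I" using assms by (simp add: duality_def)
  have B0: "b = 0" if "b \<in> Bc 0" for b :: "nat \<Rightarrow> 'g list \<Rightarrow> rat"
  proof -
    obtain a where a: "a \<in> ipart H (- 1)" "b = gdiff a" using \<open>b \<in> Bc 0\<close> by (auto simp: Bc_iff)
    have "a = 0" using part_negative[of "-1" a] a by simp
    then show ?thesis using a by (auto simp: ss_diff_def fun_eq_iff)
  qed
  have ev: "functional (\<lambda>c. c 0 [0 :: 'g])" by (intro functional_I) auto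
  have B0': "b 0 [0] = 0" if "b \<in> Bc 0" for b :: "nat \<Rightarrow> 'g list \<Rightarrow> rat"
    using B0[OF that] by simp
  have n0: "0 + n = n" by simp
  obtain e where e: "e \<in> Zc n" "\<And>a. a \<in> Zc 0 \<Longrightarrow> a 0 [0] = I (dga_mult (inv_cochains H) a e)"
    using dualityD2[where \<mu> = "\<lambda>c. c 0 [0 :: 'g]", OF assms n0 ev] B0' by blast
  have "e \<in> ipart H n" using e(1) Zc_iff by blast
  then have "I e = 1" using e(2)[OF unit_Zc] unit_cup[of e n] by (simp add: inv_cochains_def)
  then show "\<exists>b\<in>Zc n. I b = 1" using e by blast
  show "b \<in> Bc n" if b: "b \<in> Zc n" "I b = 0"
  proof -
    have "I (a \<smile> b) = 0" if "a \<in> Zc 0" for a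
    proof -
      have "a \<smile> b = fscale (a 0 [0]) ?u \<smile> b" using Zc0_constant[OF that] by simp
      also have "\<dots> = fscale (a 0 [0]) (?u \<smile> b)"
        using mult_simps(7)[simplified] by simp
      also have "\<dots> = fscale (a 0 [0]) b" using unit_cup[of b n] b Zc_iff by simp
      finally show ?thesis using b by (simp add: lin_simps[OF I])
    qed
    then show ?thesis
      using duality_nondegenerate_right[of n I 0 n b] assms b by (simp add: inv_cochains_def)
  qed
qed

end

section \<open>The Wang sequence and duality for cyclic extensions\<close>

primrec nmult :: "nat \<Rightarrow> 'g::group_add \<Rightarrow> 'g" where
  "nmult 0 t = 0" | "nmult (Suc n) t = t + nmult n t"

lemma nmult_commute: "nmult n t + t = t + nmult n t"
  by (induction n) (simp_all add: add.assoc)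

definition zmult :: "int \<Rightarrow> 'g::group_add \<Rightarrow> 'g" where
  "zmult j t = (if j \<ge> 0 then nmult (nat j) t else - nmult (nat (- j)) t)"

lemma zmult_Suc: "zmult (j + 1) t = zmult j t + t"
proof (cases "j \<ge> 0")
  case True
  then have "nat (j + 1) = Suc (nat j)" by simp
  then show ?thesis using True by (simp add: zmult_def nmult_commute)
next
  case False
  then obtain n where n: "- j = int (Suc n)" by (metis not_le neg_0_less_iff_less zero_less_imp_eq_int gr0_conv_Suc)
  then have "nat (- j) = Suc n" "nat (- (j + 1)) = n" "j = -1 - int n" by simp_all
  then show ?thesis using False by (auto simp: zmult_def minus_add add.assoc)
qed

lemma zmult_commute: "zmult j t + t = t + zmult j t"
proof -
  have "- a + t = t + - a" if "a + t = t + a" for a :: 'a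
    using that by (metis add.assoc add_diff_cancel diff_conv_add_uminus minus_add_cancel)
  then show ?thesis by (simp add: zmult_def nmult_commute)
qed

lemma zmult_0 [simp]: "zmult 0 t = 0"
  by (simp add: zmult_def)

text \<open>\<open>H\<close> is the kernel of the character \<open>deg\<close> on \<open>K\<close>,
  and \<open>t\<close> lifts a generator. Tuples have entries in the whole ambient group, so
  \<open>deg\<close> is defined there, as a function equivariant under left multiplication by
  \<open>K\<close>.\<close>

locale wang = H: group_cochains H + K: group_cochains K
  for H K :: "'g::group_add set" +
  fixes t :: 'g and deg :: "'g \<Rightarrow> int"
  assumes t_K: "t \<in> K" and deg_add: "k \<in> K \<Longrightarrow> deg (k + g) = deg k + deg g" and deg_t: "deg t = 1"
    and H_iff: "h \<in> H \<longleftrightarrow> h \<in> K \<and> deg h = 0"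
begin

lemma K_closed: "0 \<in> K" "a \<in> K \<Longrightarrow> b \<in> K \<Longrightarrow> a + b \<in> K" "a \<in> K \<Longrightarrow> - a \<in> K"
  using K.subgrp by (auto simp: subgrp_def)

lemma deg_simps [simp]: "deg 0 = 0" "k \<in> K \<Longrightarrow> deg (- k) = - deg k" "k \<in> K \<Longrightarrow> deg (- k + g) = deg g - deg k"
proof -
  show 0: "deg 0 = 0" using deg_add[OF K_closed(1), of 0] by simp
  show n: "deg (- k) = - deg k" if "k \<in> K" for k using deg_add[OF that, of "- k"] 0 by simp
  show "deg (- k + g) = deg g - deg k" if "k \<in> K" using deg_add[OF K_closed(3)[OF that], of g] n[OF that] by simp
qed

lemma zmult_K: "zmult j t \<in> K"
proof -
  have "nmult n t \<in> K" for n by (induction n) (auto intro: K_closed t_K)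
  then show ?thesis by (auto simp: zmult_def intro: K_closed)
qed

lemma deg_zmult: "deg (zmult j t) = j"
proof -
  have "nmult n t \<in> K \<and> deg (nmult n t) = int n" for n
    by (induction n) (auto intro: K_closed t_K simp: deg_add[OF t_K] deg_t)
  then show ?thesis by (simp add: zmult_def)
qed

lemma H_normal: "k \<in> K \<Longrightarrow> h \<in> H \<Longrightarrow> - k + h + k \<in> H"
  by (auto simp: H_iff K_closed deg_add add.assoc)

lemma lact_part: "f \<in> ipart H p \<Longrightarrow> lact t f \<in> ipart H p" "f \<in> ipart H p \<Longrightarrow> lact (- t) f \<in> ipart H p"
  using lact_ipart[OF H.subgrp] H_normal t_K K_closed(3) by blast+

lemma K_part_H: "f \<in> ipart K p \<Longrightarrow> f \<in> ipart H p"
  by (auto simp: H.part_iff K.part_iff H_iff)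

lemma K_part_t: "f \<in> ipart K p \<Longrightarrow> lact t f = f"
  using t_K by (auto simp: K.part_iff)

text \<open>Every element of \<open>K\<close> is a power of \<open>t\<close> times an element of
  \<open>H\<close>.\<close>

lemma K_partI:
  assumes f: "f \<in> ipart H p" "lact t f = f"
  shows "f \<in> ipart K p"
proof -
  have n: "lact (nmult n t) f = f" for n
    by (induction n) (auto simp: f lact_lact[symmetric])
  moreover have "lact (- nmult n t) f = f" for n
    using lact_neg(1)[of "nmult n t" f] n by simp
  ultimately have z: "lact (zmult j t) f = f" for j by (simp add: zmult_def)
  have "lact k f = f" if k: "k \<in> K" for k
  proof -
    have "- zmult (deg k) t + k \<in> H" using k zmult_K K_closed by (simp add: H_iff deg_zmult)
    then have "lact (- zmult (deg k) t + k) f = f" using f(1) by (simp add: H.part_iff)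
    then have "lact (zmult (deg k) t) (lact (- zmult (deg k) t + k) f) = f" using z by simp
    then show ?thesis by (simp add: lact_lact add.assoc[symmetric])
  qed
  then show ?thesis using f(1) by (simp add: K.part_iff H.part_iff)
qed

text \<open>A right inverse of \<open>lact t - 1\<close>: sums along the cosets of \<open>H\<close>, starting from degree \<open>0\<close>.\<close>

definition primitive :: "(nat \<Rightarrow> 'g list \<Rightarrow> rat) \<Rightarrow> nat \<Rightarrow> 'g list \<Rightarrow> rat" where
  "primitive b = (\<lambda>q s. (\<Sum>j\<in>{deg (hd s)..<0}. b q (shift (- zmult j t) s)) -
      (\<Sum>j\<in>{0..<deg (hd s)}. b q (shift (- zmult j t) s)))"

lemma primitive_linear: "linop primitive"
  by (intro linop_I) (simp_all add: primitive_def fun_eq_iff sum.distrib sum_distrib_left algebra_simps)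

lemmas primitive_simps = lin_simps[OF primitive_linear]

text \<open>Translation by \<open>- t\<close> lowers \<open>deg (hd s)\<close> by one and shifts the
  summation index by one, so the two sums telescope to the term with index 0. The empty list has no
  head and is excluded by the support of \<open>b\<close>.\<close>

lemma lact_primitive:
  assumes b: "b \<in> ipart H p"
  shows "lact t (primitive b) - primitive b = b"
proof (intro ext)
  fix q s
  show "(lact t (primitive b) - primitive b) q s = b q s"
  proof (cases "s = []")
    case True
    then have "b q s = 0" for q using H.support[OF b] by (simp add: tuples_def)
    then show ?thesis using True by (simp add: lact_def primitive_def)
  next
    case False
    define m where "m = deg (hd s)"
    define a where "a j = b q (shift (- zmult j t) s)" for j
    have hd: "deg (hd (shift (- t) s)) = m - 1"
      using False t_K deg_t by (simp add: hd_map m_def)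
    have a: "b q (shift (- zmult j t) (shift (- t) s)) = a (j + 1)" for j
      unfolding shift_shift a_def zmult_Suc zmult_commute minus_add ..
    have "lact t (primitive b) q s = (\<Sum>j\<in>{m - 1..<0}. a (j + 1)) - (\<Sum>j\<in>{0..<m - 1}. a (j + 1))"
      unfolding lact_def primitive_def hd a ..
    also have "(\<Sum>j\<in>{m - 1..<0}. a (j + 1)) = (\<Sum>j\<in>{m..<1}. a j)"
      by (rule sum.reindex_bij_witness[of _ "\<lambda>j. j - 1" "\<lambda>j. j + 1"]) auto
    also have "(\<Sum>j\<in>{0..<m - 1}. a (j + 1)) = (\<Sum>j\<in>{1..<m}. a j)"
      by (rule sum.reindex_bij_witness[of _ "\<lambda>j. j - 1" "\<lambda>j. j + 1"]) auto
    finally have L: "lact t (primitive b) q s = (\<Sum>j\<in>{m..<1}. a j) - (\<Sum>j\<in>{1..<m}. a j)" .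
    have R: "primitive b q s = (\<Sum>j\<in>{m..<0}. a j) - (\<Sum>j\<in>{0..<m}. a j)"
      by (simp add: primitive_def m_def a_def)
    have "a 0 = b q s" by (simp add: a_def map_idI)
    moreover have "(\<Sum>j\<in>{m..<1}. a j) - (\<Sum>j\<in>{1..<m}. a j) = a 0 + ((\<Sum>j\<in>{m..<0}. a j) - (\<Sum>j\<in>{0..<m}. a j))"
    proof (cases "m \<le> 0")
      case True
      then have "{m..<1} = insert 0 {m..<0}" by auto
      then show ?thesis using True by simp
    next
      case False
      then have "{0..<m} = insert 0 {1..<m}" by auto
      then show ?thesis using False by simp
    qed
    ultimately show ?thesis using L R by simp
  qed
qed

lemma primitive_part:
  assumes b: "b \<in> ipart H p"
  shows "primitive b \<in> ipart H p"
  unfolding ss_part_def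
proof (intro CollectI conjI allI impI ballI)
  fix q s assume nz: "primitive b q s \<noteq> 0"
  have "\<exists>j. b q (shift (- zmult j t) s) \<noteq> 0"
  proof (rule ccontr)
    assume "\<not> ?thesis"
    then show False using nz by (simp add: primitive_def)
  qed
  then obtain j where "b q (shift (- zmult j t) s) \<noteq> 0" ..
  then have "int q = p \<and> length (shift (- zmult j t) s) = Suc q" using b unfolding H.part_iff by blast
  then show "int q = p" "s \<in> tuples q" by (auto simp: tuples_def)
next
  fix \<tau> q and s :: "'g list" assume "\<tau> \<in> shifts H" "s \<in> tuples q"
  then obtain h where h: "h \<in> H" "\<tau> = shift h" and s: "length s = Suc q" by (auto simp: tuples_def)
  have "deg (hd (\<tau> s)) = deg (hd s)"
    using h s by (cases s) (auto simp: H_iff deg_add)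
  moreover have "b q (shift (- zmult j t) (\<tau> s)) = b q (shift (- zmult j t) s)" for j
  proof -
    let ?h = "- zmult j t + h + zmult j t"
    have "b q (shift ?h (shift (- zmult j t) s)) = b q (shift (- zmult j t) s)"
      using b s H_normal[OF zmult_K h(1)] by (auto simp: ss_part_def tuples_def simp del: map_map)
    then show ?thesis by (simp only: h shift_shift add.assoc right_minus add_0_right)
  qed
  ultimately show "primitive b q (\<tau> s) = primitive b q s" by (simp add: primitive_def)
qed

text \<open>A projection onto the \<open>K\<close>-invariant cochains, as \<open>primitive\<close>
  inverts \<open>lact t - 1\<close> from the right. It splits the short exact sequence of complexes
  behind the Wang sequence, though not as a sequence of complexes.\<close>

lemma lift_invariant:
  assumes "f \<in> ipart H p"
  shows "f - primitive (lact t f - f) \<in> ipart K p"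
proof (rule K_partI)
  have 1: "lact t f - f \<in> ipart H p"
    using lact_part(1)[OF assms] assms fs.subspace_diff[OF H.part_subspace] by simp
  show "f - primitive (lact t f - f) \<in> ipart H p"
    using primitive_part[OF 1] assms fs.subspace_diff[OF H.part_subspace] by simp
  show "lact t (f - primitive (lact t f - f)) = f - primitive (lact t f - f)"
    using lact_primitive[OF 1] by (simp add: lact_simps algebra_simps)
qed

section \<open>Exactness of the Wang sequence on the level of cochains\<close>

lemma K_Zc_t: "a \<in> K.Zc p \<Longrightarrow> lact t a = a"
  using K_part_t K.Zc_iff by blast

lemma Zc_K_H: "a \<in> K.Zc p \<Longrightarrow> a \<in> H.Zc p"
  by (simp add: K.Zc_iff H.Zc_iff K_part_H)

lemma lact_t_Zc: "a \<in> H.Zc p \<Longrightarrow> lact t a \<in> H.Zc p" "a \<in> H.Zc p \<Longrightarrow> lact (- t) a \<in> H.Zc p"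
  using H.lact_Zc H_normal t_K K_closed(3) by blast+

text \<open>\<open>gdiff (primitive a)\<close> is the connecting homomorphism of the Wang sequence,
  called transgression below.\<close>

lemma gdiff_primitive_Zc: "a \<in> H.Zc p \<Longrightarrow> gdiff (primitive a) \<in> K.Zc (p + 1)"
proof -
  assume a: "a \<in> H.Zc p"
  then have p: "primitive a \<in> ipart H p" using primitive_part H.Zc_iff by blast
  have "lact t (gdiff (primitive a)) - gdiff (primitive a) = gdiff (lact t (primitive a) - primitive a)"
    using H.d_simps(3) by (simp add: lact_gdiff)
  also have "\<dots> = 0" using lact_primitive[of a p] a by (simp add: H.Zc_iff)
  finally have "lact t (gdiff (primitive a)) = gdiff (primitive a)" by simp
  then show ?thesis using K_partI[of _ "p + 1"] H.d_part[of "primitive a" p] H.d_d[of "primitive a" p] p by (simp add: K.Zc_iff)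
qed

text \<open>Exactness at the cohomology of \<open>H\<close>: a class fixed by \<open>t\<close> is
  restricted from \<open>K\<close>. The cochain \<open>m\<close> witnessing invariance is absorbed
  by subtracting the coboundary of its primitive.\<close>

lemma correct_invariant:
  assumes a: "a \<in> H.Zc p" "lact t a - a \<in> H.Bc p"
  obtains x where "x \<in> K.Zc p" "x - a \<in> H.Bc p"
proof -
  obtain m where m: "m \<in> ipart H (p - 1)" "lact t a - a = gdiff m" using a by (auto simp: H.Bc_iff)
  let ?x = "a - gdiff (primitive m)"
  have pm: "primitive m \<in> ipart H (p - 1)" using primitive_part m by blast
  have B: "gdiff (primitive m) \<in> H.Bc p" using pm H.Bc_iff by blast
  then have BZ: "gdiff (primitive m) \<in> H.Zc p" using H.B_Z by (simp add: inv_cochains_def)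
  have xZ: "?x \<in> H.Zc p" using a(1) BZ fs.subspace_diff[OF H.Z_subspace] by (simp add: inv_cochains_def)
  have "lact t ?x - ?x = (lact t a - a) - gdiff (lact t (primitive m) - primitive m)"
    using H.d_simps(3) by (simp add: lact_simps lact_gdiff)
  also have "\<dots> = 0" using lact_primitive[OF m(1)] m(2) by simp
  finally have "lact t ?x = ?x" by simp
  then have "?x \<in> K.Zc p" using xZ K_partI by (simp add: K.Zc_iff H.Zc_iff)
  moreover have "?x - a \<in> H.Bc p" using fs.subspace_neg[OF H.B_subspace, of "gdiff (primitive m)" p] B by (simp add: inv_cochains_def)
  ultimately show ?thesis using that by blast
qed

text \<open>Exactness at the cohomology of \<open>K\<close>, dualized: the classes that die on
  \<open>H\<close> are the transgressions, so a functional killing those passes to the image of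
  restriction and extends to \<open>H\<close>.\<close>

lemma descend_functional:
  assumes f: "functional \<mu>" "\<And>b. b \<in> K.Bc q \<Longrightarrow> \<mu> b = 0" "\<And>b. b \<in> H.Zc (q - 1) \<Longrightarrow> \<mu> (gdiff (primitive b)) = 0"
  obtains \<nu> where "functional \<nu>" "\<And>b. b \<in> K.Zc q \<Longrightarrow> \<nu> b = \<mu> b" "\<And>b. b \<in> H.Bc q \<Longrightarrow> \<nu> b = 0"
proof (rule functional_separate_extension[of "K.Zc q" "H.Bc q" \<mu>])
  show "fs.subspace (K.Zc q)" "fs.subspace (H.Bc q)"
    using K.Z_subspace H.B_subspace by (simp_all add: inv_cochains_def)
  fix v assume v: "v \<in> K.Zc q" "v \<in> H.Bc q"
  then obtain e where e: "e \<in> ipart H (q - 1)" "v = gdiff e" by (auto simp: H.Bc_iff)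
  let ?b = "lact t e - e"
  have bp: "?b \<in> ipart H (q - 1)" using lact_part(1)[OF e(1)] e fs.subspace_diff[OF H.part_subspace] by simp
  have "gdiff ?b = lact t v - v" using H.d_simps(3) e by (simp add: lact_gdiff)
  also have "\<dots> = 0" using K_Zc_t[OF v(1)] by simp
  finally have bZ: "?b \<in> H.Zc (q - 1)" using bp H.Zc_iff by simp
  \<comment> \<open>\<open>e\<close> is the sum of a \<open>K\<close>-invariant cochain and
    \<open>primitive ?b\<close>, so \<open>v\<close> is a coboundary over \<open>K\<close> plus a
    transgression.\<close>
  have "gdiff (e - primitive ?b) \<in> K.Bc q" using lift_invariant[OF e(1)] by (auto simp: K.Bc_iff)
  then have "\<mu> (gdiff (e - primitive ?b)) = 0" by (rule f)
  then have "\<mu> v - \<mu> (gdiff (primitive ?b)) = 0" using H.d_simps(3) e by (simp add: lin_simps[OF f(1)])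
  then show "\<mu> v = 0" using f(3)[OF bZ] by simp
qed (use f that in auto)

end

text \<open>\<open>I_t\<close> says that \<open>t\<close> preserves the top class of
  \<open>H\<close>, so that the top class of the extension is not twisted.\<close>

locale wang_duality = wang +
  fixes n :: int and I :: "(nat \<Rightarrow> 'a list \<Rightarrow> rat) \<Rightarrow> rat"
  assumes duality: "duality (inv_cochains H) n I"
    and I_t: "b \<in> H.Zc n \<Longrightarrow> I (lact t b) = I b"
begin

lemma I_functional: "functional I" and I_B: "b \<in> H.Bc n \<Longrightarrow> I b = 0"
  using duality by (auto simp: duality_def)

lemmas I_simps = lin_simps[OF I_functional]

lemma I_cong: "a - b \<in> H.Bc n \<Longrightarrow> I a = I b"
  using I_B[of "a - b"] by (simp add: I_simps)

lemma mult_eq: "dga_mult (inv_cochains H) = ss_cup tuples tuple_act" "dga_mult (inv_cochains K) = ss_cup tuples tuple_act"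
  by (simp_all add: inv_cochains_def)

text \<open>Above the top degree everything is exact, the dual degree being -1, where there are no
  cochains.\<close>

lemma top_exact:
  assumes "c \<in> H.Zc (n + 1)"
  obtains e where "e \<in> ipart H n" "c = gdiff e"
proof -
  have "I (a \<smile> c) = 0" if "a \<in> H.Zc (- 1)" for a
  proof -
    have "a = 0" using H.part_negative[of "-1" a] that by (simp add: H.Zc_iff)
    then show ?thesis using H.mult_simps by (simp add: I_simps)
  qed
  then have "c \<in> H.Bc (n + 1)"
    using H.duality_nondegenerate_right[of n I "-1" "n + 1" c] duality assms by (simp add: inv_cochains_def)
  then show ?thesis using that by (auto simp: H.Bc_iff)
qed

text \<open>By \<open>lift_invariant\<close>, \<open>gdiff e\<close> is cohomologous over
  \<open>K\<close> to the transgression of \<open>lact t e - e\<close>; integrating over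
  \<open>K\<close> is therefore undoing the transgression and integrating over
  \<open>H\<close>.\<close>

lemma fundamental_exists:
  obtains J where "functional J"
    "\<And>e. e \<in> ipart H n \<Longrightarrow> gdiff e \<in> K.Zc (n + 1) \<Longrightarrow> J (gdiff e) = I (lact t e - e)"
proof -
  let ?V = "{e \<in> ipart H n. lact t (gdiff e) = gdiff e}"
  have V: "fs.subspace ?V"
    using H.part_subspace[of n] by (auto simp: fs.subspace_def H.d_simps[simplified] lact_simps)
  have l: "functional (\<lambda>e. I (lact t e - e))"
    by (intro functional_I) (simp_all add: I_simps lact_simps algebra_simps)
  \<comment> \<open>The value depends only on \<open>gdiff e\<close>: if it vanishes,
    \<open>e\<close> is a top cocycle and \<open>t\<close> preserves its integral.\<close>
  have "I (lact t e - e) = 0" if "e \<in> ?V" "gdiff e = 0" for e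
  proof -
    have "e \<in> H.Zc n" using that by (simp add: H.Zc_iff)
    then show ?thesis using I_t by (simp add: I_simps)
  qed
  then obtain J where J: "functional J" "\<And>v. v \<in> ?V \<Longrightarrow> J (gdiff v) = I (lact t v - v)"
    using functional_factor[OF V l, of gdiff] H.lin_d by auto
  show ?thesis
  proof (rule that[OF J(1)])
    fix e assume "e \<in> ipart H n" "gdiff e \<in> K.Zc (n + 1)"
    then show "J (gdiff e) = I (lact t e - e)" using J(2) K_Zc_t by blast
  qed
qed

definition fundamental :: "(nat \<Rightarrow> 'a list \<Rightarrow> rat) \<Rightarrow> rat" where
  "fundamental = (SOME J. functional J \<and> (\<forall>e\<in>ipart H n. gdiff e \<in> K.Zc (n + 1) \<longrightarrow> J (gdiff e) = I (lact t e - e)))"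

lemma fundamental:
  "functional fundamental"
  "e \<in> ipart H n \<Longrightarrow> gdiff e \<in> K.Zc (n + 1) \<Longrightarrow> fundamental (gdiff e) = I (lact t e - e)"
proof -
  have "\<exists>J. functional J \<and> (\<forall>e\<in>ipart H n. gdiff e \<in> K.Zc (n + 1) \<longrightarrow> J (gdiff e) = I (lact t e - e))"
    using fundamental_exists by metis
  from someI_ex[OF this, folded fundamental_def]
  show "functional fundamental"
    "e \<in> ipart H n \<Longrightarrow> gdiff e \<in> K.Zc (n + 1) \<Longrightarrow> fundamental (gdiff e) = I (lact t e - e)" by auto
qed

lemmas J_simps = lin_simps[OF fundamental(1)]

lemma fundamental_B:
  assumes "b \<in> K.Bc (n + 1)"
  shows "fundamental b = 0"
proof -
  obtain e where e: "e \<in> ipart K n" "b = gdiff e" using assms by (auto simp: K.Bc_iff)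
  have "b \<in> K.Zc (n + 1)" using K.B_Z assms by (simp add: inv_cochains_def)
  then show ?thesis using fundamental(2)[of e] e K_part_H K_part_t by (simp add: I_simps)
qed

lemma I_shift_left: "a \<in> H.Zc p \<Longrightarrow> b \<in> H.Zc q \<Longrightarrow> p + q = n \<Longrightarrow> I (lact t a \<smile> b) = I (a \<smile> lact (- t) b)"
  using I_t[of "a \<smile> lact (- t) b"] H.ZZ[of a p "lact (- t) b" q] lact_t_Zc(2)[of b q]
  by (simp add: lact_gcup inv_cochains_def)

lemma I_shift_right: "a \<in> H.Zc p \<Longrightarrow> b \<in> H.Zc q \<Longrightarrow> p + q = n \<Longrightarrow> I (a \<smile> lact t b) = I (lact (- t) a \<smile> b)"
  using I_t[of "lact (- t) a \<smile> b"] H.ZZ[of "lact (- t) a" p b q] lact_t_Zc(2)[of a p]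
  by (simp add: lact_gcup inv_cochains_def)

text \<open>The two cochains differ by the coboundary of a \<open>K\<close>-invariant one. For a
  cocycle \<open>b\<close> the right side is 0, so functionals composed with transgression are
  \<open>t\<close>-invariant.\<close>

lemma kills_coinvariants:
  assumes "functional \<mu>" "\<And>b. b \<in> K.Bc q \<Longrightarrow> \<mu> b = 0" "b \<in> ipart H (q - 1)"
  shows "\<mu> (gdiff (primitive (lact t b - b))) = \<mu> (gdiff b)"
proof -
  have "gdiff (b - primitive (lact t b - b)) \<in> K.Bc q"
    using lift_invariant[OF assms(3)] by (auto simp: K.Bc_iff)
  then have "\<mu> (gdiff (b - primitive (lact t b - b))) = 0" by (rule assms)
  then show ?thesis using H.d_simps(3) by (simp add: lin_simps[OF assms(1)])
qed

lemma transgression_functional: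
  assumes "functional \<mu>"
  shows "functional (\<lambda>b. \<mu> (gdiff (primitive b)))"
  by (intro functional_I) (simp_all add: lin_simps[OF assms] H.d_simps[simplified] primitive_simps)

text \<open>For \<open>b = gdiff c\<close>, the cochain \<open>gdiff (primitive c)\<close> has
  \<open>b\<close> as its image under \<open>lact t - 1\<close>; \<open>kills_coinvariants\<close>
  then reduces the claim to \<open>d d = 0\<close>.\<close>

lemma transgression_B:
  assumes "functional \<mu>" "\<And>b. b \<in> K.Bc q \<Longrightarrow> \<mu> b = 0" "b \<in> H.Bc (q - 1)"
  shows "\<mu> (gdiff (primitive b)) = 0"
proof -
  obtain c where c: "c \<in> ipart H (q - 2)" "b = gdiff c" using assms(3) by (auto simp: H.Bc_iff)
  let ?e = "primitive c"
  have e: "?e \<in> ipart H (q - 2)" using primitive_part c by blast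
  have de: "gdiff ?e \<in> ipart H (q - 1)" using H.d_part[of ?e "q - 2"] e by simp
  have "lact t (gdiff ?e) - gdiff ?e = b" using lact_primitive[OF c(1)] c(2) H.d_simps(3) lact_gdiff by (metis ss_dga_simps(3))
  then have "\<mu> (gdiff (primitive b)) = \<mu> (gdiff (gdiff ?e))" using kills_coinvariants[OF assms(1,2) de] by simp
  also have "gdiff (gdiff ?e) = 0" using H.d_d[of ?e "q - 2"] e by simp
  also have "\<mu> 0 = 0" by (rule lin_simps(5)[OF assms(1)])
  finally show ?thesis .
qed

text \<open>The class is assembled from both ends of the Wang sequence. On transgressions the
  functional is represented by a \<open>t\<close>-invariant class of \<open>H\<close>, which comes
  from some \<open>x0\<close> on \<open>K\<close>; the rest of the functional descends to
  \<open>H\<close> and is represented there by some \<open>a'\<close>, whose transgression is the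
  second summand. Products are integrated by exhibiting them as coboundaries over
  \<open>H\<close>.\<close>

lemma represent_right:
  assumes pq: "p + q = n + 1" and f: "functional \<mu>" "\<And>b. b \<in> K.Bc q \<Longrightarrow> \<mu> b = 0"
  shows "\<exists>a\<in>K.Zc p. \<forall>b\<in>K.Zc q. \<mu> b = fundamental (a \<smile> b)"
proof -
  let ?s = "if even p then 1 else -1 :: rat"
  have q: "p + (q - 1) = n" "(p - 1) + q = n" using pq by auto
  have TB: "\<mu> (gdiff (primitive b)) = 0" if "b \<in> H.Bc (q - 1)" for b using transgression_B[OF f that] .
  obtain a where a: "a \<in> H.Zc p" "\<And>b. b \<in> H.Zc (q - 1) \<Longrightarrow> \<mu> (gdiff (primitive b)) = I (a \<smile> b)"
    using dualityD1[OF duality q(1) transgression_functional[OF f(1)] TB] unfolding mult_eq by metis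
  \<comment> \<open>Nondegeneracy on \<open>H\<close> converts the \<open>t\<close>-invariance of
    the transgressed functional into invariance of the representing class.\<close>
  have "lact t a - a \<in> H.Bc p"
  proof -
    have ta: "lact t a - a \<in> H.Zc p" using lact_t_Zc(1)[OF a(1)] a(1) fs.subspace_diff[OF H.Z_subspace] by (simp add: inv_cochains_def)
    have "I ((lact t a - a) \<smile> b) = 0" if b: "b \<in> H.Zc (q - 1)" for b
    proof -
      let ?b = "lact (- t) b"
      have b': "?b \<in> H.Zc (q - 1)" using lact_t_Zc(2) b by blast
      have d: "lact t ?b - ?b \<in> H.Zc (q - 1)" using lact_t_Zc(1)[OF b'] b' fs.subspace_diff[OF H.Z_subspace] by (simp add: inv_cochains_def)
      have "I ((lact t a - a) \<smile> b) = I (a \<smile> ?b) - I (a \<smile> b)"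
        using I_shift_left[OF a(1) b q(1)] H.mult_simps by (simp add: I_simps)
      also have "\<dots> = - I (a \<smile> (lact t ?b - ?b))" using H.mult_simps by (simp add: I_simps)
      also have "\<dots> = - \<mu> (gdiff ?b)" using a(2)[OF d] kills_coinvariants[OF f, where b = ?b] b' by (simp add: H.Zc_iff)
      also have "\<dots> = 0" using b' by (simp add: H.Zc_iff lin_simps[OF f(1)])
      finally show ?thesis .
    qed
    then show ?thesis using H.duality_nondegenerate_left[of n I p "q - 1"] duality q(1) ta by (simp add: inv_cochains_def)
  qed
  then obtain x0 where x0: "x0 \<in> K.Zc p" "x0 - a \<in> H.Bc p" using correct_invariant[OF a(1)] by blast
  have x0H: "x0 \<in> ipart H p" "gdiff x0 = 0" "lact t x0 = x0" "x0 \<in> H.Zc p"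
    using x0 Zc_K_H K_part_t K_part_H by (auto simp: K.Zc_iff)
  \<comment> \<open>Over \<open>H\<close> the transgression of \<open>b\<close> has the primitive
    \<open>primitive b\<close>; multiplying this by the closed \<open>x0\<close> costs the Leibniz
    sign \<open>?s\<close>.\<close>
  have J1: "fundamental (x0 \<smile> gdiff (primitive b)) = ?s * \<mu> (gdiff (primitive b))" if b: "b \<in> H.Zc (q - 1)" for b
  proof -
    have bp: "b \<in> ipart H (q - 1)" "primitive b \<in> ipart H (q - 1)" using b primitive_part by (auto simp: H.Zc_iff)
    let ?e = "fscale ?s (x0 \<smile> primitive b)"
    have e: "?e \<in> ipart H n" using H.mult_part[of x0 p "primitive b" "q - 1"] x0H bp q(1) fs.subspace_scale[OF H.part_subspace] by simp
    have de: "gdiff ?e = x0 \<smile> gdiff (primitive b)"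
      using H.cup_leibniz[OF x0H(1) bp(2)] x0H(2) H.d_simps H.mult_simps by simp
    have "x0 \<smile> gdiff (primitive b) \<in> K.Zc (n + 1)"
      using K.ZZ[of x0 p "gdiff (primitive b)" q] gdiff_primitive_Zc[OF b] x0 pq by (simp add: inv_cochains_def)
    then have "fundamental (x0 \<smile> gdiff (primitive b)) = I (lact t ?e - ?e)" using fundamental(2)[OF e] de by simp
    also have "lact t ?e - ?e = fscale ?s (x0 \<smile> (lact t (primitive b) - primitive b))"
      using H.mult_simps by (simp add: lact_simps lact_gcup x0H fs.scale_right_diff_distrib)
    also have "lact t (primitive b) - primitive b = b" by (rule lact_primitive[OF bp(1)])
    also have "I (fscale ?s (x0 \<smile> b)) = ?s * I (x0 \<smile> b)" by (simp only: I_simps)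
    also have "I (x0 \<smile> b) = I (a \<smile> b)"
    proof (rule I_cong)
      have "x0 \<smile> b - a \<smile> b = (x0 - a) \<smile> b" using H.mult_simps by simp
      also have "\<dots> \<in> H.Bc n" using H.BZ[of "x0 - a" p b "q - 1"] x0 b q(1) by (simp add: inv_cochains_def)
      finally show "x0 \<smile> b - a \<smile> b \<in> H.Bc n" .
    qed
    finally show ?thesis using a(2)[OF b] by simp
  qed
  \<comment> \<open>After subtracting the part carried by \<open>x0\<close>, nothing is left on
    transgressions.\<close>
  let ?m = "\<lambda>c. \<mu> c - ?s * fundamental (x0 \<smile> c)"
  have m: "functional ?m"
    using H.mult_simps by (intro functional_I) (simp_all add: lin_simps[OF f(1)] J_simps algebra_simps)
  have mB: "?m b = 0" if "b \<in> K.Bc q" for b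
  proof -
    have "x0 \<smile> b \<in> K.Bc (n + 1)" using K.ZB[of x0 p b q] x0 that pq by (simp add: inv_cochains_def)
    then show ?thesis using f(2)[OF that] fundamental_B by simp
  qed
  have mT: "?m (gdiff (primitive b)) = 0" if "b \<in> H.Zc (q - 1)" for b
    using J1[OF that] by simp
  obtain \<nu> where \<nu>: "functional \<nu>" "\<And>b. b \<in> K.Zc q \<Longrightarrow> \<nu> b = ?m b" "\<And>b. b \<in> H.Bc q \<Longrightarrow> \<nu> b = 0"
    using descend_functional[OF m mB mT] by blast
  obtain a' where a': "a' \<in> H.Zc (p - 1)" "\<And>b. b \<in> H.Zc q \<Longrightarrow> \<nu> b = I (a' \<smile> b)"
    using dualityD1[OF duality q(2) \<nu>(1) \<nu>(3)] unfolding mult_eq by metis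
  let ?x1 = "gdiff (primitive a')"
  have a'p: "a' \<in> ipart H (p - 1)" "primitive a' \<in> ipart H (p - 1)" using a' primitive_part by (auto simp: H.Zc_iff)
  have x1: "?x1 \<in> K.Zc p" using gdiff_primitive_Zc[OF a'(1)] by simp
  have J2: "fundamental (?x1 \<smile> c) = ?m c" if c: "c \<in> K.Zc q" for c
  proof -
    have cH: "c \<in> ipart H q" "gdiff c = 0" "lact t c = c" "c \<in> H.Zc q"
      using c Zc_K_H K_part_t K_part_H by (auto simp: K.Zc_iff)
    let ?e = "primitive a' \<smile> c"
    have e: "?e \<in> ipart H n" using H.mult_part[of "primitive a'" "p - 1" c q] a'p cH q by simp
    have de: "gdiff ?e = ?x1 \<smile> c" using H.cup_leibniz[OF a'p(2) cH(1)] cH(2) H.mult_simps by simp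
    have "?x1 \<smile> c \<in> K.Zc (n + 1)" using K.ZZ[of ?x1 p c q] x1 c pq by (simp add: inv_cochains_def)
    then have "fundamental (?x1 \<smile> c) = I (lact t ?e - ?e)" using fundamental(2)[OF e] de by simp
    also have "lact t ?e - ?e = (lact t (primitive a') - primitive a') \<smile> c"
      using H.mult_simps by (simp add: lact_gcup cH)
    also have "\<dots> = a' \<smile> c" by (simp add: lact_primitive[OF a'p(1)])
    finally show ?thesis using a'(2)[OF cH(4)] \<nu>(2)[OF c] by simp
  qed
  show ?thesis
  proof (intro bexI ballI)
    show "fscale ?s x0 + ?x1 \<in> K.Zc p"
      using x0 x1 fs.subspace_add[OF K.Z_subspace] fs.subspace_scale[OF K.Z_subspace] by (simp add: inv_cochains_def)
    fix b assume b: "b \<in> K.Zc q"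
    have "fundamental ((fscale ?s x0 + ?x1) \<smile> b) = ?s * fundamental (x0 \<smile> b) + fundamental (?x1 \<smile> b)"
      using H.mult_simps by (simp add: J_simps)
    then show "\<mu> b = fundamental ((fscale ?s x0 + ?x1) \<smile> b)" using J2[OF b] by simp
  qed
qed

text \<open>The mirror image. The factor with a primitive now stands on the right in the second
  summand, so the Leibniz sign moves from \<open>x0\<close> to the transgression of
  \<open>a'\<close>.\<close>

lemma represent_left:
  assumes pq: "p + q = n + 1" and f: "functional \<mu>" "\<And>b. b \<in> K.Bc p \<Longrightarrow> \<mu> b = 0"
  shows "\<exists>b\<in>K.Zc q. \<forall>a\<in>K.Zc p. \<mu> a = fundamental (a \<smile> b)"
proof -
  let ?s = "if even p then 1 else -1 :: rat"
  have q: "(p - 1) + q = n" "p + (q - 1) = n" using pq by auto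
  have TB: "\<mu> (gdiff (primitive b)) = 0" if "b \<in> H.Bc (p - 1)" for b using transgression_B[OF f that] .
  obtain a where a: "a \<in> H.Zc q" "\<And>b. b \<in> H.Zc (p - 1) \<Longrightarrow> \<mu> (gdiff (primitive b)) = I (b \<smile> a)"
    using dualityD2[OF duality q(1) transgression_functional[OF f(1)] TB] unfolding mult_eq by metis
  have "lact t a - a \<in> H.Bc q"
  proof -
    have ta: "lact t a - a \<in> H.Zc q" using lact_t_Zc(1)[OF a(1)] a(1) fs.subspace_diff[OF H.Z_subspace] by (simp add: inv_cochains_def)
    have "I (b \<smile> (lact t a - a)) = 0" if b: "b \<in> H.Zc (p - 1)" for b
    proof -
      let ?b = "lact (- t) b"
      have b': "?b \<in> H.Zc (p - 1)" using lact_t_Zc(2) b by blast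
      have d: "lact t ?b - ?b \<in> H.Zc (p - 1)" using lact_t_Zc(1)[OF b'] b' fs.subspace_diff[OF H.Z_subspace] by (simp add: inv_cochains_def)
      have "I (b \<smile> (lact t a - a)) = I (?b \<smile> a) - I (b \<smile> a)"
        using I_shift_right[OF b a(1) q(1)] H.mult_simps by (simp add: I_simps)
      also have "\<dots> = - I ((lact t ?b - ?b) \<smile> a)" using H.mult_simps by (simp add: I_simps)
      also have "\<dots> = - \<mu> (gdiff ?b)" using a(2)[OF d] kills_coinvariants[OF f, where b = ?b] b' by (simp add: H.Zc_iff)
      also have "\<dots> = 0" using b' by (simp add: H.Zc_iff lin_simps[OF f(1)])
      finally show ?thesis .
    qed
    then show ?thesis using H.duality_nondegenerate_right[of n I "p - 1" q] duality q(1) ta by (simp add: inv_cochains_def)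
  qed
  then obtain x0 where x0: "x0 \<in> K.Zc q" "x0 - a \<in> H.Bc q" using correct_invariant[OF a(1)] by blast
  have x0H: "x0 \<in> ipart H q" "gdiff x0 = 0" "lact t x0 = x0" "x0 \<in> H.Zc q"
    using x0 Zc_K_H K_part_t K_part_H by (auto simp: K.Zc_iff)
  have J1: "fundamental (gdiff (primitive b) \<smile> x0) = \<mu> (gdiff (primitive b))" if b: "b \<in> H.Zc (p - 1)" for b
  proof -
    have bp: "b \<in> ipart H (p - 1)" "primitive b \<in> ipart H (p - 1)" using b primitive_part by (auto simp: H.Zc_iff)
    let ?e = "primitive b \<smile> x0"
    have e: "?e \<in> ipart H n" using H.mult_part[of "primitive b" "p - 1" x0 q] x0H bp q(1) by simp
    have de: "gdiff ?e = gdiff (primitive b) \<smile> x0"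
      using H.cup_leibniz[OF bp(2) x0H(1)] x0H(2) H.mult_simps by simp
    have "gdiff (primitive b) \<smile> x0 \<in> K.Zc (n + 1)"
      using K.ZZ[of "gdiff (primitive b)" p x0 q] gdiff_primitive_Zc[OF b] x0 pq by (simp add: inv_cochains_def)
    then have "fundamental (gdiff (primitive b) \<smile> x0) = I (lact t ?e - ?e)" using fundamental(2)[OF e] de by simp
    also have "lact t ?e - ?e = (lact t (primitive b) - primitive b) \<smile> x0"
      using H.mult_simps by (simp add: lact_gcup x0H)
    also have "lact t (primitive b) - primitive b = b" by (rule lact_primitive[OF bp(1)])
    also have "I (b \<smile> x0) = I (b \<smile> a)"
    proof (rule I_cong)
      have "b \<smile> x0 - b \<smile> a = b \<smile> (x0 - a)" using H.mult_simps by simp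
      also have "\<dots> \<in> H.Bc n" using H.ZB[of b "p - 1" "x0 - a" q] x0 b q(1) by (simp add: inv_cochains_def)
      finally show "b \<smile> x0 - b \<smile> a \<in> H.Bc n" .
    qed
    finally show ?thesis using a(2)[OF b] by simp
  qed
  let ?m = "\<lambda>c. \<mu> c - fundamental (c \<smile> x0)"
  have m: "functional ?m"
    using H.mult_simps by (intro functional_I) (simp_all add: lin_simps[OF f(1)] J_simps algebra_simps)
  have mB: "?m b = 0" if "b \<in> K.Bc p" for b
  proof -
    have "b \<smile> x0 \<in> K.Bc (n + 1)" using K.BZ[of b p x0 q] x0 that pq by (simp add: inv_cochains_def)
    then show ?thesis using f(2)[OF that] fundamental_B by simp
  qed
  have mT: "?m (gdiff (primitive b)) = 0" if "b \<in> H.Zc (p - 1)" for b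
    using J1[OF that] by simp
  obtain \<nu> where \<nu>: "functional \<nu>" "\<And>b. b \<in> K.Zc p \<Longrightarrow> \<nu> b = ?m b" "\<And>b. b \<in> H.Bc p \<Longrightarrow> \<nu> b = 0"
    using descend_functional[OF m mB mT] by blast
  obtain a' where a': "a' \<in> H.Zc (q - 1)" "\<And>b. b \<in> H.Zc p \<Longrightarrow> \<nu> b = I (b \<smile> a')"
    using dualityD2[OF duality q(2) \<nu>(1) \<nu>(3)] unfolding mult_eq by metis
  let ?x1 = "gdiff (primitive a')"
  have a'p: "a' \<in> ipart H (q - 1)" "primitive a' \<in> ipart H (q - 1)" using a' primitive_part by (auto simp: H.Zc_iff)
  have x1: "?x1 \<in> K.Zc q" using gdiff_primitive_Zc[OF a'(1)] by simp
  have J2: "?s * fundamental (c \<smile> ?x1) = ?m c" if c: "c \<in> K.Zc p" for c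
  proof -
    have cH: "c \<in> ipart H p" "gdiff c = 0" "lact t c = c" "c \<in> H.Zc p"
      using c Zc_K_H K_part_t K_part_H by (auto simp: K.Zc_iff)
    let ?e = "fscale ?s (c \<smile> primitive a')"
    have e: "?e \<in> ipart H n" using H.mult_part[of c p "primitive a'" "q - 1"] cH a'p q fs.subspace_scale[OF H.part_subspace] by simp
    have de: "gdiff ?e = c \<smile> ?x1" using H.cup_leibniz[OF cH(1) a'p(2)] cH(2) H.mult_simps H.d_simps by simp
    have "c \<smile> ?x1 \<in> K.Zc (n + 1)" using K.ZZ[of c p ?x1 q] x1 c pq by (simp add: inv_cochains_def)
    then have "fundamental (c \<smile> ?x1) = I (lact t ?e - ?e)" using fundamental(2)[OF e] de by simp
    also have "lact t ?e - ?e = fscale ?s (c \<smile> (lact t (primitive a') - primitive a'))"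
      using H.mult_simps by (simp add: lact_simps lact_gcup cH fs.scale_right_diff_distrib)
    also have "lact t (primitive a') - primitive a' = a'" by (rule lact_primitive[OF a'p(1)])
    also have "I (fscale ?s (c \<smile> a')) = ?s * I (c \<smile> a')" by (simp only: I_simps)
    finally show ?thesis using a'(2)[OF cH(4)] \<nu>(2)[OF c] by simp
  qed
  show ?thesis
  proof (intro bexI ballI)
    show "x0 + fscale ?s ?x1 \<in> K.Zc q"
      using x0 x1 fs.subspace_add[OF K.Z_subspace] fs.subspace_scale[OF K.Z_subspace] by (simp add: inv_cochains_def)
    fix b assume b: "b \<in> K.Zc p"
    have "fundamental (b \<smile> (x0 + fscale ?s ?x1)) = fundamental (b \<smile> x0) + ?s * fundamental (b \<smile> ?x1)"
      using H.mult_simps by (simp add: J_simps)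
    then show "\<mu> b = fundamental (b \<smile> (x0 + fscale ?s ?x1))" using J2[OF b] by simp
  qed
qed

theorem duality_extension: "duality (inv_cochains K) (n + 1) fundamental"
  unfolding duality_def mult_eq
  using fundamental(1) fundamental_B represent_right represent_left by blast

text \<open>An element normalizing both groups acts on the top class of \<open>K\<close> by its
  action \<kappa> on the top class of \<open>H\<close> times the sign \<epsilon> with which
  conjugation acts on the cyclic quotient.\<close>

lemma fundamental_character:
  assumes NH: "\<And>h. h \<in> H \<Longrightarrow> - g + h + g \<in> H" and NK: "\<And>k. k \<in> K \<Longrightarrow> - g + k + g \<in> K"
    and conj: "(\<epsilon> = 1 \<and> - t + (- g + t + g) \<in> H) \<or> (\<epsilon> = -1 \<and> t + (- g + t + g) \<in> H)"
    and \<kappa>: "\<And>b. b \<in> H.Zc n \<Longrightarrow> I (lact g b) = \<kappa> * I b"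
    and c: "c \<in> K.Zc (n + 1)"
  shows "fundamental (lact g c) = \<epsilon> * \<kappa> * fundamental c"
proof -
  obtain e where e: "e \<in> ipart H n" "c = gdiff e" using top_exact Zc_K_H[OF c] by blast
  have ge: "lact g e \<in> ipart H n" using lact_ipart[OF H.subgrp NH] e by blast
  have gc: "gdiff (lact g e) \<in> K.Zc (n + 1)" using K.lact_Zc[OF NK c] e(2) lact_gdiff by metis
  let ?z = "lact t e - e"
  have zp: "?z \<in> ipart H n" using lact_part(1)[OF e(1)] e(1) fs.subspace_diff[OF H.part_subspace] by simp
  have "gdiff ?z = lact t c - c" using H.d_simps(3) e by (simp add: lact_gdiff)
  also have "\<dots> = 0" using K_Zc_t[OF c] by simp
  finally have z: "?z \<in> H.Zc n" using zp by (simp add: H.Zc_iff)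
  have "fundamental (lact g c) = I (lact t (lact g e) - lact g e)"
    using fundamental(2)[OF ge gc] e(2) by (simp add: lact_gdiff)
  also have "lact t (lact g e) - lact g e = lact g (lact (- g + t + g) e - e)"
    by (simp add: lact_simps lact_lact add.assoc[symmetric])
  finally have L: "fundamental (lact g c) = I (lact g (lact (- g + t + g) e - e))" .
  have R: "fundamental c = I ?z" using fundamental(2)[OF e(1)] c e(2) by simp
  from conj show ?thesis
  proof
    assume h: "\<epsilon> = 1 \<and> - t + (- g + t + g) \<in> H"
    have "lact (- g + t + g) e = lact t (lact (- t + (- g + t + g)) e)" by (simp only: lact_lact add_minus_cancel)
    also have "\<dots> = lact t e" using h e(1) by (simp add: H.part_iff)
    finally show ?thesis using L R \<kappa>[OF z] h by simp
  next
    assume h: "\<epsilon> = -1 \<and> t + (- g + t + g) \<in> H"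
    have "lact (- g + t + g) e = lact (- t) (lact (t + (- g + t + g)) e)" by (simp only: lact_lact minus_add_cancel)
    also have "\<dots> = lact (- t) e" using h e(1) by (simp add: H.part_iff)
    \<comment> \<open>Reversing \<open>t\<close> replaces the difference by minus its translate by
      \<open>- t\<close>, and the integral ignores translates.\<close>
    finally have eq: "lact (- g + t + g) e - e = - lact (- t) ?z" by (simp add: lact_simps)
    have z': "lact (- t) ?z \<in> H.Zc n" using lact_t_Zc(2)[OF z] .
    have "I (lact (- t) ?z) = I ?z" using I_t[OF z'] by (simp only: lact_neg)
    then have "I (lact g (- lact (- t) ?z)) = - (\<kappa> * I ?z)"
      using \<kappa>[OF z'] by (simp only: lact_simps(4) I_simps(4))
    then show ?thesis using L R h unfolding eq by simp
  qed
qed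

end

section \<open>Duality for the trivial group and for extensions by a finite group\<close>

text \<open>The full simplex on the group is a cone: prepending 0 to tuples is a contracting
  homotopy, and it is available because invariance under \<open>{0}\<close> is no
  restriction.\<close>

lemma trivial_group_exact:
  fixes a :: "nat \<Rightarrow> 'g::group_add list \<Rightarrow> rat"
  assumes "a \<in> cocycles (inv_cochains {0}) p" "p \<noteq> 0"
  shows "a \<in> coboundaries (inv_cochains {0}) p"
proof -
  interpret group_cochains "{0 :: 'g}" by unfold_locales (auto simp: subgrp_def)
  note a = assms(1)[unfolded Zc_iff]
  define h where "h = (\<lambda>q s. a (Suc q) (0 # s))"
  have "h \<in> ipart {0} (p - 1)"
    unfolding part_iff
  proof (intro conjI allI impI ballI)
    fix q s assume "h q s \<noteq> 0"
    then have "int (Suc q) = p \<and> length (0 # s) = Suc (Suc q)" using a unfolding part_iff h_def by blast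
    then show "int q = p - 1" "length s = Suc q" by auto
  qed simp
  moreover have "a = gdiff h"
  proof (intro ext)
    fix q s
    show "a q s = gdiff h q s"
    proof (cases "int q = p \<and> length s = Suc q")
      case False
      have "gdiff h \<in> ipart {0} p" using d_part[of h "p - 1"] \<open>h \<in> _\<close> by simp
      then have "gdiff h q s = 0" "a q s = 0" using False a unfolding part_iff by blast+
      then show ?thesis by simp
    next
      case True
      then obtain r where r: "q = Suc r" using assms(2) by (cases q) auto
      have s: "length s = Suc (Suc r)" using True r by simp
      have 0: "tuple_act q (skip 0) (0 # s) = s"
        using s r by (intro nth_equalityI) (auto simp: less_Suc_eq_le skip_def)
      have 1: "tuple_act q (skip (Suc k)) (0 # s) = 0 # tuple_act r (skip k) s" for k
      proof (rule nth_equalityI)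
        fix i assume "i < length (tuple_act q (skip (Suc k)) (0 # s))"
        then have "i \<le> Suc r" by (simp add: r)
        then show "tuple_act q (skip (Suc k)) (0 # s) ! i = (0 # tuple_act r (skip k) s) ! i"
          by (cases i) (auto simp: r skip_def)
      qed (simp add: r)
      have "gdiff a (Suc q) (0 # s) = 0" using a by simp
      then have "(\<Sum>k\<le>Suc q. (-1) ^ k * a q (tuple_act q (skip k) (0 # s))) = 0"
        using s r by (simp add: ss_diff_def tuples_def del: sum.atMost_Suc)
      then have "a q s = (\<Sum>k\<le>q. (-1) ^ k * a q (0 # tuple_act r (skip k) s))"
        unfolding sum.atMost_Suc_shift by (simp add: 0 1 sum_negf)
      also have "\<dots> = gdiff h q s" using s r by (simp add: ss_diff_def tuples_def h_def)
      finally show ?thesis .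
    qed
  qed
  ultimately show ?thesis by (auto simp: Bc_iff)
qed

lemma trivial_group_duality:
  "duality (inv_cochains {0 :: 'g::group_add}) 0 (\<lambda>c. c 0 [0])"
proof -
  interpret group_cochains "{0 :: 'g}" by unfold_locales (auto simp: subgrp_def)
  let ?u = "\<lambda>q (s :: 'g list). if q = 0 \<and> length s = 1 then 1 else 0 :: rat"
  have mult: "dga_mult (inv_cochains {0 :: 'g}) = ss_cup tuples tuple_act" by (simp add: inv_cochains_def)
  have up: "?u \<in> ipart {0} 0" using unit_Zc Zc_iff by blast
  have cu: "(fscale r ?u \<smile> b) 0 [0] = r * b 0 [0]" if "b \<in> Zc 0" for r b
  proof -
    have "fscale r ?u \<smile> b = fscale r (?u \<smile> b)" using mult_simps(7) by simp
    moreover have "?u \<smile> b = b" using unit_cup[of b 0] that Zc_iff by blast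
    ultimately show ?thesis by simp
  qed
  have z: "b 0 [0] = 0" if b: "b \<in> Bc 0" for b :: "nat \<Rightarrow> 'g list \<Rightarrow> rat"
  proof -
    obtain a where "a \<in> ipart {0} (- 1)" "b = gdiff a" using b by (auto simp: Bc_iff)
    then show ?thesis by (simp add: ss_diff_def)
  qed
  show ?thesis unfolding duality_def mult
  proof (intro conjI allI impI ballI)
    show "functional (\<lambda>c. c 0 [0 :: 'g])" by (intro functional_I) auto
    show "b 0 [0] = 0" if "b \<in> Bc 0" for b using z that .
  next
    fix p q \<mu> assume h: "p + q = 0 \<and> functional \<mu> \<and> (\<forall>b\<in>Bc q. \<mu> b = 0)"
    then have m: "functional \<mu>" by simp
    show "\<exists>a\<in>Zc p. \<forall>b\<in>Zc q. \<mu> b = (a \<smile> b) 0 [0]"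
    proof (cases "q = 0")
      case True
      have "fscale (\<mu> ?u) ?u \<in> Zc 0"
        using unit_Zc fs.subspace_scale[OF Z_subspace] by (simp add: inv_cochains_def)
      moreover have "\<mu> b = (fscale (\<mu> ?u) ?u \<smile> b) 0 [0]" if "b \<in> Zc 0" for b
        using arg_cong[OF Zc0_constant[OF that], of \<mu>] cu[OF that] by (simp add: lin_simps[OF m] mult.commute)
      ultimately show ?thesis using True h by (intro bexI[of _ "fscale (\<mu> ?u) ?u"]) auto
    next
      case False
      then have "\<mu> b = 0" if "b \<in> Zc q" for b using h trivial_group_exact that by blast
      then show ?thesis using cup_zero_left fs.subspace_0[OF Z_subspace]
        by (intro bexI[of _ 0]) (simp_all add: inv_cochains_def)
    qed
  next
    fix p q \<mu> assume h: "p + q = 0 \<and> functional \<mu> \<and> (\<forall>b\<in>Bc p. \<mu> b = 0)"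
    then have m: "functional \<mu>" by simp
    show "\<exists>b\<in>Zc q. \<forall>a\<in>Zc p. \<mu> a = (a \<smile> b) 0 [0]"
    proof (cases "p = 0")
      case True
      have b: "fscale (\<mu> ?u) ?u \<in> Zc 0"
        using unit_Zc fs.subspace_scale[OF Z_subspace] by (simp add: inv_cochains_def)
      moreover have "\<mu> a = (a \<smile> fscale (\<mu> ?u) ?u) 0 [0]" if "a \<in> Zc 0" for a
      proof -
        have "\<mu> a = a 0 [0] * \<mu> ?u" using arg_cong[OF Zc0_constant[OF that], of \<mu>] by (simp add: lin_simps[OF m])
        also have "\<dots> = (fscale (a 0 [0]) ?u \<smile> fscale (\<mu> ?u) ?u) 0 [0]" using cu[OF b] by simp
        finally show ?thesis using Zc0_constant[OF that] by simp
      qed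
      ultimately show ?thesis using True h by (intro bexI[of _ "fscale (\<mu> ?u) ?u"]) auto
    next
      case False
      then have "\<mu> b = 0" if "b \<in> Zc p" for b using h trivial_group_exact that by blast
      then show ?thesis using lin_mult_right fs.subspace_0[OF Z_subspace]
        by (intro bexI[of _ 0]) (auto simp: inv_cochains_def ss_cup_def)
    qed
  qed
qed

text \<open>Averaging over the two cosets is a chain projection onto the \<open>K\<close>-invariant
  cochains. Since \<open>\<tau>\<close> preserves \<open>I\<close>, averaging one factor does not
  change its integral against an invariant one, so the same functional gives duality for
  \<open>K\<close>.\<close>

lemma duality_index_two:
  fixes H K :: "'g::group_add set"
  assumes sub: "subgrp H" "subgrp K" and K: "H \<subseteq> K" "\<tau> \<in> K" "\<And>k. k \<in> K \<Longrightarrow> k \<in> H \<or> - \<tau> + k \<in> H"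
    and tau: "\<tau> + \<tau> \<in> H" "\<And>h. h \<in> H \<Longrightarrow> - \<tau> + h + \<tau> \<in> H"
    and duality: "duality (inv_cochains H) n I" and It: "\<And>b. b \<in> cocycles (inv_cochains H) n \<Longrightarrow> I (lact \<tau> b) = I b"
  shows "duality (inv_cochains K) n I"
proof -
  interpret H: group_cochains H by unfold_locales fact
  interpret K: group_cochains K by unfold_locales fact
  have I: "functional I" and IB: "\<And>b. b \<in> H.Bc n \<Longrightarrow> I b = 0" using duality by (auto simp: duality_def)
  note I_simps = lin_simps[OF I]
  have mult: "dga_mult (inv_cochains H) = ss_cup tuples tuple_act" "dga_mult (inv_cochains K) = ss_cup tuples tuple_act"
    by (simp_all add: inv_cochains_def)
  have KH: "f \<in> ipart H p" if "f \<in> ipart K p" for f p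
    using that K by (auto simp: H.part_iff K.part_iff)
  have Kt: "lact \<tau> f = f" if "f \<in> ipart K p" for f p using that K by (auto simp: K.part_iff)
  have KI: "f \<in> ipart K p" if f: "f \<in> ipart H p" "lact \<tau> f = f" for f p
  proof -
    have "lact k f = f" if "k \<in> K" for k
    proof (cases "k \<in> H")
      case False
      then have "- \<tau> + k \<in> H" using K that by blast
      then have "lact \<tau> (lact (- \<tau> + k) f) = f" using f by (simp add: H.part_iff)
      then show ?thesis by (simp only: lact_lact add_minus_cancel)
    qed (use f in \<open>auto simp: H.part_iff\<close>)
    then show ?thesis using f by (simp add: H.part_iff K.part_iff)
  qed
  define avg where "avg f = fscale (1/2) (f + lact \<tau> f)" for f :: "nat \<Rightarrow> 'g list \<Rightarrow> rat"
  have avg_lin: "linop avg"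
    by (intro linop_I) (auto simp: avg_def lact_def fun_eq_iff algebra_simps)
  have lt: "lact \<tau> f \<in> ipart H p" if "f \<in> ipart H p" for f p using lact_ipart[OF sub(1) tau(2) that] .
  have avgK: "avg f \<in> ipart K p" if "f \<in> ipart H p" for f p
  proof (rule KI)
    show "avg f \<in> ipart H p" unfolding avg_def
      using that lt fs.subspace_scale[OF H.part_subspace] fs.subspace_add[OF H.part_subspace] by simp
    have "lact \<tau> (lact \<tau> f) = f" using that tau(1) by (simp add: H.part_iff lact_lact)
    then show "lact \<tau> (avg f) = avg f" by (simp add: avg_def lact_simps add.commute)
  qed
  have avgd: "gdiff (avg f) = avg (gdiff f)" for f
    using H.d_simps by (simp add: avg_def lact_gdiff)
  have avg_id: "avg f = f" if "f \<in> ipart K p" for f p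
    using Kt[OF that] by (simp add: avg_def fun_eq_iff)
  have avgZ: "avg f \<in> K.Zc p" if "f \<in> H.Zc p" for f p
    using that avgK avgd lin_simps(5)[OF avg_lin] by (simp add: H.Zc_iff K.Zc_iff)
  have avgB: "avg f \<in> K.Bc p" if "f \<in> H.Bc p" for f p
    using that avgK by (force simp: H.Bc_iff K.Bc_iff avgd[symmetric])
  have KZH: "c \<in> H.Zc p" if "c \<in> K.Zc p" for c p using that KH by (simp add: H.Zc_iff K.Zc_iff)
  have KZt: "lact \<tau> c = c" if "c \<in> K.Zc p" for c p using that Kt by (auto simp: K.Zc_iff)
  have avgc: "avg c = c" if "c \<in> K.Zc p" for c p using that avg_id by (auto simp: K.Zc_iff)
  show ?thesis unfolding duality_def mult
  proof (intro conjI allI impI ballI)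
    show "functional I" by (rule I)
    show "I b = 0" if b: "b \<in> K.Bc n" for b
    proof (rule IB)
      show "b \<in> H.Bc n" using b KH by (auto simp: H.Bc_iff K.Bc_iff)
    qed
  next
    fix p q \<mu> assume h: "p + q = n \<and> functional \<mu> \<and> (\<forall>b\<in>K.Bc q. \<mu> b = 0)"
    then have m: "functional \<mu>" and pq: "p + q = n" by auto
    have f: "functional (\<lambda>b. \<mu> (avg b))"
      by (intro functional_I) (simp_all add: lin_simps[OF m] lin_simps[OF avg_lin])
    have v: "\<mu> (avg b) = 0" if "b \<in> H.Bc q" for b using h avgB[OF that] by blast
    obtain a where a: "a \<in> H.Zc p" "\<And>b. b \<in> H.Zc q \<Longrightarrow> \<mu> (avg b) = I (a \<smile> b)"
      using dualityD1[OF duality pq f v] unfolding mult by metis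
    show "\<exists>a\<in>K.Zc p. \<forall>b\<in>K.Zc q. \<mu> b = I (a \<smile> b)"
    proof (intro bexI[of _ "avg a"] ballI)
      fix b assume b: "b \<in> K.Zc q"
      have ab: "a \<smile> b \<in> H.Zc n" using H.ZZ[of a p b q] a KZH[OF b] pq by (simp add: inv_cochains_def)
      have "I (avg a \<smile> b) = 1/2 * (I (a \<smile> b) + I (lact \<tau> a \<smile> b))"
        unfolding avg_def using H.mult_simps by (simp add: I_simps)
      also have "lact \<tau> a \<smile> b = lact \<tau> (a \<smile> b)" using KZt[OF b] by (simp add: lact_gcup)
      also have "I (lact \<tau> (a \<smile> b)) = I (a \<smile> b)" by (rule It[OF ab])
      finally show "\<mu> b = I (avg a \<smile> b)" using a(2)[OF KZH[OF b]] avgc[OF b] by simp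
    qed (use avgZ a in blast)
  next
    fix p q \<mu> assume h: "p + q = n \<and> functional \<mu> \<and> (\<forall>b\<in>K.Bc p. \<mu> b = 0)"
    then have m: "functional \<mu>" and pq: "p + q = n" by auto
    have f: "functional (\<lambda>b. \<mu> (avg b))"
      by (intro functional_I) (simp_all add: lin_simps[OF m] lin_simps[OF avg_lin])
    have v: "\<mu> (avg b) = 0" if "b \<in> H.Bc p" for b using h avgB[OF that] by blast
    obtain a where a: "a \<in> H.Zc q" "\<And>b. b \<in> H.Zc p \<Longrightarrow> \<mu> (avg b) = I (b \<smile> a)"
      using dualityD2[OF duality pq f v] unfolding mult by metis
    show "\<exists>b\<in>K.Zc q. \<forall>a\<in>K.Zc p. \<mu> a = I (a \<smile> b)"
    proof (intro bexI[of _ "avg a"] ballI)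
      fix b assume b: "b \<in> K.Zc p"
      have ab: "b \<smile> a \<in> H.Zc n" using H.ZZ[of b p a q] a KZH[OF b] pq by (simp add: inv_cochains_def)
      have "I (b \<smile> avg a) = 1/2 * (I (b \<smile> a) + I (b \<smile> lact \<tau> a))"
        unfolding avg_def using H.mult_simps by (simp add: I_simps)
      also have "b \<smile> lact \<tau> a = lact \<tau> (b \<smile> a)" using KZt[OF b] by (simp add: lact_gcup)
      also have "I (lact \<tau> (b \<smile> a)) = I (b \<smile> a)" by (rule It[OF ab])
      finally show "\<mu> b = I (b \<smile> avg a)" using a(2)[OF KZH[OF b]] avgc[OF b] by simp
    qed (use avgZ a in blast)
  qed
qed

section \<open>The group\<close>

text \<open>
  \<open>El f0 f1 f2 f3 h0 h1 h2 x u e\<close> is a pair of integral polynomials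
  \<open>f = f0 + f1 s + f2 s\<^sup>2 + f3 s\<^sup>3\<close>, \<open>h = h0 + h1 s + h2 s\<^sup>2\<close>, followed by integers \<open>x\<close>, \<open>u\<close> and a
  sign \<open>e\<close>. The sign acts by \<open>(f, h) \<mapsto> (f, -h)\<close> and \<open>u \<mapsto> -u\<close>, the integer \<open>x\<close> translates the variable
  \<open>s\<close>, and \<open>u\<close> acts by \<open>(f, h) \<mapsto> (f + u h''/2, h + u f''/2)\<close>. Let \<open>X\<close>, \<open>U\<close>, \<open>V\<close>, \<open>Y\<close> be the elements
  given by \<open>x = 1\<close>, \<open>u = 1\<close>, \<open>h = 6 s\<^sup>2\<close> and \<open>f = s\<^sup>3\<close>. Then \<open>[X, [X, [X, Y]]]\<close> is the constant \<open>f = 6\<close> and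
  equals \<open>[U, V]\<close>, while the sign inverts \<open>U\<close> and \<open>V\<close>.
\<close>

datatype pgroup = El (f0: int) (f1: int) (f2: int) (f3: int) (h0: int) (h1: int) (h2: int)
  (px: int) (pu: int) (pe: bool)

definition esgn :: "bool \<Rightarrow> int" where "esgn e = (if e then -1 else 1)"

instantiation pgroup :: group_add
begin

definition zero_pgroup :: pgroup where "0 = El 0 0 0 0 0 0 0 0 0 False"

text \<open>The law of a semidirect product: the polynomials of \<open>g'\<close> undergo the sign
  of \<open>g\<close>, then \<open>u\<close>, then the substitution of \<open>s + x\<close> for
  \<open>s\<close>, and are added to those of \<open>g\<close>. \<open>F0\<close>,
  \<open>H0\<close>, \<open>H1\<close> are the coefficients that \<open>u\<close> changes, taken
  before the substitution.\<close>

definition plus_pgroup :: "pgroup \<Rightarrow> pgroup \<Rightarrow> pgroup" where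
  "(g :: pgroup) + g' = (let x = px g; u = pu g; s = esgn (pe g);
       F0 = f0 g' + u * s * h2 g'; H0 = s * h0 g' + u * f2 g'; H1 = s * h1 g' + 3 * u * f3 g'
     in El (f0 g + F0 + f1 g' * x + f2 g' * x^2 + f3 g' * x^3)
          (f1 g + f1 g' + 2 * f2 g' * x + 3 * f3 g' * x^2)
          (f2 g + f2 g' + 3 * f3 g' * x)
          (f3 g + f3 g')
          (h0 g + H0 + H1 * x + s * h2 g' * x^2)
          (h1 g + H1 + 2 * s * h2 g' * x)
          (h2 g + s * h2 g')
          (x + px g') (u + s * pu g') (pe g \<noteq> pe g'))"

definition uminus_pgroup :: "pgroup \<Rightarrow> pgroup" where
  "- (g :: pgroup) = (let x = - px g; s = esgn (pe g); u = - s * pu g;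
       F0 = f0 g + u * s * h2 g; H0 = s * h0 g + u * f2 g; H1 = s * h1 g + 3 * u * f3 g
     in El (- (F0 + f1 g * x + f2 g * x^2 + f3 g * x^3))
          (- (f1 g + 2 * f2 g * x + 3 * f3 g * x^2))
          (- (f2 g + 3 * f3 g * x))
          (- f3 g)
          (- (H0 + H1 * x + s * h2 g * x^2))
          (- (H1 + 2 * s * h2 g * x))
          (- (s * h2 g))
          x u (pe g))"

definition minus_pgroup :: "pgroup \<Rightarrow> pgroup \<Rightarrow> pgroup" where "(g :: pgroup) - g' = g + - g'"

instance
proof
  fix a b c :: pgroup
  show "a + b + c = a + (b + c)"
    by (cases "pe a"; cases "pe b"; cases "pe c")
       (simp_all add: plus_pgroup_def Let_def esgn_def algebra_simps power2_eq_square power3_eq_cube)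
  show "0 + a = a" "a + 0 = a"
    by (simp_all add: plus_pgroup_def zero_pgroup_def Let_def esgn_def)
  show "- a + a = 0"
    by (cases "pe a") (simp_all add: plus_pgroup_def uminus_pgroup_def zero_pgroup_def Let_def esgn_def
      algebra_simps power2_eq_square power3_eq_cube)
qed (simp add: minus_pgroup_def)

end

text \<open>Countability makes the set where two step functions differ measurable and lets their
  values be coded by natural numbers.\<close>

instance pgroup :: countable by countable_datatype

text \<open>The polynomial coefficients come by increasing degree, then \<open>x\<close> and
  \<open>u\<close>. Translation and \<open>u\<close> change a coefficient only by later ones, so
  killing all coordinates from \<open>k\<close> on gives a normal subgroup, with infinite cyclic
  successive quotients.\<close>

definition coord :: "nat \<Rightarrow> pgroup \<Rightarrow> int" where
  "coord k = (if k = 0 then f0 else if k = 1 then h0 else if k = 2 then f1 else if k = 3 then h1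
     else if k = 4 then f2 else if k = 5 then h2 else if k = 6 then f3 else if k = 7 then px else pu)"

definition coord_unit :: "nat \<Rightarrow> pgroup" where
  "coord_unit k = El (of_bool (k = 0)) (of_bool (k = 2)) (of_bool (k = 4)) (of_bool (k = 6))
     (of_bool (k = 1)) (of_bool (k = 3)) (of_bool (k = 5)) (of_bool (k = 7)) (of_bool (k = 8)) False"

definition coord_sign :: "nat \<Rightarrow> pgroup \<Rightarrow> rat" where
  "coord_sign k g = (if pe g \<and> k \<in> {1, 3, 5, 8} then -1 else 1)"

definition chain :: "nat \<Rightarrow> pgroup set" where
  "chain k = {g. \<not> pe g \<and> (\<forall>i. k \<le> i \<and> i < 9 \<longrightarrow> coord i g = 0)}"

lemma all_less_9: "(\<forall>i. k \<le> i \<and> i < 9 \<longrightarrow> P i) \<longleftrightarrow>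
    (k \<le> 0 \<longrightarrow> P 0) \<and> (k \<le> 1 \<longrightarrow> P 1) \<and> (k \<le> 2 \<longrightarrow> P 2) \<and> (k \<le> 3 \<longrightarrow> P 3) \<and> (k \<le> 4 \<longrightarrow> P 4) \<and>
    (k \<le> 5 \<longrightarrow> P 5) \<and> (k \<le> 6 \<longrightarrow> P 6) \<and> (k \<le> 7 \<longrightarrow> P 7) \<and> (k \<le> 8 \<longrightarrow> P (8 :: nat))"
proof -
  have "i < 9 \<longleftrightarrow> i = 0 \<or> i = 1 \<or> i = 2 \<or> i = 3 \<or> i = 4 \<or> i = 5 \<or> i = 6 \<or> i = 7 \<or> i = 8" for i :: nat
    by linarith
  then show ?thesis by (simp add: conj_disj_distribL imp_disjL all_conj_distrib)
qed

lemma less_9: "(k :: nat) < 9 \<Longrightarrow> k = 0 \<or> k = 1 \<or> k = 2 \<or> k = 3 \<or> k = 4 \<or> k = 5 \<or> k = 6 \<or> k = 7 \<or> k = 8"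
  by linarith

lemma chain_mem: "g \<in> chain k \<longleftrightarrow> \<not> pe g \<and>
    (k \<le> 0 \<longrightarrow> f0 g = 0) \<and> (k \<le> 1 \<longrightarrow> h0 g = 0) \<and> (k \<le> 2 \<longrightarrow> f1 g = 0) \<and> (k \<le> 3 \<longrightarrow> h1 g = 0) \<and>
    (k \<le> 4 \<longrightarrow> f2 g = 0) \<and> (k \<le> 5 \<longrightarrow> h2 g = 0) \<and> (k \<le> 6 \<longrightarrow> f3 g = 0) \<and> (k \<le> 7 \<longrightarrow> px g = 0) \<and> (k \<le> 8 \<longrightarrow> pu g = 0)"
  unfolding chain_def all_less_9 by (simp add: coord_def)

lemma subgrp_chain: "subgrp (chain k)"
  unfolding subgrp_def
  by (auto simp: chain_mem plus_pgroup_def uminus_pgroup_def zero_pgroup_def Let_def esgn_def)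

lemma chain_9: "chain 9 = {g. \<not> pe g}" and chain_0: "chain 0 = {0}"
  by (auto simp: chain_mem zero_pgroup_def intro: pgroup.expand)

lemma chain_step: "h \<in> chain k \<longleftrightarrow> h \<in> chain (Suc k) \<and> coord k h = 0" if "k < 9"
  unfolding chain_mem using less_9[OF that] by (auto simp: coord_def)

lemma chain_normal:
  assumes "h \<in> chain k"
  shows "- g + h + g \<in> chain k"
  using assms unfolding chain_mem
  by (cases "pe g") (auto simp: plus_pgroup_def uminus_pgroup_def Let_def esgn_def algebra_simps power2_eq_square power3_eq_cube)

lemma coord_add: "k < 9 \<Longrightarrow> a \<in> chain (Suc k) \<Longrightarrow> coord k (a + g) = coord k a + coord k g"
  unfolding chain_mem using less_9[of k]
  by (auto simp: coord_def plus_pgroup_def Let_def esgn_def)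

lemma coord_unit_conj:
  assumes "k < 9"
  shows "(coord_sign k g = 1 \<and> - coord_unit k + (- g + coord_unit k + g) \<in> chain k) \<or>
    (coord_sign k g = -1 \<and> coord_unit k + (- g + coord_unit k + g) \<in> chain k)"
  using less_9[OF assms] unfolding chain_mem
  by (cases "pe g") (auto simp: plus_pgroup_def uminus_pgroup_def Let_def esgn_def coord_unit_def coord_sign_def
      algebra_simps power2_eq_square power3_eq_cube)

text \<open>The induction carries along the character by which the whole group acts on top cocycles.
  It shows that each \<open>coord_unit k\<close> acts trivially, as the extension step requires, and
  finally determines the action of the sign.\<close>

lemma chain_duality:
  "k \<le> 9 \<Longrightarrow> \<exists>I. duality (inv_cochains (chain k)) (int k) I \<and>
     (\<forall>g. \<forall>b\<in>cocycles (inv_cochains (chain k)) (int k). I (lact g b) = (\<Prod>i<k. coord_sign i g) * I b)"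
proof (induction k)
  case 0
  interpret group_cochains "{0 :: pgroup}" by unfold_locales (auto simp: subgrp_def)
  have "lact g b 0 [0] = b 0 [0]" if "b \<in> Zc 0" for g b
    using arg_cong[OF Zc0_constant[OF that], of "\<lambda>c. c 0 [- g]"] by (simp add: lact_def)
  then show ?case using trivial_group_duality[where 'g = pgroup] by (auto simp: chain_0)
next
  case (Suc k)
  then have k: "k < 9" by simp
  from Suc obtain I where I: "duality (inv_cochains (chain k)) (int k) I"
    "\<And>g b. b \<in> cocycles (inv_cochains (chain k)) (int k) \<Longrightarrow> I (lact g b) = (\<Prod>i<k. coord_sign i g) * I b" by auto
  have 1: "coord_sign i (coord_unit k) = 1" for i by (simp add: coord_sign_def coord_unit_def)
  interpret wang_duality "chain k" "chain (Suc k)" "coord_unit k" "coord k" "int k" I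
  proof
    show "coord_unit k \<in> chain (Suc k)" "coord k (coord_unit k) = 1"
      using less_9[OF k] by (auto simp: chain_mem coord_unit_def coord_def)
    show "I (lact (coord_unit k) b) = I b" if "b \<in> cocycles (inv_cochains (chain k)) (int k)" for b
      using I(2)[OF that] 1 by simp
  qed (use k I subgrp_chain chain_step coord_add in auto)
  have "fundamental (lact g c) = (\<Prod>i<Suc k. coord_sign i g) * fundamental c"
    if "c \<in> cocycles (inv_cochains (chain (Suc k))) (int k + 1)" for g c
    using fundamental_character[OF chain_normal chain_normal coord_unit_conj[OF k] I(2) that]
    by (simp add: mult.commute)
  then show ?case using duality_extension by (auto simp: add.commute)
qed

definition sign_elt :: pgroup where "sign_elt = El 0 0 0 0 0 0 0 0 0 True"

lemma pgroup_duality: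
  obtains I where "duality (inv_cochains {g. \<not> pe g}) 9 I" "duality (inv_cochains UNIV) 9 I"
proof -
  obtain I where I: "duality (inv_cochains (chain 9)) (int 9) I"
    "\<And>g b. b \<in> cocycles (inv_cochains (chain 9)) (int 9) \<Longrightarrow> I (lact g b) = (\<Prod>i<9. coord_sign i g) * I b"
    using chain_duality[of 9] by auto
  \<comment> \<open>The sign negates the coordinates 1, 3, 5 and 8, that is \<open>h0\<close>,
    \<open>h1\<close>, \<open>h2\<close>, \<open>u\<close>; four factors -1 cancel.\<close>
  have s: "(\<Prod>i<9. coord_sign i sign_elt) = 1"
    by (simp add: numeral_eq_Suc coord_sign_def sign_elt_def)
  have "duality (inv_cochains UNIV) (int 9) I"
  proof (rule duality_index_two[OF subgrp_chain _ _ _ _ _ _ I(1)])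
    show "k \<in> chain 9 \<or> - sign_elt + k \<in> chain 9" for k
      by (simp add: chain_9 sign_elt_def plus_pgroup_def uminus_pgroup_def Let_def)
    show "sign_elt + sign_elt \<in> chain 9" by (simp add: chain_9 sign_elt_def plus_pgroup_def Let_def)
  qed (use I(2) s chain_normal in \<open>auto simp: subgrp_def\<close>)
  then show ?thesis using that I(1) by (simp add: chain_9)
qed

section \<open>A contractible space with a free action\<close>

text \<open>
  Right-continuous measurable functions on \<open>[0, 1)\<close> with values in a countable discrete group,
  metrized by the measure of the set where two functions differ. They vanish outside \<open>[0, 1)\<close>.
\<close>

definition steps :: "(real \<Rightarrow> 'g::{group_add,countable}) set" where
  "steps = {f. (\<forall>s. s \<notin> {0..<1} \<longrightarrow> f s = 0) \<and>
     (\<forall>s\<in>{0..<1}. \<exists>\<epsilon>>0. \<forall>r. s \<le> r \<and> r < s + \<epsilon> \<and> r < 1 \<longrightarrow> f r = f s) \<and>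
     (\<forall>g. {s\<in>{0..<1}. f s = g} \<in> sets lborel)}"

lemma steps_right_constant:
  assumes "f \<in> steps" "s \<in> {0..<1}"
  shows "\<exists>\<epsilon>>0. \<forall>r. s \<le> r \<and> r < s + \<epsilon> \<and> r < 1 \<longrightarrow> f r = f s"
  using assms(1)[unfolded steps_def mem_Collect_eq, THEN conjunct2, THEN conjunct1] assms(2) by (rule bspec)

lemma steps_outside: "f \<in> steps \<Longrightarrow> s \<notin> {0..<1} \<Longrightarrow> f s = 0"
  by (simp add: steps_def)

definition disagree :: "(real \<Rightarrow> 'g) \<Rightarrow> (real \<Rightarrow> 'g) \<Rightarrow> real set" where
  "disagree f g = {s\<in>{0..<1}. f s \<noteq> g s}"

definition dstep :: "(real \<Rightarrow> 'g) \<Rightarrow> (real \<Rightarrow> 'g) \<Rightarrow> real" where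
  "dstep f g = measure lborel (disagree f g)"

lemma disagree_sets:
  assumes "f \<in> steps" "g \<in> steps"
  shows "disagree f g \<in> sets lborel"
proof -
  have "disagree f g = {0..<1} - (\<Union>a. {s\<in>{0..<1}. f s = a} \<inter> {s\<in>{0..<1}. g s = a})"
    by (auto simp: disagree_def)
  also have "\<dots> \<in> sets lborel"
    using assms by (intro sets.Diff sets.countable_UN' sets.Int) (auto simp: steps_def)
  finally show ?thesis .
qed

lemma unit_interval_subset_measure:
  assumes "A \<subseteq> {0..<1 :: real}" "A \<in> sets lborel"
  shows "A \<in> fmeasurable lborel"
  by (rule fmeasurableI2[of "{0..<1}"]) (use assms in \<open>auto simp: fmeasurable_def\<close>)

lemma disagree_fmeasurable: "f \<in> steps \<Longrightarrow> g \<in> steps \<Longrightarrow> disagree f g \<in> fmeasurable lborel"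
  using disagree_sets by (intro unit_interval_subset_measure) (auto simp: disagree_def)

lemma measure_le_disagree:
  assumes "A \<subseteq> B" "A \<in> sets lborel" "B \<in> fmeasurable lborel"
  shows "measure lborel A \<le> measure lborel (B :: real set)"
  using assms by (intro measure_mono_fmeasurable)

lemma dstep_triangle:
  assumes "f \<in> steps" "g \<in> steps" "h \<in> steps"
  shows "dstep f h \<le> dstep f g + dstep g h"
proof -
  have "measure lborel (disagree f h) \<le> measure lborel (disagree f g \<union> disagree g h)"
    using assms by (intro measure_le_disagree disagree_sets fmeasurable.Un disagree_fmeasurable)
      (auto simp: disagree_def)
  also have "\<dots> \<le> measure lborel (disagree f g) + measure lborel (disagree g h)"
    using assms by (intro measure_Un_le disagree_sets)
  finally show ?thesis by (simp add: dstep_def)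
qed

text \<open>Right continuity spreads a difference at one point over an interval of positive length,
  so functions need not be identified up to null sets.\<close>

lemma dstep_zero:
  assumes "f \<in> steps" "g \<in> steps"
  shows "dstep f g = 0 \<longleftrightarrow> f = g"
proof
  assume d: "dstep f g = 0"
  show "f = g"
  proof (rule ccontr)
    assume "f \<noteq> g"
    then obtain s where s: "f s \<noteq> g s" by blast
    have s01: "s \<in> {0..<1}"
    proof (rule ccontr)
      assume "s \<notin> {0..<1}"
      then have "f s = 0" "g s = 0" using assms steps_outside by blast+
      then show False using s by simp
    qed
    obtain \<epsilon> where e: "\<epsilon> > 0" "\<forall>r. s \<le> r \<and> r < s + \<epsilon> \<and> r < 1 \<longrightarrow> f r = f s"
      using steps_right_constant[OF assms(1) s01] by blast
    obtain \<delta> where d': "\<delta> > 0" "\<forall>r. s \<le> r \<and> r < s + \<delta> \<and> r < 1 \<longrightarrow> g r = g s"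
      using steps_right_constant[OF assms(2) s01] by blast
    define t where "t = min 1 (min (s + \<epsilon>) (s + \<delta>))"
    have "s < t" using e d' s01 by (auto simp: t_def)
    have "{s..<t} \<subseteq> disagree f g"
    proof
      fix r assume r: "r \<in> {s..<t}"
      then have "s \<le> r" "r < 1" "r < s + \<epsilon>" "r < s + \<delta>" by (auto simp: t_def)
      then have "f r = f s" "g r = g s" using e(2) d'(2) by blast+
      then show "r \<in> disagree f g" using s s01 r by (auto simp: disagree_def t_def)
    qed
    then have "measure lborel {s..<t} \<le> measure lborel (disagree f g)"
      using assms by (intro measure_le_disagree disagree_fmeasurable) auto
    then show False using d \<open>s < t\<close> by (simp add: dstep_def)
  qed
qed (simp add: dstep_def disagree_def)

lemma Metric_space_steps: "Metric_space steps dstep"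
proof
  show "0 \<le> dstep x y" for x y :: "real \<Rightarrow> 'a" by (simp add: dstep_def)
  show "dstep x y = dstep y x" for x y :: "real \<Rightarrow> 'a"
  proof -
    have "disagree x y = disagree y x" by (auto simp: disagree_def)
    then show ?thesis by (simp add: dstep_def)
  qed
qed (use dstep_zero dstep_triangle in auto)

interpretation E: Metric_space steps dstep by (rule Metric_space_steps)

abbreviation Etop :: "(real \<Rightarrow> 'g::{group_add,countable}) topology" where "Etop \<equiv> E.mtopology"

section \<open>The free isometric action on step functions\<close>

definition gact :: "'g::{group_add,countable} \<Rightarrow> (real \<Rightarrow> 'g) \<Rightarrow> real \<Rightarrow> 'g" where
  "gact k f = (\<lambda>s. if s \<in> {0..<1} then k + f s else 0)"

lemma gact_steps: "f \<in> steps \<Longrightarrow> gact k f \<in> steps"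
proof -
  assume f: "f \<in> steps"
  have "{s\<in>{0..<1}. gact k f s = g} = {s\<in>{0..<1}. f s = - k + g}" for g
  proof -
    have "k + a = g \<longleftrightarrow> a = - k + g" for a :: 'a by (metis add_minus_cancel minus_add_cancel)
    then show ?thesis by (auto simp: gact_def)
  qed
  moreover have "\<exists>\<epsilon>>0. \<forall>r. s \<le> r \<and> r < s + \<epsilon> \<and> r < 1 \<longrightarrow> gact k f r = gact k f s" if s: "s \<in> {0..<1}" for s
  proof -
    obtain \<epsilon> where e: "\<epsilon> > 0" "\<forall>r. s \<le> r \<and> r < s + \<epsilon> \<and> r < 1 \<longrightarrow> f r = f s"
      using steps_right_constant[OF f s] by blast
    have "gact k f r = gact k f s" if r: "s \<le> r" "r < s + \<epsilon>" "r < 1" for r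
    proof -
      have "f r = f s" using e(2) r by blast
      then show ?thesis using r s by (simp add: gact_def)
    qed
    then show ?thesis using e(1) by blast
  qed
  moreover have "\<forall>s. s \<notin> {0..<1} \<longrightarrow> gact k f s = 0" by (simp add: gact_def)
  ultimately show ?thesis using f unfolding steps_def by auto
qed

lemma gact_gact: "gact a (gact b f) = gact (a + b) f"
  by (auto simp: gact_def add.assoc)

lemma gact_zero: "f \<in> steps \<Longrightarrow> gact 0 f = f"
  by (auto simp: gact_def steps_def fun_eq_iff)

lemma gact_at_0 [simp]: "gact k f 0 = k + f 0"
  by (simp add: gact_def)

lemma dstep_gact: "dstep (gact k f) (gact k g) = dstep f g"
proof -
  have "disagree (gact k f) (gact k g) = disagree f g" by (auto simp: disagree_def gact_def)
  then show ?thesis by (simp add: dstep_def)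
qed

text \<open>A nontrivial translate differs from \<open>f\<close> at every point of the unit
  interval. This uniform gap of 1 replaces evenly covered neighbourhoods throughout.\<close>

lemma dstep_gact_self: "k \<noteq> 0 \<Longrightarrow> dstep (gact k f) f = 1"
proof -
  assume "k \<noteq> 0"
  then have "k + a \<noteq> a" for a using add_right_cancel[of k a 0] by simp
  then have "disagree (gact k f) f = {0..<1}" by (auto simp: disagree_def gact_def)
  then show ?thesis by (simp add: dstep_def)
qed

lemma gact_near:
  assumes "f \<in> steps" "dstep (gact h f) f < 1"
  shows "h = 0"
  using dstep_gact_self[of h f] assms by auto

section \<open>Straight simplices and joins\<close>

definition breakpoint :: "(nat \<Rightarrow> real) \<Rightarrow> nat \<Rightarrow> real" where
  "breakpoint x j = (\<Sum>l\<le>j. x l)"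

definition index :: "(nat \<Rightarrow> real) \<Rightarrow> real \<Rightarrow> nat" where
  "index x s = (LEAST j. s < breakpoint x j)"

text \<open>The barycentric coordinates cut the unit interval into consecutive intervals of lengths
  \<open>x 0\<close>, \<open>x 1\<close>, \<dots>, and the function takes the value
  \<open>gs ! j\<close> on the interval number \<open>j\<close>. Empty intervals are never selected
  by \<open>index\<close>.\<close>

definition straight :: "'g::{group_add,countable} list \<Rightarrow> (nat \<Rightarrow> real) \<Rightarrow> real \<Rightarrow> 'g" where
  "straight gs x = (\<lambda>s. if s \<in> {0..<1} then gs ! index x s else 0)"

definition glue :: "real \<Rightarrow> (real \<Rightarrow> 'g) \<Rightarrow> (real \<Rightarrow> 'g) \<Rightarrow> real \<Rightarrow> 'g" where
  "glue T f h = (\<lambda>s. if 0 \<le> s \<and> s < T then f s else h s)"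

lemma breakpoint_mono: "x \<in> standard_simplex q \<Longrightarrow> i \<le> j \<Longrightarrow> breakpoint x i \<le> breakpoint x j"
  unfolding breakpoint_def by (rule sum_mono2) (auto simp: standard_simplex_def)

lemma breakpoint_nonneg: "x \<in> standard_simplex q \<Longrightarrow> 0 \<le> breakpoint x j"
  unfolding breakpoint_def by (rule sum_nonneg) (auto simp: standard_simplex_def)

lemma breakpoint_last: "x \<in> standard_simplex q \<Longrightarrow> q \<le> j \<Longrightarrow> breakpoint x j = 1"
proof -
  assume x: "x \<in> standard_simplex q" and "q \<le> j"
  then have "(\<Sum>l\<le>j. x l) = (\<Sum>l\<le>q. x l)"
    by (intro sum.mono_neutral_right) (auto simp: standard_simplex_def)
  then show ?thesis using x by (simp add: breakpoint_def standard_simplex_def)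
qed

lemma breakpoint_le_1: "x \<in> standard_simplex q \<Longrightarrow> breakpoint x j \<le> 1"
  using breakpoint_mono[of x q j "max q j"] breakpoint_last[of x q "max q j"] by simp

lemma index_less_iff:
  assumes "x \<in> standard_simplex q" "s < 1"
  shows "index x s \<le> j \<longleftrightarrow> s < breakpoint x j"
proof
  assume "index x s \<le> j"
  have "s < breakpoint x q" using breakpoint_last[OF assms(1)] assms by simp
  then have "s < breakpoint x (index x s)" unfolding index_def by (rule LeastI)
  then show "s < breakpoint x j" using breakpoint_mono[OF assms(1) \<open>index x s \<le> j\<close>] by simp
qed (auto simp: index_def intro: Least_le)

lemma index_le: "x \<in> standard_simplex q \<Longrightarrow> s < 1 \<Longrightarrow> index x s \<le> q"
  using index_less_iff breakpoint_last by fastforce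

lemma index_eq_iff:
  assumes "x \<in> standard_simplex q" "s < 1"
  shows "index x s = j \<longleftrightarrow> s < breakpoint x j \<and> (\<forall>i<j. breakpoint x i \<le> s)"
proof -
  have "index x s = j \<longleftrightarrow> index x s \<le> j \<and> (\<forall>i<j. \<not> index x s \<le> i)"
    by (metis le_neq_implies_less less_or_eq_imp_le linorder_not_less order_refl)
  then show ?thesis using index_less_iff[OF assms] by (simp add: not_less)
qed

text \<open>A monotone vertex map merges neighbouring intervals and inserts empty ones, without
  changing the order; a point of interval \<open>k\<close> ends up in interval
  \<open>\<theta> k\<close>. This is why straight simplices are compatible with all vertex
  maps.\<close>

lemma index_affine_vertex:
  assumes x: "x \<in> standard_simplex m" and \<theta>: "vertex_map m n \<theta>" and s: "0 \<le> s" "s < 1"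
  shows "index (affine_vertex m \<theta> x) s = \<theta> (index x s)"
proof -
  have y: "affine_vertex m \<theta> x \<in> standard_simplex n"
    using affine_vertex_simplex x \<theta> by (auto simp: vertex_map_def)
  have b: "breakpoint (affine_vertex m \<theta> x) j = (\<Sum>l | l \<le> m \<and> \<theta> l \<le> j. x l)" for j
  proof -
    have "(\<Sum>i\<in>{..j}. sum x {l \<in> {l. l \<le> m \<and> \<theta> l \<le> j}. \<theta> l = i}) = (\<Sum>l | l \<le> m \<and> \<theta> l \<le> j. x l)"
      by (rule sum.group) auto
    moreover have "{l \<in> {l. l \<le> m \<and> \<theta> l \<le> j}. \<theta> l = i} = {l. l \<le> m \<and> \<theta> l = i}" if "i \<le> j" for i
      using that by auto
    ultimately show ?thesis by (simp add: breakpoint_def affine_vertex_def)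
  qed
  have xn: "0 \<le> x l" for l using x by (auto simp: standard_simplex_def)
  define k where "k = index x s"
  have k: "k \<le> m" "s < breakpoint x k" "\<And>i. i < k \<Longrightarrow> breakpoint x i \<le> s"
    using index_le[OF x s(2)] index_eq_iff[OF x s(2), of k] by (auto simp: k_def)
  have mono: "a \<le> b \<Longrightarrow> b \<le> m \<Longrightarrow> \<theta> a \<le> \<theta> b" for a b
    using \<theta> by (auto simp: vertex_map_def mono_on_def)
  have "s < breakpoint (affine_vertex m \<theta> x) (\<theta> k)"
  proof -
    have "breakpoint x k \<le> (\<Sum>l | l \<le> m \<and> \<theta> l \<le> \<theta> k. x l)"
      unfolding breakpoint_def by (rule sum_mono2) (use k mono xn in auto)
    then show ?thesis using k b by simp
  qed
  moreover have "breakpoint (affine_vertex m \<theta> x) i \<le> s" if i: "i < \<theta> k" for i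
  proof (cases k)
    case 0
    then have "{l. l \<le> m \<and> \<theta> l \<le> i} = {}" using i mono[of 0] by fastforce
    then have "breakpoint (affine_vertex m \<theta> x) i = 0" unfolding b by (simp only: sum.empty)
    then show ?thesis using s by simp
  next
    case (Suc k')
    have "(\<Sum>l | l \<le> m \<and> \<theta> l \<le> i. x l) \<le> breakpoint x k'"
      unfolding breakpoint_def
    proof (rule sum_mono2)
      show "{l. l \<le> m \<and> \<theta> l \<le> i} \<subseteq> {..k'}"
      proof
        fix l assume "l \<in> {l. l \<le> m \<and> \<theta> l \<le> i}"
        then have "\<not> k \<le> l" using mono[of k l] i by auto
        then show "l \<in> {..k'}" using Suc by simp
      qed
    qed (use xn in auto)
    then show ?thesis using b k(3)[of k'] Suc by simp
  qed
  ultimately show ?thesis using index_eq_iff[OF y s(2), of "\<theta> k"] by (simp add: k_def)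
qed

lemma straight_steps:
  assumes x: "x \<in> standard_simplex q"
  shows "straight gs x \<in> steps"
proof -
  have "{s\<in>{0..<1}. straight gs x s = g} = (\<Union>j\<in>{j. gs ! j = g}. {s\<in>{0..<1}. index x s = j})" for g
    by (auto simp: straight_def)
  moreover have "{s\<in>{0..<1}. index x s = j} \<in> sets lborel" for j
  proof -
    have "{s\<in>{0..<1}. index x s = j} = {0..<1} \<inter> {..<breakpoint x j} \<inter> (\<Inter>i\<in>{..<j}. {breakpoint x i..})" if "j \<noteq> 0"
      using index_eq_iff[OF x] by auto
    moreover have "{s\<in>{0..<1}. index x s = 0} = {0..<1} \<inter> {..<breakpoint x 0}"
      using index_eq_iff[OF x] by auto
    ultimately show ?thesis by (cases "j = 0") (auto intro!: sets.Int sets.finite_INT)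
  qed
  ultimately have "{s\<in>{0..<1}. straight gs x s = g} \<in> sets lborel" for g
    by (auto intro!: sets.countable_UN')
  moreover have "\<exists>\<epsilon>>0. \<forall>r. s \<le> r \<and> r < s + \<epsilon> \<and> r < 1 \<longrightarrow> straight gs x r = straight gs x s" if s: "s \<in> {0..<1}" for s
  proof -
    define j where "j = index x s"
    have j: "s < breakpoint x j" "\<And>i. i < j \<Longrightarrow> breakpoint x i \<le> s"
      using index_eq_iff[OF x, of s j] s by (auto simp: j_def)
    have c: "straight gs x r = straight gs x s" if "s \<le> r" "r < s + (breakpoint x j - s)" "r < 1" for r
    proof -
      have "index x r = j" using index_eq_iff[OF x, of r j] j that by force
      then show ?thesis using that s by (simp add: straight_def j_def)
    qed
    show ?thesis
    proof (intro exI conjI allI impI)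
      show "0 < breakpoint x j - s" using j(1) by simp
    qed (use c in blast)
  qed
  ultimately show ?thesis by (simp add: steps_def straight_def)
qed

lemma glue_steps:
  assumes "0 < T \<Longrightarrow> f \<in> steps" "h \<in> steps" "T \<le> 1"
  shows "glue T f h \<in> steps"
proof (cases "0 < T")
  case False
  then have "glue T f h = h" by (auto simp: glue_def fun_eq_iff)
  then show ?thesis using assms by simp
next
  case True
  note f = assms(1)[OF True]
  have "{s\<in>{0..<1}. glue T f h s = g} = ({0..<T} \<inter> {s\<in>{0..<1}. f s = g}) \<union> ({T..} \<inter> {s\<in>{0..<1}. h s = g})" for g
    using assms(3) by (auto simp: glue_def)
  then have "{s\<in>{0..<1}. glue T f h s = g} \<in> sets lborel" for g
    using f assms(2) by (auto simp: steps_def)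
  moreover have "\<exists>\<epsilon>>0. \<forall>r. s \<le> r \<and> r < s + \<epsilon> \<and> r < 1 \<longrightarrow> glue T f h r = glue T f h s" if s: "s \<in> {0..<1}" for s
  proof (cases "s < T")
    case True
    obtain \<epsilon> where e: "\<epsilon> > 0" "\<forall>r. s \<le> r \<and> r < s + \<epsilon> \<and> r < 1 \<longrightarrow> f r = f s"
      using steps_right_constant[OF f s] by blast
    have c: "glue T f h r = glue T f h s" if r: "s \<le> r" "r < s + min \<epsilon> (T - s)" "r < 1" for r
    proof -
      have "r < s + \<epsilon>" using r by simp
      then have "f r = f s" using e(2) r by blast
      moreover have "r < T" using r(2) by linarith
      ultimately show ?thesis using r s True by (simp add: glue_def)
    qed
    show ?thesis
    proof (intro exI conjI allI impI)
      show "0 < min \<epsilon> (T - s)" using e(1) True by simp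
    qed (use c in blast)
  next
    case False
    obtain \<epsilon> where e: "\<epsilon> > 0" "\<forall>r. s \<le> r \<and> r < s + \<epsilon> \<and> r < 1 \<longrightarrow> h r = h s"
      using steps_right_constant[OF assms(2) s] by blast
    have "glue T f h r = glue T f h s" if r: "s \<le> r" "r < s + \<epsilon>" "r < 1" for r
    proof -
      have "h r = h s" using e(2) r by blast
      then show ?thesis using r False by (simp add: glue_def)
    qed
    then show ?thesis using e(1) by blast
  qed
  moreover have "glue T f h s = 0" if "s \<notin> {0..<1}" for s
    using that assms(2,3) by (auto simp: glue_def steps_def)
  ultimately show ?thesis by (simp add: steps_def)
qed

lemma interval_fmeasurable [simp]: "{a..<b :: real} \<in> fmeasurable lborel"
  by (cases "a \<le> b") (auto simp: fmeasurable_def)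

lemma measure_interval_le: "measure lborel {min a b..<max a b} = \<bar>a - b :: real\<bar>"
  by (auto simp: min_def max_def)

text \<open>With the same labels, two points can disagree only between corresponding
  breakpoints.\<close>

lemma dstep_straight:
  assumes "x \<in> standard_simplex q" "y \<in> standard_simplex q"
  shows "dstep (straight gs x) (straight gs y) \<le> (\<Sum>j\<le>q. \<bar>breakpoint x j - breakpoint y j\<bar>)"
proof -
  let ?I = "\<lambda>j. {min (breakpoint x j) (breakpoint y j)..<max (breakpoint x j) (breakpoint y j)}"
  have "disagree (straight gs x) (straight gs y) \<subseteq> (\<Union>j\<in>{..q}. ?I j)"
  proof
    fix s assume "s \<in> disagree (straight gs x) (straight gs y)"
    then have s: "0 \<le> s" "s < 1" "index x s \<noteq> index y s" by (auto simp: disagree_def straight_def)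
    have "\<exists>j\<le>q. \<not> (index x s \<le> j \<longleftrightarrow> index y s \<le> j)"
      using s index_le[OF assms(1) s(2)] index_le[OF assms(2) s(2)] by (metis linorder_le_cases order_antisym order_refl)
    then obtain j where "j \<le> q" "\<not> (s < breakpoint x j \<longleftrightarrow> s < breakpoint y j)"
      using index_less_iff[OF assms(1) s(2)] index_less_iff[OF assms(2) s(2)] by blast
    then show "s \<in> (\<Union>j\<in>{..q}. ?I j)" by (intro UN_I[of j]) auto
  qed
  then have "measure lborel (disagree (straight gs x) (straight gs y)) \<le> measure lborel (\<Union>j\<in>{..q}. ?I j)"
    using assms by (intro measure_le_disagree disagree_sets straight_steps fmeasurable.finite_UN) auto
  also have "\<dots> \<le> (\<Sum>j\<in>{..q}. measure lborel (?I j))"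
    by (rule measure_UNION_le) auto
  finally show ?thesis by (simp only: dstep_def measure_interval_le)
qed

lemma dstep_glue_aux:
  assumes B: "disagree (glue T f h) (glue T' f' h') \<subseteq> A \<union> B \<union> C"
    and m: "A \<in> fmeasurable lborel" "B \<in> fmeasurable lborel" "C \<in> fmeasurable lborel"
    and st: "glue T f h \<in> steps" "glue T' f' h' \<in> steps"
  shows "dstep (glue T f h) (glue T' f' h') \<le> measure lborel A + measure lborel B + measure lborel C"
proof -
  have "dstep (glue T f h) (glue T' f' h') \<le> measure lborel (A \<union> B \<union> C)"
    unfolding dstep_def using B m disagree_sets[OF st] by (intro measure_le_disagree) auto
  also have "\<dots> \<le> measure lborel (A \<union> B) + measure lborel C"
    by (intro measure_Un_le fmeasurableD fmeasurable.Un m)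
  also have "measure lborel (A \<union> B) \<le> measure lborel A + measure lborel B"
    by (intro measure_Un_le fmeasurableD m)
  finally show ?thesis by simp
qed

lemma dstep_glue:
  assumes "f \<in> steps" "f' \<in> steps" "h \<in> steps" "h' \<in> steps" "T \<le> 1" "T' \<le> 1"
  shows "dstep (glue T f h) (glue T' f' h') \<le> \<bar>T - T'\<bar> + dstep f f' + dstep h h'"
proof -
  have "disagree (glue T f h) (glue T' f' h') \<subseteq> {min T T'..<max T T'} \<union> disagree f f' \<union> disagree h h'"
    by (auto simp: disagree_def glue_def split: if_splits)
  from dstep_glue_aux[OF this] show ?thesis
    using assms disagree_fmeasurable[of f f'] disagree_fmeasurable[of h h'] glue_steps
    by (auto simp: measure_interval_le dstep_def)
qed

text \<open>For continuity of a join where its front face has weight 0: the function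
  \<open>f'\<close> may be anything, as it occupies only an interval of length
  \<open>T'\<close>.\<close>

lemma dstep_glue_0:
  assumes "0 < T' \<Longrightarrow> f' \<in> steps" "h \<in> steps" "h' \<in> steps" "T \<le> 0" "0 \<le> T'" "T' \<le> 1"
  shows "dstep (glue T f h) (glue T' f' h') \<le> T' + dstep h h'"
proof -
  have "disagree (glue T f h) (glue T' f' h') \<subseteq> {0..<T'} \<union> {} \<union> disagree h h'"
    using assms(4) by (auto simp: disagree_def glue_def split: if_splits)
  from dstep_glue_aux[OF this] show ?thesis
    using assms disagree_fmeasurable[of h h'] glue_steps[of T f h] glue_steps[of T' f' h']
    by (auto simp: dstep_def)
qed

text \<open>The projection to the front face. Where the front weight is 0 the quotients are 0 and no
  point of the face results, but \<open>glue\<close> then does not consult the value.\<close>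

definition front :: "nat \<Rightarrow> (nat \<Rightarrow> real) \<Rightarrow> nat \<Rightarrow> real" where
  "front i x = (\<lambda>j. if j \<le> i then x j / breakpoint x i else 0)"

text \<open>The join of the front \<open>i\<close>-face of \<open>\<sigma>\<close> with the straight simplex on \<open>gs ! i\<close>, \<open>gs ! (i + 1)\<close>, \<open>\<dots>\<close>.\<close>

definition join :: "nat \<Rightarrow> ((nat \<Rightarrow> real) \<Rightarrow> real \<Rightarrow> 'g::{group_add,countable}) \<Rightarrow> 'g list \<Rightarrow>
    (nat \<Rightarrow> real) \<Rightarrow> real \<Rightarrow> 'g" where
  "join i \<sigma> gs x = glue (breakpoint x i) (\<sigma> (front i x)) (straight (0 # gs) x)"

lemma front_simplex:
  assumes "x \<in> standard_simplex q" "0 < breakpoint x i"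
  shows "front i x \<in> standard_simplex i"
proof -
  have x: "0 \<le> x j" for j using assms by (auto simp: standard_simplex_def)
  have "x j \<le> breakpoint x i" if "j \<le> i" for j
    unfolding breakpoint_def using that x by (intro member_le_sum) auto
  moreover have "(\<Sum>j\<le>i. x j / breakpoint x i) = 1"
    using assms(2) by (simp add: sum_divide_distrib[symmetric] breakpoint_def)
  ultimately show ?thesis using assms(2) x by (auto simp: standard_simplex_def front_def)
qed

abbreviation simplex_top :: "nat \<Rightarrow> (nat \<Rightarrow> real) topology" where
  "simplex_top q \<equiv> subtopology (powertop_real UNIV) (standard_simplex q)"

lemma continuous_coordinate: "continuous_map (simplex_top q) euclideanreal (\<lambda>x. x i)"
  by (intro continuous_map_from_subtopology continuous_map_product_projection) auto

lemma continuous_breakpoint: "continuous_map (simplex_top q) euclideanreal (\<lambda>x. breakpoint x j)"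
  unfolding breakpoint_def by (intro continuous_map_sum continuous_coordinate) auto

lemma continuous_into_stepsI:
  assumes "\<And>x. x \<in> topspace X \<Longrightarrow> F x \<in> steps"
    and "\<And>x \<epsilon>. x \<in> topspace X \<Longrightarrow> 0 < \<epsilon> \<Longrightarrow> \<exists>U. openin X U \<and> x \<in> U \<and> (\<forall>y\<in>U. dstep (F x) (F y) < \<epsilon>)"
  shows "continuous_map X Etop F"
  unfolding E.continuous_map_to_metric
proof (intro ballI allI impI)
  fix x and \<epsilon> :: real assume x: "x \<in> topspace X" and "0 < \<epsilon>"
  from assms(2)[OF this] obtain U where U: "openin X U" "x \<in> U" "\<forall>y\<in>U. dstep (F x) (F y) < \<epsilon>"
    by blast
  have "F y \<in> E.mball (F x) \<epsilon>" if y: "y \<in> U" for y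
  proof -
    have "y \<in> topspace X" using openin_subset[OF U(1)] y by blast
    then show ?thesis using assms(1) x U(3) y by (simp add: E.in_mball)
  qed
  then show "\<exists>U. openin X U \<and> x \<in> U \<and> (\<forall>y\<in>U. F y \<in> E.mball (F x) \<epsilon>)"
    using U(1,2) by (intro exI[of _ U]) simp
qed

lemma continuous_map_small:
  assumes "continuous_map X euclideanreal \<phi>" "x \<in> topspace X" "\<phi> x < \<epsilon>"
  shows "openin X {y \<in> topspace X. \<phi> y < \<epsilon>} \<and> x \<in> {y \<in> topspace X. \<phi> y < \<epsilon>}"
  using openin_continuous_map_preimage[OF assms(1), of "{..<\<epsilon>}"] assms by auto

lemma continuous_gap:
  "continuous_map (simplex_top q) euclideanreal (\<lambda>y. \<Sum>j\<le>q. \<bar>breakpoint x j - breakpoint y j\<bar>)"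
  by (intro continuous_map_sum continuous_map_real_abs continuous_map_diff continuous_breakpoint) auto

lemma continuous_straight: "continuous_map (simplex_top q) Etop (straight gs)"
proof (rule continuous_into_stepsI)
  fix x :: "nat \<Rightarrow> real" and \<epsilon> :: real assume x: "x \<in> topspace (simplex_top q)" and "0 < \<epsilon>"
  let ?\<phi> = "\<lambda>y. \<Sum>j\<le>q. \<bar>breakpoint x j - breakpoint y j\<bar>"
  let ?U = "{y \<in> topspace (simplex_top q). ?\<phi> y < \<epsilon>}"
  have "openin (simplex_top q) ?U \<and> x \<in> ?U"
    using x \<open>0 < \<epsilon>\<close> by (intro continuous_map_small continuous_gap) auto
  moreover have "dstep (straight gs x) (straight gs y) < \<epsilon>" if "y \<in> ?U" for y
    using dstep_straight[of x q y gs] x that by auto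
  ultimately show "\<exists>U. openin (simplex_top q) U \<and> x \<in> U \<and> (\<forall>y\<in>U. dstep (straight gs x) (straight gs y) < \<epsilon>)" by blast
qed (auto intro: straight_steps)

text \<open>Where the front weight is positive, \<open>front\<close> is continuous and the three
  contributions to the distance are small separately. Where it is 0, \<open>front\<close> cannot be
  controlled, but its share of the unit interval tends to 0.\<close>

lemma continuous_join:
  assumes \<sigma>: "continuous_map (simplex_top i) Etop \<sigma>"
  shows "continuous_map (simplex_top q) Etop (join i \<sigma> gs)"
proof -
  let ?h = "straight (0 # gs)" and ?T = "\<lambda>x. breakpoint x i" and ?X = "simplex_top q"
  have st: "\<sigma> (front i x) \<in> steps" if "x \<in> standard_simplex q" "0 < ?T x" for x
    using continuous_map_image_subset_topspace[OF \<sigma>] front_simplex[OF that] by auto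
  show ?thesis
  proof (rule continuous_into_stepsI)
    fix x assume "x \<in> topspace ?X"
    then have x: "x \<in> standard_simplex q" by simp
    show "join i \<sigma> gs x \<in> steps" unfolding join_def
      by (intro glue_steps st straight_steps[OF x] x breakpoint_le_1[OF x])
    fix \<epsilon> :: real assume e: "0 < \<epsilon>"
    let ?\<phi> = "\<lambda>y. \<Sum>j\<le>q. \<bar>breakpoint x j - breakpoint y j\<bar>"
    show "\<exists>U. openin ?X U \<and> x \<in> U \<and> (\<forall>y\<in>U. dstep (join i \<sigma> gs x) (join i \<sigma> gs y) < \<epsilon>)"
    proof (cases "0 < ?T x")
      case False
      then have T0: "?T x = 0" using breakpoint_nonneg[OF x, of i] by simp
      let ?\<psi> = "\<lambda>y. ?T y + ?\<phi> y"
      let ?U = "{y \<in> topspace ?X. ?\<psi> y < \<epsilon>}"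
      have "continuous_map ?X euclideanreal ?\<psi>"
        by (intro continuous_map_add continuous_breakpoint continuous_gap)
      then have "openin ?X ?U \<and> x \<in> ?U" using x e T0 by (intro continuous_map_small) auto
      moreover have "dstep (join i \<sigma> gs x) (join i \<sigma> gs y) < \<epsilon>" if "y \<in> ?U" for y
      proof -
        have y: "y \<in> standard_simplex q" using that by simp
        have "dstep (join i \<sigma> gs x) (join i \<sigma> gs y) \<le> ?T y + dstep (?h x) (?h y)"
          unfolding join_def using T0 st[OF y]
          by (intro dstep_glue_0 straight_steps[OF x] straight_steps[OF y] breakpoint_le_1[OF y] breakpoint_nonneg[OF y]) auto
        also have "\<dots> \<le> ?\<psi> y" using dstep_straight[OF x y] by simp
        finally show ?thesis using that by simp
      qed
      ultimately show ?thesis by blast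
    next
      case True
      let ?P = "{y \<in> topspace ?X. 0 < ?T y}"
      have P: "openin ?X ?P" using openin_continuous_map_preimage[OF continuous_breakpoint, of "{0<..}" q i] by simp
      have "continuous_map (subtopology ?X ?P) (simplex_top i) (front i)"
        unfolding continuous_map_in_subtopology continuous_map_componentwise_UNIV
      proof (intro conjI allI)
        fix k
        show "continuous_map (subtopology ?X ?P) euclideanreal (\<lambda>x. front i x k)"
        proof (cases "k \<le> i")
          case True
          have "continuous_map (subtopology ?X ?P) euclideanreal (\<lambda>x. x k / ?T x)"
            by (intro continuous_map_real_divide continuous_map_from_subtopology[OF continuous_coordinate]
                continuous_map_from_subtopology[OF continuous_breakpoint]) auto
          then show ?thesis using True by (simp add: front_def)
        qed (simp add: front_def)
      qed (use front_simplex in auto)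
      then have c: "continuous_map (subtopology ?X ?P) Etop (\<lambda>y. \<sigma> (front i y))"
        using continuous_map_compose[OF _ \<sigma>] by (auto simp: o_def)
      have "x \<in> topspace (subtopology ?X ?P)" using x True by simp
      from c[unfolded E.continuous_map_to_metric, rule_format, OF this, of "\<epsilon> / 2"] e
      obtain V where V: "openin (subtopology ?X ?P) V" "x \<in> V" "\<forall>y\<in>V. \<sigma> (front i y) \<in> E.mball (\<sigma> (front i x)) (\<epsilon> / 2)"
        by auto
      have VX: "openin ?X V" "V \<subseteq> ?P"
        using openin_trans_full[OF V(1) P] openin_subset[OF V(1)] by auto
      let ?\<psi> = "\<lambda>y. \<bar>?T x - ?T y\<bar> + ?\<phi> y"
      let ?U = "{y \<in> topspace ?X. ?\<psi> y < \<epsilon> / 2}"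
      have "continuous_map ?X euclideanreal ?\<psi>"
        by (intro continuous_map_add continuous_map_real_abs continuous_map_diff continuous_breakpoint continuous_gap) auto
      then have "openin ?X ?U \<and> x \<in> ?U" using x e by (intro continuous_map_small) auto
      then have "openin ?X (V \<inter> ?U) \<and> x \<in> V \<inter> ?U" using VX V(2) by auto
      moreover have "dstep (join i \<sigma> gs x) (join i \<sigma> gs y) < \<epsilon>" if "y \<in> V \<inter> ?U" for y
      proof -
        have y: "y \<in> standard_simplex q" "0 < ?T y" using that VX by auto
        have "dstep (join i \<sigma> gs x) (join i \<sigma> gs y) \<le> \<bar>?T x - ?T y\<bar> + dstep (\<sigma> (front i x)) (\<sigma> (front i y)) + dstep (?h x) (?h y)"
          unfolding join_def
          by (intro dstep_glue st x y True straight_steps[OF x] straight_steps[OF y(1)] breakpoint_le_1[OF y(1)] breakpoint_le_1[OF x])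
        moreover have "dstep (\<sigma> (front i x)) (\<sigma> (front i y)) < \<epsilon> / 2" using V(3) that by (simp add: E.in_mball)
        moreover have "?\<psi> y < \<epsilon> / 2" using that by simp
        moreover have "dstep (?h x) (?h y) \<le> ?\<phi> y" using dstep_straight[OF x y(1)] .
        ultimately show ?thesis by simp
      qed
      ultimately show ?thesis by blast
    qed
  qed
qed

section \<open>Orbit spaces and lifting of simplices\<close>

text \<open>A right-continuous function is determined by its values at rational points.\<close>

definition code :: "(real \<Rightarrow> 'g::countable) \<Rightarrow> nat \<Rightarrow> real" where
  "code f = (\<lambda>n. real (to_nat (f (of_rat (from_nat n)))))"

definition orbit :: "'g::{group_add,countable} set \<Rightarrow> (real \<Rightarrow> 'g) \<Rightarrow> (real \<Rightarrow> 'g) set" where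
  "orbit H f = (\<lambda>h. gact h f) ` H"

text \<open>Orbits become sequences of reals, the common point type of all the spaces: one element
  is chosen from the orbit and coded. The choice depends on the orbit as a set only, hence is
  constant along it.\<close>

definition proj :: "'g::{group_add,countable} set \<Rightarrow> (real \<Rightarrow> 'g) \<Rightarrow> nat \<Rightarrow> real" where
  "proj H f = code (SOME f'. f' \<in> orbit H f)"

definition orbit_space :: "'g::{group_add,countable} set \<Rightarrow> (nat \<Rightarrow> real) topology" where
  "orbit_space H = topology (\<lambda>U. U \<subseteq> proj H ` steps \<and> openin Etop {f \<in> steps. proj H f \<in> U})"

lemma code_inj:
  assumes f: "f \<in> steps" and g: "g \<in> steps" and eq: "code f = code g"
  shows "f = g"
proof
  fix s
  have rat: "f (of_rat r) = g (of_rat r)" for r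
  proof -
    have "code f (to_nat r) = code g (to_nat r)" using eq by simp
    then show ?thesis by (simp add: code_def)
  qed
  show "f s = g s"
  proof (cases "s \<in> {0..<1}")
    case True
    obtain \<epsilon> where e: "\<epsilon> > 0" "\<forall>r. s \<le> r \<and> r < s + \<epsilon> \<and> r < 1 \<longrightarrow> f r = f s"
      using steps_right_constant[OF f True] by blast
    obtain \<delta> where d: "\<delta> > 0" "\<forall>r. s \<le> r \<and> r < s + \<delta> \<and> r < 1 \<longrightarrow> g r = g s"
      using steps_right_constant[OF g True] by blast
    have "s < min 1 (min (s + \<epsilon>) (s + \<delta>))" using e(1) d(1) True by simp
    then obtain r where r: "s < of_rat r" "of_rat r < min 1 (min (s + \<epsilon>) (s + \<delta>))"
      using of_rat_dense by blast
    then have "f (of_rat r) = f s" "g (of_rat r) = g s" using e(2) d(2) by auto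
    then show ?thesis using rat by metis
  next
    case False
    then show ?thesis using f g steps_outside by metis
  qed
qed

lemma orbit_mem: "subgrp H \<Longrightarrow> f \<in> steps \<Longrightarrow> f \<in> orbit H f"
  using gact_zero[of f] by (auto simp: orbit_def subgrp_def image_iff intro!: bexI[of _ 0])

lemma orbit_eq:
  assumes "subgrp H" "h \<in> H"
  shows "orbit H (gact h f) = orbit H f"
proof -
  have "gact k (gact h f) \<in> orbit H f" if "k \<in> H" for k
    using assms that by (auto simp: orbit_def gact_gact subgrp_def)
  moreover have "gact k f \<in> orbit H (gact h f)" if "k \<in> H" for k
  proof -
    have "gact k f = gact (k + - h) (gact h f)" by (simp add: gact_gact add.assoc)
    moreover have "k + - h \<in> H" using assms that unfolding subgrp_def by blast
    ultimately show ?thesis unfolding orbit_def by blast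
  qed
  ultimately show ?thesis unfolding orbit_def by blast
qed

lemma proj_gact: "subgrp H \<Longrightarrow> h \<in> H \<Longrightarrow> proj H (gact h f) = proj H f"
  by (simp add: proj_def orbit_eq)

lemma proj_eqD:
  assumes H: "subgrp H" and f: "f \<in> steps" "g \<in> steps" and eq: "proj H f = proj H g"
  obtains h where "h \<in> H" "g = gact h f"
proof -
  define f' where "f' = (SOME f'. f' \<in> orbit H f)"
  define g' where "g' = (SOME f'. f' \<in> orbit H g)"
  have "f' \<in> orbit H f" unfolding f'_def using orbit_mem[OF H f(1)] by (rule someI[where P = "\<lambda>f'. f' \<in> orbit H f"])
  then obtain a where a: "a \<in> H" "f' = gact a f" by (auto simp: orbit_def)
  have "g' \<in> orbit H g" unfolding g'_def using orbit_mem[OF H f(2)] by (rule someI[where P = "\<lambda>f'. f' \<in> orbit H g"])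
  then obtain b where b: "b \<in> H" "g' = gact b g" by (auto simp: orbit_def)
  have "code f' = code g'" using eq by (simp add: proj_def f'_def g'_def)
  then have "f' = g'" using code_inj a b f gact_steps by metis
  then have "gact (- b) (gact a f) = gact (- b) (gact b g)" using a b by simp
  then have "gact (- b + a) f = g" using f gact_zero by (simp add: gact_gact)
  moreover have "- b + a \<in> H" using H a b by (auto simp: subgrp_def)
  ultimately show ?thesis using that by blast
qed

lemma istopology_orbit:
  "istopology (\<lambda>U. U \<subseteq> proj H ` steps \<and> openin Etop {f \<in> steps. proj H f \<in> U})"
  unfolding istopology_def
proof (intro conjI allI impI)
  fix S T assume h: "S \<subseteq> proj H ` steps \<and> openin Etop {f \<in> steps. proj H f \<in> S}"
    "T \<subseteq> proj H ` steps \<and> openin Etop {f \<in> steps. proj H f \<in> T}"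
  then show "S \<inter> T \<subseteq> proj H ` steps" by blast
  have eq: "{f \<in> steps. proj H f \<in> S \<inter> T} = {f \<in> steps. proj H f \<in> S} \<inter> {f \<in> steps. proj H f \<in> T}" by auto
  show "openin Etop {f \<in> steps. proj H f \<in> S \<inter> T}" unfolding eq using h by (intro openin_Int) auto
next
  fix \<U> assume h: "\<forall>K\<in>\<U>. K \<subseteq> proj H ` steps \<and> openin Etop {f \<in> steps. proj H f \<in> K}"
  then show "\<Union>\<U> \<subseteq> proj H ` steps" by blast
  have eq: "{f \<in> steps. proj H f \<in> \<Union>\<U>} = \<Union>((\<lambda>K. {f \<in> steps. proj H f \<in> K}) ` \<U>)" by auto
  show "openin Etop {f \<in> steps. proj H f \<in> \<Union>\<U>}" unfolding eq using h by (intro openin_Union) auto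
qed

lemma openin_orbit_space:
  "openin (orbit_space H) U \<longleftrightarrow> U \<subseteq> proj H ` steps \<and> openin Etop {f \<in> steps. proj H f \<in> U}"
  unfolding orbit_space_def by (simp add: istopology_orbit)

lemma topspace_orbit_space: "topspace (orbit_space H) = proj H ` steps"
proof (rule antisym)
  show "topspace (orbit_space H) \<subseteq> proj H ` steps"
    using openin_orbit_space by (metis openin_topspace)
  have "{f \<in> steps. proj H f \<in> proj H ` steps} = topspace Etop" by auto
  then have "openin (orbit_space H) (proj H ` steps)" unfolding openin_orbit_space by (metis openin_topspace order_refl)
  then show "proj H ` steps \<subseteq> topspace (orbit_space H)" by (rule openin_subset)
qed

lemma continuous_proj: "continuous_map Etop (orbit_space H) (proj H)"
  unfolding continuous_map_def by (auto simp: topspace_orbit_space openin_orbit_space)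

lemma continuous_orbit_space_map:
  assumes "continuous_map Etop X (g \<circ> proj H)"
  shows "continuous_map (orbit_space H) X g"
  unfolding continuous_map_def
proof (intro conjI allI impI)
  show "g \<in> topspace (orbit_space H) \<rightarrow> topspace X"
    using continuous_map_image_subset_topspace[OF assms] by (auto simp: topspace_orbit_space)
  fix U assume "openin X U"
  then have "openin Etop {f \<in> topspace Etop. (g \<circ> proj H) f \<in> U}"
    using assms openin_continuous_map_preimage by blast
  moreover have "{f \<in> topspace Etop. (g \<circ> proj H) f \<in> U} =
    {f \<in> steps. proj H f \<in> {x \<in> topspace (orbit_space H). g x \<in> U}}"
    by (auto simp: topspace_orbit_space)
  ultimately show "openin (orbit_space H) {x \<in> topspace (orbit_space H). g x \<in> U}"
    unfolding openin_orbit_space by (auto simp: topspace_orbit_space)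
qed

text \<open>The action is by isometries, so a ball around a point of the open set can be carried to
  any other point of the same orbit.\<close>

lemma proj_open:
  assumes H: "subgrp H" and V: "openin Etop V"
  shows "openin (orbit_space H) (proj H ` V)"
  unfolding openin_orbit_space
proof
  have VE: "V \<subseteq> steps" using openin_subset[OF V] by simp
  then show "proj H ` V \<subseteq> proj H ` steps" by blast
  show "openin Etop {f \<in> steps. proj H f \<in> proj H ` V}"
    unfolding E.openin_mtopology
  proof (intro conjI allI impI)
    fix f assume "f \<in> {f \<in> steps. proj H f \<in> proj H ` V}"
    then obtain v where f: "f \<in> steps" and v: "v \<in> V" "proj H f = proj H v" by auto
    then obtain h where h: "h \<in> H" "v = gact h f" using proj_eqD[OF H f] VE by blast
    obtain r where r: "r > 0" "E.mball v r \<subseteq> V" using V v(1) unfolding E.openin_mtopology by blast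
    have "E.mball f r \<subseteq> {f \<in> steps. proj H f \<in> proj H ` V}"
    proof
      fix g assume "g \<in> E.mball f r"
      then have g: "g \<in> steps" "dstep f g < r" by (auto simp: E.in_mball)
      have "gact h g \<in> E.mball v r" using g v VE h gact_steps by (auto simp: E.in_mball dstep_gact)
      then have "gact h g \<in> V" using r by blast
      moreover have "proj H g = proj H (gact h g)" using proj_gact[OF H h(1)] by simp
      ultimately show "g \<in> {f \<in> steps. proj H f \<in> proj H ` V}" using g by blast
    qed
    then show "\<exists>r>0. E.mball f r \<subseteq> {f \<in> steps. proj H f \<in> proj H ` V}" using r by blast
  qed auto
qed

section \<open>Lifting simplices through the orbit projection\<close>

lemma lift_unique:
  assumes H: "subgrp H" and f: "f \<in> steps" "g \<in> steps" "proj H f = proj H g" "dstep f g < 1"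
  shows "f = g"
proof -
  obtain h where h: "h \<in> H" "g = gact h f" using proj_eqD[OF H f(1-3)] by blast
  have "dstep (gact h f) f < 1" using f h E.commute by metis
  then have "h = 0" using gact_near f by blast
  then show ?thesis using h f gact_zero by metis
qed

text \<open>Projected balls of radius 1/8 are open, and a Lebesgue number puts the images of nearby
  points into one of them. The given \<open>e\<close> over the first point is a translate of a point
  of the ball; the same translation puts a lift of the second point within 1/8 + 1/8 of
  \<open>e\<close>.\<close>

lemma local_lifts:
  assumes H: "subgrp H" and \<sigma>: "continuous_map (simplex_top p) (orbit_space H) \<sigma>"
  obtains \<delta> where "0 < \<delta>"
    "\<And>a b e. \<lbrakk>a \<in> standard_simplex p; b \<in> standard_simplex p; dist a b < \<delta>; e \<in> steps; proj H e = \<sigma> a\<rbrakk>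
      \<Longrightarrow> \<exists>e'\<in>steps. proj H e' = \<sigma> b \<and> dstep e e' < 1/4"
proof -
  let ?S = "standard_simplex p"
  have "\<exists>O'. open O' \<and> a \<in> O' \<and> (\<exists>e\<in>steps. \<forall>b\<in>O' \<inter> ?S. \<sigma> b \<in> proj H ` E.mball e (1/8))" if a: "a \<in> ?S" for a
  proof -
    have "\<sigma> a \<in> topspace (orbit_space H)" using continuous_map_image_subset_topspace[OF \<sigma>] a by auto
    then obtain e where e: "e \<in> steps" "proj H e = \<sigma> a" by (auto simp: topspace_orbit_space)
    have "openin (orbit_space H) (proj H ` E.mball e (1/8))" by (intro proj_open[OF H] E.openin_mball)
    then have "openin (simplex_top p) {b \<in> topspace (simplex_top p). \<sigma> b \<in> proj H ` E.mball e (1/8)}"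
      using \<sigma> openin_continuous_map_preimage by blast
    then obtain O' where O': "openin (powertop_real UNIV) O'"
      "{b \<in> topspace (simplex_top p). \<sigma> b \<in> proj H ` E.mball e (1/8)} = O' \<inter> ?S"
      unfolding openin_subtopology by blast
    have "open O'" using O'(1) by (simp add: euclidean_product_topology)
    moreover have "e \<in> E.mball e (1/8)" using e by simp
    then have "\<sigma> a \<in> proj H ` E.mball e (1/8)" using e(2) by (intro image_eqI[of _ _ e]) auto
    then have "a \<in> {b \<in> topspace (simplex_top p). \<sigma> b \<in> proj H ` E.mball e (1/8)}" using a by simp
    then have "a \<in> O'" unfolding O'(2) by blast
    moreover have "\<forall>b\<in>O' \<inter> ?S. \<sigma> b \<in> proj H ` E.mball e (1/8)" using O'(2) by blast
    ultimately show ?thesis using e by blast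
  qed
  then have "\<forall>a\<in>?S. \<exists>O'. open O' \<and> a \<in> O' \<and> (\<exists>e\<in>steps. \<forall>b\<in>O' \<inter> ?S. \<sigma> b \<in> proj H ` E.mball e (1/8))" by blast
  from bchoice[OF this] obtain O' where O'': "\<forall>a\<in>?S. open (O' a) \<and> a \<in> O' a \<and>
    (\<exists>e\<in>steps. \<forall>b\<in>O' a \<inter> ?S. \<sigma> b \<in> proj H ` E.mball e (1/8))" ..
  then have O': "\<And>a. a \<in> ?S \<Longrightarrow> open (O' a)" "\<And>a. a \<in> ?S \<Longrightarrow> a \<in> O' a"
    "\<And>a. a \<in> ?S \<Longrightarrow> \<exists>e\<in>steps. \<forall>b\<in>O' a \<inter> ?S. \<sigma> b \<in> proj H ` E.mball e (1/8)"
    by blast+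
  have "compact ?S" using compactin_standard_simplex[of p] by (simp add: euclidean_product_topology)
  then obtain \<delta> where d: "0 < \<delta>" "\<And>x. x \<in> ?S \<Longrightarrow> \<exists>G\<in>O' ` ?S. ball x \<delta> \<subseteq> G"
    by (rule Heine_Borel_lemma[of ?S "O' ` ?S"]) (use O' in auto)
  show ?thesis
  proof (rule that[OF d(1)])
    fix a b e assume ab: "a \<in> ?S" "b \<in> ?S" "dist a b < \<delta>" and e: "e \<in> steps" "proj H e = \<sigma> a"
    obtain c where c: "c \<in> ?S" "ball a \<delta> \<subseteq> O' c" using d(2)[OF ab(1)] by blast
    have "a \<in> O' c" "b \<in> O' c" using c(2) ab d(1) by auto
    then obtain e0 where e0: "e0 \<in> steps" "\<sigma> a \<in> proj H ` E.mball e0 (1/8)" "\<sigma> b \<in> proj H ` E.mball e0 (1/8)"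
      using O'(3)[OF c(1)] ab by blast
    then obtain fa fb where f: "fa \<in> steps" "fb \<in> steps" "dstep e0 fa < 1/8" "dstep e0 fb < 1/8" "\<sigma> a = proj H fa" "\<sigma> b = proj H fb"
      by (auto simp: E.in_mball)
    have "proj H fa = proj H e" using e(2) f(5) by simp
    then obtain h where h: "h \<in> H" "e = gact h fa" using proj_eqD[OF H f(1) e(1)] by blast
    have "dstep fa fb \<le> dstep fa e0 + dstep e0 fb" using E.triangle f e0 by blast
    then have "dstep fa fb < 1/4" using f E.commute[of fa e0] by linarith
    then have "dstep e (gact h fb) < 1/4" using h dstep_gact by metis
    moreover have "proj H (gact h fb) = \<sigma> b" using proj_gact[OF H h(1)] f by metis
    ultimately show "\<exists>e'\<in>steps. proj H e' = \<sigma> b \<and> dstep e e' < 1/4" using gact_steps f by blast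
  qed
qed

definition ray :: "real \<Rightarrow> (nat \<Rightarrow> real) \<Rightarrow> nat \<Rightarrow> real" where
  "ray r a = (\<lambda>i. (1 - r) * (if i = 0 then 1 else 0) + r * a i)"

lemma ray_simplex: "a \<in> standard_simplex p \<Longrightarrow> 0 \<le> r \<Longrightarrow> r \<le> 1 \<Longrightarrow> ray r a \<in> standard_simplex p"
  unfolding ray_def by (rule convex_standard_simplex) auto

text \<open>Every coordinate moves by at most \<open>\<bar>r - r'\<bar>\<close>. The product metric
  is bounded by twice the largest of finitely many coordinate distances plus a tail
  \<open>(1/2) ^ N\<close>, and \<open>N\<close> tends to infinity.\<close>

lemma dist_ray_ray:
  assumes a: "a \<in> standard_simplex p"
  shows "dist (ray r a) (ray r' a) \<le> 2 * \<bar>r - r'\<bar>"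
proof -
  have c: "dist (ray r a i) (ray r' a i) \<le> \<bar>r - r'\<bar>" for i
  proof -
    let ?e = "if i = 0 then 1 else 0 :: real"
    have "ray r a i - ray r' a i = (r - r') * (a i - ?e)" by (simp add: ray_def algebra_simps)
    moreover have "0 \<le> a i" "a i \<le> 1" using a by (auto simp: standard_simplex_def)
    then have "\<bar>a i - ?e\<bar> \<le> 1" by auto
    then have "\<bar>r - r'\<bar> * \<bar>a i - ?e\<bar> \<le> \<bar>r - r'\<bar> * 1" by (intro mult_left_mono) auto
    ultimately show ?thesis by (simp add: dist_real_def abs_mult)
  qed
  have "dist (ray r a) (ray r' a) \<le> 2 * \<bar>r - r'\<bar> + (1/2) ^ N" for N
  proof -
    let ?M = "{dist (ray r a (from_nat n)) (ray r' a (from_nat n)) | n. n \<le> N}"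
    have "finite ?M" by simp
    moreover have "?M \<noteq> {}" by auto
    ultimately have "Max ?M \<le> \<bar>r - r'\<bar>" using c by (auto simp: Max_le_iff)
    then have "2 * Max ?M + (1/2) ^ N \<le> 2 * \<bar>r - r'\<bar> + (1/2) ^ N" by simp
    then show ?thesis by (rule order_trans[OF dist_fun_le_dist_first_terms])
  qed
  moreover have "(\<lambda>N. 2 * \<bar>r - r'\<bar> + (1/2) ^ N) \<longlonglongrightarrow> 2 * \<bar>r - r'\<bar> + 0"
    by (intro tendsto_intros LIMSEQ_power_zero) auto
  ultimately show ?thesis using LIMSEQ_le_const by fastforce
qed

lemma dist_ray:
  assumes "0 \<le> r" "r \<le> 1"
  shows "dist (ray r a) (ray r b) \<le> dist a b"
proof -
  have S: "summable (\<lambda>n. (1/2) ^ n * min (dist (x (from_nat n)) (y (from_nat n))) 1)" for x y :: "nat \<Rightarrow> real"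
    by (rule summable_comparison_test'[of "\<lambda>n. (1/2)^n"]) (auto simp: summable_geometric_iff)
  show ?thesis unfolding dist_fun_def
  proof (rule suminf_le[OF _ S S])
  fix n
  have "ray r a i - ray r b i = r * (a i - b i)" for i by (simp add: ray_def algebra_simps)
  moreover have "r * \<bar>a i - b i\<bar> \<le> 1 * \<bar>a i - b i\<bar>" for i using assms by (intro mult_right_mono) auto
  ultimately have "dist (ray r a i) (ray r b i) \<le> dist (a i) (b i)" for i
    using assms by (simp add: dist_real_def abs_mult)
  then show "(1/2) ^ n * min (dist (ray r a (from_nat n)) (ray r b (from_nat n))) 1 \<le>
      (1/2) ^ n * min (dist (a (from_nat n)) (b (from_nat n))) 1"
    by (intro mult_left_mono min.mono) auto
  qed
qed

text \<open>All points are reached from vertex 0 along segments, in \<open>N\<close> moves of length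
  at most \<open>2 / N < \<delta>\<close>, each lifted to within 1/4 of the previous lift.
  Continuity of the final lift follows from closeness of the lifts at neighbouring points, carried
  through the moves.\<close>

lemma lift_exists:
  assumes H: "subgrp H" and \<sigma>: "singular_simplex p (orbit_space H) \<sigma>"
  obtains \<tau> where "singular_simplex p Etop \<tau>" "simplex_map p (proj H) \<tau> = \<sigma>"
proof -
  let ?S = "standard_simplex p"
  have c: "continuous_map (simplex_top p) (orbit_space H) \<sigma>" and ext: "\<sigma> \<in> extensional ?S"
    using \<sigma> by (auto simp: singular_simplex_def)
  obtain \<delta> where d: "0 < \<delta>" and near: "\<And>a b e. \<lbrakk>a \<in> ?S; b \<in> ?S; dist a b < \<delta>; e \<in> steps; proj H e = \<sigma> a\<rbrakk>
      \<Longrightarrow> \<exists>e'\<in>steps. proj H e' = \<sigma> b \<and> dstep e e' < 1/4"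
    using local_lifts[OF H c] by blast
  obtain N :: nat where N': "2 / \<delta> < real N" using reals_Archimedean2 by blast
  have "0 < 2 / \<delta>" using d by simp
  then have N0: "0 < real N" using N' by linarith
  have "2 < real N * \<delta>" using N' d by (simp add: pos_divide_less_eq)
  then have N: "2 / real N < \<delta>" "0 < real N" using N0 by (simp_all add: pos_divide_less_eq mult.commute)
  define v :: "nat \<Rightarrow> real" where "v = (\<lambda>i. if i = 0 then 1 else 0)"
  have vS: "v \<in> ?S" by (simp add: v_def)
  have "\<sigma> v \<in> topspace (orbit_space H)" using continuous_map_image_subset_topspace[OF c] vS by auto
  then obtain e0 where e0: "e0 \<in> steps" "proj H e0 = \<sigma> v" by (auto simp: topspace_orbit_space)
  define pt where "pt k a = ray (real k / real N) a" for k a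
  define L where "L = rec_nat (\<lambda>a. e0) (\<lambda>k F a. SOME e. e \<in> steps \<and> proj H e = \<sigma> (pt (Suc k) a) \<and> dstep (F a) e < 1/4)"
  have L0: "L 0 a = e0" and LS: "L (Suc k) a = (SOME e. e \<in> steps \<and> proj H e = \<sigma> (pt (Suc k) a) \<and> dstep (L k a) e < 1/4)" for k a
    by (simp_all add: L_def)
  have ptS: "pt k a \<in> ?S" if "a \<in> ?S" "k \<le> N" for k a
    unfolding pt_def using that N by (intro ray_simplex) auto
  have pt0: "pt 0 a = v" for a by (auto simp: pt_def ray_def v_def)
  have ptN: "pt N a = a" for a using N by (auto simp: pt_def ray_def)
  have ptstep: "dist (pt k a) (pt (Suc k) a) < \<delta>" if "a \<in> ?S" for k a
  proof -
    have "dist (pt k a) (pt (Suc k) a) \<le> 2 * \<bar>real k / real N - real (Suc k) / real N\<bar>"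
      unfolding pt_def by (rule dist_ray_ray[OF that])
    also have "real k / real N - real (Suc k) / real N = - (1 / real N)"
      by (simp add: diff_divide_distrib[symmetric])
    finally show ?thesis using N by simp
  qed
  have lift: "k \<le> N \<Longrightarrow> L k a \<in> steps \<and> proj H (L k a) = \<sigma> (pt k a)" if a: "a \<in> ?S" for k a
  proof (induction k)
    case (Suc k)
    then have "\<exists>e\<in>steps. proj H e = \<sigma> (pt (Suc k) a) \<and> dstep (L k a) e < 1/4"
      using near[OF ptS[OF a, of k] ptS[OF a, of "Suc k"] ptstep[OF a]] by simp
    then have "\<exists>e. e \<in> steps \<and> proj H e = \<sigma> (pt (Suc k) a) \<and> dstep (L k a) e < 1/4" by blast
    from someI_ex[OF this] show ?case unfolding LS by blast
  qed (use e0 pt0 L0 in simp)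
  have Lstep: "dstep (L k a) (L (Suc k) a) < 1/4" if a: "a \<in> ?S" and k: "Suc k \<le> N" for k a
  proof -
    have "\<exists>e\<in>steps. proj H e = \<sigma> (pt (Suc k) a) \<and> dstep (L k a) e < 1/4"
      using near[OF ptS[OF a, of k] ptS[OF a, of "Suc k"] ptstep[OF a]] lift[OF a, of k] k by simp
    then have "\<exists>e. e \<in> steps \<and> proj H e = \<sigma> (pt (Suc k) a) \<and> dstep (L k a) e < 1/4" by blast
    from someI_ex[OF this] show ?thesis unfolding LS by blast
  qed
  have close: "k \<le> N \<Longrightarrow> dstep (L k a) (L k b) < 1/4" if ab: "a \<in> ?S" "b \<in> ?S" "dist a b < \<delta>" for a b k
  proof (induction k)
    case 0
    then show ?case using e0 by (simp add: L0)
  next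
    case (Suc k)
    let ?P = "L k a" and ?Q = "L k b" and ?P' = "L (Suc k) a" and ?Q' = "L (Suc k) b"
    have "dist (pt (Suc k) a) (pt (Suc k) b) \<le> dist a b"
      unfolding pt_def using Suc(2) N by (intro dist_ray) auto
    then have "dist (pt (Suc k) a) (pt (Suc k) b) < \<delta>" using ab by linarith
    then obtain R where R: "R \<in> steps" "proj H R = \<sigma> (pt (Suc k) b)" "dstep ?P' R < 1/4"
      using near[OF ptS[OF ab(1)] ptS[OF ab(2)], of "Suc k" "Suc k" ?P'] lift[OF ab(1)] Suc by blast
    have s: "?P \<in> steps" "?Q \<in> steps" "?P' \<in> steps" "?Q' \<in> steps" using lift ab Suc by auto
    \<comment> \<open>Going from \<open>R\<close> through \<open>?P'\<close>, \<open>?P\<close>,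
      \<open>?Q\<close> to \<open>?Q'\<close> uses four distances below 1/4. The total is below the
      gap 1, so \<open>R\<close> and \<open>?Q'\<close>, which lie over the same point,
      coincide.\<close>
    have "dstep R ?Q' \<le> dstep R ?P' + dstep ?P' ?Q'" "dstep ?P' ?Q' \<le> dstep ?P' ?P + dstep ?P ?Q'"
      "dstep ?P ?Q' \<le> dstep ?P ?Q + dstep ?Q ?Q'" using s R E.triangle by blast+
    moreover have "dstep ?P' ?P < 1/4" "dstep ?Q ?Q' < 1/4" "dstep R ?P' < 1/4"
      using Lstep ab Suc R E.commute by metis+
    moreover have "dstep ?P ?Q < 1/4" using Suc by simp
    ultimately have "dstep R ?Q' < 1" by linarith
    then have "R = ?Q'" using lift_unique[OF H R(1) s(4)] R lift[OF ab(2)] Suc by metis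
    then show ?case using R by simp
  qed
  let ?\<tau> = "restrict (L N) ?S"
  have LN: "L N a \<in> steps" "proj H (L N a) = \<sigma> a" if "a \<in> ?S" for a using lift[OF that, of N] ptN by auto
  have "continuous_map (simplex_top p) Etop (L N)"
  proof (rule continuous_into_stepsI)
    fix a \<epsilon> assume "a \<in> topspace (simplex_top p)" and e: "0 < (\<epsilon> :: real)"
    then have a: "a \<in> ?S" by simp
    let ?V = "proj H ` E.mball (L N a) (min \<epsilon> (1/4))"
    let ?U = "{b \<in> topspace (simplex_top p). \<sigma> b \<in> ?V} \<inter> (ball a \<delta> \<inter> ?S)"
    have "openin (orbit_space H) ?V" by (intro proj_open[OF H] E.openin_mball)
    then have o1: "openin (simplex_top p) {b \<in> topspace (simplex_top p). \<sigma> b \<in> ?V}"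
      using c openin_continuous_map_preimage by blast
    have "openin (powertop_real UNIV) (ball a \<delta>)" by (simp add: euclidean_product_topology)
    then have "openin (simplex_top p) (ball a \<delta> \<inter> ?S)" unfolding openin_subtopology by blast
    then have "openin (simplex_top p) ?U" using o1 by blast
    moreover have "L N a \<in> E.mball (L N a) (min \<epsilon> (1/4))" using LN[OF a] e by simp
    then have "a \<in> ?U" using LN[OF a] a d by (auto intro: image_eqI[of _ _ "L N a"])
    moreover have "dstep (L N a) (L N b) < \<epsilon>" if b: "b \<in> ?U" for b
    proof -
      have bS: "b \<in> ?S" "dist a b < \<delta>" using b by auto
      obtain R where R: "R \<in> steps" "dstep (L N a) R < min \<epsilon> (1/4)" "\<sigma> b = proj H R"
        using b by (auto simp: E.in_mball)
      have "dstep R (L N b) \<le> dstep R (L N a) + dstep (L N a) (L N b)" using E.triangle R LN a bS by blast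
      moreover have "dstep R (L N a) < 1/4" using R E.commute[of R "L N a"] by simp
      moreover have "dstep (L N a) (L N b) < 1/4" using close[OF a bS] by simp
      ultimately have "R = L N b" using lift_unique[OF H R(1) LN(1)[OF bS(1)]] R LN(2)[OF bS(1)] by auto
      then show ?thesis using R by simp
    qed
    ultimately show "\<exists>U. openin (simplex_top p) U \<and> a \<in> U \<and> (\<forall>y\<in>U. dstep (L N a) (L N y) < \<epsilon>)" by blast
  qed (use LN in auto)
  then have "singular_simplex p Etop ?\<tau>"
    unfolding singular_simplex_def by (auto intro: continuous_map_eq)
  moreover have "simplex_map p (proj H) ?\<tau> = \<sigma>"
    unfolding simplex_map_def using LN ext by (auto simp: restrict_def fun_eq_iff extensional_def)
  ultimately show ?thesis using that by blast
qed

text \<open>The element \<open>h\<close> is read off at vertex 0. The locus where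
  \<open>\<tau>'\<close> and the translate of \<open>\<tau>\<close> agree is open and closed, since
  moves of less than 1/2 on either side cannot bridge the gap 1, and the simplex is
  connected.\<close>

lemma lift_unique_up_to_action:
  assumes H: "subgrp H" and t: "singular_simplex p Etop \<tau>" "singular_simplex p Etop \<tau>'"
    and eq: "simplex_map p (proj H) \<tau> = simplex_map p (proj H) \<tau>'"
  obtains h where "h \<in> H" "\<And>x. x \<in> standard_simplex p \<Longrightarrow> \<tau>' x = gact h (\<tau> x)"
proof -
  let ?S = "standard_simplex p"
  have c: "continuous_map (simplex_top p) Etop \<tau>" "continuous_map (simplex_top p) Etop \<tau>'"
    using t by (auto simp: singular_simplex_def)
  have st: "\<tau> x \<in> steps" "\<tau>' x \<in> steps" if "x \<in> ?S" for x
    using continuous_map_image_subset_topspace[OF c(1)] continuous_map_image_subset_topspace[OF c(2)] that by auto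
  have pe: "proj H (\<tau> x) = proj H (\<tau>' x)" if "x \<in> ?S" for x
    using fun_cong[OF eq, of x] that by (simp add: simplex_map_def)
  define v :: "nat \<Rightarrow> real" where "v = (\<lambda>i. if i = 0 then 1 else 0)"
  have vS: "v \<in> ?S" by (simp add: v_def)
  obtain h where h: "h \<in> H" "\<tau>' v = gact h (\<tau> v)" using proj_eqD[OF H st[OF vS] pe[OF vS]] by blast
  have ph: "proj H (gact h (\<tau> x)) = proj H (\<tau>' x)" if "x \<in> ?S" for x using proj_gact[OF H h(1)] pe[OF that] by simp
  let ?A = "{x \<in> topspace (simplex_top p). \<tau>' x = gact h (\<tau> x)}" and ?B = "{x \<in> topspace (simplex_top p). \<tau>' x \<noteq> gact h (\<tau> x)}"
  have nbhd: "\<exists>U. openin (simplex_top p) U \<and> x \<in> U \<and> (\<forall>y\<in>U. \<tau>' y = gact h (\<tau> y) \<longleftrightarrow> \<tau>' x = gact h (\<tau> x))" if x: "x \<in> ?S" for x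
  proof -
    obtain U where U: "openin (simplex_top p) U" "x \<in> U" "\<forall>y\<in>U. \<tau> y \<in> E.mball (\<tau> x) (1/2)"
      using c(1)[unfolded E.continuous_map_to_metric, rule_format, of x "1/2"] x by auto
    obtain U' where U': "openin (simplex_top p) U'" "x \<in> U'" "\<forall>y\<in>U'. \<tau>' y \<in> E.mball (\<tau>' x) (1/2)"
      using c(2)[unfolded E.continuous_map_to_metric, rule_format, of x "1/2"] x by auto
    have key: "\<tau>' y = gact h (\<tau> y) \<longleftrightarrow> \<tau>' x = gact h (\<tau> x)" if y: "y \<in> U \<inter> U'" for y
    proof -
      have yS: "y \<in> ?S" using openin_subset[OF U(1)] y by auto
      have d: "dstep (gact h (\<tau> x)) (gact h (\<tau> y)) < 1/2" "dstep (\<tau>' x) (\<tau>' y) < 1/2"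
        using U(3) U'(3) y by (auto simp: E.in_mball dstep_gact)
      note s = gact_steps[OF st(1)[OF x], of h] gact_steps[OF st(1)[OF yS], of h] st(2)[OF x] st(2)[OF yS]
      show ?thesis
      proof
        assume "\<tau>' y = gact h (\<tau> y)"
        then have "dstep (gact h (\<tau> x)) (\<tau>' x) < 1"
          using E.triangle[OF s(1,2,3)] d E.commute[of "\<tau>' x" "\<tau>' y"] by simp
        then show "\<tau>' x = gact h (\<tau> x)" using lift_unique[OF H s(1,3) ph[OF x]] by simp
      next
        assume "\<tau>' x = gact h (\<tau> x)"
        then have "dstep (gact h (\<tau> y)) (\<tau>' y) < 1"
          using E.triangle[OF s(2,1,4)] d E.commute[of "gact h (\<tau> x)" "gact h (\<tau> y)"] by simp
        then show "\<tau>' y = gact h (\<tau> y)" using lift_unique[OF H s(2,4) ph[OF yS]] by simp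
      qed
    qed
    show ?thesis
    proof (intro exI conjI ballI)
      show "openin (simplex_top p) (U \<inter> U')" using U(1) U'(1) by (rule openin_Int)
      show "x \<in> U \<inter> U'" using U(2) U'(2) by simp
    qed (rule key)
  qed
  have oA: "openin (simplex_top p) ?A"
  proof (subst openin_subopen, intro ballI)
    fix x assume x: "x \<in> ?A"
    then obtain U where U: "openin (simplex_top p) U" "x \<in> U" "\<forall>y\<in>U. \<tau>' y = gact h (\<tau> y) \<longleftrightarrow> \<tau>' x = gact h (\<tau> x)"
      using nbhd[of x] by auto
    then have "U \<subseteq> ?A" using x openin_subset[OF U(1)] by blast
    then show "\<exists>T. openin (simplex_top p) T \<and> x \<in> T \<and> T \<subseteq> ?A" using U(1,2) by blast
  qed
  have oB: "openin (simplex_top p) ?B"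
  proof (subst openin_subopen, intro ballI)
    fix x assume x: "x \<in> ?B"
    then obtain U where U: "openin (simplex_top p) U" "x \<in> U" "\<forall>y\<in>U. \<tau>' y = gact h (\<tau> y) \<longleftrightarrow> \<tau>' x = gact h (\<tau> x)"
      using nbhd[of x] by auto
    then have "U \<subseteq> ?B" using x openin_subset[OF U(1)] by blast
    then show "\<exists>T. openin (simplex_top p) T \<and> x \<in> T \<and> T \<subseteq> ?B" using U(1,2) by blast
  qed
  note oA oB
  moreover have "connected_space (simplex_top p)"
    using connectedin_standard_simplex[of p] by (simp add: connectedin_def)
  moreover have "?A \<inter> ?B = {}" "topspace (simplex_top p) \<subseteq> ?A \<union> ?B" "v \<in> ?A" using h vS by auto
  ultimately have "?B = {}" unfolding connected_space_def by blast
  then have "\<tau>' x = gact h (\<tau> x)" if "x \<in> ?S" for x using that by auto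
  then show ?thesis using that h by blast
qed

section \<open>Singular cochains of orbit spaces\<close>

definition vertex :: "nat \<Rightarrow> nat \<Rightarrow> real" where
  "vertex i = (\<lambda>j. if j = i then 1 else 0)"

text \<open>Evaluation at \<open>s = 0\<close> is an equivariant map from step functions to the
  group, so it labels the vertices of any simplex; continuity of the labels plays no part.\<close>

definition vert :: "nat \<Rightarrow> ((nat \<Rightarrow> real) \<Rightarrow> real \<Rightarrow> 'g) \<Rightarrow> 'g list" where
  "vert q \<tau> = map (\<lambda>i. \<tau> (vertex i) 0) [0..<Suc q]"

definition straight_simplex :: "nat \<Rightarrow> 'g::{group_add,countable} list \<Rightarrow> (nat \<Rightarrow> real) \<Rightarrow> real \<Rightarrow> 'g" where
  "straight_simplex q gs = restrict (straight gs) (standard_simplex q)"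

definition join_simplex :: "nat \<Rightarrow> nat \<Rightarrow> ((nat \<Rightarrow> real) \<Rightarrow> real \<Rightarrow> 'g::{group_add,countable}) \<Rightarrow> 'g list \<Rightarrow>
    (nat \<Rightarrow> real) \<Rightarrow> real \<Rightarrow> 'g" where
  "join_simplex q i \<tau> gs = restrict (join i \<tau> gs) (standard_simplex (Suc q))"

definition gact_simplex :: "nat \<Rightarrow> 'g::{group_add,countable} \<Rightarrow> ((nat \<Rightarrow> real) \<Rightarrow> real \<Rightarrow> 'g) \<Rightarrow>
    (nat \<Rightarrow> real) \<Rightarrow> real \<Rightarrow> 'g" where
  "gact_simplex q h \<tau> = restrict (\<lambda>x. gact h (\<tau> x)) (standard_simplex q)"

lemma length_vert [simp]: "length (vert q \<tau>) = Suc q"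
  by (simp add: vert_def)

lemma nth_vert [simp]: "i \<le> q \<Longrightarrow> vert q \<tau> ! i = \<tau> (vertex i) 0"
  unfolding vert_def by (subst nth_map) (simp_all add: less_Suc_eq_le del: upt_Suc)

lemma vertex_simplex: "i \<le> q \<Longrightarrow> vertex i \<in> standard_simplex q"
  by (simp add: vertex_def)

lemma affine_vertex_vertex: "i \<le> m \<Longrightarrow> affine_vertex m \<theta> (vertex i) = vertex (\<theta> i)"
  by (auto simp: affine_vertex_def vertex_def fun_eq_iff sum.delta if_distrib cong: if_cong)

lemma vert_act:
  assumes "vertex_map m n \<theta>"
  shows "vert m (simplex_act m \<theta> \<tau>) = tuple_act m \<theta> (vert n \<tau>)"
proof (rule nth_equalityI)
  fix i assume "i < length (vert m (simplex_act m \<theta> \<tau>))"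
  then have i: "i \<le> m" by simp
  then have "\<theta> i \<le> n" using assms by (auto simp: vertex_map_def)
  then show "vert m (simplex_act m \<theta> \<tau>) ! i = tuple_act m \<theta> (vert n \<tau>) ! i"
    using i by (simp add: simplex_act_eq vertex_simplex affine_vertex_vertex)
qed simp

lemma vert_gact: "vert q (gact_simplex q h \<tau>) = shift h (vert q \<tau>)"
  by (rule nth_equalityI) (auto simp: gact_simplex_def vertex_simplex less_Suc_eq_le simp del: upt_Suc)

lemma singular_straight: "singular_simplex q Etop (straight_simplex q gs)"
  unfolding singular_simplex_def straight_simplex_def
  using continuous_straight[of q gs] by (auto intro: continuous_map_eq)

lemma singular_steps: "singular_simplex q Etop \<tau> \<Longrightarrow> x \<in> standard_simplex q \<Longrightarrow> \<tau> x \<in> steps"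
  using continuous_map_image_subset_topspace[of "simplex_top q" Etop \<tau>] by (auto simp: singular_simplex_def)

lemma singular_join:
  assumes "singular_simplex q Etop \<tau>" "i \<le> q"
  shows "singular_simplex (Suc q) Etop (join_simplex q i \<tau> gs)"
proof -
  have "standard_simplex i \<subseteq> standard_simplex q" using standard_simplex_mono[OF assms(2)] .
  then have "continuous_map (simplex_top i) Etop \<tau>"
    using assms(1) continuous_map_from_subtopology_mono[of "powertop_real UNIV" "standard_simplex q" Etop \<tau>]
    by (auto simp: singular_simplex_def)
  then have "continuous_map (simplex_top (Suc q)) Etop (join i \<tau> gs)" by (rule continuous_join)
  then show ?thesis unfolding singular_simplex_def join_simplex_def by (auto intro: continuous_map_eq)
qed

lemma straight_affine:
  assumes "x \<in> standard_simplex m" "vertex_map m n \<theta>" "length gs = Suc n"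
  shows "straight gs (affine_vertex m \<theta> x) = straight (tuple_act m \<theta> gs) x"
proof
  fix s
  show "straight gs (affine_vertex m \<theta> x) s = straight (tuple_act m \<theta> gs) x s"
    using index_affine_vertex[OF assms(1,2), of s] index_le[OF assms(1), of s] by (auto simp: straight_def)
qed

lemma straight_simplex_act:
  assumes "vertex_map m n \<theta>" "length gs = Suc n"
  shows "straight_simplex m (tuple_act m \<theta> gs) = simplex_act m \<theta> (straight_simplex n gs)"
  unfolding straight_simplex_def simplex_act_eq
  using straight_affine[OF _ assms] affine_vertex_simplex[of _ m \<theta> n] assms(1)
  by (auto simp: restrict_def fun_eq_iff[of "\<lambda>x. if _ x then _ x else _ x"] vertex_map_def)

lemma index_vertex: "0 \<le> s \<Longrightarrow> s < 1 \<Longrightarrow> index (vertex i) s = i"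
proof -
  assume s: "0 \<le> s" "s < 1"
  have "breakpoint (vertex i) j = (if i \<le> j then 1 else 0)" for j
    by (simp add: breakpoint_def vertex_def)
  then show ?thesis using index_eq_iff[OF vertex_simplex[of i i] s(2), of i] s by auto
qed

lemma vert_straight: "length gs = Suc q \<Longrightarrow> vert q (straight_simplex q gs) = gs"
  by (rule nth_equalityI) (auto simp: straight_simplex_def vertex_simplex straight_def index_vertex less_Suc_eq_le simp del: upt_Suc)

lemma straight_shift:
  assumes "length gs = Suc q"
  shows "straight_simplex q (shift h gs) = gact_simplex q h (straight_simplex q gs)"
proof -
  have "straight (shift h gs) x = gact h (straight gs x)" if "x \<in> standard_simplex q" for x
    using index_le[OF that] assms by (auto simp: straight_def gact_def fun_eq_iff less_Suc_eq_le)
  then show ?thesis by (auto simp: straight_simplex_def gact_simplex_def restrict_def fun_eq_iff[of "\<lambda>x. if _ x then _ x else _ x"])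
qed

text \<open>The padding entry 0 in \<open>join\<close> is never read: beyond the front face the
  index is at least 1. It makes \<open>gs ! i\<close> the label of vertex
  \<open>i + 1\<close>.\<close>

lemma join_eval:
  assumes y: "y \<in> standard_simplex m"
  shows "join i \<tau> gs y s = (if s \<in> {0..<1} then if index y s \<le> i then \<tau> (front i y) s else gs ! (index y s - 1) else 0)"
proof (cases "s \<in> {0..<1}")
  case True
  then have "index y s \<le> i \<longleftrightarrow> s < breakpoint y i" using index_less_iff[OF y] by simp
  moreover have "(0 # gs) ! index y s = gs ! (index y s - 1)" if "\<not> index y s \<le> i"
    using that by (cases "index y s") auto
  ultimately show ?thesis using True by (auto simp: join_def glue_def straight_def)
next
  case False
  then show ?thesis using breakpoint_le_1[OF y, of i] by (auto simp: join_def glue_def straight_def)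
qed

lemma breakpoint_positive:
  assumes "y \<in> standard_simplex m" "0 \<le> s" "s < 1" "index y s \<le> i"
  shows "0 < breakpoint y i"
  using index_less_iff[OF assms(1,3), of i] assms by simp

lemma simplical_face_breakpoint:
  "k \<le> i \<Longrightarrow> i = Suc j \<Longrightarrow> breakpoint (simplical_face k x) i = breakpoint x j"
  "i < k \<Longrightarrow> breakpoint (simplical_face k x) i = breakpoint x i"
proof -
  assume ki: "k \<le> i" "i = Suc j"
  have "breakpoint (simplical_face k x) i = (\<Sum>l\<in>{..Suc j} - {k}. simplical_face k x l)"
    unfolding breakpoint_def ki(2) by (rule sum.mono_neutral_right) (auto simp: simplical_face_def)
  also have "\<dots> = (\<Sum>l\<le>j. x l)"
    by (rule sum.reindex_bij_witness[of _ "skip k" "\<lambda>l. if l < k then l else l - 1"])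
       (use ki in \<open>auto simp: skip_def simplical_face_def\<close>)
  finally show "breakpoint (simplical_face k x) i = breakpoint x j" by (simp add: breakpoint_def)
next
  assume "i < k"
  then show "breakpoint (simplical_face k x) i = breakpoint x i"
    unfolding breakpoint_def by (intro sum.cong) (auto simp: simplical_face_def)
qed

lemma front_face_low: "k \<le> Suc j \<Longrightarrow> front (Suc j) (simplical_face k x) = simplical_face k (front j x)"
  unfolding front_def by (subst simplical_face_breakpoint(1)[OF _ refl]) (auto simp: simplical_face_def fun_eq_iff)

lemma front_face_high: "i < k \<Longrightarrow> front i (simplical_face k x) = front i x"
  unfolding front_def by (subst simplical_face_breakpoint(2)) (auto simp: simplical_face_def fun_eq_iff)

lemma simplical_face_beyond:
  assumes "x \<in> standard_simplex i" "i < k"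
  shows "simplical_face k x = x"
  using assms by (auto simp: simplical_face_def standard_simplex_def fun_eq_iff)

lemma index_face:
  "x \<in> standard_simplex n \<Longrightarrow> 0 \<le> s \<Longrightarrow> s < 1 \<Longrightarrow> index (simplical_face k x) s = skip k (index x s)"
  using index_affine_vertex[OF _ vertex_map_skip[of n k], of x s] affine_vertex_skip[of x n k] by simp

lemma face_join:
  assumes x: "x \<in> standard_simplex q" and k: "k \<le> Suc q"
  shows "join i \<tau> gs (simplical_face k x) s = (if s \<in> {0..<1} then
     if skip k (index x s) \<le> i then \<tau> (front i (simplical_face k x)) s else gs ! (skip k (index x s) - 1) else 0)"
proof -
  have "simplical_face k x \<in> standard_simplex (Suc q)"
    using simplical_face_in_standard_simplex[of "Suc q" k x] x k by simp
  then show ?thesis using join_eval[of "simplical_face k x" "Suc q" i \<tau> gs s] index_face[OF x, of s k] by auto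
qed

lemma join_face:
  assumes x: "x \<in> standard_simplex q" and t: "\<tau> = simplex_act n \<theta> \<tau>'" "i \<le> n"
  shows "join i \<tau> gs x s = (if s \<in> {0..<1} then
     if index x s \<le> i then \<tau>' (affine_vertex n \<theta> (front i x)) s else gs ! (index x s - 1) else 0)"
proof -
  have "\<tau> (front i x) = \<tau>' (affine_vertex n \<theta> (front i x))" if "0 \<le> s" "s < 1" "index x s \<le> i"
  proof -
    have "front i x \<in> standard_simplex n"
      using front_simplex[OF x breakpoint_positive[OF x that]] standard_simplex_mono[OF t(2)] by blast
    then show ?thesis by (simp add: t simplex_act_eq)
  qed
  then show ?thesis using join_eval[OF x, of i \<tau> gs s] by auto
qed

lemma act_join_simplex:
  assumes "k \<le> Suc q"
  shows "simplex_act q (skip k) (join_simplex q i \<tau> gs) =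
    restrict (\<lambda>x. join i \<tau> gs (simplical_face k x)) (standard_simplex q)"
  unfolding simplex_act_eq join_simplex_def
  using simplical_face_in_standard_simplex[of "Suc q" k] assms
  by (auto simp: restrict_def affine_vertex_skip fun_eq_iff[of "\<lambda>x. if _ x then _ x else _ x"])

text \<open>The faces of the joins satisfy the identities of a simplicial homotopy from \<open>\<tau>\<close> to a straight simplex.\<close>

lemma face_join_low:
  assumes "k \<le> j" "Suc j \<le> Suc r"
  shows "simplex_act (Suc r) (skip k) (join_simplex (Suc r) (Suc j) \<tau> gs) =
    join_simplex r j (simplex_act r (skip k) \<tau>) (tuple_act r (skip k) gs)"
proof -
  have "join (Suc j) \<tau> gs (simplical_face k x) s = join j (simplex_act r (skip k) \<tau>) (tuple_act r (skip k) gs) x s"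
    if x: "x \<in> standard_simplex (Suc r)" for x s
  proof (cases "s \<in> {0..<1}")
    case True
    then have s: "0 \<le> s" "s < 1" by auto
    have ix: "index x s \<le> Suc r" using index_le[OF x s(2)] .
    show ?thesis
    proof (cases "index x s \<le> j")
      case le: True
      have f: "front j x \<in> standard_simplex r"
        using front_simplex[OF x breakpoint_positive[OF x s le]] standard_simplex_mono[of j r] assms by auto
      have "skip k (index x s) \<le> Suc j" using le by (auto simp: skip_def)
      moreover have "affine_vertex r (skip k) (front j x) = front (Suc j) (simplical_face k x)"
        using affine_vertex_skip[OF f] front_face_low[of k j x] assms by simp
      ultimately show ?thesis
        using assms le True by (simp add: face_join[OF x] join_face[OF x refl])
    next
      case gt: False
      have "\<not> skip k (index x s) \<le> Suc j" using gt assms by (auto simp: skip_def)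
      moreover have "gs ! (skip k (index x s) - 1) = tuple_act r (skip k) gs ! (index x s - 1)"
        using gt assms ix by (auto simp: skip_def)
      ultimately show ?thesis
        using assms gt True by (simp add: face_join[OF x] join_face[OF x refl])
    qed
  next
    case False
    then show ?thesis using assms by (auto simp: face_join[OF x] join_face[OF x refl])
  qed
  then have "join (Suc j) \<tau> gs (simplical_face k x) = join j (simplex_act r (skip k) \<tau>) (tuple_act r (skip k) gs) x"
    if "x \<in> standard_simplex (Suc r)" for x using that by blast
  then show ?thesis using assms
    by (subst act_join_simplex) (auto simp: join_simplex_def intro!: restrict_ext)
qed

lemma face_join_high:
  assumes "j \<le> r" "j < k" "k \<le> Suc r"
  shows "simplex_act (Suc r) (skip (Suc k)) (join_simplex (Suc r) j \<tau> gs) =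
    join_simplex r j (simplex_act r (skip k) \<tau>) (tuple_act r (skip k) gs)"
proof -
  have "join j \<tau> gs (simplical_face (Suc k) x) s = join j (simplex_act r (skip k) \<tau>) (tuple_act r (skip k) gs) x s"
    if x: "x \<in> standard_simplex (Suc r)" for x s
  proof (cases "s \<in> {0..<1}")
    case True
    then have s: "0 \<le> s" "s < 1" by auto
    have ix: "index x s \<le> Suc r" using index_le[OF x s(2)] .
    show ?thesis
    proof (cases "index x s \<le> j")
      case le: True
      have f: "front j x \<in> standard_simplex j" using front_simplex[OF x breakpoint_positive[OF x s le]] .
      then have fr: "front j x \<in> standard_simplex r" using standard_simplex_mono[of j r] assms by auto
      have "skip (Suc k) (index x s) \<le> j" using le assms by (auto simp: skip_def)
      moreover have "affine_vertex r (skip k) (front j x) = front j (simplical_face (Suc k) x)"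
        using affine_vertex_skip[OF fr] simplical_face_beyond[OF f assms(2)] front_face_high[of j "Suc k" x] assms by simp
      ultimately show ?thesis
        using assms le True by (simp add: face_join[OF x] join_face[OF x refl])
    next
      case gt: False
      have "\<not> skip (Suc k) (index x s) \<le> j" using gt assms by (auto simp: skip_def)
      moreover have "gs ! (skip (Suc k) (index x s) - 1) = tuple_act r (skip k) gs ! (index x s - 1)"
        using gt assms ix by (auto simp: skip_def)
      ultimately show ?thesis
        using assms gt True by (simp add: face_join[OF x] join_face[OF x refl])
    qed
  next
    case False
    then show ?thesis using assms by (auto simp: face_join[OF x] join_face[OF x refl])
  qed
  then have "join j \<tau> gs (simplical_face (Suc k) x) = join j (simplex_act r (skip k) \<tau>) (tuple_act r (skip k) gs) x"
    if "x \<in> standard_simplex (Suc r)" for x using that by blast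
  then show ?thesis using assms
    by (subst act_join_simplex) (auto simp: join_simplex_def intro!: restrict_ext)
qed

text \<open>Consecutive joins share a wall: one has the vertex \<open>Suc j\<close> of
  \<open>\<tau>\<close> and the other the label \<open>gs ! j\<close> in position
  \<open>Suc j\<close>, and dropping that position leaves the same join.\<close>

lemma face_join_middle:
  assumes "Suc j \<le> q"
  shows "simplex_act q (skip (Suc j)) (join_simplex q (Suc j) \<tau> gs) = simplex_act q (skip (Suc j)) (join_simplex q j \<tau> gs)"
proof -
  have "join (Suc j) \<tau> gs (simplical_face (Suc j) x) s = join j \<tau> gs (simplical_face (Suc j) x) s"
    if x: "x \<in> standard_simplex q" for x s
  proof (cases "s \<in> {0..<1} \<and> index x s \<le> j")
    case True
    then have f: "front j x \<in> standard_simplex j" using front_simplex[OF x breakpoint_positive[OF x]] by auto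
    have "front (Suc j) (simplical_face (Suc j) x) = front j (simplical_face (Suc j) x)"
      using front_face_low[of "Suc j" j x] front_face_high[of j "Suc j" x] simplical_face_beyond[OF f, of "Suc j"] by simp
    then show ?thesis
      using assms True by (simp add: face_join[OF x] skip_def)
  next
    case False
    then have "s \<in> {0..<1} \<Longrightarrow> \<not> skip (Suc j) (index x s) \<le> Suc j" by (auto simp: skip_def)
    moreover from False have "s \<in> {0..<1} \<Longrightarrow> \<not> skip (Suc j) (index x s) \<le> j" by (auto simp: skip_def)
    ultimately show ?thesis using assms by (auto simp: face_join[OF x])
  qed
  then have "join (Suc j) \<tau> gs (simplical_face (Suc j) x) = join j \<tau> gs (simplical_face (Suc j) x)"
    if "x \<in> standard_simplex q" for x using that by blast
  then show ?thesis using assms by (simp add: act_join_simplex) (auto intro!: restrict_ext)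
qed

lemma face_join_first: "simplex_act q (skip 0) (join_simplex q 0 \<tau> gs) = straight_simplex q gs"
proof -
  have "join 0 \<tau> gs (simplical_face 0 x) s = straight gs x s" if x: "x \<in> standard_simplex q" for x s
    using face_join[OF x, of 0 0 \<tau> gs s] by (auto simp: skip_def straight_def)
  then have "join 0 \<tau> gs (simplical_face 0 x) = straight gs x" if "x \<in> standard_simplex q" for x
    using that by blast
  then show ?thesis by (subst act_join_simplex) (auto simp: straight_simplex_def intro!: restrict_ext)
qed

lemma face_join_last:
  assumes "singular_simplex q Etop \<tau>"
  shows "simplex_act q (skip (Suc q)) (join_simplex q q \<tau> gs) = \<tau>"
proof -
  have "join q \<tau> gs (simplical_face (Suc q) x) s = \<tau> x s" if x: "x \<in> standard_simplex q" for x s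
  proof -
    have "front q x = x" using breakpoint_last[OF x order_refl] x by (auto simp: front_def standard_simplex_def fun_eq_iff)
    then have "front q (simplical_face (Suc q) x) = x" using front_face_high[of q "Suc q" x] by simp
    moreover have "\<tau> x s = 0" if "s \<notin> {0..<1}" using singular_steps[OF assms x] that steps_outside by blast
    moreover have "skip (Suc q) (index x s) \<le> q" if "s < 1" using index_le[OF x that] by (simp add: skip_def)
    ultimately show ?thesis using face_join[OF x, of "Suc q" q \<tau> gs s] by auto
  qed
  then have "join q \<tau> gs (simplical_face (Suc q) x) = \<tau> x" if "x \<in> standard_simplex q" for x
    using that by blast
  then have "restrict (\<lambda>x. join q \<tau> gs (simplical_face (Suc q) x)) (standard_simplex q) = restrict \<tau> (standard_simplex q)"
    by (rule restrict_ext)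
  also have "\<dots> = \<tau>" using assms by (simp add: singular_simplex_def extensional_restrict)
  finally show ?thesis by (simp add: act_join_simplex)
qed

lemma join_gact:
  assumes t: "singular_simplex q Etop \<tau>" and gs: "length gs = Suc q" and i: "i \<le> q"
  shows "join_simplex q i (gact_simplex q h \<tau>) (shift h gs) = gact_simplex (Suc q) h (join_simplex q i \<tau> gs)"
proof -
  have "join i (gact_simplex q h \<tau>) (shift h gs) x s = gact h (join i \<tau> gs x) s" if x: "x \<in> standard_simplex (Suc q)" for x s
  proof (cases "s \<in> {0..<1} \<and> index x s \<le> i")
    case True
    then have "front i x \<in> standard_simplex q"
      using front_simplex[OF x breakpoint_positive[OF x]] standard_simplex_mono[OF i] by auto
    then show ?thesis using True by (simp add: join_eval[OF x] gact_def gact_simplex_def)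
  next
    case False
    have "s \<in> {0..<1} \<Longrightarrow> index x s \<le> Suc q" using index_le[OF x] by simp
    then show ?thesis using False gs by (auto simp: join_eval[OF x] gact_def)
  qed
  then have "join i (gact_simplex q h \<tau>) (shift h gs) x = gact h (join i \<tau> gs x)" if "x \<in> standard_simplex (Suc q)" for x
    using that by blast
  then show ?thesis by (auto simp: join_simplex_def gact_simplex_def[of "Suc q"] restrict_def)
qed

text \<open>\<open>D k i\<close> stands for face \<open>k\<close> of prism \<open>i\<close>, and
  \<open>E i k\<close> for prism \<open>i\<close> over face \<open>k\<close> of the base. Faces with
  \<open>k < i\<close> or \<open>Suc i < k\<close> make up the sum over \<open>E\<close>; those with
  \<open>k = i\<close> and \<open>k = Suc i\<close> have opposite signs and telescope through
  \<open>mid\<close>.\<close>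

lemma prism_sum:
  fixes D E :: "nat \<Rightarrow> nat \<Rightarrow> rat"
  assumes low: "\<And>k j. k \<le> j \<Longrightarrow> Suc j \<le> q \<Longrightarrow> D k (Suc j) = E j k"
    and high: "\<And>k j. j < k \<Longrightarrow> k \<le> q \<Longrightarrow> D (Suc k) j = E j k"
    and mid: "\<And>j. Suc j \<le> q \<Longrightarrow> D (Suc j) (Suc j) = D (Suc j) j"
  shows "(\<Sum>i\<le>q. (-1) ^ i * (\<Sum>k\<le>Suc q. (-1) ^ k * D k i)) =
    D 0 0 - D (Suc q) q - (\<Sum>k\<le>q. (-1) ^ k * (\<Sum>i<q. (-1) ^ i * E i k))"
proof -
  let ?g = "\<lambda>(i, k). (-1) ^ i * ((-1) ^ k * D k i)"
  let ?f = "\<lambda>(i, k). (-1) ^ i * ((-1) ^ k * E i k)"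
  let ?L = "{(i, k). i \<le> q \<and> k < i}" and ?H = "{(i, k). i \<le> q \<and> k \<le> Suc q \<and> Suc i < k}"
    and ?M = "{(i, k). i \<le> q \<and> k = i}" and ?N = "{(i, k). i \<le> q \<and> k = Suc i}"
  let ?A = "{(i, k). i < q \<and> k \<le> i}" and ?B = "{(i, k). i < q \<and> k \<le> q \<and> i < k}"
  have fin: "finite ({..q} \<times> {..Suc q})" by simp
  have fL: "finite ?L" "finite ?H" "finite ?M" "finite ?N" by (auto intro: finite_subset[OF _ fin])
  have fA: "finite ?A" "finite ?B" by (auto intro: finite_subset[OF _ fin])
  have "(\<Sum>i\<le>q. (-1) ^ i * (\<Sum>k\<le>Suc q. (-1) ^ k * D k i)) = sum ?g ({..q} \<times> {..Suc q})"
    by (simp only: sum.cartesian_product sum_distrib_left)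
  also have "{..q} \<times> {..Suc q} = (?L \<union> ?H) \<union> (?M \<union> ?N)" by auto
  also have "sum ?g ((?L \<union> ?H) \<union> (?M \<union> ?N)) = sum ?g (?L \<union> ?H) + sum ?g (?M \<union> ?N)"
    by (rule sum.union_disjoint[OF finite_UnI[OF fL(1,2)] finite_UnI[OF fL(3,4)]]) auto
  also have "sum ?g (?L \<union> ?H) = sum ?g ?L + sum ?g ?H"
    by (rule sum.union_disjoint[OF fL(1,2)]) auto
  also have "sum ?g (?M \<union> ?N) = sum ?g ?M + sum ?g ?N"
    by (rule sum.union_disjoint[OF fL(3,4)]) auto
  also have "sum ?g ?L = - sum ?f ?A"
    unfolding sum_negf[symmetric]
  proof (rule sum.reindex_bij_witness[of _ "\<lambda>(i, k). (Suc i, k)" "\<lambda>(i, k). (i - 1, k)"], goal_cases)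
    case (5 a)
    then obtain i k where a: "a = (i, k)" "i \<le> q" "k < i" by auto
    then obtain j where "i = Suc j" by (cases i) auto
    then show ?case using a low[of k j] by simp
  qed auto
  also have "sum ?g ?H = - sum ?f ?B"
    unfolding sum_negf[symmetric]
  proof (rule sum.reindex_bij_witness[of _ "\<lambda>(i, k). (i, Suc k)" "\<lambda>(i, k). (i, k - 1)"], goal_cases)
    case (5 a)
    then obtain i k where a: "a = (i, k)" "i \<le> q" "k \<le> Suc q" "Suc i < k" by auto
    then obtain j where "k = Suc j" by (cases k) auto
    then show ?case using a high[of i j] by simp
  qed auto
  also have "sum ?g ?M = (\<Sum>i\<le>q. D i i)"
    by (rule sum.reindex_bij_witness[of _ "\<lambda>i. (i, i)" fst]) (auto simp flip: power_add mult_2)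
  also have "sum ?g ?N = - (\<Sum>i\<le>q. D (Suc i) i)"
    unfolding sum_negf[symmetric]
    by (rule sum.reindex_bij_witness[of _ "\<lambda>i. (i, Suc i)" fst]) (auto simp flip: power_add mult_2 mult.assoc)
  finally have 1: "(\<Sum>i\<le>q. (-1) ^ i * (\<Sum>k\<le>Suc q. (-1) ^ k * D k i)) =
     - sum ?f ?A + - sum ?f ?B + ((\<Sum>i\<le>q. D i i) + - (\<Sum>i\<le>q. D (Suc i) i))" .
  have "(\<Sum>k\<le>q. (-1) ^ k * (\<Sum>i<q. (-1) ^ i * E i k)) = (\<Sum>k\<le>q. \<Sum>i<q. (-1) ^ i * ((-1) ^ k * E i k))"
    unfolding sum_distrib_left by (intro sum.cong refl) (rule mult.left_commute)
  also have "\<dots> = (\<Sum>i<q. \<Sum>k\<le>q. (-1) ^ i * ((-1) ^ k * E i k))" by (rule sum.swap)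
  also have "\<dots> = sum ?f ({..<q} \<times> {..q})" by (simp only: sum.cartesian_product)
  also have "{..<q} \<times> {..q} = ?A \<union> ?B" by auto
  also have "sum ?f (?A \<union> ?B) = sum ?f ?A + sum ?f ?B"
    by (rule sum.union_disjoint[OF fA]) auto
  finally have 2: "(\<Sum>k\<le>q. (-1) ^ k * (\<Sum>i<q. (-1) ^ i * E i k)) = sum ?f ?A + sum ?f ?B" .
  have "(\<Sum>i\<le>q. D i i) - (\<Sum>i\<le>q. D (Suc i) i) = D 0 0 - D (Suc q) q"
    using mid
  proof (induction q)
    case (Suc q)
    have "D (Suc q) (Suc q) = D (Suc q) q" by (rule Suc.prems) simp
    moreover have "(\<Sum>i\<le>q. D i i) - (\<Sum>i\<le>q. D (Suc i) i) = D 0 0 - D (Suc q) q"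
      by (rule Suc.IH) (rule Suc.prems, simp)
    ultimately show ?case by simp
  qed simp
  then show ?thesis using 1 2 by simp
qed

section \<open>Comparison of singular cochains of an orbit space with invariant group
  cochains\<close>

locale orbit_quotient =
  fixes H :: "'g::{group_add,countable} set"
  assumes subgrp: "subgrp H"
begin

abbreviation "X \<equiv> orbit_space H"
abbreviation push :: "nat \<Rightarrow> ((nat \<Rightarrow> real) \<Rightarrow> real \<Rightarrow> 'g) \<Rightarrow> (nat \<Rightarrow> real) \<Rightarrow> nat \<Rightarrow> real" where
  "push q \<tau> \<equiv> simplex_map q (proj H) \<tau>"

sublocale G: group_cochains H by unfold_locales (rule subgrp)
sublocale S: simplicial "sing X" simplex_act "{}" by (rule simplicial_sing)

lemma push_singular: "singular_simplex q Etop \<tau> \<Longrightarrow> singular_simplex q X (push q \<tau>)"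
  using singular_simplex_simplex_map continuous_proj by blast

lemma push_act: "singular_simplex n Etop \<tau> \<Longrightarrow> vertex_map m n \<theta> \<Longrightarrow> push m (simplex_act m \<theta> \<tau>) = simplex_act m \<theta> (push n \<tau>)"
  using affine_vertex_simplex[of _ m \<theta> n] by (auto simp: simplex_map_def simplex_act_eq vertex_map_def restrict_def)

lemma push_gact: "h \<in> H \<Longrightarrow> push q (gact_simplex q h \<tau>) = push q \<tau>"
  using proj_gact[OF subgrp] by (auto simp: simplex_map_def gact_simplex_def restrict_def)

definition lift :: "nat \<Rightarrow> ((nat \<Rightarrow> real) \<Rightarrow> nat \<Rightarrow> real) \<Rightarrow> (nat \<Rightarrow> real) \<Rightarrow> real \<Rightarrow> 'g" where
  "lift q \<sigma> = (SOME \<tau>. singular_simplex q Etop \<tau> \<and> push q \<tau> = \<sigma>)"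

lemma lift:
  assumes "singular_simplex q X \<sigma>"
  shows "singular_simplex q Etop (lift q \<sigma>)" "push q (lift q \<sigma>) = \<sigma>"
proof -
  have "\<exists>\<tau>. singular_simplex q Etop \<tau> \<and> push q \<tau> = \<sigma>" using lift_exists[OF subgrp assms] by metis
  from someI_ex[OF this] show "singular_simplex q Etop (lift q \<sigma>)" "push q (lift q \<sigma>) = \<sigma>"
    by (auto simp: lift_def)
qed

lemma lift_push:
  assumes t: "singular_simplex q Etop \<tau>"
  obtains h where "h \<in> H" "lift q (push q \<tau>) = gact_simplex q h \<tau>"
proof -
  note l = lift[OF push_singular[OF t]]
  obtain h where h: "h \<in> H" "\<And>x. x \<in> standard_simplex q \<Longrightarrow> lift q (push q \<tau>) x = gact h (\<tau> x)"
    using lift_unique_up_to_action[OF subgrp t l(1)] l(2) by metis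
  have "lift q (push q \<tau>) = gact_simplex q h \<tau>"
    using h(2) l(1) by (auto simp: gact_simplex_def singular_simplex_def extensional_def restrict_def fun_eq_iff[of _ "\<lambda>x. if _ x then _ x else _ x"])
  then show ?thesis using that h by blast
qed

text \<open>Pullback along the simplicial map sending a tuple to its straight simplex, hence
  multiplicative.\<close>

definition to_group :: "(nat \<Rightarrow> ((nat \<Rightarrow> real) \<Rightarrow> nat \<Rightarrow> real) \<Rightarrow> rat) \<Rightarrow> nat \<Rightarrow> 'g list \<Rightarrow> rat" where
  "to_group c = (\<lambda>q gs. if length gs = Suc q then c q (push q (straight_simplex q gs)) else 0)"

text \<open>Two lifts of a simplex differ by an element of \<open>H\<close>, so for invariant
  cochains the labels of any lift give the same value.\<close>

definition from_group :: "(nat \<Rightarrow> 'g list \<Rightarrow> rat) \<Rightarrow> nat \<Rightarrow> ((nat \<Rightarrow> real) \<Rightarrow> nat \<Rightarrow> real) \<Rightarrow> rat" where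
  "from_group a = (\<lambda>q \<sigma>. if singular_simplex q X \<sigma> then a q (vert q (lift q \<sigma>)) else 0)"

lemma from_group_push:
  assumes a: "a \<in> ipart H p" and t: "singular_simplex q Etop \<tau>"
  shows "from_group a q (push q \<tau>) = a q (vert q \<tau>)"
proof -
  obtain h where h: "h \<in> H" "lift q (push q \<tau>) = gact_simplex q h \<tau>" using lift_push[OF t] .
  have "a q (shift h (vert q \<tau>)) = a q (vert q \<tau>)"
    using G.invariant[OF a, of "shift h" "vert q \<tau>" q] h(1) by (simp add: tuples_def)
  then show ?thesis using h push_singular[OF t] by (simp add: from_group_def vert_gact)
qed

lemma to_group_part:
  assumes c: "c \<in> ss_part (sing X) {} p"
  shows "to_group c \<in> ipart H p"
  unfolding ss_part_def
proof (intro CollectI conjI allI impI ballI)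
  fix q s assume "to_group c q s \<noteq> 0"
  then show "int q = p" "s \<in> tuples q" using c by (auto simp: to_group_def tuples_def ss_part_def split: if_splits)
next
  fix \<tau> q and s :: "'g list" assume "\<tau> \<in> shifts H" "s \<in> tuples q"
  then show "to_group c q (\<tau> s) = to_group c q s"
    by (auto simp: to_group_def tuples_def straight_shift push_gact simp del: map_map)
qed

lemma from_group_part:
  assumes a: "a \<in> ipart H p"
  shows "from_group a \<in> ss_part (sing X) {} p"
  using a by (auto simp: ss_part_def from_group_def split: if_splits)

lemma to_group_diff: "to_group (ss_diff (sing X) simplex_act c) = gdiff (to_group c)"
proof (intro ext)
  fix q and s :: "'g list"
  show "to_group (ss_diff (sing X) simplex_act c) q s = gdiff (to_group c) q s"
  proof (cases "\<exists>r. q = Suc r \<and> length s = Suc q")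
    case True
    then obtain r where r: "q = Suc r" and s: "length s = Suc (Suc r)" by auto
    then show ?thesis
      using push_singular[OF singular_straight, of q s]
      by (simp add: to_group_def ss_diff_def tuples_def straight_simplex_act[OF vertex_map_skip s]
          push_act[OF singular_straight vertex_map_skip] del: sum.atMost_Suc)
  next
    case False
    then show ?thesis by (cases q) (auto simp: to_group_def ss_diff_def tuples_def)
  qed
qed

lemma to_group_cup: "to_group (ss_cup (sing X) simplex_act c d) = to_group c \<smile> to_group d"
proof (intro ext)
  fix q and s :: "'g list"
  show "to_group (ss_cup (sing X) simplex_act c d) q s = (to_group c \<smile> to_group d) q s"
  proof (cases "length s = Suc q")
    case s: True
    then show ?thesis
      using push_singular[OF singular_straight, of q s]
      by (auto simp: to_group_def ss_cup_def tuples_def straight_simplex_act[OF vertex_map_id s]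
          straight_simplex_act[OF vertex_map_shift s] push_act[OF singular_straight vertex_map_id]
          push_act[OF singular_straight vertex_map_shift] intro!: sum.cong)
  qed (simp add: to_group_def ss_cup_def tuples_def)
qed

lemma from_group_diff:
  assumes a: "a \<in> ipart H p"
  shows "from_group (gdiff a) = ss_diff (sing X) simplex_act (from_group a)"
proof (intro ext)
  fix q \<sigma>
  show "from_group (gdiff a) q \<sigma> = ss_diff (sing X) simplex_act (from_group a) q \<sigma>"
  proof (cases "\<exists>r. q = Suc r \<and> singular_simplex q X \<sigma>")
    case True
    then obtain r where r: "q = Suc r" and s: "singular_simplex q X \<sigma>" by auto
    note l = lift[OF s]
    have "from_group a r (simplex_act r (skip k) \<sigma>) = a r (tuple_act r (skip k) (vert q (lift q \<sigma>)))" for k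
    proof -
      have t: "singular_simplex r Etop (simplex_act r (skip k) (lift q \<sigma>))"
        using simplex_act_singular[OF l(1), of "skip k" r] vertex_map_skip[of r k] by (simp add: r vertex_map_def)
      have "simplex_act r (skip k) \<sigma> = push r (simplex_act r (skip k) (lift q \<sigma>))"
        using push_act[OF l(1), of r "skip k"] l(2) vertex_map_skip by (simp add: r)
      then show ?thesis using from_group_push[OF a t] vert_act[OF vertex_map_skip[of r k], of "lift q \<sigma>"] by (simp add: r)
    qed
    moreover have "from_group (gdiff a) q \<sigma> = gdiff a q (vert q (lift q \<sigma>))"
      using s by (simp only: from_group_def if_True)
    ultimately show ?thesis using s r by (simp add: ss_diff_def tuples_def del: sum.atMost_Suc)
  next
    case False
    then show ?thesis by (cases q) (auto simp: from_group_def ss_diff_def)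
  qed
qed

lemma to_from_group: "a \<in> ipart H p \<Longrightarrow> to_group (from_group a) = a"
proof (intro ext)
  fix q and s :: "'g list" assume a: "a \<in> ipart H p"
  show "to_group (from_group a) q s = a q s"
  proof (cases "length s = Suc q")
    case True
    then show ?thesis using from_group_push[OF a singular_straight, of q s] by (simp add: to_group_def vert_straight)
  next
    case False
    then show ?thesis using G.support[OF a] by (simp add: to_group_def tuples_def)
  qed
qed

text \<open>The dual of the prism operator for the homotopy, through joins, from a simplex to the
  straight simplex with the same vertex labels; by equivariance of joins it is independent of the
  lift for any cochain.\<close>

definition prism :: "(nat \<Rightarrow> ((nat \<Rightarrow> real) \<Rightarrow> nat \<Rightarrow> real) \<Rightarrow> rat) \<Rightarrow> nat \<Rightarrow> ((nat \<Rightarrow> real) \<Rightarrow> nat \<Rightarrow> real) \<Rightarrow> rat" where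
  "prism c = (\<lambda>q \<sigma>. if singular_simplex q X \<sigma> then
     \<Sum>i\<le>q. (-1) ^ i * c (Suc q) (push (Suc q) (join_simplex q i (lift q \<sigma>) (vert q (lift q \<sigma>)))) else 0)"

lemma prism_push:
  assumes t: "singular_simplex q Etop \<tau>"
  shows "prism c q (push q \<tau>) = (\<Sum>i\<le>q. (-1) ^ i * c (Suc q) (push (Suc q) (join_simplex q i \<tau> (vert q \<tau>))))"
proof -
  obtain h where h: "h \<in> H" "lift q (push q \<tau>) = gact_simplex q h \<tau>" using lift_push[OF t] .
  then show ?thesis using push_singular[OF t]
    by (simp add: prism_def vert_gact join_gact[OF t] push_gact del: map_map)
qed

lemma prism_part:
  assumes "c \<in> ss_part (sing X) {} p"
  shows "prism c \<in> ss_part (sing X) {} (p - 1)"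
  unfolding ss_part_def
proof (intro CollectI conjI allI impI ballI)
  fix q \<sigma> assume nz: "prism c q \<sigma> \<noteq> 0"
  then show "singular_simplex q X \<sigma>" by (auto simp: prism_def split: if_splits)
  have "\<exists>i. c (Suc q) (push (Suc q) (join_simplex q i (lift q \<sigma>) (vert q (lift q \<sigma>)))) \<noteq> 0"
  proof (rule ccontr)
    assume "\<not> ?thesis"
    then show False using nz by (simp add: prism_def split: if_splits)
  qed
  then obtain i where "c (Suc q) (push (Suc q) (join_simplex q i (lift q \<sigma>) (vert q (lift q \<sigma>)))) \<noteq> 0" ..
  then have "int (Suc q) = p" using assms unfolding ss_part_def by blast
  then show "int q = p - 1" by simp
qed auto

text \<open>A cocycle vanishes on the boundary of each prism; summing over the prisms leaves the
  straight end, the original simplex and the prisms over the faces.\<close>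

lemma prism_homotopy:
  assumes c: "c \<in> ss_part (sing X) {} p" "ss_diff (sing X) simplex_act c = 0"
  shows "from_group (to_group c) - c = ss_diff (sing X) simplex_act (prism c)"
proof (intro ext)
  fix q \<sigma>
  show "(from_group (to_group c) - c) q \<sigma> = ss_diff (sing X) simplex_act (prism c) q \<sigma>"
  proof (cases "singular_simplex q X \<sigma>")
    case False
    then show ?thesis using S.support[OF c(1), of q \<sigma>] by (auto simp: from_group_def ss_diff_def)
  next
    case True
    define \<tau> where "\<tau> = lift q \<sigma>"
    have t: "singular_simplex q Etop \<tau>" "push q \<tau> = \<sigma>" using lift[OF True] by (simp_all add: \<tau>_def)
    define gs where "gs = vert q \<tau>"
    define J where "J i = join_simplex q i \<tau> gs" for i
    have J: "singular_simplex (Suc q) Etop (J i)" if "i \<le> q" for i using singular_join[OF t(1) that] by (simp add: J_def)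
    define D where "D k i = c q (push q (simplex_act q (skip k) (J i)))" for k i
    \<comment> \<open>For \<open>q = 0\<close> the truncated \<open>q - 1\<close> is harmless: the
      sums over \<open>i < q\<close> are empty and the face relations have no instances.\<close>
    define E where "E i k = c q (push q (join_simplex (q - 1) i (simplex_act (q - 1) (skip k) \<tau>) (tuple_act (q - 1) (skip k) gs)))" for i k
    have z: "(\<Sum>k\<le>Suc q. (-1) ^ k * D k i) = 0" if "i \<le> q" for i
    proof -
      have "ss_diff (sing X) simplex_act c (Suc q) (push (Suc q) (J i)) = 0" by (simp add: c(2))
      moreover have "push q (simplex_act q (skip k) (J i)) = simplex_act q (skip k) (push (Suc q) (J i))" for k
        using push_act[OF J[OF that] vertex_map_skip] .
      ultimately show ?thesis
        using push_singular[OF J[OF that]] by (simp add: ss_diff_def D_def del: sum.atMost_Suc)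
    qed
    have low: "D k (Suc j) = E j k" if "k \<le> j" "Suc j \<le> q" for k j
      using face_join_low[OF that(1), of "q - 1" \<tau> gs] that by (cases q) (auto simp: D_def E_def J_def)
    have high: "D (Suc k) j = E j k" if "j < k" "k \<le> q" for k j
      using face_join_high[of j "q - 1" k \<tau> gs] that by (cases q) (auto simp: D_def E_def J_def)
    have mid: "D (Suc j) (Suc j) = D (Suc j) j" if "Suc j \<le> q" for j
      using face_join_middle[OF that, of \<tau> gs] by (simp add: D_def J_def)
    have "0 = D 0 0 - D (Suc q) q - (\<Sum>k\<le>q. (-1) ^ k * (\<Sum>i<q. (-1) ^ i * E i k))"
      using prism_sum[of q D E, OF low high mid] z by simp
    moreover have "D 0 0 = from_group (to_group c) q \<sigma>"
      using face_join_first[of q \<tau> gs] True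
      by (simp add: D_def J_def from_group_def to_group_def gs_def \<tau>_def)
    moreover have "D (Suc q) q = c q \<sigma>" using face_join_last[OF t(1), of gs] t(2) by (simp add: D_def J_def)
    moreover have "(\<Sum>k\<le>q. (-1) ^ k * (\<Sum>i<q. (-1) ^ i * E i k)) = ss_diff (sing X) simplex_act (prism c) q \<sigma>"
    proof (cases q)
      case 0
      then show ?thesis by (simp add: ss_diff_def)
    next
      case (Suc r)
      have "prism c r (simplex_act r (skip k) \<sigma>) = (\<Sum>i<q. (-1) ^ i * E i k)" for k
      proof -
        have t': "singular_simplex r Etop (simplex_act r (skip k) \<tau>)"
          using simplex_act_singular[OF t(1), of "skip k" r] vertex_map_skip[of r k] by (simp add: Suc vertex_map_def)
        have "simplex_act r (skip k) \<sigma> = push r (simplex_act r (skip k) \<tau>)"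
          using push_act[OF t(1), of r "skip k"] t(2) vertex_map_skip by (simp add: Suc)
        moreover have "vert r (simplex_act r (skip k) \<tau>) = tuple_act r (skip k) gs"
          using vert_act[OF vertex_map_skip[of r k], of \<tau>] by (simp add: Suc gs_def)
        ultimately show ?thesis using prism_push[OF t'] by (simp add: Suc E_def lessThan_Suc_atMost)
      qed
      then show ?thesis using True by (simp add: Suc ss_diff_def del: sum.atMost_Suc)
    qed
    ultimately show ?thesis by simp
  qed
qed

text \<open>\<open>to_group\<close> is the multiplicative side of the transfer and
  \<open>from_group\<close> its right inverse; \<open>prism\<close> provides the homotopy on
  cocycles.\<close>

theorem duality_orbit_space:
  assumes "duality (inv_cochains H) n I"
  shows "duality (singular_cochains X) n (\<lambda>c. I (to_group c))"
proof (rule duality_transfer[where C = "inv_cochains H" and F = to_group and G = from_group and I = I])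
  show "cochain_dga (singular_cochains X)" by (simp add: singular_cochains_eq S.cochain_dga)
  show "cochain_dga (inv_cochains H)" by (simp add: inv_cochains_def G.cochain_dga)
  show "linop to_group" by (intro linop_I) (auto simp: to_group_def fun_eq_iff)
  show "linop from_group" by (intro linop_I) (auto simp: from_group_def fun_eq_iff)
  fix p a assume "a \<in> cocycles (singular_cochains X) p"
  then have a: "a \<in> ss_part (sing X) {} p" "ss_diff (sing X) simplex_act a = 0"
    by (auto simp: singular_cochains_eq cocycles_def)
  show "from_group (to_group a) - a \<in> coboundaries (singular_cochains X) p"
    unfolding prism_homotopy[OF a] using prism_part[OF a(1)] by (auto simp: singular_cochains_eq coboundaries_def)
next
  show "duality (inv_cochains H) n I" by (rule assms)
qed (simp_all add: singular_cochains_eq inv_cochains_def to_group_part from_group_part to_group_diff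
    to_group_cup from_group_diff to_from_group)

theorem rational_PD_orbit_space:
  assumes d: "duality (inv_cochains H) (int n) I"
  shows "rational_PD_space n X"
proof -
  have d': "duality (singular_cochains X) (int n) (\<lambda>c. I (to_group c))" using duality_orbit_space[OF d] .
  interpret C: cochain_algebra "singular_cochains X" by unfold_locales (simp add: singular_cochains_eq S.cochain_dga)
  obtain e where e: "e \<in> G.Zc (int n)" "I e = 1" using G.duality_top(1)[OF d] by blast
  have "coh_one_dimensional (singular_cochains X) (int n)"
  proof (rule C.one_dimensional)
    show "functional (\<lambda>c. I (to_group c))" "\<And>b. b \<in> C.B (int n) \<Longrightarrow> I (to_group b) = 0"
      using d' by (auto simp: duality_def)
    have ep: "e \<in> ipart H (int n)" using e G.Zc_iff by blast
    show "I (to_group (from_group e)) = 1" using to_from_group[OF ep] e by simp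
    have "gdiff e = 0" using e(1) G.Zc_iff by blast
    moreover have "from_group 0 = 0" by (simp add: from_group_def fun_eq_iff)
    ultimately show "from_group e \<in> C.Z (int n)"
      using from_group_part[OF ep] from_group_diff[OF ep] by (simp add: singular_cochains_eq S.Z_iff)
  next
    fix b assume b: "b \<in> C.Z (int n)" "I (to_group b) = 0"
    then have bp: "b \<in> ss_part (sing X) {} (int n)" "ss_diff (sing X) simplex_act b = 0"
      by (auto simp: singular_cochains_eq cocycles_def)
    have "to_group b \<in> G.Zc (int n)"
    proof -
      have "to_group 0 = 0" by (simp add: to_group_def fun_eq_iff)
      then show ?thesis using to_group_part[OF bp(1)] to_group_diff[of b] bp(2) by (simp add: G.Zc_iff)
    qed
    then have "to_group b \<in> G.Bc (int n)" using G.duality_top(2)[OF d] b by blast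
    then obtain a where a: "a \<in> ipart H (int n - 1)" "to_group b = gdiff a" by (auto simp: G.Bc_iff)
    have "from_group (to_group b) = ss_diff (sing X) simplex_act (from_group a)" using from_group_diff[OF a(1)] a(2) by simp
    moreover have "ss_diff (sing X) simplex_act (from_group a - prism b) =
        ss_diff (sing X) simplex_act (from_group a) - ss_diff (sing X) simplex_act (prism b)"
      using S.d_simps(3) by simp
    ultimately have "b = ss_diff (sing X) simplex_act (from_group a - prism b)"
      using prism_homotopy[OF bp] by (simp add: diff_eq_eq add.commute eq_diff_eq)
    moreover have "from_group a - prism b \<in> ss_part (sing X) {} (int n - 1)"
      using from_group_part[OF a(1)] prism_part[OF bp(1)] fs.subspace_diff[OF S.part_subspace] by simp
    ultimately show "b \<in> C.B (int n)" by (auto simp: singular_cochains_eq S.B_iff)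
  qed
  then show ?thesis using C.pairing_nondegenerate[OF d'] by (simp add: rational_PD_space_def)
qed

end

section \<open>Polynomials\<close>

abbreviation mono :: "(nat \<Rightarrow>\<^sub>0 nat) \<Rightarrow> rat \<Rightarrow> rpoly" where
  "mono \<equiv> Poly_Mapping.single"

abbreviation ev :: "nat \<Rightarrow> nat \<Rightarrow>\<^sub>0 nat" where
  "ev i \<equiv> Poly_Mapping.single i 1"

abbreviation lkp :: "('a \<Rightarrow>\<^sub>0 'b::zero) \<Rightarrow> 'a \<Rightarrow> 'b" where
  "lkp \<equiv> Poly_Mapping.lookup"

text \<open>The common shape of derivative, substitution and evaluation, which sum over the
  monomials actually present. Linearity is proved once, by enlarging the range of summation.\<close>

definition linear_extension :: "((nat \<Rightarrow>\<^sub>0 nat) \<Rightarrow> rat \<Rightarrow> 'a::comm_monoid_add) \<Rightarrow> rpoly \<Rightarrow> 'a" where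
  "linear_extension F P = (\<Sum>m\<in>Poly_Mapping.keys P. F m (lkp P m))"

lemma linear_extension_superset:
  assumes "\<And>m. F m 0 = 0" "finite S" "Poly_Mapping.keys P \<subseteq> S"
  shows "linear_extension F P = (\<Sum>m\<in>S. F m (lkp P m))"
  unfolding linear_extension_def
  by (rule sum.mono_neutral_left) (use assms in \<open>auto simp: in_keys_iff\<close>)

lemma linear_extension_add:
  assumes F: "\<And>m. F m 0 = 0" "\<And>m a b. F m (a + b) = F m a + F m b"
  shows "linear_extension F (P + Q) = linear_extension F P + linear_extension F Q"
proof -
  let ?S = "Poly_Mapping.keys P \<union> Poly_Mapping.keys Q"
  have fin: "finite ?S" by simp
  have "linear_extension F R = (\<Sum>m\<in>?S. F m (lkp R m))" if "Poly_Mapping.keys R \<subseteq> ?S" for R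
    by (rule linear_extension_superset) (use F(1) fin that in auto)
  then show ?thesis using keys_add[of P Q] by (simp add: lookup_add F(2) sum.distrib)
qed

lemma linear_extension_single: "F m 0 = 0 \<Longrightarrow> linear_extension F (mono m c) = F m c"
  by (cases "c = 0") (simp_all add: linear_extension_def)

lemma linear_extension_0 [simp]: "linear_extension F 0 = 0"
  by (simp add: linear_extension_def)

lemma rpoly_sum_mono: "P = (\<Sum>m\<in>Poly_Mapping.keys P. mono m (lkp P m))"
proof (rule poly_mapping_eqI)
  fix k
  have "lkp (\<Sum>m\<in>Poly_Mapping.keys P. mono m (lkp P m)) k = (\<Sum>m\<in>Poly_Mapping.keys P. if m = k then lkp P m else 0)"
    by (simp add: lookup_sum lookup_single when_def)
  also have "\<dots> = lkp P k" by (simp add: in_keys_iff)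
  finally show "lkp P k = lkp (\<Sum>m\<in>Poly_Mapping.keys P. mono m (lkp P m)) k" by simp
qed

definition pvars :: "nat set \<Rightarrow> rpoly set" where
  "pvars V = {P. \<forall>m\<in>Poly_Mapping.keys P. Poly_Mapping.keys m \<subseteq> V}"

lemma pvars_UNIV [simp]: "P \<in> pvars UNIV"
  by (simp add: pvars_def)

lemma rpoly_add_induct [consumes 1, case_names add mono]:
  assumes P: "P \<in> pvars V"
    and add: "\<And>p q. p \<in> pvars V \<Longrightarrow> q \<in> pvars V \<Longrightarrow> A p \<Longrightarrow> A q \<Longrightarrow> A (p + q)"
    and mono: "\<And>m c. Poly_Mapping.keys m \<subseteq> V \<Longrightarrow> A (mono m c)"
  shows "A P"
proof -
  have zero: "A 0" using mono[of 0 0] by simp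
  have "A (\<Sum>m\<in>S. mono m (lkp P m)) \<and> (\<Sum>m\<in>S. mono m (lkp P m)) \<in> pvars V" if "finite S" "S \<subseteq> Poly_Mapping.keys P" for S
    using that
  proof (induction S rule: finite_induct)
    case empty
    then show ?case using zero by (simp add: pvars_def)
  next
    case (insert m S)
    have m: "Poly_Mapping.keys m \<subseteq> V" using insert P by (auto simp: pvars_def)
    have mv: "mono m (lkp P m) \<in> pvars V" using m by (auto simp: pvars_def split: if_splits)
    let ?Q = "\<Sum>m\<in>S. mono m (lkp P m)"
    have IH: "A ?Q" "?Q \<in> pvars V" using insert by auto
    have "mono m (lkp P m) + ?Q \<in> pvars V"
      using mv IH(2) keys_add[of "mono m (lkp P m)" ?Q] unfolding pvars_def by blast
    then show ?case using add[OF mv IH(2) mono[OF m] IH(1)] insert by simp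
  qed
  then show ?thesis using rpoly_sum_mono[of P] by (metis finite_keys order_refl)
qed

lemma monomial_induct [consumes 1, case_names zero step]:
  fixes m :: "nat \<Rightarrow>\<^sub>0 nat"
  assumes "Poly_Mapping.keys m \<subseteq> V" and zero: "A 0"
    and step: "\<And>m i. i \<in> V \<Longrightarrow> Poly_Mapping.keys m \<subseteq> V \<Longrightarrow> A m \<Longrightarrow> A (ev i + m)"
  shows "A m"
  using assms(1)
proof (induction "\<Sum>i\<in>Poly_Mapping.keys m. lkp m i" arbitrary: m rule: less_induct)
  case (less m)
  show ?case
  proof (cases "m = 0")
    case False
    then obtain i where i: "i \<in> Poly_Mapping.keys m" by (metis keys_eq_empty ex_in_conv)
    define m' where "m' = m - ev i"
    have l: "0 < lkp m i" using i by (simp add: in_keys_iff)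
    have m: "m = ev i + m'"
      by (rule poly_mapping_eqI) (use l in \<open>auto simp: m'_def lookup_add lookup_minus lookup_single when_def\<close>)
    have sub: "Poly_Mapping.keys m' \<subseteq> Poly_Mapping.keys m"
      by (auto simp: m'_def in_keys_iff lookup_minus)
    have "(\<Sum>j\<in>Poly_Mapping.keys m'. lkp m' j) = (\<Sum>j\<in>Poly_Mapping.keys m. lkp m' j)"
      by (rule sum.mono_neutral_left) (use sub in \<open>auto simp: in_keys_iff\<close>)
    also have "\<dots> < (\<Sum>j\<in>Poly_Mapping.keys m. lkp m j)"
      by (rule sum_strict_mono_ex1) (use i l in \<open>auto simp: m'_def lookup_minus lookup_single when_def intro!: bexI[of _ i]\<close>)
    finally have "A m'" using less sub by blast
    moreover have "Poly_Mapping.keys m' \<subseteq> V" "i \<in> V" using less.prems sub i by auto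
    ultimately show ?thesis using step m by metis
  qed (use zero in simp)
qed

lemma mono_ev_add: "mono (ev i + m) c = poly_var i * mono m c"
  by (simp add: poly_var_def mult_single)

lemma mono_const: "mono 0 c = poly_const c"
  by (simp add: poly_const_def)

lemma pvars_const: "poly_const c \<in> pvars V" and pvars_var: "i \<in> V \<Longrightarrow> poly_var i \<in> pvars V"
  by (auto simp: pvars_def poly_const_def poly_var_def split: if_splits)

lemma pvars_0 [simp]: "0 \<in> pvars V" and pvars_1 [simp]: "1 \<in> pvars V"
  by (auto simp: pvars_def)

lemma pvars_add: "p \<in> pvars V \<Longrightarrow> q \<in> pvars V \<Longrightarrow> p + q \<in> pvars V"
  using keys_add[of p q] by (auto simp: pvars_def)

lemma pvars_mult:
  assumes "p \<in> pvars V" "q \<in> pvars V"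
  shows "p * q \<in> pvars V"
  unfolding pvars_def
proof (intro CollectI ballI)
  fix m assume "m \<in> Poly_Mapping.keys (p * q)"
  then obtain a b where ab: "m = a + b" "a \<in> Poly_Mapping.keys p" "b \<in> Poly_Mapping.keys q" using keys_mult[of p q] by auto
  then show "Poly_Mapping.keys m \<subseteq> V" using assms keys_add[of a b] by (fastforce simp: pvars_def)
qed

lemma pvars_uminus: "p \<in> pvars V \<Longrightarrow> - p \<in> pvars V"
  by (simp add: pvars_def)

lemma pvars_diff: "p \<in> pvars V \<Longrightarrow> q \<in> pvars V \<Longrightarrow> p - q \<in> pvars V"
  using pvars_add[of p V "- q"] pvars_uminus by simp

lemma pvars_sum: "(\<And>i. i \<in> S \<Longrightarrow> f i \<in> pvars V) \<Longrightarrow> sum f S \<in> pvars V"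
  by (induction S rule: infinite_finite_induct) (auto intro: pvars_add)

lemma rpoly_induct [consumes 1, case_names const var add mult]:
  assumes P: "P \<in> pvars V" and c: "\<And>c. A (poly_const c)" and v: "\<And>i. i \<in> V \<Longrightarrow> A (poly_var i)"
    and a: "\<And>p q. p \<in> pvars V \<Longrightarrow> q \<in> pvars V \<Longrightarrow> A p \<Longrightarrow> A q \<Longrightarrow> A (p + q)"
    and m: "\<And>p q. p \<in> pvars V \<Longrightarrow> q \<in> pvars V \<Longrightarrow> A p \<Longrightarrow> A q \<Longrightarrow> A (p * q)"
  shows "A P"
  using P
proof (induction rule: rpoly_add_induct)
  case (mono n c)
  show ?case using mono
  proof (induction n rule: monomial_induct)
    case zero
    then show ?case using c by (simp add: mono_const)
  next
    case (step n i)
    have "mono n c \<in> pvars V" using step by (auto simp: pvars_def split: if_splits)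
    then show ?case using m[OF pvars_var] v step by (simp only: mono_ev_add)
  qed
qed (use a in blast)

subsection \<open>Partial derivatives\<close>

lemma poly_partial_eq: "poly_partial k = linear_extension (\<lambda>m c. mono (m - ev k) (of_nat (lkp m k) * c))"
  by (simp add: poly_partial_def linear_extension_def fun_eq_iff)

lemma poly_partial_add: "poly_partial k (p + q) = poly_partial k p + poly_partial k q"
  unfolding poly_partial_eq by (rule linear_extension_add) (simp_all add: single_add[symmetric] algebra_simps)

lemma poly_partial_mono: "poly_partial k (mono m c) = mono (m - ev k) (of_nat (lkp m k) * c)"
  unfolding poly_partial_eq by (rule linear_extension_single) simp

lemma poly_partial_0 [simp]: "poly_partial k 0 = 0"
  by (simp add: poly_partial_eq)

lemma poly_partial_uminus: "poly_partial k (- p) = - poly_partial k p"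
  using poly_partial_add[of k p "- p"] by (simp add: eq_neg_iff_add_eq_0 add.commute)

lemma poly_partial_diff: "poly_partial k (p - q) = poly_partial k p - poly_partial k q"
  using poly_partial_add[of k p "- q"] by (simp add: poly_partial_uminus)

lemma poly_partial_sum: "poly_partial k (sum f S) = (\<Sum>i\<in>S. poly_partial k (f i))"
  by (induction S rule: infinite_finite_induct) (simp_all add: poly_partial_add)

lemma poly_partial_const [simp]: "poly_partial k (poly_const c) = 0"
  by (simp add: poly_partial_mono flip: mono_const)

lemma poly_partial_1 [simp]: "poly_partial k 1 = 0"
  using poly_partial_const[of k 1] by (simp add: poly_const_def)

lemma poly_partial_var: "poly_partial k (poly_var i) = (if i = k then 1 else 0)"
  by (auto simp: poly_var_def poly_partial_mono lookup_single when_def)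

lemma poly_partial_mult: "poly_partial k (p * q) = poly_partial k p * q + p * poly_partial k q"
proof -
  have "p \<in> pvars UNIV" "q \<in> pvars UNIV" by simp_all
  then show ?thesis
  proof (induction rule: rpoly_add_induct)
    case (mono m c)
    show ?case using mono(2)
    proof (induction rule: rpoly_add_induct)
      case (mono n d)
      have e: "m + n - ev k = (m - ev k) + n" if "lkp m k \<noteq> 0"
        by (rule poly_mapping_eqI) (use that in \<open>auto simp: lookup_add lookup_minus lookup_single when_def\<close>)
      have e': "m + n - ev k = m + (n - ev k)" if "lkp n k \<noteq> 0"
        by (rule poly_mapping_eqI) (use that in \<open>auto simp: lookup_add lookup_minus lookup_single when_def\<close>)
      have "mono (m + n - ev k) (of_nat (lkp m k) * (c * d)) = mono (m - ev k + n) (of_nat (lkp m k) * (c * d))"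
        using e by (cases "lkp m k = 0") auto
      moreover have "mono (m + n - ev k) (of_nat (lkp n k) * (c * d)) = mono (m + (n - ev k)) (of_nat (lkp n k) * (c * d))"
        using e' by (cases "lkp n k = 0") auto
      moreover have "mono (m + n - ev k) (of_nat (lkp (m + n) k) * (c * d)) =
          mono (m + n - ev k) (of_nat (lkp m k) * (c * d)) + mono (m + n - ev k) (of_nat (lkp n k) * (c * d))"
        by (simp add: single_add[symmetric] lookup_add algebra_simps)
      ultimately show ?case by (simp add: mult_single poly_partial_mono mult.assoc mult.left_commute)
    qed (simp add: poly_partial_add algebra_simps)
  qed (simp add: poly_partial_add algebra_simps)
qed

lemma poly_partial_pvars:
  assumes "p \<in> pvars V"
  shows "poly_partial k p \<in> pvars V"
  using assms
proof (induction rule: rpoly_add_induct)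
  case (mono m c)
  have "Poly_Mapping.keys (m - ev k) \<subseteq> Poly_Mapping.keys m" by (auto simp: in_keys_iff lookup_minus)
  then show ?case using mono by (auto simp: poly_partial_mono pvars_def split: if_splits)
qed (simp add: poly_partial_add pvars_add)

lemma poly_partial_commute: "poly_partial j (poly_partial k p) = poly_partial k (poly_partial j p)"
proof -
  have "p \<in> pvars UNIV" by simp
  then show ?thesis
    by (induction rule: rpoly_induct) (simp_all add: poly_partial_add poly_partial_mult poly_partial_var algebra_simps)
qed

subsection \<open>Substitution and evaluation\<close>

definition monomial_value :: "(nat \<Rightarrow> 'a::comm_semiring_1) \<Rightarrow> (nat \<Rightarrow>\<^sub>0 nat) \<Rightarrow> 'a" where
  "monomial_value s m = (\<Prod>i\<in>Poly_Mapping.keys m. s i ^ lkp m i)"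

lemma monomial_value_superset:
  "finite S \<Longrightarrow> Poly_Mapping.keys m \<subseteq> S \<Longrightarrow> monomial_value s m = (\<Prod>i\<in>S. s i ^ lkp m i)"
  unfolding monomial_value_def by (rule prod.mono_neutral_left) (auto simp: in_keys_iff)

lemma monomial_value_add: "monomial_value s (m + n) = monomial_value s m * monomial_value s n"
proof -
  let ?S = "Poly_Mapping.keys m \<union> Poly_Mapping.keys n"
  have "finite ?S" "Poly_Mapping.keys (m + n) \<subseteq> ?S" using keys_add[of m n] by auto
  then show ?thesis
    using monomial_value_superset[of ?S m s] monomial_value_superset[of ?S n s] monomial_value_superset[of ?S "m + n" s]
    by (simp add: lookup_add power_add prod.distrib)
qed

lemma poly_subst_eq: "poly_subst s = linear_extension (\<lambda>m c. poly_const c * monomial_value s m)"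
  by (simp add: poly_subst_def linear_extension_def monomial_value_def fun_eq_iff)

lemma poly_const_simps: "poly_const (a + b) = poly_const a + poly_const b" "poly_const (a * b) = poly_const a * poly_const b"
  "poly_const 0 = 0" "poly_const 1 = 1"
  by (simp_all add: poly_const_def single_add mult_single)

lemma poly_subst_add: "poly_subst s (p + q) = poly_subst s p + poly_subst s q"
  unfolding poly_subst_eq by (rule linear_extension_add) (simp_all add: poly_const_simps algebra_simps)

lemma poly_subst_0 [simp]: "poly_subst s 0 = 0"
  by (simp add: poly_subst_eq)

lemma poly_subst_mono: "poly_subst s (mono m c) = poly_const c * monomial_value s m"
  unfolding poly_subst_eq by (rule linear_extension_single) (simp add: poly_const_simps)

lemma poly_subst_const [simp]: "poly_subst s (poly_const c) = poly_const c"
  unfolding mono_const[symmetric] poly_subst_mono by (simp add: monomial_value_def mono_const)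

lemma poly_subst_var [simp]: "poly_subst s (poly_var i) = s i"
  unfolding poly_var_def poly_subst_mono by (simp add: monomial_value_def poly_const_simps)

lemma poly_subst_mult: "poly_subst s (p * q) = poly_subst s p * poly_subst s q"
proof -
  have "p \<in> pvars UNIV" "q \<in> pvars UNIV" by simp_all
  then show ?thesis
  proof (induction rule: rpoly_add_induct)
    case (mono m c)
    show ?case using mono(2)
      by (induction rule: rpoly_add_induct)
        (simp_all add: poly_subst_add algebra_simps mult_single poly_subst_mono poly_const_simps monomial_value_add)
  qed (simp add: poly_subst_add algebra_simps)
qed

lemma poly_subst_uminus: "poly_subst s (- p) = - poly_subst s p"
  using poly_subst_add[of s p "- p"] by (simp add: eq_neg_iff_add_eq_0 add.commute)

lemma poly_subst_diff: "poly_subst s (p - q) = poly_subst s p - poly_subst s q"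
  using poly_subst_add[of s p "- q"] by (simp add: poly_subst_uminus)

lemma poly_subst_sum: "poly_subst s (sum f S) = (\<Sum>i\<in>S. poly_subst s (f i))"
  by (induction S rule: infinite_finite_induct) (simp_all add: poly_subst_add)

lemma poly_subst_1 [simp]: "poly_subst s 1 = 1"
  using poly_subst_const[of s 1] by (simp add: poly_const_simps)

lemma poly_subst_pvars:
  assumes "p \<in> pvars V" "\<And>i. i \<in> V \<Longrightarrow> s i \<in> pvars W"
  shows "poly_subst s p \<in> pvars W"
  using assms(1) by (induction rule: rpoly_induct)
    (simp_all add: pvars_const assms(2) poly_subst_add poly_subst_mult pvars_add pvars_mult)

lemma poly_subst_partial:
  assumes "p \<in> pvars V" "finite V"
  shows "poly_partial j (poly_subst s p) = (\<Sum>i\<in>V. poly_subst s (poly_partial i p) * poly_partial j (s i))"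
  using assms(1)
proof (induction rule: rpoly_induct)
  case (var k)
  have "(\<Sum>i\<in>V. poly_subst s (poly_partial i (poly_var k)) * poly_partial j (s i)) = (\<Sum>i\<in>V. if k = i then poly_partial j (s i) else 0)"
    by (intro sum.cong) (auto simp: poly_partial_var)
  then show ?case using var assms(2) by simp
next
  case (mult p q)
  then show ?case
    by (simp add: poly_subst_mult poly_partial_mult poly_subst_add sum.distrib sum_distrib_left sum_distrib_right algebra_simps)
qed (simp_all add: poly_subst_add poly_partial_add sum.distrib algebra_simps)

definition peval :: "(nat \<Rightarrow> rat) \<Rightarrow> rpoly \<Rightarrow> rat" where
  "peval c = linear_extension (\<lambda>m a. a * monomial_value c m)"

lemma peval_add: "peval c (p + q) = peval c p + peval c q"
  unfolding peval_def by (rule linear_extension_add) (simp_all add: algebra_simps)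

lemma peval_0 [simp]: "peval c 0 = 0"
  by (simp add: peval_def)

lemma peval_mono: "peval c (mono m a) = a * monomial_value c m"
  unfolding peval_def by (rule linear_extension_single) simp

lemma peval_const [simp]: "peval c (poly_const a) = a"
  unfolding mono_const[symmetric] peval_mono by (simp add: monomial_value_def)

lemma peval_1 [simp]: "peval c 1 = 1"
  using peval_const[of c 1] by (simp add: poly_const_simps)

lemma peval_var [simp]: "peval c (poly_var i) = c i"
  unfolding poly_var_def peval_mono by (simp add: monomial_value_def)

lemma peval_mult: "peval c (p * q) = peval c p * peval c q"
proof -
  have "p \<in> pvars UNIV" "q \<in> pvars UNIV" by simp_all
  then show ?thesis
  proof (induction rule: rpoly_add_induct)
    case (mono m a)
    show ?case using mono(2)
      by (induction rule: rpoly_add_induct) (simp_all add: peval_add algebra_simps mult_single peval_mono monomial_value_add)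
  qed (simp add: peval_add algebra_simps)
qed

lemma peval_uminus: "peval c (- p) = - peval c p"
  using peval_add[of c p "- p"] by simp

lemma peval_diff: "peval c (p - q) = peval c p - peval c q"
  using peval_add[of c p "- q"] by (simp add: peval_uminus)

lemma peval_sum: "peval c (sum f S) = (\<Sum>i\<in>S. peval c (f i))"
  by (induction S rule: infinite_finite_induct) (simp_all add: peval_add)

lemma peval_subst: "peval c (poly_subst s p) = peval (\<lambda>i. peval c (s i)) p"
proof -
  have "p \<in> pvars UNIV" by simp
  then show ?thesis
    by (induction rule: rpoly_induct) (simp_all add: poly_subst_add poly_subst_mult peval_add peval_mult)
qed

lemma peval_cong:
  assumes "p \<in> pvars V" "\<And>i. i \<in> V \<Longrightarrow> c i = c' i"
  shows "peval c p = peval c' p"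
  using assms(1) by (induction rule: rpoly_induct) (simp_all add: peval_add peval_mult assms(2))

subsection \<open>The Poincare lemma\<close>

definition total_degree :: "(nat \<Rightarrow>\<^sub>0 nat) \<Rightarrow> nat" where
  "total_degree m = (\<Sum>i\<in>Poly_Mapping.keys m. lkp m i)"

text \<open>With the weight \<open>1 / (d + 1)\<close> this is integration along rays from the
  origin: the integral of \<open>t ^ d\<close> over the unit interval.\<close>

definition degree_scale :: "(nat \<Rightarrow> rat) \<Rightarrow> rpoly \<Rightarrow> rpoly" where
  "degree_scale r = linear_extension (\<lambda>m c. mono m (r (total_degree m) * c))"

lemma degree_scale_add: "degree_scale r (p + q) = degree_scale r p + degree_scale r q"
  unfolding degree_scale_def by (rule linear_extension_add) (simp_all add: single_add[symmetric] algebra_simps)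

lemma degree_scale_mono: "degree_scale r (mono m c) = mono m (r (total_degree m) * c)"
  unfolding degree_scale_def by (rule linear_extension_single) simp

lemma degree_scale_pvars: "p \<in> pvars V \<Longrightarrow> degree_scale r p \<in> pvars V"
proof (induction rule: rpoly_add_induct)
  case (mono m c)
  then show ?case by (auto simp: degree_scale_mono pvars_def split: if_splits)
qed (simp add: degree_scale_add pvars_add)

lemma degree_scale_0 [simp]: "degree_scale r 0 = 0"
  by (simp add: degree_scale_def)

lemma total_degree_ev: "lkp m k \<noteq> 0 \<Longrightarrow> total_degree m = Suc (total_degree (m - ev k))"
proof -
  assume k: "lkp m k \<noteq> 0"
  have sub: "Poly_Mapping.keys (m - ev k) \<subseteq> Poly_Mapping.keys m" by (auto simp: in_keys_iff lookup_minus)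
  have km: "k \<in> Poly_Mapping.keys m" using k by (simp add: in_keys_iff)
  have "total_degree (m - ev k) = (\<Sum>i\<in>Poly_Mapping.keys m. lkp (m - ev k) i)"
    unfolding total_degree_def by (rule sum.mono_neutral_left) (use sub in \<open>auto simp: in_keys_iff\<close>)
  also have "\<dots> = lkp m k - 1 + (\<Sum>i\<in>Poly_Mapping.keys m - {k}. lkp m i)"
    by (subst sum.remove[OF _ km]) (auto simp: lookup_minus lookup_single when_def intro!: sum.cong)
  finally show ?thesis using k by (simp add: total_degree_def sum.remove[OF _ km])
qed

text \<open>Differentiation lowers the degree by one, so the weight of the original monomial reads
  \<open>1 / (d + 2)\<close> in terms of the new degree \<open>d\<close>.\<close>

lemma partial_degree_scale: "poly_partial k (degree_scale (\<lambda>d. 1 / of_nat (d + 1)) p) = degree_scale (\<lambda>d. 1 / of_nat (d + 2)) (poly_partial k p)"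
proof -
  have "p \<in> pvars UNIV" by simp
  then show ?thesis
  proof (induction rule: rpoly_add_induct)
    case (mono m c)
    then show ?case using total_degree_ev[of m k]
      by (cases "lkp m k = 0") (simp_all add: degree_scale_mono poly_partial_mono)
  qed (simp add: degree_scale_add poly_partial_add)
qed

lemma euler_mono:
  assumes "Poly_Mapping.keys m \<subseteq> V" "finite V"
  shows "(\<Sum>i\<in>V. poly_var i * poly_partial i (mono m c)) = mono m (of_nat (total_degree m) * c)"
proof -
  have t: "poly_var i * poly_partial i (mono m c) = mono m (of_nat (lkp m i) * c)" for i
  proof (cases "lkp m i = 0")
    case False
    then have "ev i + (m - ev i) = m"
      by (intro poly_mapping_eqI) (auto simp: lookup_add lookup_minus lookup_single when_def)
    then show ?thesis by (simp add: poly_partial_mono mono_ev_add[symmetric])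
  qed (simp add: poly_partial_mono)
  have "(\<Sum>i\<in>V. mono m (of_nat (lkp m i) * c)) = mono m (\<Sum>i\<in>V. of_nat (lkp m i) * c)"
    by (induction V rule: infinite_finite_induct) (simp_all add: single_add)
  also have "(\<Sum>i\<in>V. of_nat (lkp m i) * c) = of_nat (\<Sum>i\<in>V. lkp m i) * c"
    by (simp add: sum_distrib_right)
  also have "(\<Sum>i\<in>V. lkp m i) = total_degree m"
    unfolding total_degree_def by (rule sum.mono_neutral_right) (use assms in \<open>auto simp: in_keys_iff\<close>)
  finally show ?thesis by (simp add: t)
qed

text \<open>By Euler's identity the operator on the left multiplies monomials of degree
  \<open>d\<close> by \<open>d + 1\<close>, which the weight cancels.\<close>

lemma euler_degree_scale:
  assumes "p \<in> pvars V" "finite V"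
  shows "degree_scale (\<lambda>d. 1 / of_nat (d + 1)) p +
    (\<Sum>i\<in>V. poly_var i * poly_partial i (degree_scale (\<lambda>d. 1 / of_nat (d + 1)) p)) = p"
  using assms(1)
proof (induction rule: rpoly_add_induct)
  case (mono m c)
  let ?d = "of_nat (total_degree m) :: rat"
  have "(1 / (?d + 1)) * c + ?d * ((1 / (?d + 1)) * c) = c"
  proof -
    have "?d + 1 \<noteq> 0" by (metis of_nat_Suc add.commute of_nat_neq_0)
    then have "1 / (?d + 1) * (?d + 1) = 1" by simp
    then show ?thesis by (metis (no_types, lifting) distrib_left mult.commute mult.left_commute mult_1 mult.right_neutral add.commute)
  qed
  then show ?case using euler_mono[OF mono assms(2)]
    by (simp add: degree_scale_mono single_add[symmetric] add.commute)
qed (simp add: degree_scale_add poly_partial_add sum.distrib algebra_simps)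

text \<open>The primitive is the radial integral of the form. Its derivative contains the
  derivatives of all components, closedness exchanges the indices, and
  \<open>euler_degree_scale\<close> returns the component.\<close>

lemma poincare_lemma:
  assumes \<alpha>: "\<And>i. i \<in> V \<Longrightarrow> \<alpha> i \<in> pvars V" and V: "finite V"
    and closed: "\<And>i j. i \<in> V \<Longrightarrow> j \<in> V \<Longrightarrow> poly_partial j (\<alpha> i) = poly_partial i (\<alpha> j)"
  obtains f where "f \<in> pvars V" "\<And>i. i \<in> V \<Longrightarrow> poly_partial i f = \<alpha> i"
proof -
  let ?R = "degree_scale (\<lambda>d. 1 / of_nat (d + 1))"
  define f where "f = (\<Sum>i\<in>V. poly_var i * ?R (\<alpha> i))"
  have "f \<in> pvars V" unfolding f_def
    by (intro pvars_sum pvars_mult pvars_var degree_scale_pvars \<alpha>)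
  moreover have "poly_partial j f = \<alpha> j" if j: "j \<in> V" for j
  proof -
    have "poly_partial j f = (\<Sum>i\<in>V. (if i = j then ?R (\<alpha> i) else 0) + poly_var i * poly_partial j (?R (\<alpha> i)))"
      unfolding f_def poly_partial_sum by (intro sum.cong refl) (auto simp: poly_partial_mult poly_partial_var)
    also have "\<dots> = ?R (\<alpha> j) + (\<Sum>i\<in>V. poly_var i * poly_partial j (?R (\<alpha> i)))"
      using j V by (simp add: sum.distrib)
    also have "(\<Sum>i\<in>V. poly_var i * poly_partial j (?R (\<alpha> i))) = (\<Sum>i\<in>V. poly_var i * poly_partial i (?R (\<alpha> j)))"
      unfolding partial_degree_scale by (intro sum.cong refl) (simp add: closed j)
    finally show ?thesis using euler_degree_scale[OF \<alpha>[OF j] V] by simp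
  qed
  ultimately show ?thesis using that by blast
qed

text \<open>The Euler operator multiplies each coefficient by its total degree, so only the constant
  coefficient can be nonzero.\<close>

lemma partials_zero_constant:
  assumes p: "p \<in> pvars V" "finite V" and z: "\<And>i. i \<in> V \<Longrightarrow> poly_partial i p = 0"
  shows "p = poly_const (peval c p)"
proof -
  have l: "lkp (\<Sum>i\<in>V. poly_var i * poly_partial i q) m = of_nat (total_degree m) * lkp q m" if "q \<in> pvars V" for q m
    using that
  proof (induction rule: rpoly_add_induct)
    case (mono n a)
    show ?case unfolding euler_mono[OF mono p(2)] by (simp add: lookup_single when_def)
  qed (simp add: poly_partial_add sum.distrib lookup_add algebra_simps)
  have "lkp p m = 0" if "m \<noteq> 0" for m
  proof -
    obtain k where k: "k \<in> Poly_Mapping.keys m" using \<open>m \<noteq> 0\<close> keys_eq_empty[of m] by blast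
    then have "total_degree m \<noteq> 0" by (auto simp: total_degree_def in_keys_iff)
    moreover have "(\<Sum>i\<in>V. poly_var i * poly_partial i p) = 0" by (rule sum.neutral) (simp add: z)
    then have "of_nat (total_degree m) * lkp p m = 0" using l[OF p(1), of m] by simp
    ultimately show ?thesis by simp
  qed
  then have "p = poly_const (lkp p 0)"
    by (intro poly_mapping_eqI) (auto simp: poly_const_def lookup_single when_def)
  then show ?thesis using peval_const[of c "lkp p 0"] by simp
qed

section \<open>One-forms\<close>

definition one_form :: "(nat \<Rightarrow> rpoly) \<Rightarrow> form" where
  "one_form \<alpha> = (\<lambda>I. if card I = 1 then \<alpha> (the_elem I) else 0)"

definition deg1 :: "form \<Rightarrow> bool" where
  "deg1 \<omega> \<longleftrightarrow> (\<forall>I. card I \<noteq> 1 \<longrightarrow> \<omega> I = 0)"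

lemma one_form_singleton [simp]: "one_form \<alpha> {p} = \<alpha> p"
  by (simp add: one_form_def)

lemma deg1_one_form: "deg1 (one_form \<alpha>)"
  by (simp add: deg1_def one_form_def)

lemma deg1_eqI:
  assumes "deg1 \<omega>" "deg1 \<eta>" "\<And>p. \<omega> {p} = \<eta> {p}"
  shows "\<omega> = \<eta>"
proof
  fix I
  show "\<omega> I = \<eta> I"
  proof (cases "card I = 1")
    case True
    then obtain p where "I = {p}" by (auto simp: card_1_singleton_iff)
    then show ?thesis using assms(3) by simp
  qed (use assms(1,2) in \<open>simp add: deg1_def\<close>)
qed

lemma form_diff_singleton: "form_diff \<omega> {k} = poly_partial k (\<omega> {})"
  by (simp add: form_diff_def cong: conj_cong)

lemma form_diff_pair:
  assumes "p < q"
  shows "form_diff \<omega> {p, q} = poly_partial p (\<omega> {q}) - poly_partial q (\<omega> {p})"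
proof -
  have c: "{i \<in> {p, q}. i < p} = {}" "{i \<in> {p, q}. i < q} = {p}" and d: "{p, q} - {p} = {q}" "{p, q} - {q} = {p}" and pq: "p \<noteq> q"
    using assms by auto
  have "form_diff \<omega> {p, q} = (-1) ^ card {i \<in> {p, q}. i < p} * poly_partial p (\<omega> ({p, q} - {p})) +
      (-1) ^ card {i \<in> {p, q}. i < q} * poly_partial q (\<omega> ({p, q} - {q}))"
    unfolding form_diff_def using pq by (subst sum.insert) simp_all
  then show ?thesis unfolding c d by simp
qed

lemma form_mult_pair:
  assumes "p < q" "\<omega> {} = 0" "\<eta> {} = 0"
  shows "form_mult \<omega> \<eta> {p, q} = \<omega> {p} * \<eta> {q} - \<omega> {q} * \<eta> {p}"
proof -
  have P: "Pow {p, q} = {{}, {p}, {q}, {p, q}}" by auto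
  have d: "{p, q} - {p} = {q}" "{p, q} - {q} = {p}" "p \<noteq> q" using assms(1) by auto
  have s: "{(i, j). i \<in> {p} \<and> j \<in> {q} \<and> j < i} = {}" "{(i, j). i \<in> {q} \<and> j \<in> {p} \<and> j < i} = {(q, p)}"
    using assms(1) by auto
  define t where "t I = (-1) ^ card {(i, j). i \<in> I \<and> j \<in> {p, q} - I \<and> j < i} * \<omega> I * \<eta> ({p, q} - I)" for I
  have "t {p} = \<omega> {p} * \<eta> {q}" unfolding t_def d s by simp
  moreover have "t {q} = - \<omega> {q} * \<eta> {p}" unfolding t_def d s by simp
  moreover have "t {} = 0" "t {p, q} = 0" using assms(2,3) by (simp_all add: t_def)
  moreover have "form_mult \<omega> \<eta> {p, q} = t {} + (t {p} + (t {q} + t {p, q}))"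
    unfolding form_mult_def P t_def[symmetric] using d(3) by (simp add: doubleton_eq_iff)
  ultimately show ?thesis by simp
qed

lemma form_diff_not_pair:
  assumes "deg1 \<omega>" "card K \<noteq> 2"
  shows "form_diff \<omega> K = 0"
proof (cases "finite K")
  case True
  have "poly_partial k (\<omega> (K - {k})) = 0" if "k \<in> K" for k
    using assms that True card_gt_0_iff[of K] by (auto simp: deg1_def)
  then show ?thesis by (simp add: form_diff_def)
qed (simp add: form_diff_def)

lemma form_mult_not_pair:
  assumes "deg1 \<omega>" "deg1 \<eta>" "card K \<noteq> 2"
  shows "form_mult \<omega> \<eta> K = 0"
proof (cases "finite K")
  case True
  have "\<omega> I * \<eta> (K - I) = 0" if "I \<subseteq> K" for I
  proof (rule ccontr)
    assume "\<not> ?thesis"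
    then have "card I = 1" "card (K - I) = 1" using assms(1,2) unfolding deg1_def by (metis mult_zero_left mult_zero_right)+
    then show False using assms(3) card_Diff_subset[OF finite_subset[OF that True] that] card_mono[OF True that] by linarith
  qed
  then show ?thesis unfolding form_mult_def by (intro sum.neutral) (simp add: mult.assoc)
qed (simp add: form_mult_def)

lemma form_pairs_eqI:
  fixes \<omega> \<eta> :: form
  assumes "\<And>K. card K \<noteq> 2 \<Longrightarrow> \<omega> K = 0" "\<And>K. card K \<noteq> 2 \<Longrightarrow> \<eta> K = 0"
    "\<And>p q. p < q \<Longrightarrow> \<omega> {p, q} = \<eta> {p, q}"
  shows "\<omega> = \<eta>"
proof
  fix K
  show "\<omega> K = \<eta> K"
  proof (cases "card K = 2")
    case True
    then obtain p q where "K = {p, q}" "p \<noteq> q" by (auto simp: card_2_iff)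
    then have "(p < q \<and> K = {p, q}) \<or> (q < p \<and> K = {q, p})" by auto
    then show ?thesis using assms(3) by blast
  qed (use assms(1,2) in simp)
qed

lemma form_mult_of_poly: "finite K \<Longrightarrow> form_mult (form_of_poly P) \<eta> K = P * \<eta> K"
proof -
  assume K: "finite K"
  have "form_mult (form_of_poly P) \<eta> K = (\<Sum>I\<in>Pow K. if I = {} then P * \<eta> K else 0)"
    unfolding form_mult_def by (intro sum.cong refl) (auto simp: form_of_poly_def)
  also have "\<dots> = P * \<eta> K" using K by simp
  finally show ?thesis .
qed

lemma form_mult_one: "finite K \<Longrightarrow> form_mult \<eta> (form_of_poly 1) K = \<eta> K"
proof -
  assume K: "finite K"
  have "form_mult \<eta> (form_of_poly 1) K = (\<Sum>I\<in>Pow K. if I = K then \<eta> K else 0)"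
    unfolding form_mult_def by (intro sum.cong refl) (auto simp: form_of_poly_def cong: conj_cong)
  also have "\<dots> = \<eta> K" using K by simp
  finally show ?thesis .
qed

lemma sum_fun: "(\<Sum>i\<in>S. f i) x = (\<Sum>i\<in>S. f i x)"
  by (induction S rule: infinite_finite_induct) simp_all

lemma form_mult_zero_left [simp]: "form_mult 0 \<eta> = 0"
  by (simp add: form_mult_def fun_eq_iff)

lemma form_of_poly_0 [simp]: "form_of_poly 0 = 0"
  by (simp add: form_of_poly_def fun_eq_iff)

lemma deg1_form_diff_of_poly: "deg1 (form_diff (form_of_poly P))"
  unfolding deg1_def
proof (intro allI impI)
  fix K :: "nat set" assume K: "card K \<noteq> 1"
  have "K - {k} \<noteq> {}" if "k \<in> K" for k using K that by (metis Diff_eq_empty_iff is_singletonI is_singleton_altdef subset_singletonD empty_iff)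
  then show "form_diff (form_of_poly P) K = 0" by (simp add: form_diff_def form_of_poly_def)
qed

text \<open>Only one-element index sets contribute; they give the terms of the chain rule.\<close>

lemma form_pullback_one_form:
  assumes \<omega>: "deg1 \<omega>"
  shows "deg1 (form_pullback m n \<theta> \<omega>)"
    "form_pullback m n \<theta> \<omega> {q} = (\<Sum>i\<in>{1..n}. poly_subst (vertex_pullback m \<theta>) (\<omega> {i}) * poly_partial q (vertex_pullback m \<theta> i))"
proof -
  define T where "T I = form_mult (form_of_poly (poly_subst (vertex_pullback m \<theta>) (\<omega> I)))
       (foldr form_mult (map (\<lambda>i. form_diff (form_of_poly (vertex_pullback m \<theta> i))) (sorted_list_of_set I)) (form_of_poly 1))" for I
  have zero: "T I = 0" if "card I \<noteq> 1" for I using that \<omega> by (simp add: T_def deg1_def)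
  have "form_pullback m n \<theta> \<omega> = (\<Sum>I\<in>(\<lambda>i. {i}) ` {1..n}. T I)" unfolding form_pullback_def T_def[symmetric]
  proof (rule sum.mono_neutral_right)
    show "\<forall>i\<in>Pow {1..n} - (\<lambda>i. {i}) ` {1..n}. T i = 0"
    proof
      fix I :: "nat set" assume I: "I \<in> Pow {1..n} - (\<lambda>i. {i}) ` {1..n}"
      then have "card I \<noteq> 1" by (auto simp: card_1_singleton_iff)
      then show "T I = 0" by (rule zero)
    qed
  qed auto
  then have sum: "form_pullback m n \<theta> \<omega> = (\<Sum>i\<in>{1..n}. T {i})"
    by (simp add: sum.reindex)
  have T: "T {i} K = poly_subst (vertex_pullback m \<theta>) (\<omega> {i}) * form_diff (form_of_poly (vertex_pullback m \<theta> i)) K" if "finite K" for i K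
    using that by (simp add: T_def form_mult_of_poly form_mult_one)
  show "deg1 (form_pullback m n \<theta> \<omega>)" unfolding deg1_def
  proof (intro allI impI)
    fix K :: "nat set" assume K: "card K \<noteq> 1"
    have "T {i} K = 0" for i
    proof (cases "finite K")
      case True
      then show ?thesis using deg1_form_diff_of_poly K by (simp add: T deg1_def)
    next
      case False
      then show ?thesis by (simp add: T_def form_mult_def)
    qed
    then show "form_pullback m n \<theta> \<omega> K = 0" by (simp add: sum sum_fun)
  qed
  show "form_pullback m n \<theta> \<omega> {q} = (\<Sum>i\<in>{1..n}. poly_subst (vertex_pullback m \<theta>) (\<omega> {i}) * poly_partial q (vertex_pullback m \<theta> i))"
    by (simp add: sum sum_fun T form_diff_singleton form_of_poly_def)
qed

lemma simplex_forms_1_iff: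
  "\<omega> \<in> simplex_forms n 1 \<longleftrightarrow> deg1 \<omega> \<and> (\<forall>p. p \<notin> {1..n} \<longrightarrow> \<omega> {p} = 0) \<and> (\<forall>p. \<omega> {p} \<in> pvars {1..n})"
proof (intro iffI)
  assume w: "\<omega> \<in> simplex_forms n 1"
  have "\<omega> {p} \<in> pvars {1..n}" for p using w by (cases "\<omega> {p} = 0") (auto simp: simplex_forms_def pvars_def)
  then show "deg1 \<omega> \<and> (\<forall>p. p \<notin> {1..n} \<longrightarrow> \<omega> {p} = 0) \<and> (\<forall>p. \<omega> {p} \<in> pvars {1..n})"
    using w by (auto simp: simplex_forms_def deg1_def)
next
  assume w: "deg1 \<omega> \<and> (\<forall>p. p \<notin> {1..n} \<longrightarrow> \<omega> {p} = 0) \<and> (\<forall>p. \<omega> {p} \<in> pvars {1..n})"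
  show "\<omega> \<in> simplex_forms n 1" unfolding simplex_forms_def
  proof (intro CollectI allI impI)
    fix I assume nz: "\<omega> I \<noteq> 0"
    then have c: "card I = 1" using w unfolding deg1_def by blast
    then obtain p where p: "I = {p}" by (auto simp: card_1_singleton_iff)
    then show "I \<subseteq> {1..n} \<and> int (card I) = 1 \<and> (\<forall>m\<in>Poly_Mapping.keys (\<omega> I). Poly_Mapping.keys m \<subseteq> {1..n})"
      using w nz by (auto simp: pvars_def)
  qed
qed

section \<open>Integration over the interval\<close>

text \<open>The weight \<open>fact k / fact (k + 1)\<close> is the integral of the power
  \<open>k\<close>, so this is the fundamental theorem of calculus on the edge.\<close>

lemma simplex_integral_edge:
  assumes f: "f \<in> pvars {1}" and w: "\<omega> {1} = poly_partial 1 f"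
  shows "simplex_integral 1 \<omega> = peval (\<lambda>_. 1) f - peval (\<lambda>_. 0) f"
proof -
  define L where "L m a = a * fact (lkp m (1::nat)) / fact (lkp m 1 + 1)" for m and a :: rat
  have L: "simplex_integral 1 \<omega> = linear_extension L (poly_partial 1 f)"
    by (simp add: simplex_integral_def linear_extension_def L_def w[simplified])
  have add: "linear_extension L (p + q) = linear_extension L p + linear_extension L q" for p q
    by (rule linear_extension_add) (simp_all add: L_def add_divide_distrib distrib_right)
  have "linear_extension L (poly_partial 1 f) = peval (\<lambda>_. 1) f - peval (\<lambda>_. 0) f" using f
  proof (induction rule: rpoly_add_induct)
    case (mono m c)
    have v: "monomial_value (\<lambda>_. x) m = x ^ lkp m (Suc 0)" for x :: rat
      using monomial_value_superset[of "{1}" m "\<lambda>_. x"] mono by simp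
    show ?case
    proof (cases "lkp m 1")
      case 0
      then show ?thesis by (simp add: poly_partial_mono peval_mono v)
    next
      case (Suc k)
      have "lkp (m - ev 1) 1 = k" by (simp add: lookup_minus Suc[simplified])
      moreover have "of_nat (Suc k) \<noteq> (0 :: rat)" by (rule of_nat_neq_0)
      then have "of_nat (Suc k) * c * fact k / fact (k + 1) = c"
        by (simp add: mult.assoc mult.left_commute[of c] del: of_nat_Suc flip: of_nat_Suc)
      ultimately show ?thesis
        by (simp add: poly_partial_mono linear_extension_single L_def peval_mono v Suc[simplified] del: of_nat_Suc)
    qed
  qed (simp add: poly_partial_add add peval_add)
  then show ?thesis using L by simp
qed

lemma simplex_integral_deg1: "deg1 \<omega> \<Longrightarrow> n \<noteq> 1 \<Longrightarrow> simplex_integral n \<omega> = 0"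
  by (simp add: simplex_integral_def deg1_def)

section \<open>Flat connections with values in unipotent matrices\<close>

text \<open>For a unipotent matrix \<open>F\<close> of polynomials this is the matrix \<open>A\<close> of one-forms with \<open>dF = A F\<close>.\<close>

function conn :: "(nat \<Rightarrow> nat \<Rightarrow> rpoly) \<Rightarrow> nat \<Rightarrow> nat \<Rightarrow> nat \<Rightarrow> rpoly" where
  "conn F p i j = poly_partial p (F i j) - (\<Sum>l\<in>{i<..<j}. conn F p i l * F l j)"
  by auto
termination by (relation "Wellfounded.measure (\<lambda>(F, p, i, j). j - i)") auto

declare conn.simps [simp del]

lemma greaterThanAtMost_insert: "i < j \<Longrightarrow> {i<..j} = insert j {i<..<j}" for i j :: nat
  by auto

lemma partial_conn:
  assumes "F j j = 1" "i \<le> j"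
  shows "poly_partial p (F i j) = (\<Sum>l\<in>{i<..j}. conn F p i l * F l j)"
  using assms by (cases "i = j") (simp_all add: greaterThanAtMost_insert conn.simps[of F p i j])

lemma triangle_swap:
  "(\<Sum>l\<in>{i<..j}. \<Sum>m\<in>{l<..j}. g l m) = (\<Sum>m\<in>{i<..j}. \<Sum>l\<in>{i<..<m}. g l m)" for g :: "nat \<Rightarrow> nat \<Rightarrow> 'a::comm_monoid_add"
proof -
  have "(\<Sum>l\<in>{i<..j}. \<Sum>m | m \<in> {i<..j} \<and> l < m. g l m) = (\<Sum>m\<in>{i<..j}. \<Sum>l | l \<in> {i<..j} \<and> l < m. g l m)"
    by (rule sum.swap_restrict) simp_all
  moreover have "{m. m \<in> {i<..j} \<and> l < m} = {l<..j}" if "l \<in> {i<..j}" for l using that by auto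
  moreover have "{l. l \<in> {i<..j} \<and> l < m} = {i<..<m}" if "m \<in> {i<..j}" for m using that by auto
  ultimately show ?thesis by simp
qed

text \<open>Differentiating the system once more and inserting the system for the derivatives of
  \<open>F\<close> leaves the curvature of \<open>A\<close> applied to \<open>F\<close>.\<close>

lemma system_curvature:
  fixes F :: "nat \<Rightarrow> rpoly" and A :: "nat \<Rightarrow> nat \<Rightarrow> nat \<Rightarrow> rpoly"
  assumes "\<And>l p. i < l \<Longrightarrow> l \<le> j \<Longrightarrow> p \<in> {r, s} \<Longrightarrow> poly_partial p (F l) = (\<Sum>m\<in>{l<..j}. A p l m * F m)"
  shows "poly_partial r (\<Sum>l\<in>{i<..j}. A s i l * F l) - poly_partial s (\<Sum>l\<in>{i<..j}. A r i l * F l) =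
    (\<Sum>m\<in>{i<..j}. (poly_partial r (A s i m) - poly_partial s (A r i m) -
      (\<Sum>l\<in>{i<..<m}. A r i l * A s l m - A s i l * A r l m)) * F m)"
proof -
  have d: "poly_partial p (\<Sum>l\<in>{i<..j}. A q i l * F l) =
      (\<Sum>l\<in>{i<..j}. poly_partial p (A q i l) * F l) + (\<Sum>m\<in>{i<..j}. \<Sum>l\<in>{i<..<m}. A q i l * A p l m * F m)" if "p \<in> {r, s}" for p q
  proof -
    have "poly_partial p (\<Sum>l\<in>{i<..j}. A q i l * F l) =
        (\<Sum>l\<in>{i<..j}. poly_partial p (A q i l) * F l) + (\<Sum>l\<in>{i<..j}. \<Sum>m\<in>{l<..j}. A q i l * A p l m * F m)"
      unfolding poly_partial_sum sum.distrib[symmetric]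
      by (intro sum.cong refl) (use that in \<open>simp add: poly_partial_mult assms(1) sum_distrib_left mult.assoc\<close>)
    then show ?thesis by (simp only: triangle_swap)
  qed
  have "poly_partial r (\<Sum>l\<in>{i<..j}. A s i l * F l) =
      (\<Sum>l\<in>{i<..j}. poly_partial r (A s i l) * F l) + (\<Sum>m\<in>{i<..j}. \<Sum>l\<in>{i<..<m}. A s i l * A r l m * F m)"
    "poly_partial s (\<Sum>l\<in>{i<..j}. A r i l * F l) =
      (\<Sum>l\<in>{i<..j}. poly_partial s (A r i l) * F l) + (\<Sum>m\<in>{i<..j}. \<Sum>l\<in>{i<..<m}. A r i l * A s l m * F m)"
    by (rule d; simp)+
  then show ?thesis by (simp add: left_diff_distrib sum_subtractf sum_distrib_left sum.distrib algebra_simps)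
qed

text \<open>Mixed partial derivatives commute, so the curvature annihilates \<open>F\<close>. As
  \<open>F\<close> is unipotent, the curvature entries in row \<open>i\<close> vanish one after the
  other, moving away from the diagonal.\<close>

lemma conn_flat:
  assumes F: "\<And>j. F j j = 1"
  shows "i < j \<Longrightarrow> poly_partial p (conn F q i j) - poly_partial q (conn F p i j) =
    (\<Sum>l\<in>{i<..<j}. conn F p i l * conn F q l j - conn F q i l * conn F p l j)"
proof (induction j rule: less_induct)
  case (less j)
  define R where "R m = poly_partial p (conn F q i m) - poly_partial q (conn F p i m) -
      (\<Sum>l\<in>{i<..<m}. conn F p i l * conn F q l m - conn F q i l * conn F p l m)" for m
  have "poly_partial p (poly_partial q (F i j)) - poly_partial q (poly_partial p (F i j)) = (\<Sum>m\<in>{i<..j}. R m * F m j)"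
    unfolding R_def partial_conn[of F, OF F less_imp_le[OF less.prems]]
    by (rule system_curvature[where F = "\<lambda>l. F l j" and A = "conn F"])
        (use less.prems in \<open>auto intro: partial_conn[of F, OF F]\<close>)
  also have "\<dots> = R j"
  proof -
    have "R m = 0" if "m \<in> {i<..<j}" for m using less.IH[of m] that by (simp add: R_def)
    then show ?thesis using less.prems by (simp add: greaterThanAtMost_insert F)
  qed
  finally show ?case by (simp add: poly_partial_commute[of p q] R_def)
qed

text \<open>\<open>dF\<close> times the inverse of \<open>F\<close> does not change when
  \<open>F\<close> is multiplied on the right by a constant matrix.\<close>

lemma conn_mult_const:
  assumes "\<And>j. F j j = 1" "\<And>j. F' j j = 1"
    and "\<And>l m. i \<le> l \<Longrightarrow> l \<le> m \<Longrightarrow> m \<le> j \<Longrightarrow> F' l m = (\<Sum>k\<in>{l..m}. F l k * poly_const (C k m))"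
  shows "i < j \<Longrightarrow> conn F' p i j = conn F p i j"
  using assms(3)
proof (induction j rule: less_induct)
  case (less j)
  have IH: "conn F' p i l = conn F p i l" if "l \<in> {i<..<j}" for l using less that by auto
  have "poly_partial p (F' i j) = (\<Sum>k\<in>{i..j}. poly_partial p (F i k) * poly_const (C k j))"
    using less.prems by (simp add: poly_partial_sum poly_partial_mult)
  also have "\<dots> = (\<Sum>k\<in>{i..j}. \<Sum>m | m \<in> {i<..j} \<and> m \<le> k. conn F p i m * F m k * poly_const (C k j))"
  proof (intro sum.cong refl)
    fix k assume k: "k \<in> {i..j}"
    then have "{m. m \<in> {i<..j} \<and> m \<le> k} = {i<..k}" by auto
    then show "poly_partial p (F i k) * poly_const (C k j) = (\<Sum>m | m \<in> {i<..j} \<and> m \<le> k. conn F p i m * F m k * poly_const (C k j))"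
      using k by (simp add: partial_conn[of F, OF assms(1)] sum_distrib_right)
  qed
  also have "\<dots> = (\<Sum>m\<in>{i<..j}. \<Sum>k | k \<in> {i..j} \<and> m \<le> k. conn F p i m * F m k * poly_const (C k j))"
    by (rule sum.swap_restrict) simp_all
  also have "\<dots> = (\<Sum>m\<in>{i<..j}. conn F p i m * F' m j)"
  proof (intro sum.cong refl)
    fix m assume m: "m \<in> {i<..j}"
    then have "{k. k \<in> {i..j} \<and> m \<le> k} = {m..j}" by auto
    then show "(\<Sum>k | k \<in> {i..j} \<and> m \<le> k. conn F p i m * F m k * poly_const (C k j)) = conn F p i m * F' m j"
      using m less.prems(2)[of m j] by (simp add: sum_distrib_left mult.assoc)
  qed
  also have "\<dots> = conn F p i j + (\<Sum>m\<in>{i<..<j}. conn F p i m * F' m j)"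
    unfolding greaterThanAtMost_insert[OF less.prems(1)] by (simp add: assms(2))
  also have "(\<Sum>m\<in>{i<..<j}. conn F p i m * F' m j) = (\<Sum>m\<in>{i<..<j}. conn F' p i m * F' m j)"
    by (intro sum.cong refl) (simp only: IH)
  finally show ?case unfolding conn.simps[of F' p i j] by simp
qed

lemma conn_subst:
  assumes "\<And>i j. F i j \<in> pvars V" "finite V"
  shows "conn (\<lambda>i j. poly_subst s (F i j)) q i j = (\<Sum>p\<in>V. poly_subst s (conn F p i j) * poly_partial q (s p))"
proof (induction j rule: less_induct)
  case (less j)
  have "conn (\<lambda>i j. poly_subst s (F i j)) q i j = (\<Sum>p\<in>V. poly_subst s (poly_partial p (F i j)) * poly_partial q (s p)) -
     (\<Sum>l\<in>{i<..<j}. \<Sum>p\<in>V. poly_subst s (conn F p i l) * poly_partial q (s p) * poly_subst s (F l j))"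
    using less by (simp add: conn.simps[of _ q i j] poly_subst_partial[OF assms] sum_distrib_right)
  also have "(\<Sum>l\<in>{i<..<j}. \<Sum>p\<in>V. poly_subst s (conn F p i l) * poly_partial q (s p) * poly_subst s (F l j)) =
     (\<Sum>p\<in>V. \<Sum>l\<in>{i<..<j}. poly_subst s (conn F p i l) * poly_partial q (s p) * poly_subst s (F l j))"
    by (rule sum.swap)
  finally show ?case
    by (simp add: conn.simps[of F _ i j] poly_subst_diff poly_subst_sum poly_subst_mult left_diff_distrib sum_subtractf sum_distrib_left algebra_simps)
qed

lemma conn_pvars: "(\<And>i j. F i j \<in> pvars V) \<Longrightarrow> conn F p i j \<in> pvars V"
proof (induction j rule: less_induct)
  case (less j)
  show ?case unfolding conn.simps[of F p i j]
    by (intro pvars_diff pvars_sum pvars_mult poly_partial_pvars less.prems less.IH) auto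
qed

lemma poly_partial_outside: "f \<in> pvars V \<Longrightarrow> p \<notin> V \<Longrightarrow> poly_partial p f = 0"
proof (induction rule: rpoly_induct)
  case (var i)
  then show ?case by (auto simp: poly_partial_var)
qed (simp_all add: poly_partial_add poly_partial_mult)

lemma conn_outside: "(\<And>i j. F i j \<in> pvars V) \<Longrightarrow> p \<notin> V \<Longrightarrow> conn F p i j = 0"
proof (induction j rule: less_induct)
  case (less j)
  have "poly_partial p (F i j) = 0" using less.prems by (intro poly_partial_outside[of _ V])
  moreover have "(\<Sum>l\<in>{i<..<j}. conn F p i l * F l j) = 0"
    by (rule sum.neutral) (use less in auto)
  ultimately show ?case unfolding conn.simps[of F p i j] by simp
qed

section \<open>Vertices\<close>

definition vtx :: "nat \<Rightarrow> nat \<Rightarrow> rat" where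
  "vtx k = (\<lambda>i. if i = k then 1 else 0)"

lemma barycentric_pvars: "j \<le> n \<Longrightarrow> barycentric n j \<in> pvars {1..n}"
  by (auto simp: barycentric_def intro!: pvars_diff pvars_sum pvars_var)

lemma barycentric_sum: "(\<Sum>j\<le>n. barycentric n j) = 1"
proof -
  have "{..n} = insert 0 {1..n}" by auto
  moreover have "(\<Sum>j\<in>{1..n}. barycentric n j) = (\<Sum>j\<in>{1..n}. poly_var j)"
    by (intro sum.cong) (auto simp: barycentric_def)
  ultimately show ?thesis by (simp add: barycentric_def)
qed

lemma vertex_pullback_pvars: "vertex_pullback m \<theta> i \<in> pvars {1..m}"
  unfolding vertex_pullback_def by (intro pvars_sum barycentric_pvars) auto

lemma vertex_pullback_sum:
  assumes "vertex_map m n \<theta>"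
  shows "(\<Sum>i\<le>n. vertex_pullback m \<theta> i) = 1"
proof -
  have "(\<Sum>i\<le>n. vertex_pullback m \<theta> i) = (\<Sum>i\<in>{..n}. \<Sum>j | j \<in> {..m} \<and> \<theta> j = i. barycentric m j)"
    by (simp add: vertex_pullback_def)
  also have "\<dots> = (\<Sum>j\<in>{..m}. barycentric m j)"
    by (rule sum.group) (use assms in \<open>auto simp: vertex_map_def\<close>)
  finally show ?thesis by (simp add: barycentric_sum)
qed

lemma poly_subst_barycentric:
  assumes "vertex_map m n \<theta>" "k \<le> n"
  shows "poly_subst (vertex_pullback m \<theta>) (barycentric n k) = vertex_pullback m \<theta> k"
proof (cases "k = 0")
  case True
  have "{..n} = insert 0 {1..n}" by auto
  then have "vertex_pullback m \<theta> 0 = 1 - (\<Sum>i\<in>{1..n}. vertex_pullback m \<theta> i)"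
    using vertex_pullback_sum[OF assms(1)] by (simp add: eq_diff_eq)
  then show ?thesis using True by (simp add: barycentric_def poly_subst_diff poly_subst_sum)
qed (simp add: barycentric_def)

lemma peval_barycentric: "k \<le> n \<Longrightarrow> j \<le> n \<Longrightarrow> peval (vtx k) (barycentric n j) = (if j = k then 1 else 0)"
  by (auto simp: barycentric_def peval_diff peval_sum vtx_def)

lemma peval_vertex_pullback: "k \<le> m \<Longrightarrow> peval (vtx k) (vertex_pullback m \<theta> i) = vtx (\<theta> k) i"
  by (simp add: vertex_pullback_def peval_sum peval_barycentric, simp add: vtx_def)

lemma peval_vertex_subst: "k \<le> m \<Longrightarrow> peval (vtx k) (poly_subst (vertex_pullback m \<theta>) f) = peval (vtx (\<theta> k)) f"
  by (simp add: peval_subst peval_vertex_pullback)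

lemma simplex_integral_edge_vtx:
  assumes f: "f \<in> pvars {1}" and w: "\<omega> {1} = poly_partial 1 f"
  shows "simplex_integral 1 \<omega> = peval (vtx 1) f - peval (vtx 0) f"
  using simplex_integral_edge[of f \<omega>, OF f w] peval_cong[OF f, of "\<lambda>_. 1" "vtx 1"] peval_cong[OF f, of "\<lambda>_. 0" "vtx 0"] by (simp add: vtx_def)

section \<open>Solutions of flat systems\<close>

definition solves :: "nat set \<Rightarrow> (nat \<Rightarrow> nat \<Rightarrow> nat \<Rightarrow> rpoly) \<Rightarrow> nat \<Rightarrow> (nat \<Rightarrow> nat \<Rightarrow> rpoly) \<Rightarrow> bool" where
  "solves V A N F \<longleftrightarrow> (\<forall>j. F j j = 1) \<and> (\<forall>i j. i \<le> j \<and> j \<le> N \<longrightarrow> F i j \<in> pvars V \<and>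
     (\<forall>p\<in>V. poly_partial p (F i j) = (\<Sum>l\<in>{i<..j}. A p i l * F l j)))"

text \<open>Entries are found diagonal by diagonal. The right side for a new entry involves only
  known ones; it is closed because the curvature vanishes, so the Poincare lemma integrates it, and
  a constant adjusts the value at \<open>c\<close>.\<close>

lemma flat_solution:
  assumes V: "finite V" and A: "\<And>p i j. p \<in> V \<Longrightarrow> i < j \<Longrightarrow> j \<le> N \<Longrightarrow> A p i j \<in> pvars V"
    and flat: "\<And>p q i j. p \<in> V \<Longrightarrow> q \<in> V \<Longrightarrow> i < j \<Longrightarrow> j \<le> N \<Longrightarrow>
      poly_partial p (A q i j) - poly_partial q (A p i j) = (\<Sum>l\<in>{i<..<j}. A p i l * A q l j - A q i l * A p l j)"
  shows "\<exists>F. solves V A N F \<and> (\<forall>i j. i < j \<and> j \<le> N \<longrightarrow> peval c (F i j) = 0)"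
proof -
  define good where "good F i j \<longleftrightarrow> F i j \<in> pvars V \<and> (i < j \<longrightarrow> peval c (F i j) = 0) \<and>
     (\<forall>p\<in>V. poly_partial p (F i j) = (\<Sum>l\<in>{i<..j}. A p i l * F l j))" for F i j
  have "\<exists>F. (\<forall>j. F j j = 1) \<and> (\<forall>i j. i \<le> j \<and> j \<le> N \<and> j - i \<le> d \<longrightarrow> good F i j)" for d
  proof (induction d)
    case 0
    have "good (\<lambda>i j. 1) i j" if "i \<le> j" "j - i \<le> 0" for i j using that by (simp add: good_def)
    then show ?case by (intro exI[of _ "\<lambda>i j. 1"]) auto
  next
    case (Suc d)
    then obtain F where F1: "\<And>j. F j j = 1" and F: "\<And>i j. i \<le> j \<Longrightarrow> j \<le> N \<Longrightarrow> j - i \<le> d \<Longrightarrow> good F i j" by blast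
    define P where "P i f \<longleftrightarrow> f \<in> pvars V \<and> peval c f = 0 \<and>
      (\<forall>p\<in>V. poly_partial p f = (\<Sum>l\<in>{i<..i + Suc d}. A p i l * F l (i + Suc d)))" for i f
    have "\<exists>f. i + Suc d \<le> N \<longrightarrow> P i f" for i
    proof (cases "i + Suc d \<le> N")
      case N: True
      let ?j = "i + Suc d"
      define \<alpha> where "\<alpha> p = (\<Sum>l\<in>{i<..?j}. A p i l * F l ?j)" for p
      have Fl: "good F l ?j" if "i < l" "l \<le> ?j" for l using F[of l ?j] that N by auto
      have "poly_partial q (\<alpha> p) = poly_partial p (\<alpha> q)" if pq: "p \<in> V" "q \<in> V" for p q
      proof -
        have "poly_partial p (\<alpha> q) - poly_partial q (\<alpha> p) =
          (\<Sum>m\<in>{i<..?j}. (poly_partial p (A q i m) - poly_partial q (A p i m) -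
            (\<Sum>l\<in>{i<..<m}. A p i l * A q l m - A q i l * A p l m)) * F m ?j)"
          unfolding \<alpha>_def by (rule system_curvature[where F = "\<lambda>l. F l ?j"]) (use Fl pq in \<open>auto simp: good_def\<close>)
        also have "\<dots> = 0" by (rule sum.neutral) (use flat[OF pq] N in auto)
        finally show ?thesis by simp
      qed
      moreover have "\<alpha> p \<in> pvars V" if "p \<in> V" for p
        unfolding \<alpha>_def by (intro pvars_sum pvars_mult) (use A[OF that] Fl N in \<open>auto simp: good_def\<close>)
      ultimately obtain f where f: "f \<in> pvars V" "\<And>p. p \<in> V \<Longrightarrow> poly_partial p f = \<alpha> p"
        using poincare_lemma[of V \<alpha>] V by metis
      have "P i (f - poly_const (peval c f))" using f
        by (auto simp: P_def \<alpha>_def peval_diff poly_partial_diff intro!: pvars_diff pvars_const)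
      then show ?thesis by blast
    qed simp
    then obtain f where f: "\<And>i. i + Suc d \<le> N \<Longrightarrow> P i (f i)" by metis
    define F' where "F' i j = (if j = i + Suc d then f i else F i j)" for i j
    have "good F' i j" if ij: "i \<le> j" "j \<le> N" "j - i \<le> Suc d" for i j
    proof (cases "j = i + Suc d")
      case True
      have "F' l j = F l j" if "l \<in> {i<..j}" for l using that True by (auto simp: F'_def)
      then show ?thesis using f[of i] True ij by (simp add: good_def P_def F'_def)
    next
      case False
      then have d: "j - i \<le> d" using ij by auto
      have "F' l j = F l j" if "l \<in> {i..j}" for l using that d by (auto simp: F'_def)
      then show ?thesis using F[OF ij(1,2) d] ij by (simp add: good_def)
    qed
    moreover have "F' j j = 1" for j by (simp add: F'_def F1)
    ultimately show ?case by blast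
  qed
  from this[of N] obtain F where "\<And>j. F j j = 1" "\<And>i j. i \<le> j \<Longrightarrow> j \<le> N \<Longrightarrow> good F i j" by fastforce
  then show ?thesis unfolding solves_def good_def by (intro exI[of _ F]) auto
qed

text \<open>\<open>F\<close> is the identity at \<open>c\<close>, so \<open>F'\<close> must be
  \<open>F\<close> times the value of \<open>F'\<close> there. The difference \<open>G\<close> has
  zero derivatives, and evaluation at \<open>c\<close> identifies the constant.\<close>

lemma solution_unique:
  assumes V: "finite V" and F: "solves V A N F" "\<And>i j. i < j \<Longrightarrow> j \<le> N \<Longrightarrow> peval c (F i j) = 0"
    and F': "solves V A N F'"
  shows "i \<le> j \<Longrightarrow> j \<le> N \<Longrightarrow> F' i j = (\<Sum>l\<in>{i..j}. F i l * poly_const (peval c (F' l j)))"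
proof (induction "j - i" arbitrary: i rule: less_induct)
  case less
  define C where "C l = poly_const (peval c (F' l j))" for l
  define G where "G = F' i j - (\<Sum>l\<in>{i<..j}. F i l * C l)"
  have "poly_partial p G = 0" if p: "p \<in> V" for p
  proof -
    have "poly_partial p (\<Sum>l\<in>{i<..j}. F i l * C l) = (\<Sum>l\<in>{i<..j}. \<Sum>m | m \<in> {i<..j} \<and> m \<le> l. A p i m * F m l * C l)"
      unfolding poly_partial_sum
    proof (intro sum.cong refl)
      fix l assume l: "l \<in> {i<..j}"
      then have "{m. m \<in> {i<..j} \<and> m \<le> l} = {i<..l}" by auto
      then show "poly_partial p (F i l * C l) = (\<Sum>m | m \<in> {i<..j} \<and> m \<le> l. A p i m * F m l * C l)"
        using F(1) l less.prems p by (simp add: solves_def poly_partial_mult C_def sum_distrib_right)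
    qed
    also have "\<dots> = (\<Sum>m\<in>{i<..j}. \<Sum>l | l \<in> {i<..j} \<and> m \<le> l. A p i m * F m l * C l)"
      by (rule sum.swap_restrict) simp_all
    also have "\<dots> = (\<Sum>m\<in>{i<..j}. A p i m * F' m j)"
    proof (intro sum.cong refl)
      fix m assume m: "m \<in> {i<..j}"
      then have "{l. l \<in> {i<..j} \<and> m \<le> l} = {m..j}" by auto
      moreover have "F' m j = (\<Sum>l\<in>{m..j}. F m l * C l)" unfolding C_def by (rule less.hyps) (use m less.prems in auto)
      ultimately show "(\<Sum>l | l \<in> {i<..j} \<and> m \<le> l. A p i m * F m l * C l) = A p i m * F' m j"
        by (simp add: sum_distrib_left mult.assoc)
    qed
    also have "\<dots> = poly_partial p (F' i j)" using F' p less.prems by (simp add: solves_def)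
    finally show ?thesis by (simp add: G_def poly_partial_diff)
  qed
  moreover have "G \<in> pvars V" unfolding G_def
    by (intro pvars_diff pvars_sum pvars_mult) (use F(1) F' less.prems in \<open>auto simp: solves_def C_def pvars_const\<close>)
  ultimately have "G = poly_const (peval c G)" using partials_zero_constant[OF _ V] by blast
  moreover have "peval c (\<Sum>l\<in>{i<..j}. F i l * C l) = 0" unfolding peval_sum
    by (rule sum.neutral) (use F(2) less.prems in \<open>auto simp: peval_mult\<close>)
  ultimately have "G = C i" by (simp add: G_def C_def peval_diff)
  then have "F' i j = C i + (\<Sum>l\<in>{i<..j}. F i l * C l)" by (simp add: G_def diff_eq_eq)
  moreover have "{i..j} = insert i {i<..j}" using less.prems by auto
  ultimately show ?case using F(1) by (simp add: C_def solves_def)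
qed

lemma solves_subst:
  assumes "finite V" "solves V A N F" "\<And>i. i \<in> V \<Longrightarrow> s i \<in> pvars W"
    and B: "\<And>q i j. q \<in> W \<Longrightarrow> i < j \<Longrightarrow> j \<le> N \<Longrightarrow> B q i j = (\<Sum>p\<in>V. poly_subst s (A p i j) * poly_partial q (s p))"
  shows "solves W B N (\<lambda>i j. poly_subst s (F i j))"
  unfolding solves_def
proof (intro conjI allI impI ballI)
  fix i j assume ij: "i \<le> j \<and> j \<le> N"
  have Fij: "F i j \<in> pvars V" using assms(2) ij by (simp add: solves_def)
  then show "poly_subst s (F i j) \<in> pvars W" by (rule poly_subst_pvars[OF _ assms(3)])
  fix q assume q: "q \<in> W"
  have "poly_partial q (poly_subst s (F i j)) =
      (\<Sum>p\<in>V. \<Sum>l\<in>{i<..j}. poly_subst s (A p i l) * poly_partial q (s p) * poly_subst s (F l j))"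
    unfolding poly_subst_partial[OF Fij assms(1)]
    by (intro sum.cong refl) (use assms(2) ij in \<open>simp add: solves_def poly_subst_sum poly_subst_mult sum_distrib_left sum_distrib_right algebra_simps\<close>)
  also have "\<dots> = (\<Sum>l\<in>{i<..j}. \<Sum>p\<in>V. poly_subst s (A p i l) * poly_partial q (s p) * poly_subst s (F l j))"
    by (rule sum.swap)
  also have "\<dots> = (\<Sum>l\<in>{i<..j}. B q i l * poly_subst s (F l j))"
    by (intro sum.cong refl) (use ij in \<open>simp add: B[OF q] sum_distrib_right\<close>)
  finally show "poly_partial q (poly_subst s (F i j)) = (\<Sum>l\<in>{i<..j}. B q i l * poly_subst s (F l j))" .
qed (use assms(2) in \<open>simp add: solves_def\<close>)

section \<open>Massey products in the forms on orbit spaces\<close>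

text \<open>A one-form is determined by its components on singletons, so naturality amounts to the
  chain rule for these.\<close>

lemma A_PL_1_iff:
  "\<omega> \<in> dga_part (A_PL X) 1 \<longleftrightarrow>
    (\<forall>n \<sigma>. singular_simplex n X \<sigma> \<longrightarrow> \<omega> n \<sigma> \<in> simplex_forms n 1) \<and>
    (\<forall>n \<sigma>. \<not> singular_simplex n X \<sigma> \<longrightarrow> \<omega> n \<sigma> = 0) \<and>
    (\<forall>m n \<theta> \<sigma>. singular_simplex n X \<sigma> \<and> vertex_map m n \<theta> \<longrightarrow>
       (\<forall>q. \<omega> m (simplex_act m \<theta> \<sigma>) {q} =
         (\<Sum>i\<in>{1..n}. poly_subst (vertex_pullback m \<theta>) (\<omega> n \<sigma> {i}) * poly_partial q (vertex_pullback m \<theta> i))))"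
  (is "_ \<longleftrightarrow> ?F \<and> ?Z \<and> ?N")
proof -
  have e: "(\<omega> m (simplex_act m \<theta> \<sigma>) = form_pullback m n \<theta> (\<omega> n \<sigma>)) \<longleftrightarrow>
      (\<forall>q. \<omega> m (simplex_act m \<theta> \<sigma>) {q} =
         (\<Sum>i\<in>{1..n}. poly_subst (vertex_pullback m \<theta>) (\<omega> n \<sigma> {i}) * poly_partial q (vertex_pullback m \<theta> i)))"
    if F: "?F" and s: "singular_simplex n X \<sigma> \<and> vertex_map m n \<theta>" for m n \<theta> \<sigma>
  proof -
    have "singular_simplex m X (simplex_act m \<theta> \<sigma>)"
      using s simplex_act_singular by (auto simp: vertex_map_def)
    then have d: "deg1 (\<omega> m (simplex_act m \<theta> \<sigma>))" "deg1 (\<omega> n \<sigma>)" using F s by (auto simp: simplex_forms_1_iff)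
    note p = form_pullback_one_form[OF d(2), of m n \<theta>]
    show ?thesis
    proof
      assume eq: "\<omega> m (simplex_act m \<theta> \<sigma>) = form_pullback m n \<theta> (\<omega> n \<sigma>)"
      show "\<forall>q. \<omega> m (simplex_act m \<theta> \<sigma>) {q} =
         (\<Sum>i\<in>{1..n}. poly_subst (vertex_pullback m \<theta>) (\<omega> n \<sigma> {i}) * poly_partial q (vertex_pullback m \<theta> i))"
        unfolding eq p(2) by simp
    next
      assume "\<forall>q. \<omega> m (simplex_act m \<theta> \<sigma>) {q} =
         (\<Sum>i\<in>{1..n}. poly_subst (vertex_pullback m \<theta>) (\<omega> n \<sigma> {i}) * poly_partial q (vertex_pullback m \<theta> i))"
      then show "\<omega> m (simplex_act m \<theta> \<sigma>) = form_pullback m n \<theta> (\<omega> n \<sigma>)"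
        using deg1_eqI[OF d(1) p(1)] p(2) by simp
    qed
  qed
  have "\<omega> \<in> dga_part (A_PL X) 1 \<longleftrightarrow> ?F \<and> ?Z \<and> (\<forall>m n \<theta> \<sigma>. singular_simplex n X \<sigma> \<and> vertex_map m n \<theta> \<longrightarrow>
      \<omega> m (simplex_act m \<theta> \<sigma>) = form_pullback m n \<theta> (\<omega> n \<sigma>))"
    by (simp add: A_PL_def vertex_map_def)
  also have "\<dots> \<longleftrightarrow> ?F \<and> ?Z \<and> ?N"
  proof (intro conj_cong refl)
    assume F: "?F"
    show "(\<forall>m n \<theta> \<sigma>. singular_simplex n X \<sigma> \<and> vertex_map m n \<theta> \<longrightarrow>
      \<omega> m (simplex_act m \<theta> \<sigma>) = form_pullback m n \<theta> (\<omega> n \<sigma>)) \<longleftrightarrow> ?N"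
      by (intro all_cong1 imp_cong refl e F)
  qed
  finally show ?thesis .
qed

lemma massey_degree_ones: "i < j \<Longrightarrow> j \<le> 4 \<Longrightarrow> massey_degree [1, 1, 1, 1] i j = 1"
proof -
  assume ij: "i < j" "j \<le> 4"
  have "[1, 1, 1, 1 :: int] ! l = 1" if "l \<in> {i..<j}" for l
  proof -
    have "l = 0 \<or> l = 1 \<or> l = 2 \<or> l = 3" using that ij by auto
    then show ?thesis by (auto simp: numeral_eq_Suc)
  qed
  then show ?thesis using ij by (simp add: massey_degree_def)
qed

text \<open>All entries have degree 1, where the bar is the identity. The equations say that a
  strictly triangular matrix of one-forms has zero curvature, the corner left open.\<close>

lemma defining_system_ones:
  assumes "length xs = 4"
  shows "defining_system A [1, 1, 1, 1] xs a \<longleftrightarrow>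
    (\<forall>i j. i < j \<and> j \<le> 4 \<and> (i, j) \<noteq> (0, 4) \<longrightarrow> a i j \<in> dga_part A 1) \<and>
    (\<forall>i. 1 \<le> i \<and> i \<le> 4 \<longrightarrow> a (i - 1) i \<in> xs ! (i - 1)) \<and>
    (\<forall>i j. i + 2 \<le> j \<and> j \<le> 4 \<and> (i, j) \<noteq> (0, 4) \<longrightarrow>
      dga_diff A (a i j) = (\<Sum>l\<in>{i<..<j}. dga_mult A (a i l) (a l j)))"
proof -
  have "(\<Sum>l\<in>{i<..<j}. dga_mult A (dga_bar (massey_degree [1, 1, 1, 1] i l) (a i l)) (a l j)) =
      (\<Sum>l\<in>{i<..<j}. dga_mult A (a i l) (a l j))" if "j \<le> 4" for i j
    by (intro sum.cong refl) (use that in \<open>simp add: massey_degree_ones dga_bar_def\<close>)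
  then show ?thesis unfolding defining_system_def assms by (auto simp: massey_degree_ones)
qed

lemma massey_product_ones:
  assumes "length xs = 4"
  shows "massey_product A [1, 1, 1, 1] xs =
    {coh_class A 2 (\<Sum>l\<in>{0<..<4}. dga_mult A (a 0 l) (a l 4)) | a. defining_system A [1, 1, 1, 1] xs a}"
proof -
  have "(\<Sum>l\<in>{0<..<4}. dga_mult A (dga_bar (massey_degree [1, 1, 1, 1] 0 l) (a 0 l)) (a l 4)) =
      (\<Sum>l\<in>{0<..<4}. dga_mult A (a 0 l) (a l 4))" for a
    by (intro sum.cong refl) (simp add: massey_degree_ones dga_bar_def)
  then show ?thesis unfolding massey_product_def assms by (simp add: massey_degree_ones)
qed

lemma A_PL_diff: "dga_diff (A_PL X) \<omega> n \<sigma> = form_diff (\<omega> n \<sigma>)"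
  and A_PL_mult: "dga_mult (A_PL X) \<omega> \<eta> n \<sigma> = form_mult (\<omega> n \<sigma>) (\<eta> n \<sigma>)"
  by (simp_all add: A_PL_def)

text \<open>The corner \<open>(0, N)\<close> is included: this is a defining system completed by a
  primitive of its product.\<close>

locale flat_system = orbit_quotient H for H :: "'g::{group_add,countable} set" +
  fixes N :: nat and a :: "nat \<Rightarrow> nat \<Rightarrow> nat \<Rightarrow> ((nat \<Rightarrow> real) \<Rightarrow> nat \<Rightarrow> real) \<Rightarrow> form"
  assumes part: "i < j \<Longrightarrow> j \<le> N \<Longrightarrow> a i j \<in> dga_part (A_PL (orbit_space H)) 1"
    and flat: "i < j \<Longrightarrow> j \<le> N \<Longrightarrow>
      dga_diff (A_PL (orbit_space H)) (a i j) = (\<Sum>l\<in>{i<..<j}. dga_mult (A_PL (orbit_space H)) (a i l) (a l j))"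
begin

definition coeff :: "nat \<Rightarrow> 'g list \<Rightarrow> nat \<Rightarrow> nat \<Rightarrow> nat \<Rightarrow> rpoly" where
  "coeff n gs p i j = a i j n (push n (straight_simplex n gs)) {p}"

lemma simplex_form: "i < j \<Longrightarrow> j \<le> N \<Longrightarrow> a i j n (push n (straight_simplex n gs)) \<in> simplex_forms n 1"
  using part[of i j] push_singular[OF singular_straight] unfolding A_PL_1_iff by blast

lemma coeff_pvars: "i < j \<Longrightarrow> j \<le> N \<Longrightarrow> coeff n gs p i j \<in> pvars {1..n}"
  using simplex_form unfolding simplex_forms_1_iff coeff_def by blast

lemma coeff_flat:
  assumes ij: "i < j" "j \<le> N"
  shows "poly_partial p (coeff n gs q i j) - poly_partial q (coeff n gs p i j) =
    (\<Sum>l\<in>{i<..<j}. coeff n gs p i l * coeff n gs q l j - coeff n gs q i l * coeff n gs p l j)"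
proof -
  let ?\<sigma> = "push n (straight_simplex n gs)"
  have lt: "poly_partial p (coeff n gs q i j) - poly_partial q (coeff n gs p i j) =
      (\<Sum>l\<in>{i<..<j}. coeff n gs p i l * coeff n gs q l j - coeff n gs q i l * coeff n gs p l j)" if pq: "p < q" for p q
  proof -
    have "form_diff (a i j n ?\<sigma>) {p, q} = (\<Sum>l\<in>{i<..<j}. form_mult (a i l n ?\<sigma>) (a l j n ?\<sigma>) {p, q})"
      using arg_cong[OF flat[OF ij], of "\<lambda>\<omega>. \<omega> n ?\<sigma> {p, q}"] by (simp add: A_PL_diff A_PL_mult sum_fun)
    moreover have "form_mult (a i l n ?\<sigma>) (a l j n ?\<sigma>) {p, q} = coeff n gs p i l * coeff n gs q l j - coeff n gs q i l * coeff n gs p l j"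
      if "l \<in> {i<..<j}" for l
    proof -
      have "a i l n ?\<sigma> {} = 0" "a l j n ?\<sigma> {} = 0"
        using simplex_form[of i l n gs] simplex_form[of l j n gs] that ij by (auto simp: simplex_forms_1_iff deg1_def)
      then show ?thesis using form_mult_pair[OF pq] by (simp add: coeff_def)
    qed
    ultimately show ?thesis by (simp add: form_diff_pair[OF pq] coeff_def)
  qed
  consider "p < q" | "p = q" | "q < p" by linarith
  then show ?thesis
  proof cases
    case 3
    have "(\<Sum>l\<in>{i<..<j}. coeff n gs p i l * coeff n gs q l j - coeff n gs q i l * coeff n gs p l j) =
        - (\<Sum>l\<in>{i<..<j}. coeff n gs q i l * coeff n gs p l j - coeff n gs p i l * coeff n gs q l j)"
      by (simp add: sum_negf[symmetric])
    also have "\<dots> = - (poly_partial q (coeff n gs p i j) - poly_partial p (coeff n gs q i j))" by (simp only: lt[OF 3])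
    finally show ?thesis by simp
  qed (use lt in simp_all)
qed

lemma coeff_act:
  assumes "vertex_map m n \<theta>" "length gs = Suc n" "i < j" "j \<le> N"
  shows "coeff m (tuple_act m \<theta> gs) q i j =
    (\<Sum>p\<in>{1..n}. poly_subst (vertex_pullback m \<theta>) (coeff n gs p i j) * poly_partial q (vertex_pullback m \<theta> p))"
proof -
  have "push m (straight_simplex m (tuple_act m \<theta> gs)) = simplex_act m \<theta> (push n (straight_simplex n gs))"
    using straight_simplex_act[OF assms(1,2)] push_act[OF singular_straight assms(1)] by simp
  then show ?thesis using part[OF assms(3,4)] push_singular[OF singular_straight, of n gs] assms(1)
    unfolding coeff_def A_PL_1_iff by simp
qed

lemma solution_exists: "\<exists>F. solves {1..n} (coeff n gs) N F \<and> (\<forall>i j. i < j \<and> j \<le> N \<longrightarrow> peval c (F i j) = 0)"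
  by (rule flat_solution) (rule finite_atLeastAtMost coeff_pvars coeff_flat; assumption)+

definition edge_solution :: "'g \<Rightarrow> 'g \<Rightarrow> nat \<Rightarrow> nat \<Rightarrow> rpoly" where
  "edge_solution g h = (SOME F. solves {1..1} (coeff 1 [g, h]) N F \<and> (\<forall>i j. i < j \<and> j \<le> N \<longrightarrow> peval (vtx 0) (F i j) = 0))"

lemma edge_solution:
  shows "solves {1..1} (coeff 1 [g, h]) N (edge_solution g h)"
    "i < j \<Longrightarrow> j \<le> N \<Longrightarrow> peval (vtx 0) (edge_solution g h i j) = 0"
  using someI_ex[OF solution_exists[of 1 "[g, h]" "vtx 0"]] by (simp_all add: edge_solution_def)

text \<open>Parallel transport along the straight edge from \<open>g\<close> to \<open>h\<close>:
  the end value of the solution that starts at the identity.\<close>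

definition hol :: "'g \<Rightarrow> 'g \<Rightarrow> nat \<Rightarrow> nat \<Rightarrow> rat" where
  "hol g h i j = peval (vtx 1) (edge_solution g h i j)"

lemma hol_diag: "hol g h j j = 1"
  using edge_solution(1)[of g h] by (simp add: hol_def solves_def)

text \<open>Restricted to an edge, any solution is \<open>edge_solution\<close> times a constant on
  the right, namely its value at the initial vertex.\<close>

lemma hol_edge:
  assumes F: "solves {1..n} (coeff n gs) N F" and gs: "length gs = Suc n" and \<theta>: "vertex_map 1 n \<theta>" and ij: "i \<le> j" "j \<le> N"
  shows "peval (vtx (\<theta> 1)) (F i j) = (\<Sum>l\<in>{i..j}. hol (gs ! \<theta> 0) (gs ! \<theta> 1) i l * peval (vtx (\<theta> 0)) (F l j))"
proof -
  let ?s = "vertex_pullback 1 \<theta>" and ?g = "gs ! \<theta> 0" and ?h = "gs ! \<theta> 1"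
  have e: "tuple_act 1 \<theta> gs = [?g, ?h]" by (simp add: tuple_act_def)
  have "solves {1..1} (coeff 1 [?g, ?h]) N (\<lambda>i j. poly_subst ?s (F i j))"
  proof (rule solves_subst[OF _ F])
    fix q i j assume "i < j" "j \<le> N"
    from coeff_act[OF \<theta> gs this, of q]
    show "coeff 1 [?g, ?h] q i j = (\<Sum>p\<in>{1..n}. poly_subst ?s (coeff n gs p i j) * poly_partial q (?s p))"
      unfolding e .
  qed (simp, rule vertex_pullback_pvars)
  from solution_unique[OF _ edge_solution this ij]
  have "poly_subst ?s (F i j) =
      (\<Sum>l\<in>{i..j}. edge_solution ?g ?h i l * poly_const (peval (vtx 0) (poly_subst ?s (F l j))))" by simp
  from arg_cong[OF this, of "peval (vtx 1)"] show ?thesis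
    by (simp add: peval_sum peval_mult peval_vertex_subst hol_def)
qed

text \<open>A solution on the whole triangle \<open>[g, h, k]\<close>, equal to the identity at
  vertex 0, is transported to vertex 2 directly and through vertex 1. Transport acts on the left, so
  the later edge is the left factor.\<close>

lemma hol_trans:
  assumes ij: "i \<le> j" "j \<le> N"
  shows "hol g k i j = (\<Sum>l\<in>{i..j}. hol h k i l * hol g h l j)"
proof -
  obtain F where F: "solves {1..2} (coeff 2 [g, h, k]) N F" and F0: "\<And>i j. i < j \<Longrightarrow> j \<le> N \<Longrightarrow> peval (vtx 0) (F i j) = 0"
    using solution_exists[of 2 "[g, h, k]" "vtx 0"] by blast
  have l: "length [g, h, k] = Suc 2" by simp
  have id: "(\<Sum>l\<in>{i..j}. f l * peval (vtx 0) (F l j)) = f j" if "i \<le> j" "j \<le> N" for i j and f :: "nat \<Rightarrow> rat"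
  proof -
    have "(\<Sum>l\<in>{i..j}. f l * peval (vtx 0) (F l j)) = (\<Sum>l\<in>{i..j}. if l = j then f l else 0)"
      by (intro sum.cong refl) (use F0 F that in \<open>auto simp: solves_def\<close>)
    then show ?thesis using that by simp
  qed
  have "vertex_map 1 2 id" "vertex_map 1 2 (\<lambda>i. 2 * i)" "vertex_map 1 2 Suc"
    by (auto simp: vertex_map_def mono_on_def)
  note e = this[THEN hol_edge[OF F l]]
  have 1: "peval (vtx 1) (F i j) = hol g h i j" if "i \<le> j" "j \<le> N" for i j using e(1)[OF that] id[OF that] by simp
  have "peval (vtx 2) (F i j) = hol g k i j" using e(2)[OF ij] id[OF ij] by simp
  moreover have "peval (vtx 2) (F i j) = (\<Sum>l\<in>{i..j}. hol h k i l * peval (vtx 1) (F l j))"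
    using e(3)[OF ij] by (simp add: numeral_2_eq_2)
  ultimately show ?thesis using 1 ij by simp
qed

lemma hol_shift: "s \<in> H \<Longrightarrow> hol (s + g) (s + h) = hol g h"
proof -
  assume s: "s \<in> H"
  have "straight_simplex 1 [s + g, s + h] = gact_simplex 1 s (straight_simplex 1 [g, h])"
    using straight_shift[of "[g, h]" 1 s] by simp
  then have "coeff 1 [s + g, s + h] = coeff 1 [g, h]" by (intro ext) (simp only: coeff_def push_gact[OF s])
  then show ?thesis by (intro ext) (simp only: hol_def edge_solution_def)
qed

text \<open>On the superdiagonal the system has no lower terms, so transport is the integral of the
  form.\<close>

lemma hol_integration:
  assumes i: "Suc i \<le> N"
  shows "hol g h i (Suc i) = integration (a i (Suc i)) 1 (push 1 (straight_simplex 1 [g, h]))"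
proof -
  let ?f = "edge_solution g h i (Suc i)"
  note s = edge_solution(1)[of g h]
  have s: "?f \<in> pvars {1}" "poly_partial 1 ?f = (\<Sum>l\<in>{i<..Suc i}. coeff 1 [g, h] 1 i l * edge_solution g h l (Suc i))"
    "edge_solution g h (Suc i) (Suc i) = 1"
    using s i by (auto simp: solves_def)
  have "{i<..Suc i} = {Suc i}" by auto
  then have "a i (Suc i) 1 (push 1 (straight_simplex 1 [g, h])) {1} = poly_partial 1 ?f" using s by (simp add: coeff_def)
  from simplex_integral_edge_vtx[OF s(1), of "a i (Suc i) 1 (push 1 (straight_simplex 1 [g, h]))", OF this]
  show ?thesis using edge_solution(2)[of i "Suc i" g h] i by (simp add: integration_def hol_def)
qed

end

definition hom_cochain :: "('g \<Rightarrow> rat) \<Rightarrow> nat \<Rightarrow> 'g list \<Rightarrow> rat" where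
  "hom_cochain \<phi> = (\<lambda>q gs. if q = 1 \<and> length gs = 2 then \<phi> (gs ! 1) - \<phi> (gs ! 0) else 0)"

text \<open>\<open>D\<close> selects the entries in which the representation law holds; it is closed
  under subintervals, so those entries involve no others. The order of factors is reversed so that
  translating labels by \<open>h\<close> multiplies by a constant on the right. \<open>b\<close> is
  given on the whole group, from which vertex labels are taken, while \<open>h\<close> is confined
  to \<open>H\<close>.\<close>

locale group_connection = orbit_quotient H for H :: "'g::{group_add,countable} set" +
  fixes b :: "'g \<Rightarrow> nat \<Rightarrow> nat \<Rightarrow> rat" and D :: "nat \<Rightarrow> nat \<Rightarrow> bool"
  assumes D_down: "D i j \<Longrightarrow> i \<le> l \<Longrightarrow> l \<le> m \<Longrightarrow> m \<le> j \<Longrightarrow> D l m"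
    and b_diag: "b g j j = 1"
    and b_add: "D i j \<Longrightarrow> i \<le> j \<Longrightarrow> h \<in> H \<Longrightarrow> b (h + g) i j = (\<Sum>l\<in>{i..j}. b g i l * b h l j)"
begin

text \<open>Linear interpolation keeps the matrices unipotent and is natural in vertex maps.
  Flatness asks nothing of the interpolation: every unipotent polynomial matrix has a flat
  \<open>conn\<close>.\<close>

definition interp :: "nat \<Rightarrow> 'g list \<Rightarrow> nat \<Rightarrow> nat \<Rightarrow> rpoly" where
  "interp n gs i j = (\<Sum>k\<le>n. barycentric n k * poly_const (b (gs ! k) i j))"

lemma interp_diag: "interp n gs j j = 1"
  by (simp add: interp_def b_diag poly_const_simps barycentric_sum)

lemma interp_pvars: "interp n gs i j \<in> pvars {1..n}"
  unfolding interp_def by (intro pvars_sum pvars_mult pvars_const barycentric_pvars) simp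

lemma interp_act:
  assumes "vertex_map m n \<theta>"
  shows "interp m (tuple_act m \<theta> gs) i j = poly_subst (vertex_pullback m \<theta>) (interp n gs i j)"
proof -
  have "poly_subst (vertex_pullback m \<theta>) (interp n gs i j) =
      (\<Sum>k\<in>{..n}. \<Sum>l | l \<in> {..m} \<and> \<theta> l = k. barycentric m l * poly_const (b (gs ! \<theta> l) i j))"
    by (simp add: interp_def poly_subst_sum poly_subst_mult poly_subst_barycentric[OF assms] vertex_pullback_def sum_distrib_right)
  also have "\<dots> = (\<Sum>l\<in>{..m}. barycentric m l * poly_const (b (gs ! \<theta> l) i j))"
    by (rule sum.group) (use assms in \<open>auto simp: vertex_map_def\<close>)
  finally show ?thesis by (simp add: interp_def)
qed

lemma interp_shift:
  assumes "D i j" "i \<le> j" "h \<in> H" "length gs = Suc n"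
  shows "interp n (shift h gs) i j = (\<Sum>l\<in>{i..j}. interp n gs i l * poly_const (b h l j))"
proof -
  have "interp n (shift h gs) i j = (\<Sum>k\<le>n. \<Sum>l\<in>{i..j}. barycentric n k * poly_const (b (gs ! k) i l) * poly_const (b h l j))"
    unfolding interp_def
  proof (intro sum.cong refl)
    fix k assume "k \<in> {..n}"
    moreover have "poly_const (sum f S) = (\<Sum>l\<in>S. poly_const (f l))" for f and S :: "nat set"
      by (induction S rule: infinite_finite_induct) (simp_all add: poly_const_simps)
    ultimately show "barycentric n k * poly_const (b (shift h gs ! k) i j) =
        (\<Sum>l\<in>{i..j}. barycentric n k * poly_const (b (gs ! k) i l) * poly_const (b h l j))"
      using assms by (simp add: b_add poly_const_simps sum_distrib_left mult.assoc)
  qed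
  also have "\<dots> = (\<Sum>l\<in>{i..j}. \<Sum>k\<le>n. barycentric n k * poly_const (b (gs ! k) i l) * poly_const (b h l j))"
    by (rule sum.swap)
  finally show ?thesis by (simp add: interp_def sum_distrib_right)
qed

definition pl_conn :: "nat \<Rightarrow> nat \<Rightarrow> nat \<Rightarrow> ((nat \<Rightarrow> real) \<Rightarrow> nat \<Rightarrow> real) \<Rightarrow> form" where
  "pl_conn i j = (\<lambda>n \<sigma>. if singular_simplex n X \<sigma> then one_form (\<lambda>p. conn (interp n (vert n (lift n \<sigma>))) p i j) else 0)"

text \<open>Another lift translates the labels by some \<open>h\<close>, which multiplies the
  interpolated matrix on the right by the constant \<open>b h\<close>.\<close>

lemma pl_conn_push:
  assumes "D i j" "i < j" "singular_simplex n Etop \<tau>"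
  shows "pl_conn i j n (push n \<tau>) = one_form (\<lambda>p. conn (interp n (vert n \<tau>)) p i j)"
proof -
  obtain h where h: "h \<in> H" "lift n (push n \<tau>) = gact_simplex n h \<tau>" using lift_push[OF assms(3)] .
  have "conn (interp n (shift h (vert n \<tau>))) p i j = conn (interp n (vert n \<tau>)) p i j" for p
  proof (rule conn_mult_const[where C = "b h", OF _ _ _ assms(2)])
    fix l m assume "i \<le> l" "l \<le> m" "m \<le> j"
    then show "interp n (shift h (vert n \<tau>)) l m = (\<Sum>k\<in>{l..m}. interp n (vert n \<tau>) l k * poly_const (b h k m))"
      using D_down[OF assms(1)] h(1) by (intro interp_shift) simp_all
  qed (simp_all add: interp_diag)
  then show ?thesis using h push_singular[OF assms(3)] by (simp add: pl_conn_def vert_gact)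
qed

lemma pl_conn_part:
  assumes ij: "D i j" "i < j"
  shows "pl_conn i j \<in> dga_part (A_PL X) 1"
  unfolding A_PL_1_iff
proof (intro conjI allI impI)
  fix n \<sigma> assume "singular_simplex n X \<sigma>"
  then show "pl_conn i j n \<sigma> \<in> simplex_forms n 1"
    unfolding simplex_forms_1_iff using conn_pvars[OF interp_pvars] conn_outside[OF interp_pvars]
    by (simp add: pl_conn_def deg1_one_form)
next
  fix n \<sigma> assume "\<not> singular_simplex n X \<sigma>"
  then show "pl_conn i j n \<sigma> = 0" by (simp add: pl_conn_def)
next
  fix m n \<theta> \<sigma> q assume s: "singular_simplex n X \<sigma> \<and> vertex_map m n \<theta>"
  define \<tau> where "\<tau> = lift n \<sigma>"
  have t: "singular_simplex n Etop \<tau>" "\<sigma> = push n \<tau>" using lift[of n \<sigma>] s by (simp_all add: \<tau>_def)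
  have t': "singular_simplex m Etop (simplex_act m \<theta> \<tau>)"
    using simplex_act_singular[OF t(1)] s by (auto simp: vertex_map_def)
  have "simplex_act m \<theta> \<sigma> = push m (simplex_act m \<theta> \<tau>)" using push_act[OF t(1)] s by (simp add: t(2))
  then have "pl_conn i j m (simplex_act m \<theta> \<sigma>) {q} =
      conn (\<lambda>i j. poly_subst (vertex_pullback m \<theta>) (interp n (vert n \<tau>) i j)) q i j"
    using s by (simp add: pl_conn_push[OF ij t'] vert_act[OF conjunct2[OF s]] interp_act[OF conjunct2[OF s], symmetric])
  also have "\<dots> = (\<Sum>p\<in>{1..n}. poly_subst (vertex_pullback m \<theta>) (conn (interp n (vert n \<tau>)) p i j) * poly_partial q (vertex_pullback m \<theta> p))"
    by (rule conn_subst[OF interp_pvars]) simp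
  finally show "pl_conn i j m (simplex_act m \<theta> \<sigma>) {q} =
      (\<Sum>p\<in>{1..n}. poly_subst (vertex_pullback m \<theta>) (pl_conn i j n \<sigma> {p}) * poly_partial q (vertex_pullback m \<theta> p))"
    by (simp add: t(2) pl_conn_push[OF ij t(1)])
qed

text \<open>On each simplex this is \<open>conn_flat\<close>. The law selected by \<open>D\<close>
  governs naturality, that is, membership in the algebra of forms.\<close>

lemma pl_conn_diff:
  assumes ij: "i < j"
  shows "dga_diff (A_PL X) (pl_conn i j) = (\<Sum>l\<in>{i<..<j}. dga_mult (A_PL X) (pl_conn i l) (pl_conn l j))"
proof (intro ext)
  fix n \<sigma> K
  have "form_diff (pl_conn i j n \<sigma>) = (\<Sum>l\<in>{i<..<j}. form_mult (pl_conn i l n \<sigma>) (pl_conn l j n \<sigma>))"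
  proof (cases "singular_simplex n X \<sigma>")
    case False
    then show ?thesis by (simp add: pl_conn_def form_diff_def fun_eq_iff)
  next
    case s: True
    let ?F = "interp n (vert n (lift n \<sigma>))"
    have d: "deg1 (pl_conn i j n \<sigma>)" for i j using s by (simp add: pl_conn_def deg1_one_form)
    show ?thesis
    proof (rule form_pairs_eqI)
      fix p q :: nat assume pq: "p < q"
      have "pl_conn i j n \<sigma> {} = 0" for i j using d[of i j] by (simp add: deg1_def)
      then show "form_diff (pl_conn i j n \<sigma>) {p, q} = (\<Sum>l\<in>{i<..<j}. form_mult (pl_conn i l n \<sigma>) (pl_conn l j n \<sigma>)) {p, q}"
        using conn_flat[of ?F, OF interp_diag ij, of p q] s
        by (simp add: form_diff_pair[OF pq] form_mult_pair[OF pq] sum_fun) (simp add: pl_conn_def)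
    qed (simp_all add: form_diff_not_pair d form_mult_not_pair sum_fun)
  qed
  then show "dga_diff (A_PL X) (pl_conn i j) n \<sigma> K = (\<Sum>l\<in>{i<..<j}. dga_mult (A_PL X) (pl_conn i l) (pl_conn l j)) n \<sigma> K"
    by (simp add: A_PL_diff A_PL_mult sum_fun)
qed

lemma integration_pl_conn:
  "integration (pl_conn i (Suc i)) = from_group (hom_cochain (\<lambda>g. b g i (Suc i)))"
proof (intro ext)
  fix n \<sigma>
  show "integration (pl_conn i (Suc i)) n \<sigma> = from_group (hom_cochain (\<lambda>g. b g i (Suc i))) n \<sigma>"
  proof (cases "singular_simplex n X \<sigma> \<and> n = 1")
    case False
    then show ?thesis
      by (auto simp: integration_def pl_conn_def from_group_def hom_cochain_def deg1_one_form
        simplex_integral_deg1[of "one_form _"] simplex_integral_def[of _ 0] simplex_integral_def[of _ "0 :: form"] split: if_splits)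
  next
    case True
    then have n: "n = 1" and s: "singular_simplex 1 X \<sigma>" by auto
    define gs where "gs = vert 1 (lift 1 \<sigma>)"
    let ?f = "interp 1 gs i (Suc i)"
    have f: "?f \<in> pvars {1}" using interp_pvars[of 1 gs] by simp
    have "{i<..<Suc i} = {}" by auto
    then have "pl_conn i (Suc i) 1 \<sigma> {1} = poly_partial 1 ?f"
      using s by (simp add: pl_conn_def conn.simps[of _ _ i "Suc i"] gs_def)
    from simplex_integral_edge_vtx[OF f, of "pl_conn i (Suc i) 1 \<sigma>", OF this]
    have "integration (pl_conn i (Suc i)) 1 \<sigma> = b (gs ! 1) i (Suc i) - b (gs ! 0) i (Suc i)"
      by (simp add: integration_def interp_def peval_add peval_mult peval_barycentric)
    then show ?thesis using s by (simp add: n from_group_def hom_cochain_def gs_def)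
  qed
qed

end

section \<open>Covering maps between orbit spaces\<close>

definition cover_map :: "'g::{group_add,countable} set \<Rightarrow> 'g set \<Rightarrow> (nat \<Rightarrow> real) \<Rightarrow> nat \<Rightarrow> real" where
  "cover_map H K y = proj H (SOME t. t \<in> steps \<and> proj K t = y)"

lemma cover_map_proj:
  assumes "subgrp H" "subgrp K" "K \<subseteq> H" "t \<in> steps"
  shows "cover_map H K (proj K t) = proj H t"
proof -
  define t' where "t' = (SOME t'. t' \<in> steps \<and> proj K t' = proj K t)"
  have t': "t' \<in> steps \<and> proj K t' = proj K t" unfolding t'_def by (rule someI[of _ t]) (use assms(4) in simp)
  then obtain h where "h \<in> K" "t' = gact h t" using proj_eqD[OF assms(2,4), of t'] by metis
  then have "proj H t' = proj H t" using proj_gact[OF assms(1)] assms(3) by auto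
  then show ?thesis by (simp add: cover_map_def t'_def)
qed

lemma continuous_cover_map:
  assumes "subgrp H" "subgrp K" "K \<subseteq> H"
  shows "continuous_map (orbit_space K) (orbit_space H) (cover_map H K)"
proof (rule continuous_orbit_space_map)
  show "continuous_map Etop (orbit_space H) (cover_map H K \<circ> proj K)"
    by (rule continuous_map_eq[OF continuous_proj[of H]]) (use cover_map_proj[OF assms] in simp)
qed

context orbit_quotient
begin

lemma from_group_0: "from_group 0 = 0"
  by (simp add: from_group_def fun_eq_iff)

lemma from_group_cocycle: "e \<in> G.Zc p \<Longrightarrow> from_group e \<in> cocycles (singular_cochains X) p"
  unfolding singular_cochains_eq S.Z_iff G.Zc_iff
  using from_group_part[of e p] from_group_diff[of e p] from_group_0 by (simp add: singular_cochains_eq)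

lemma from_group_class: "e \<in> G.Zc p \<Longrightarrow> from_group e \<in> coh_class (singular_cochains X) p (from_group e)"
  using S.coh_class_self[of "from_group e" p] from_group_cocycle[of e p] by (simp add: singular_cochains_eq)

end

lemma ipart_mono: "K \<subseteq> H \<Longrightarrow> ipart H p \<subseteq> ipart K p"
  unfolding ss_part_def by blast

lemma Zc_mono:
  assumes "K \<subseteq> H"
  shows "cocycles (inv_cochains H) p \<subseteq> cocycles (inv_cochains K) p"
  using ipart_mono[OF assms, of p] by (auto simp: inv_cochains_def cocycles_def)

locale orbit_cover = base: orbit_quotient H + cover: orbit_quotient K for H K :: "'g::{group_add,countable} set" +
  assumes KH: "K \<subseteq> H"
begin

abbreviation "cov \<equiv> cover_map H K"

text \<open>A lift of a simplex of the covering space is also a lift of its image in the base, so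
  both sides read the same labels.\<close>

lemma pullback_from_group:
  assumes c: "c \<in> ipart H p"
  shows "cochain_pullback (orbit_space K) cov (base.from_group c) = cover.from_group c"
proof (intro ext)
  fix q \<sigma>
  show "cochain_pullback (orbit_space K) cov (base.from_group c) q \<sigma> = cover.from_group c q \<sigma>"
  proof (cases "singular_simplex q (orbit_space K) \<sigma>")
    case False
    then show ?thesis by (simp add: cochain_pullback_def cover.from_group_def)
  next
    case True
    define \<tau> where "\<tau> = cover.lift q \<sigma>"
    have t: "singular_simplex q Etop \<tau>" "simplex_map q (proj K) \<tau> = \<sigma>"
      using cover.lift[OF True] by (simp_all add: \<tau>_def)
    have "simplex_map q cov \<sigma> = simplex_map q (proj H) \<tau>"
      unfolding t(2)[symmetric] simplex_map_def
      using singular_steps[OF t(1)] cover_map_proj[OF base.subgrp cover.subgrp KH] by (auto simp: restrict_def)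
    then show ?thesis
      using True base.from_group_push[OF c t(1)] by (simp add: cochain_pullback_def cover.from_group_def \<tau>_def)
  qed
qed

lemma from_group_pullback_class:
  assumes "c \<in> cocycles (inv_cochains H) p"
  shows "cover.from_group c \<in> cohomology_pullback (orbit_space K) cov p (coh_class (singular_cochains (orbit_space H)) p (base.from_group c))"
proof -
  have "c \<in> ipart H p" using assms base.G.Zc_iff by blast
  moreover have "cover.from_group c \<in> coh_class (singular_cochains (orbit_space K)) p (cover.from_group c)"
    using assms Zc_mono[OF KH] by (intro cover.from_group_class) blast
  ultimately show ?thesis unfolding cohomology_pullback_def coh_map_def
    using base.from_group_class[OF assms] pullback_from_group[of c p] by (intro UN_I[of "base.from_group c"]) simp_all
qed

text \<open>Both dualities use one functional \<open>I\<close>. An \<open>H\<close>-invariant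
  cochain with integral 1 is \<open>K\<close>-invariant too, and still has integral 1 as the
  pullback of its class.\<close>

lemma nonzero_degree_cover:
  assumes "duality (inv_cochains H) (int n) I" "duality (inv_cochains K) (int n) I"
  shows "nonzero_degree n (orbit_space K) (orbit_space H) cov"
proof -
  obtain e where e: "e \<in> cocycles (inv_cochains H) (int n)" "I e = 1" using base.G.duality_top(1)[OF assms(1)] by blast
  let ?x = "coh_class (singular_cochains (orbit_space H)) (int n) (base.from_group e)"
  have "cohomology_pullback (orbit_space K) cov (int n) ?x \<noteq> coh_class (singular_cochains (orbit_space K)) (int n) 0"
  proof
    assume "cohomology_pullback (orbit_space K) cov (int n) ?x = coh_class (singular_cochains (orbit_space K)) (int n) 0"
    then have "cover.from_group e \<in> coboundaries (singular_cochains (orbit_space K)) (int n)"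
      using from_group_pullback_class[OF e(1)] by (auto simp: coh_class_def)
    then have "I (cover.to_group (cover.from_group e)) = 0"
      using cover.duality_orbit_space[OF assms(2)] by (simp add: duality_def)
    moreover have "e \<in> ipart K (int n)" using e(1) ipart_mono[OF KH] base.G.Zc_iff by blast
    ultimately show False using e(2) cover.to_from_group by simp
  qed
  moreover have "?x \<in> singular_cohomology (orbit_space H) (int n)"
    using base.from_group_cocycle[OF e(1)] by (simp add: cohomology_def)
  ultimately show ?thesis unfolding nonzero_degree_def by blast
qed

end

lemma hom_cochain_cocycle:
  assumes H: "subgrp H" and \<phi>: "\<And>h g. h \<in> H \<Longrightarrow> \<phi> (h + g) = \<phi> h + \<phi> g"
  shows "hom_cochain \<phi> \<in> cocycles (inv_cochains H) 1"
proof -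
  interpret group_cochains H by unfold_locales (rule H)
  have "hom_cochain \<phi> \<in> ipart H 1" unfolding ss_part_def tuples_def
    using \<phi> by (auto simp: hom_cochain_def split: if_splits)
  moreover have "gdiff (hom_cochain \<phi>) q s = 0" for q s
  proof (cases "q = 2 \<and> length s = 3")
    case True
    then have "{..q} = {0, 1, 2}" by auto
    then show ?thesis using True
      by (simp add: ss_diff_def tuples_def hom_cochain_def skip_def tuple_act_def)
  next
    case False
    then show ?thesis by (auto simp: ss_diff_def tuples_def hom_cochain_def tuple_act_def)
  qed
  then have "gdiff (hom_cochain \<phi>) = 0" by (simp add: fun_eq_iff)
  ultimately show ?thesis by (simp add: Zc_iff)
qed

section \<open>Exactness and evaluation of one-forms\<close>

lemma form_diff_add: "form_diff (\<omega> + \<eta>) = form_diff \<omega> + form_diff \<eta>"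
  by (simp add: form_diff_def fun_eq_iff poly_partial_add sum.distrib algebra_simps)

lemma form_diff_uminus: "form_diff (- \<omega>) = - form_diff \<omega>"
  by (simp add: form_diff_def fun_eq_iff poly_partial_uminus sum_negf)

lemma A_PL_diff_add: "dga_diff (A_PL X) (a + b) = dga_diff (A_PL X) a + dga_diff (A_PL X) b"
  and A_PL_diff_uminus: "dga_diff (A_PL X) (- a) = - dga_diff (A_PL X) a"
  by (simp_all add: A_PL_def fun_eq_iff form_diff_add form_diff_uminus)

lemma A_PL_1_add: "a \<in> dga_part (A_PL X) 1 \<Longrightarrow> b \<in> dga_part (A_PL X) 1 \<Longrightarrow> a + b \<in> dga_part (A_PL X) 1"
  unfolding A_PL_1_iff simplex_forms_1_iff deg1_def
  by (auto simp: poly_subst_add sum.distrib distrib_right intro: pvars_add)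

lemma A_PL_1_uminus: "a \<in> dga_part (A_PL X) 1 \<Longrightarrow> - a \<in> dga_part (A_PL X) 1"
  unfolding A_PL_1_iff simplex_forms_1_iff deg1_def
  by (auto simp: poly_subst_uminus sum_negf intro: pvars_uminus)

lemma coh_class_exact:
  assumes a: "a \<in> dga_part (A_PL X) 1"
  shows "coh_class (A_PL X) 2 (dga_diff (A_PL X) a) = coh_class (A_PL X) 2 0"
proof -
  have "b - dga_diff (A_PL X) a \<in> coboundaries (A_PL X) 2 \<longleftrightarrow> b - 0 \<in> coboundaries (A_PL X) 2" for b
  proof
    assume "b - dga_diff (A_PL X) a \<in> coboundaries (A_PL X) 2"
    then obtain c where c: "c \<in> dga_part (A_PL X) 1" "b - dga_diff (A_PL X) a = dga_diff (A_PL X) c"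
      by (auto simp: coboundaries_def)
    then have "b = dga_diff (A_PL X) (c + a)" by (simp add: A_PL_diff_add diff_eq_eq)
    then show "b - 0 \<in> coboundaries (A_PL X) 2" using A_PL_1_add[OF c(1) a] by (auto simp: coboundaries_def)
  next
    assume "b - 0 \<in> coboundaries (A_PL X) 2"
    then obtain c where c: "c \<in> dga_part (A_PL X) 1" "b = dga_diff (A_PL X) c"
      by (auto simp: coboundaries_def)
    then have "b - dga_diff (A_PL X) a = dga_diff (A_PL X) (c + - a)" by (simp only: A_PL_diff_add A_PL_diff_uminus) simp
    then show "b - dga_diff (A_PL X) a \<in> coboundaries (A_PL X) 2"
      using A_PL_1_add[OF c(1) A_PL_1_uminus[OF a]] by (auto simp: coboundaries_def)
  qed
  then show ?thesis by (auto simp: coh_class_def)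
qed

text \<open>0 represents the class on the right, hence also the one on the left, so
  \<open>0 - \<mu>\<close> is a coboundary; the sign is moved to its primitive.\<close>

lemma coh_class_zero_exact:
  assumes "coh_class (A_PL X) 2 \<mu> = coh_class (A_PL X) 2 0"
  shows "\<exists>a\<in>dga_part (A_PL X) 1. dga_diff (A_PL X) a = \<mu>"
proof -
  have d0: "dga_diff (A_PL X) 0 = 0" using A_PL_diff_add[of X 0 0] by simp
  have p0: "0 \<in> dga_part (A_PL X) 1" by (simp add: A_PL_1_iff simplex_forms_1_iff deg1_def)
  have p02: "0 \<in> dga_part (A_PL X) 2"
    by (simp add: A_PL_def simplex_forms_def form_pullback_def)
  have "0 \<in> coboundaries (A_PL X) 2" using p0 d0 by (force simp: coboundaries_def)
  then have "0 \<in> coh_class (A_PL X) 2 0" using p02 d0 by (simp add: coh_class_def cocycles_def)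
  then have "0 - \<mu> \<in> coboundaries (A_PL X) 2" unfolding assms[symmetric] by (simp add: coh_class_def)
  then obtain a where a: "a \<in> dga_part (A_PL X) 1" "0 - \<mu> = dga_diff (A_PL X) a" by (auto simp: coboundaries_def)
  have "\<mu> = - (0 - \<mu>)" by simp
  then have "\<mu> = dga_diff (A_PL X) (- a)" unfolding a(2) A_PL_diff_uminus .
  then show ?thesis using A_PL_1_uminus[OF a(1)] by blast
qed

text \<open>When the whole group acts, all straight vertices have the same image, so straight edges
  are loops. A coboundary of a 0-cochain vanishes on loops, and the integral depends on the class
  only.\<close>

lemma (in orbit_quotient) integration_PL_class:
  assumes H: "H = UNIV" and \<omega>: "\<omega> \<in> PL_class X 1 (coh_class (singular_cochains X) 1 (from_group c))"
    and c: "c \<in> ipart H 1"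
  shows "integration \<omega> 1 (push 1 (straight_simplex 1 [g, h])) = c 1 [g, h]"
proof -
  let ?\<sigma> = "push 1 (straight_simplex 1 [g, h])"
  have "integration \<omega> - from_group c \<in> coboundaries (singular_cochains X) 1"
    using \<omega> by (simp add: PL_class_def coh_class_def)
  then obtain e where "integration \<omega> - from_group c = ss_diff (sing X) simplex_act e"
    by (auto simp: coboundaries_def singular_cochains_eq)
  then have "integration \<omega> 1 ?\<sigma> = from_group c 1 ?\<sigma> + ss_diff (sing X) simplex_act e 1 ?\<sigma>"
    by (simp add: fun_eq_iff diff_eq_eq add.commute)
  moreover have "ss_diff (sing X) simplex_act e 1 ?\<sigma> = 0"
  proof -
    have "simplex_act 0 (skip k) ?\<sigma> = push 0 (straight_simplex 0 [0])" for k
    proof -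
      have "simplex_act 0 (skip k) ?\<sigma> = push 0 (straight_simplex 0 (tuple_act 0 (skip k) [g, h]))"
        using push_act[OF singular_straight vertex_map_skip[of 0 k], of "[g, h]"] straight_simplex_act[OF vertex_map_skip[of 0 k], of "[g, h]"]
        by simp
      also have "tuple_act 0 (skip k) [g, h] = shift ([g, h] ! skip k 0) [0]" by (simp add: tuple_act_def)
      also have "push 0 (straight_simplex 0 \<dots>) = push 0 (straight_simplex 0 [0])"
      proof -
        have "straight_simplex 0 (shift u [0]) = gact_simplex 0 u (straight_simplex 0 [0])" for u :: 'g
          by (rule straight_shift) simp
        from this[of "[g, h] ! skip k 0"] show ?thesis by (simp only: push_gact[of "[g, h] ! skip k 0", unfolded H, OF UNIV_I] H)
      qed
      finally show ?thesis .
    qed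
    then show ?thesis by (simp add: ss_diff_def)
  qed
  moreover have "from_group c 1 ?\<sigma> = c 1 [g, h]"
    using from_group_push[OF c singular_straight] vert_straight[of "[g, h]" 1] by simp
  ultimately show ?thesis by simp
qed

lemma less_4: "i < 4 \<Longrightarrow> i = 0 \<or> i = 1 \<or> i = 2 \<or> i = (3::nat)"
  by linarith

lemma PL_classes:
  "map2 (PL_class X) [1, 1, 1, 1] [a, b, c, d] = [PL_class X 1 a, PL_class X 1 b, PL_class X 1 c, PL_class X 1 d]"
  by simp

lemma (in group_connection) defining_system_pl_conn:
  assumes D: "\<And>i j. i < j \<Longrightarrow> j \<le> 4 \<Longrightarrow> (i, j) \<noteq> (0, 4) \<Longrightarrow> D i j"
    and c: "\<And>i. i < 4 \<Longrightarrow> from_group (hom_cochain (\<lambda>g. b g i (Suc i))) \<in> c i"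
  shows "defining_system (A_PL X) [1, 1, 1, 1] [PL_class X 1 (c 0), PL_class X 1 (c 1), PL_class X 1 (c 2), PL_class X 1 (c 3)] pl_conn"
proof -
  let ?xs = "[PL_class X 1 (c 0), PL_class X 1 (c 1), PL_class X 1 (c 2), PL_class X 1 (c 3)]"
  have xs: "length ?xs = 4" by simp
  have cls: "pl_conn i (Suc i) \<in> PL_class X 1 (c i)" if i: "i < 4" for i
  proof -
    have "D i (Suc i)" using i by (intro D) auto
    then have "pl_conn i (Suc i) \<in> dga_part (A_PL X) 1" by (rule pl_conn_part) simp
    moreover have "{i<..<Suc i} = {}" by auto
    then have "dga_diff (A_PL X) (pl_conn i (Suc i)) = 0" using pl_conn_diff[of i "Suc i"] by simp
    ultimately show ?thesis using c[OF i] by (simp add: PL_class_def cocycles_def integration_pl_conn)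
  qed
  show ?thesis unfolding defining_system_ones[OF xs]
  proof (intro conjI allI impI)
    fix i j :: nat assume "i < j \<and> j \<le> 4 \<and> (i, j) \<noteq> (0, 4)"
    then show "pl_conn i j \<in> dga_part (A_PL X) 1" using D pl_conn_part by blast
  next
    fix i :: nat assume "1 \<le> i \<and> i \<le> 4"
    then obtain k where k: "i = Suc k" "k < 4" by (cases i) auto
    show "pl_conn (i - 1) i \<in> ?xs ! (i - 1)" using cls[OF k(2)] less_4[OF k(2)] k(1) by auto
  next
    fix i j :: nat assume "i + 2 \<le> j \<and> j \<le> 4 \<and> (i, j) \<noteq> (0, 4)"
    then show "dga_diff (A_PL X) (pl_conn i j) = (\<Sum>l\<in>{i<..<j}. dga_mult (A_PL X) (pl_conn i l) (pl_conn l j))"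
      by (intro pl_conn_diff) simp
  qed
qed

section \<open>The two unipotent representations\<close>

text \<open>The action of the affine map \<open>F \<mapsto> T\<^sub>x (1 + u D) F + (F\<^sub>0, \<dots>, F\<^sub>3)\<close> on polynomials of degree at most
  three in a variable \<open>s\<close>, in the basis \<open>1, s, s\<^sup>2, s\<^sup>3\<close>, where \<open>T\<^sub>x F(s) = F(s + x)\<close> and \<open>D F = F'' / 2\<close>.\<close>

definition amat :: "rat \<Rightarrow> rat \<Rightarrow> rat \<Rightarrow> rat \<Rightarrow> rat \<Rightarrow> rat \<Rightarrow> nat \<Rightarrow> nat \<Rightarrow> rat" where
  "amat x u F0 F1 F2 F3 i j = (if i = j then 1
     else if i = 0 \<and> j = 1 then x else if i = 0 \<and> j = 2 then x^2 + u else if i = 0 \<and> j = 3 then x^3 + 3 * u * x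
     else if i = 1 \<and> j = 2 then 2 * x else if i = 1 \<and> j = 3 then 3 * x^2 + 3 * u else if i = 2 \<and> j = 3 then 3 * x
     else if i = 0 \<and> j = 4 then F0 else if i = 1 \<and> j = 4 then F1 else if i = 2 \<and> j = 4 then F2
     else if i = 3 \<and> j = 4 then F3 else 0)"

text \<open>\<open>u\<close> and \<open>h\<close> enter only the constant term of \<open>f\<close>,
  and the sign fixes \<open>f\<close>. So the matrix of the translation with the higher coefficients
  of \<open>f\<close> obeys the representation law in every entry but the corner, which is set to
  0.\<close>

definition rho_base :: "pgroup \<Rightarrow> nat \<Rightarrow> nat \<Rightarrow> rat" where
  "rho_base g = amat (of_int (px g)) 0 0 (of_int (f1 g)) (of_int (f2 g)) (of_int (f3 g))"

text \<open>In the absence of the sign the sum \<open>f + h\<close> transforms by a single affine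
  law, which admits its constant term as corner. The cubic coefficient is \<open>f3\<close> alone,
  \<open>h\<close> having degree at most two.\<close>

definition rho_cover :: "pgroup \<Rightarrow> nat \<Rightarrow> nat \<Rightarrow> rat" where
  "rho_cover g = amat (of_int (px g)) (of_int (pu g)) (of_int (f0 g + h0 g)) (of_int (f1 g + h1 g))
     (of_int (f2 g + h2 g)) (of_int (f3 g))"

lemma pairs_le_4:
  fixes i j :: nat
  assumes "i \<le> j" "j \<le> 4"
  shows "(i, j) \<in> {(0,0), (0,1), (0,2), (0,3), (0,4), (1,1), (1,2), (1,3), (1,4), (2,2), (2,3), (2,4), (3,3), (3,4), (4,4)}"
proof -
  have "j = 0 \<or> j = 1 \<or> j = 2 \<or> j = 3 \<or> j = 4" "i = 0 \<or> i = 1 \<or> i = 2 \<or> i = 3 \<or> i = 4" using assms by linarith+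
  then show ?thesis using assms by (elim disjE) simp_all
qed

lemma sum_intervals:
  fixes f :: "nat \<Rightarrow> 'a::comm_monoid_add"
  shows "sum f {0..1} = f 0 + f 1" "sum f {0..2} = f 0 + (f 1 + f 2)" "sum f {0..3} = f 0 + (f 1 + (f 2 + f 3))"
    "sum f {0..4} = f 0 + (f 1 + (f 2 + (f 3 + f 4)))" "sum f {1..2} = f 1 + f 2" "sum f {1..3} = f 1 + (f 2 + f 3)"
    "sum f {1..4} = f 1 + (f 2 + (f 3 + f 4))" "sum f {2..3} = f 2 + f 3" "sum f {2..4} = f 2 + (f 3 + f 4)"
    "sum f {3..4} = f 3 + f 4"
  by (simp_all add: numeral_eq_Suc sum.atLeast_Suc_atMost add.assoc)

lemmas sum_intervals' = sum_intervals[unfolded One_nat_def]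

lemma rho_base_add:
  assumes "i \<le> j" "j \<le> 4" "(i, j) \<noteq> (0, 4)"
  shows "rho_base (g + h) i j = (\<Sum>l\<in>{i..j}. rho_base g i l * rho_base h l j)"
  using pairs_le_4[OF assms(1,2)] assms(3)
  by (auto simp: sum_intervals sum_intervals' rho_base_def amat_def plus_pgroup_def Let_def algebra_simps
      power2_eq_square power3_eq_cube)

lemma rho_cover_add:
  assumes "i \<le> j" "j \<le> 4" "\<not> pe g"
  shows "rho_cover (g + h) i j = (\<Sum>l\<in>{i..j}. rho_cover g i l * rho_cover h l j)"
  using pairs_le_4[OF assms(1,2)] assms(3)
  by (auto simp: sum_intervals sum_intervals' rho_cover_def amat_def plus_pgroup_def esgn_def Let_def algebra_simps
      power2_eq_square power3_eq_cube)

text \<open>The inverse reverses the order of factors, as the law of \<open>group_connection\<close>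
  requires.\<close>

definition b_base :: "pgroup \<Rightarrow> nat \<Rightarrow> nat \<Rightarrow> rat" where
  "b_base g = rho_base (- g)"

text \<open>The vertices of the simplices range over the whole group, so the representation of the subgroup is extended
  along coset representatives.\<close>

definition b_cover :: "pgroup \<Rightarrow> nat \<Rightarrow> nat \<Rightarrow> rat" where
  "b_cover g = rho_cover (- (if pe g then g + sign_elt else g))"

abbreviation "even_part \<equiv> {g. \<not> pe g}"

lemma subgrp_even: "subgrp even_part" and subgrp_UNIV: "subgrp UNIV"
  by (auto simp: subgrp_def plus_pgroup_def uminus_pgroup_def zero_pgroup_def Let_def)

interpretation base: group_connection UNIV b_base "\<lambda>i j. j \<le> 4 \<and> (i, j) \<noteq> (0, 4)"
proof
  fix i j :: nat and h g :: pgroup assume "j \<le> 4 \<and> (i, j) \<noteq> (0, 4)" "i \<le> j"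
  then show "b_base (h + g) i j = (\<Sum>l\<in>{i..j}. b_base g i l * b_base h l j)"
    unfolding b_base_def minus_add by (intro rho_base_add) simp_all
qed (auto simp: subgrp_UNIV b_base_def rho_base_def amat_def)

interpretation cover: group_connection even_part b_cover "\<lambda>i j. j \<le> 4"
proof
  fix i j :: nat and h g :: pgroup assume ij: "j \<le> 4" "i \<le> j" and h: "h \<in> even_part"
  define n where "n = (if pe g then g + sign_elt else g)"
  have pe: "pe (h + g) = pe g" using h by (simp add: plus_pgroup_def Let_def)
  have "(if pe (h + g) then h + g + sign_elt else h + g) = h + n" by (simp add: pe n_def add.assoc)
  then have "b_cover (h + g) = rho_cover (- n + - h)" by (simp only: b_cover_def minus_add)
  moreover have "\<not> pe (- n)" by (simp add: n_def plus_pgroup_def uminus_pgroup_def sign_elt_def Let_def)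
  moreover have "b_cover h = rho_cover (- h)" using h by (simp add: b_cover_def)
  ultimately show "b_cover (h + g) i j = (\<Sum>l\<in>{i..j}. b_cover g i l * b_cover h l j)"
    using rho_cover_add[OF ij(2,1), of "- n" "- h"] by (simp add: b_cover_def n_def)
qed (auto simp: subgrp_even b_cover_def rho_cover_def amat_def)

interpretation orbit_cover UNIV even_part
  by unfold_locales simp

text \<open>The four characters giving the degree one classes. Three are multiples of
  \<open>px\<close>, the factors 1, 2, 3 being the superdiagonal of the translation matrix on powers
  of \<open>s\<close>; the last is \<open>- f3\<close>.\<close>

definition lam :: "nat \<Rightarrow> pgroup \<Rightarrow> rat" where
  "lam i g = b_base g i (Suc i)"

lemma lam_simps: "lam 0 g = - of_int (px g)" "lam (Suc 0) g = - 2 * of_int (px g)" "lam 1 g = - 2 * of_int (px g)" "lam 2 g = - 3 * of_int (px g)" "lam 3 g = - of_int (f3 g)"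
  by (simp_all add: lam_def b_base_def rho_base_def amat_def uminus_pgroup_def Let_def)

text \<open>Both matrices have the same superdiagonal, and passing to the coset representative
  changes neither \<open>px\<close> nor \<open>f3\<close>. Hence the connection on the cover
  represents the pulled back classes.\<close>

lemma lam_cover: "i < 4 \<Longrightarrow> b_cover g i (Suc i) = lam i g"
  using less_4[of i] by (auto simp: lam_def b_base_def rho_base_def b_cover_def rho_cover_def amat_def
      plus_pgroup_def uminus_pgroup_def sign_elt_def Let_def)

lemma lam_add: "i < 4 \<Longrightarrow> lam i (g + h) = lam i g + lam i h"
  using less_4[of i] by (auto simp: lam_simps plus_pgroup_def Let_def algebra_simps)

lemma lam_cocycle: "i < 4 \<Longrightarrow> hom_cochain (lam i) \<in> cocycles (inv_cochains UNIV) 1"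
  by (rule hom_cochain_cocycle[OF subgrp_UNIV]) (simp add: lam_add)

abbreviation "baseX \<equiv> orbit_space (UNIV :: pgroup set)"
abbreviation "coverY \<equiv> orbit_space even_part"


section \<open>No unipotent representation extends the characters\<close>

text \<open>An entry of the square is twice the entry of \<open>M\<close> plus products of entries
  nearer the diagonal, which vanish by induction. The value \<open>c = 1\<close> serves for an
  idempotent, \<open>c = 0\<close> for an involution.\<close>

lemma unipotent_square_trivial:
  fixes M :: "nat \<Rightarrow> nat \<Rightarrow> rat"
  assumes diag: "\<And>j. M j j = 1" and c: "c \<noteq> 2"
    and sq: "\<And>i j. i < j \<Longrightarrow> j \<le> N \<Longrightarrow> (\<Sum>l\<in>{i..j}. M i l * M l j) = c * M i j"
  shows "i < j \<Longrightarrow> j \<le> N \<Longrightarrow> M i j = 0"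
proof (induction "j - i" arbitrary: i j rule: less_induct)
  case less
  have e: "{i..j} = insert i (insert j {i<..<j})" using less.prems by auto
  have "(\<Sum>l\<in>{i<..<j}. M i l * M l j) = 0"
    by (rule sum.neutral) (use less in auto)
  then have "(\<Sum>l\<in>{i..j}. M i l * M l j) = 2 * M i j"
    unfolding e using less.prems diag by simp
  then show ?case using sq[OF less.prems] c by simp
qed

lemma no_unipotent_representation:
  fixes r :: "pgroup \<Rightarrow> nat \<Rightarrow> nat \<Rightarrow> rat"
  assumes add: "\<And>h g i j. i \<le> j \<Longrightarrow> j \<le> 4 \<Longrightarrow> r (h + g) i j = (\<Sum>l\<in>{i..j}. r g i l * r h l j)"
    and diag: "\<And>g j. r g j j = 1"
    and super: "\<And>i g. i < 4 \<Longrightarrow> r g i (Suc i) = lam i g"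
  shows False
proof -
  define triv where "triv g \<longleftrightarrow> (\<forall>i j. i < j \<and> j \<le> 4 \<longrightarrow> r g i j = 0)" for g
  have triv_mult: "r (h + g) i j = r h i j" if "triv g" "i \<le> j" "j \<le> 4" for g h i j
  proof -
    have "r (h + g) i j = (\<Sum>l\<in>{i..j}. if l = i then r h l j else 0)"
      unfolding add[OF that(2,3)] by (intro sum.cong refl) (use that diag in \<open>auto simp: triv_def\<close>)
    then show ?thesis using that by simp
  qed
  have zero: "triv 0"
    unfolding triv_def
  proof (intro allI impI)
    fix i j :: nat assume "i < j \<and> j \<le> 4"
    then show "r 0 i j = 0"
    proof (intro unipotent_square_trivial[where c = 1 and N = 4 and M = "r 0"])
      fix i j :: nat assume "i < j" "j \<le> 4"
      then show "(\<Sum>l\<in>{i..j}. r 0 i l * r 0 l j) = 1 * r 0 i j"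
        using add[of i j 0 0] by (simp only: add_0_left mult_1_left)
    qed (use diag in auto)
  qed
  have inv: "triv g" if "g + g = 0" for g
    unfolding triv_def
  proof (intro allI impI)
    fix i j :: nat assume "i < j \<and> j \<le> 4"
    then show "r g i j = 0"
    proof (intro unipotent_square_trivial[where c = 0 and N = 4 and M = "r g"])
      fix i j :: nat assume "i < j" "j \<le> 4"
      then show "(\<Sum>l\<in>{i..j}. r g i l * r g l j) = 0 * r g i j"
        using add[of i j g g] zero that by (simp only: triv_def mult_zero_left)
    qed (use diag in auto)
  qed
  have triv_add: "triv (h + g)" if "triv h" "triv g" for g h
    unfolding triv_def using triv_mult[OF that(2)] that(1) by (simp add: triv_def)
  \<comment> \<open>If the sign inverts \<open>g\<close>, then \<open>g + sign_elt\<close> is an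
    involution, so \<open>g\<close> is a product of two involutions and acts trivially.\<close>
  have gen: "triv g" if "g + sign_elt + (g + sign_elt) = 0" for g
  proof -
    have s: "sign_elt + sign_elt = 0"
      by (simp add: sign_elt_def plus_pgroup_def zero_pgroup_def Let_def)
    have "triv (g + sign_elt + sign_elt)" using inv[OF that] inv[OF s] by (rule triv_add)
    then show ?thesis by (simp add: add.assoc s)
  qed
  \<comment> \<open>\<open>V\<close> is \<open>6 s^2\<close>, whose second derivative divided by 2
    is not 6 times a variable but the constant 6, so \<open>U\<close> and \<open>V\<close> commute
    up to \<open>K\<close>. The elements \<open>Z\<close>, \<open>P\<close>, \<open>K\<close> below
    are the successive differences \<open>3 s^2 + 3 s + 1\<close>, \<open>6 s + 6\<close>,
    \<open>6\<close> of the cube.\<close>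
  define U V K where "U = El 0 0 0 0 0 0 0 0 1 False" and "V = El 0 0 0 0 0 0 6 0 0 False" and "K = El 6 0 0 0 0 0 0 0 0 False"
  define X Y Z P where "X = El 0 0 0 0 0 0 0 1 0 False" and "Y = El 0 0 0 1 0 0 0 0 0 False"
    and "Z = El 1 3 3 0 0 0 0 0 0 False" and "P = El 6 6 0 0 0 0 0 0 0 False"
  have tU: "triv U" and tV: "triv V"
    by (rule gen; simp add: U_def V_def sign_elt_def plus_pgroup_def zero_pgroup_def Let_def esgn_def)+
  have "U + V = K + (V + U)" by (simp add: U_def V_def K_def plus_pgroup_def Let_def esgn_def)
  then have "r K i j = 0" if "i < j" "j \<le> 4" for i j
    using triv_mult[OF triv_add[OF tV tU], of i j K] triv_add[OF tU tV] that by (simp add: triv_def)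
  then have K04: "r K 0 4 = 0" by simp
  \<comment> \<open>The hypothesis says that \<open>B\<close> is the commutator of \<open>X\<close>
    and \<open>A\<close>. Since \<open>r\<close> reverses products, comparing an entry on both sides
    expresses that of \<open>B\<close> through entries nearer the diagonal.\<close>
  have comm: "(\<Sum>l\<in>{i..j}. r A i l * r X l j) = (\<Sum>l\<in>{i..j}. (\<Sum>m\<in>{i..l}. r X i m * r A m l) * r B l j)"
    if "X + A = B + (A + X)" "i \<le> j" "j \<le> 4" for A B i j
  proof -
    have "(\<Sum>l\<in>{i..j}. r A i l * r X l j) = r (B + (A + X)) i j" using add[OF that(2,3), of X A] that(1) by simp
    also have "\<dots> = (\<Sum>l\<in>{i..j}. r (A + X) i l * r B l j)" by (rule add[OF that(2,3)])
    also have "\<dots> = (\<Sum>l\<in>{i..j}. (\<Sum>m\<in>{i..l}. r X i m * r A m l) * r B l j)"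
      by (intro sum.cong refl) (use that in \<open>simp add: add\<close>)
    finally show ?thesis .
  qed
  have XY: "X + Y = Z + (Y + X)" and XZ: "X + Z = P + (Z + X)" and XP: "X + P = K + (P + X)"
    by (simp_all add: X_def Y_def Z_def P_def K_def plus_pgroup_def Let_def esgn_def)
  have super': "r g 0 1 = lam 0 g" "r g 0 (Suc 0) = lam 0 g" "r g 1 2 = lam 1 g" "r g (Suc 0) 2 = lam 1 g" "r g 2 3 = lam 2 g" "r g 3 4 = lam 3 g" for g
    using super[of 0 g] super[of 1 g] super[of 2 g] super[of 3 g] by (simp_all add: numeral_eq_Suc)
  note simps = super' lam_simps sum_intervals sum_intervals' diag
  have [simp]: "px X = 1" "f3 X = 0" "px Y = 0" "f3 Y = 1" "px Z = 0" "f3 Z = 0" "px P = 0" "f3 P = 0" "px K = 0" "f3 K = 0"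
    by (simp_all add: X_def Y_def Z_def P_def K_def)
  have Z: "r Z 0 2 = 0" "r Z 1 3 = 0" "r Z 2 4 = - 3"
    using comm[OF XY, of 0 2] comm[OF XY, of 1 3] comm[OF XY, of 2 4] by (simp_all add: simps)
  have P2: "r P 0 2 = 0" "r P 1 3 = 0" "r P 2 4 = 0"
    using comm[OF XZ, of 0 2] comm[OF XZ, of 1 3] comm[OF XZ, of 2 4] by (simp_all add: simps)
  have P: "r P 0 3 = 0" "r P 1 4 = - 6"
    using comm[OF XZ, of 0 3] comm[OF XZ, of 1 4] Z P2 by (simp_all add: simps)
  have K2: "r K 0 2 = 0" "r K 1 3 = 0" "r K 2 4 = 0"
    using comm[OF XP, of 0 2] comm[OF XP, of 1 3] comm[OF XP, of 2 4] by (simp_all add: simps)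
  have K3: "r K 0 3 = 0" "r K 1 4 = 0"
    using comm[OF XP, of 0 3] comm[OF XP, of 1 4] P P2 K2 by (simp_all add: simps)
  \<comment> \<open>In the corner only \<open>r X 0 1\<close> times \<open>r P 1 4\<close>, which is
    6, survives besides \<open>r K 0 4\<close>, so the latter is -6, against
    \<open>K04\<close>.\<close>
  show False
    using comm[OF XP, of 0 4] P P2 K2 K3 K04 by (simp add: simps)
qed

section \<open>The Massey products of the two orbit spaces\<close>

abbreviation "class_base i \<equiv> coh_class (singular_cochains baseX) 1 (base.from_group (hom_cochain (lam i)))"
abbreviation "class_cover i \<equiv> cohomology_pullback coverY cov 1 (class_base i)"

lemma base_class: "i < 4 \<Longrightarrow> base.from_group (hom_cochain (\<lambda>g. b_base g i (Suc i))) \<in> class_base i"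
  unfolding lam_def[symmetric] by (intro base.from_group_class lam_cocycle)

lemma cover_class: "i < 4 \<Longrightarrow> cover.from_group (hom_cochain (\<lambda>g. b_cover g i (Suc i))) \<in> class_cover i"
  by (simp only: lam_cover) (intro from_group_pullback_class lam_cocycle)

text \<open>The representation law fails for the base only in the corner, which a defining system
  does not contain.\<close>

lemma massey_defined_base: "massey_defined baseX [1, 1, 1, 1] [class_base 0, class_base 1, class_base 2, class_base 3]"
  unfolding massey_defined_def PL_classes
  by (rule exI[of _ base.pl_conn], rule base.defining_system_pl_conn[where c = "\<lambda>i. class_base i", OF _ base_class]) auto

lemma massey_zero_ones: "massey_zero X [1, 1, 1, 1] = coh_class (A_PL X) 2 0"
  by (simp add: massey_zero_def massey_degree_ones)

text \<open>On the cover the corner entry of the connection is a form too, and it is a primitive of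
  the product.\<close>

lemma massey_zero_cover:
  "massey_zero coverY [1, 1, 1, 1] \<in> space_massey_product coverY [1, 1, 1, 1] [class_cover 0, class_cover 1, class_cover 2, class_cover 3]"
proof -
  let ?xs = "[PL_class coverY 1 (class_cover 0), PL_class coverY 1 (class_cover 1),
      PL_class coverY 1 (class_cover 2), PL_class coverY 1 (class_cover 3)]"
  have xs: "length ?xs = 4" by simp
  have "defining_system (A_PL coverY) [1, 1, 1, 1] ?xs cover.pl_conn"
    by (rule cover.defining_system_pl_conn[where c = "\<lambda>i. class_cover i", OF _ cover_class]) auto
  moreover have "coh_class (A_PL coverY) 2 (\<Sum>l\<in>{0<..<4}. dga_mult (A_PL coverY) (cover.pl_conn 0 l) (cover.pl_conn l 4)) =
      coh_class (A_PL coverY) 2 0"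
    unfolding cover.pl_conn_diff[of 0 4, OF zero_less_numeral, symmetric]
    by (rule coh_class_exact, rule cover.pl_conn_part) auto
  ultimately show ?thesis
    unfolding space_massey_product_def PL_classes massey_product_ones[OF xs] massey_zero_ones
    by (intro CollectI exI[of _ cover.pl_conn]) simp
qed

lemma massey_nonzero_base:
  "massey_zero baseX [1, 1, 1, 1] \<notin> space_massey_product baseX [1, 1, 1, 1] [class_base 0, class_base 1, class_base 2, class_base 3]"
proof
  let ?xs = "[PL_class baseX 1 (class_base 0), PL_class baseX 1 (class_base 1),
      PL_class baseX 1 (class_base 2), PL_class baseX 1 (class_base 3)]"
  have xs: "length ?xs = 4" by simp
  assume "massey_zero baseX [1, 1, 1, 1] \<in> space_massey_product baseX [1, 1, 1, 1] [class_base 0, class_base 1, class_base 2, class_base 3]"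
  then have "\<exists>a. coh_class (A_PL baseX) 2 0 = coh_class (A_PL baseX) 2 (\<Sum>l\<in>{0<..<4}. dga_mult (A_PL baseX) (a 0 l) (a l 4)) \<and>
      defining_system (A_PL baseX) [1, 1, 1, 1] ?xs a"
    unfolding space_massey_product_def PL_classes massey_product_ones[OF xs] massey_zero_ones mem_Collect_eq .
  then obtain a where a: "coh_class (A_PL baseX) 2 0 = coh_class (A_PL baseX) 2 (\<Sum>l\<in>{0<..<4}. dga_mult (A_PL baseX) (a 0 l) (a l 4)) \<and>
      defining_system (A_PL baseX) [1, 1, 1, 1] ?xs a" ..
  obtain a04 where a04: "a04 \<in> dga_part (A_PL baseX) 1"
    "dga_diff (A_PL baseX) a04 = (\<Sum>l\<in>{0<..<4}. dga_mult (A_PL baseX) (a 0 l) (a l 4))"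
    using coh_class_zero_exact[OF conjunct1[OF a, symmetric]] by blast
  note ds = conjunct2[OF a, unfolded defining_system_ones[OF xs]]
  have part: "a i j \<in> dga_part (A_PL baseX) 1" if "i < j" "j \<le> 4" "(i, j) \<noteq> (0, 4)" for i j
    using ds[THEN conjunct1] that by blast
  have flat: "dga_diff (A_PL baseX) (a i j) = (\<Sum>l\<in>{i<..<j}. dga_mult (A_PL baseX) (a i l) (a l j))"
    if "i + 2 \<le> j" "j \<le> 4" "(i, j) \<noteq> (0, 4)" for i j
    using ds[THEN conjunct2, THEN conjunct2] that by blast
  have cl: "a i (Suc i) \<in> PL_class baseX 1 (class_base i)" if "i < 4" for i
  proof -
    have "a (Suc i - 1) (Suc i) \<in> ?xs ! (Suc i - 1)"
      by (rule ds[THEN conjunct2, THEN conjunct1, rule_format]) (use that in simp)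
    then show ?thesis using less_4[OF that] by auto
  qed
  \<comment> \<open>The primitive of the vanishing product fills the corner and completes the flat
    connection.\<close>
  define a' where "a' i j = (if i = 0 \<and> j = 4 then a04 else a i j)" for i j :: nat
  interpret flat_system "UNIV :: pgroup set" 4 a'
  proof
    fix i j :: nat assume ij: "i < j" "j \<le> 4"
    show "a' i j \<in> dga_part (A_PL baseX) 1" using part[of i j] a04(1) ij by (auto simp: a'_def)
    have "dga_diff (A_PL baseX) (a' i j) = (\<Sum>l\<in>{i<..<j}. dga_mult (A_PL baseX) (a i l) (a l j))"
    proof -
      consider "i = 0 \<and> j = 4" | "j = Suc i" | "i + 2 \<le> j" "(i, j) \<noteq> (0, 4)" using ij by fastforce
      then show ?thesis
      proof cases
        case 1
        then show ?thesis using a04(2) by (simp add: a'_def)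
      next
        case 2
        then have "{i<..<j} = {}" by auto
        moreover have "dga_diff (A_PL baseX) (a i j) = 0" using cl[of i] 2 ij by (simp add: PL_class_def cocycles_def)
        ultimately show ?thesis using 2 ij by (auto simp: a'_def)
      next
        case 3
        then have "a' i j = a i j" by (auto simp: a'_def)
        then show ?thesis using flat[OF 3(1) ij(2) 3(2)] by simp
      qed
    qed
    also have "\<dots> = (\<Sum>l\<in>{i<..<j}. dga_mult (A_PL baseX) (a' i l) (a' l j))"
      by (intro sum.cong refl) (use ij in \<open>auto simp: a'_def\<close>)
    finally show "dga_diff (A_PL baseX) (a' i j) = (\<Sum>l\<in>{i<..<j}. dga_mult (A_PL baseX) (a' i l) (a' l j))" .
  qed
  show False
  \<comment> \<open>Transport from 0 to \<open>h + g\<close> is taken through \<open>h\<close>;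
    translating the edge from \<open>h\<close> to \<open>h + g\<close> back by \<open>h\<close>
    turns it into the edge from 0 to \<open>g\<close>.\<close>
  proof (rule no_unipotent_representation[of "hol 0"])
    fix h g :: pgroup and i j :: nat assume "i \<le> j" "j \<le> 4"
    then show "hol 0 (h + g) i j = (\<Sum>l\<in>{i..j}. hol 0 g i l * hol 0 h l j)"
      using hol_trans[of i j 0 "h + g" h] hol_shift[of h 0 g] by simp
  next
    fix i :: nat and g :: pgroup assume i: "i < 4"
    have "hom_cochain (lam i) \<in> ipart UNIV 1" using lam_cocycle[OF i] base.G.Zc_iff by blast
    moreover have "a' i (Suc i) \<in> PL_class baseX 1 (class_base i)" using cl[OF i] by (auto simp: a'_def)
    ultimately have "hol 0 g i (Suc i) = hom_cochain (lam i) 1 [0, g]"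
      using hol_integration[of i 0 g] base.integration_PL_class[OF refl] i by simp
    moreover have "lam i 0 = 0" using lam_add[OF i, of 0 0] by simp
    ultimately show "hol 0 g i (Suc i) = lam i g" by (simp add: hom_cochain_def)
  qed (rule hol_diag)
qed

theorem theorem2:
  shows "\<exists>(X :: (nat \<Rightarrow> real) topology) (Y :: (nat \<Rightarrow> real) topology) (n :: nat) f p q r s w x y z.
    rational_PD_space n X \<and> rational_PD_space n Y \<and>
    continuous_map Y X f \<and> nonzero_degree n Y X f \<and>
    w \<in> singular_cohomology X p \<and> x \<in> singular_cohomology X q \<and>
    y \<in> singular_cohomology X r \<and> z \<in> singular_cohomology X s \<and>
    massey_defined X [p, q, r, s] [w, x, y, z] \<and>
    massey_zero X [p, q, r, s] \<notin> space_massey_product X [p, q, r, s] [w, x, y, z] \<and>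
    massey_zero Y [p, q, r, s] \<in> space_massey_product Y [p, q, r, s]
      [cohomology_pullback Y f p w, cohomology_pullback Y f q x,
       cohomology_pullback Y f r y, cohomology_pullback Y f s z]"
proof -
  \<comment> \<open>A single functional serves both groups, which is what makes the degree of the
    covering map nonzero.\<close>
  obtain I where I: "duality (inv_cochains even_part) (int 9) I" "duality (inv_cochains UNIV) (int 9) I"
    using pgroup_duality by auto
  have cls: "class_base i \<in> singular_cohomology baseX 1" if "i < 4" for i
    using base.from_group_cocycle[OF lam_cocycle[OF that]] by (simp add: cohomology_def)
  have "continuous_map coverY baseX cov"
    by (rule continuous_cover_map) (simp_all add: subgrp_UNIV subgrp_even)
  then show ?thesis
    using base.rational_PD_orbit_space[OF I(2)] cover.rational_PD_orbit_space[OF I(1)] nonzero_degree_cover[OF I(2,1)]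
      cls[of 0] cls[of 1] cls[of 2] cls[of 3] massey_defined_base massey_nonzero_base massey_zero_cover
    by (intro exI[of _ baseX] exI[of _ coverY] exI[of _ "9 :: nat"] exI[of _ cov] exI[of _ "1 :: int"]
        exI[of _ "class_base 0"] exI[of _ "class_base 1"] exI[of _ "class_base 2"] exI[of _ "class_base 3"]) simp
qed

end
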